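(* Let $n\ge1$ and $\alpha\in(0,1)$, and let $E\subset\mathbb{R}^n$ be a measurable set with $\chi_E\in BV^\alpha(\mathbb{R}^n)$. Then, for all $x_0\in\mathbb{R}^n$, $\nu\in\mathbb{S}^{n-1}$ and $r>0$, $$\frac{\mu_{1,\alpha}}{\alpha}\int_E\frac{\nu}{|(x-x_0)\cdot\nu|^\alpha}\,dx=-D^\alpha\chi_E(H_\nu^+(x_0)),$$ $$\int_E|\nabla^\alpha\chi_{H_\nu^+(x_0)}|\,dx\le|D^\alpha\chi_E|(H_\nu^+(x_0)),$$ $$\int_E w_{n,\alpha}(|x-x_0|,r)\,dx\le|D^\alpha\chi_E|\big(\mathbb{R}^n\setminus B_r(x_0)\big).$$ Moreover, if either $\operatorname{supp}|D^\alpha\chi_E|$ is bounded or $D^\alpha\chi_E(H_\nu^+(x_0))=0$ for some $x_0\in\mathbb{R}^n$ and $\nu\in\mathbb{S}^{n-1}$, then $|E|=0$. In particular, if $|E|>0$, then the fractional reduced boundary $\mathscr{F}^\alpha E$ must be unbounded and must intersect all half-spaces $H_\nu^+(x_0)$.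
   Context: Let $\mu_{n,\alpha}=2^{\alpha}\pi^{-n/2}\,\Gamma\left(\frac{n+\alpha+1}{2}\right)/\Gamma\left(\frac{1-\alpha}{2}\right)$; $\omega_n$ is the volume of the unit ball of $\mathbb{R}^n$; $B_r(x_0)$ is the open ball; $|E|$ is the Lebesgue measure of $E$; $\chi_E$ is the characteristic function of $E$. For $\varphi\in \mathrm{Lip}_c(\mathbb{R}^n;\mathbb{R}^n)$ (compactly supported Lipschitz), the fractional $\alpha$-divergence is $$\mathrm{div}^\alpha\varphi(x)=\mu_{n,\alpha}\int_{\mathbb{R}^n}\frac{(y-x)\cdot(\varphi(y)-\varphi(x))}{|y-x|^{n+\alpha+1}}\,dy,\quad x\in\mathbb{R}^n.$$ For $f\in L^1(\mathbb{R}^n)$ let $$|D^\alpha f|(\mathbb{R}^n)=\sup\left\{\int_{\mathbb{R}^n} f\,\mathrm{div}^\alpha\varphi\,dx:\varphi\in C^\infty_c(\mathbb{R}^n;\mathbb{R}^n),\ \|\varphi\|_{L^\infty(\mathbb{R}^n;\mathbb{R}^n)}\le1\right\},$$ and $BV^{\alpha}(\mathbb{R}^n)=\{f\in L^1(\mathbb{R}^n):|D^\alpha f|(\mathbb{R}^n)<+\infty\}$. A function $f\in L^1(\mathbb{R}^n)$ belongs to $BV^{\alpha}(\mathbb{R}^n)$ if and only if there is a (unique) finite $\mathbb{R}^n$-valued Radon measure $D^\alpha f$ on $\mathbb{R}^n$ with $\int_{\mathbb{R}^n} f\,\mathrm{div}^\alpha\varphi\,dx=-\int_{\mathbb{R}^n}\varphi\cdot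 dD^\alpha f$ for all $\varphi\in \mathrm{Lip}_c(\mathbb{R}^n;\mathbb{R}^n)$; $|D^\alpha f|$ denotes its total variation measure. For $\nu\in\mathbb{S}^{n-1}$ and $x_0\in\mathbb{R}^n$, $H_\nu^+(x_0)=\{y\in\mathbb{R}^n:(y-x_0)\cdot\nu>0\}$. The fractional gradient of its characteristic function is, for $(x-x_0)\cdot\nu\ne0$, $$\nabla^\alpha \chi_{H_\nu^+(x_0)}(x)=\mu_{n,\alpha}\int_{\mathbb{R}^n}\frac{(y-x)\,(\chi_{H_\nu^+(x_0)}(y)-\chi_{H_\nu^+(x_0)}(x))}{|y-x|^{n+\alpha+1}}\,dy.$$ The weight is $$w_{n,\alpha}(t,r)=\frac{(n-1)\,\omega_{n-1}}{n\,\omega_n}\,\frac{\mu_{1,\alpha}}{\alpha}\int_{-1}^{1}\frac{(1-s^2)^{\frac{n-3}{2}}}{|st-r|^\alpha}\,ds\ \ (n\ge2),\qquad w_{1,\alpha}(t,r)=\frac{\mu_{1,\alpha}}{2\alpha}\left(\frac{1}{|t-r|^\alpha}+\frac{1}{|t+r|^\alpha}\right).$$ The fractional reduced boundary $\mathscr{F}^\alpha E$ is the set of $x\in\operatorname{supp}|D^\alpha\chi_E|$ such that the limit $\lim_{r\to0^+}\frac{D^\alpha\chi_E(B_r(x))}{|D^\alpha\chi_E|(B_r(x))}$ exists and belongs to $\mathbb{S}^{n-1}$. *)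

theory Defs
  imports "HOL-Analysis.Analysis"
begin

section \<open>Vector measures\<close>

text \<open>
  A finite \<open>\<real>\<^sup>n\<close>-valued Radon measure is a countably additive set function on the Borel sets
  (finiteness and Radon regularity are automatic on \<open>\<real>\<^sup>n\<close>). It is represented by a total
  function, normalised to \<open>0\<close> on non-Borel sets so that equal measures are equal functions.
\<close>

definition vector_measure :: "('a::topological_space set \<Rightarrow> 'b::real_normed_vector) \<Rightarrow> bool" where
  "vector_measure D \<longleftrightarrow>
     (\<forall>X. X \<notin> sets borel \<longrightarrow> D X = 0) \<and>
     (\<forall>A::nat \<Rightarrow> 'a set. range A \<subseteq> sets borel \<and> disjoint_family A \<longrightarrow>
        (\<lambda>i. D (A i)) sums D (\<Union>i. A i))"

definition total_variation ::
    "('a::topological_space set \<Rightarrow> 'b::real_normed_vector) \<Rightarrow> 'a measure" where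
  "total_variation D = measure_of UNIV (sets borel)
     (\<lambda>X. SUP A \<in> {A::nat \<Rightarrow> 'a set. range A \<subseteq> sets borel \<and> disjoint_family A \<and> (\<Union>i. A i) = X}.
        \<Sum>i. ennreal (norm (D (A i))))"

text \<open>Upper variation in the Jordan decomposition of a signed measure; the lower variation of
  \<open>m\<close> is the upper variation of \<open>- m\<close>.\<close>

definition upper_variation :: "('a::topological_space set \<Rightarrow> real) \<Rightarrow> 'a measure" where
  "upper_variation m = measure_of UNIV (sets borel)
     (\<lambda>X. SUP B \<in> {B \<in> sets borel. B \<subseteq> X}. ennreal (m B))"

definition signed_integral :: "('a::topological_space set \<Rightarrow> real) \<Rightarrow> ('a \<Rightarrow> real) \<Rightarrow> real" where
  "signed_integral m g =
     (LINT x|upper_variation m. g x) - (LINT x|upper_variation (\<lambda>X. - m X). g x)"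

definition vector_integral ::
    "('a::topological_space set \<Rightarrow> real^'n) \<Rightarrow> ('a \<Rightarrow> real^'n) \<Rightarrow> real" where
  "vector_integral D \<phi> = (\<Sum>i\<in>UNIV. signed_integral (\<lambda>X. D X $ i) (\<lambda>x. \<phi> x $ i))"

definition measure_support :: "'a::topological_space measure \<Rightarrow> 'a set" where
  "measure_support M = {x. \<forall>U. open U \<and> x \<in> U \<longrightarrow> emeasure M U > 0}"


section \<open>Test fields\<close>

definition compactly_supported :: "('a::topological_space \<Rightarrow> 'b::zero) \<Rightarrow> bool" where
  "compactly_supported f \<longleftrightarrow> compact (closure {x. f x \<noteq> 0})"

definition Lip_c :: "('a::metric_space \<Rightarrow> 'b::{metric_space,zero}) set" where
  "Lip_c = {f. (\<exists>L. L-lipschitz_on UNIV f) \<and> compactly_supported f}"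

text \<open>\<open>C\<^sup>k\<close> on the whole space, by recursion on directional derivatives.\<close>

primrec k_times_cont_diff ::
    "nat \<Rightarrow> ('a::real_normed_vector \<Rightarrow> 'b::real_normed_vector) \<Rightarrow> bool" where
  "k_times_cont_diff 0 f \<longleftrightarrow> continuous_on UNIV f"
| "k_times_cont_diff (Suc k) f \<longleftrightarrow>
     (\<forall>x. f differentiable (at x)) \<and>
     (\<forall>v. k_times_cont_diff k (\<lambda>x. frechet_derivative f (at x) v))"

definition Cinf_c :: "('a::real_normed_vector \<Rightarrow> 'b::real_normed_vector) set" where
  "Cinf_c = {f. (\<forall>k. k_times_cont_diff k f) \<and> compactly_supported f}"


section \<open>Fractional operators and fractional variation\<close>

definition frac_const :: "nat \<Rightarrow> real \<Rightarrow> real" where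
  "frac_const n \<alpha> =
     2 powr \<alpha> * pi powr (- real n / 2) * Gamma ((real n + \<alpha> + 1) / 2) / Gamma ((1 - \<alpha>) / 2)"

text \<open>In the two singular integrals the integrand at \<open>y = x\<close> is \<open>0\<close> (division by zero),
  which is immaterial since points are null sets.\<close>

definition frac_div :: "real \<Rightarrow> (real^'n \<Rightarrow> real^'n) \<Rightarrow> real^'n \<Rightarrow> real" where
  "frac_div \<alpha> \<phi> x = frac_const CARD('n) \<alpha> *
     (LINT y|lebesgue. ((y - x) \<bullet> (\<phi> y - \<phi> x)) / norm (y - x) powr (real CARD('n) + \<alpha> + 1))"

definition frac_grad :: "real \<Rightarrow> (real^'n \<Rightarrow> real) \<Rightarrow> real^'n \<Rightarrow> real^'n" where
  "frac_grad \<alpha> f x = frac_const CARD('n) \<alpha> *\<^sub>R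
     (LINT y|lebesgue. ((f y - f x) / norm (y - x) powr (real CARD('n) + \<alpha> + 1)) *\<^sub>R (y - x))"

definition frac_total_variation :: "real \<Rightarrow> (real^'n \<Rightarrow> real) \<Rightarrow> ereal" where
  "frac_total_variation \<alpha> f =
     (SUP \<phi> \<in> {\<phi> \<in> Cinf_c. AE x in lebesgue. norm (\<phi> x) \<le> 1}.
        ereal (LINT x|lebesgue. f x * frac_div \<alpha> \<phi> x))"

definition frac_BV :: "real \<Rightarrow> (real^'n \<Rightarrow> real) set" where
  "frac_BV \<alpha> = {f. integrable lebesgue f \<and> frac_total_variation \<alpha> f < \<infinity>}"

definition is_frac_variation_measure ::
    "real \<Rightarrow> (real^'n \<Rightarrow> real) \<Rightarrow> ((real^'n) set \<Rightarrow> real^'n) \<Rightarrow> bool" where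
  "is_frac_variation_measure \<alpha> f D \<longleftrightarrow> vector_measure D \<and>
     (\<forall>\<phi>\<in>Lip_c. (LINT x|lebesgue. f x * frac_div \<alpha> \<phi> x) = - vector_integral D \<phi>)"

text \<open>For \<open>f \<in> frac_BV \<alpha>\<close> with \<open>0 < \<alpha> < 1\<close> exactly one such measure exists, so the choice
  below is determined.\<close>

definition frac_variation_measure ::
    "real \<Rightarrow> (real^'n \<Rightarrow> real) \<Rightarrow> (real^'n) set \<Rightarrow> real^'n" where
  "frac_variation_measure \<alpha> f = (SOME D. is_frac_variation_measure \<alpha> f D)"

definition frac_reduced_boundary :: "real \<Rightarrow> (real^'n) set \<Rightarrow> (real^'n) set" where
  "frac_reduced_boundary \<alpha> E =
     (let D = frac_variation_measure \<alpha> (indicator E) in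
      {x \<in> measure_support (total_variation D).
         \<exists>\<nu>\<in>sphere 0 1.
           ((\<lambda>r. D (ball x r) /\<^sub>R measure (total_variation D) (ball x r)) \<longlongrightarrow> \<nu>) (at_right 0)})"


section \<open>Half-spaces and the weight\<close>

definition half_space :: "real^'n \<Rightarrow> real^'n \<Rightarrow> (real^'n) set" where
  "half_space \<nu> x\<^sub>0 = {y. (y - x\<^sub>0) \<bullet> \<nu> > 0}"

text \<open>The weight takes values in \<open>[0,\<infinity>]\<close>: it can be infinite at \<open>t = r\<close>
  (in \<open>ennreal\<close>, \<open>1 / 0 = \<infinity>\<close>).\<close>

definition frac_weight :: "nat \<Rightarrow> real \<Rightarrow> real \<Rightarrow> real \<Rightarrow> ennreal" where
  "frac_weight n \<alpha> t r =
     (if n = 1 then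
        ennreal (frac_const 1 \<alpha> / (2 * \<alpha>)) *
          (1 / ennreal (\<bar>t - r\<bar> powr \<alpha>) + 1 / ennreal (\<bar>t + r\<bar> powr \<alpha>))
      else
        ennreal ((real n - 1) * unit_ball_vol (real n - 1) / (real n * unit_ball_vol (real n))
                 * (frac_const 1 \<alpha> / \<alpha>)) *
          (\<integral>\<^sup>+ s \<in> {-1..1}. ennreal ((1 - s\<^sup>2) powr ((real n - 3) / 2))
                             / ennreal (\<bar>s * t - r\<bar> powr \<alpha>) \<partial>lborel))"

end

theory Submission
  imports Defs
begin

text \<open>
  For a half-space \<open>H\<close> with unit inner normal \<open>\<nu>\<close> the fractional gradient can be computed:
  \<open>\<nabla>\<^sup>\<alpha>\<chi>\<^sub>H(x) = (\<mu>\<^sub>1/\<alpha>) |(x - x\<^sub>0)\<bullet>\<nu>|\<^sup>-\<^sup>\<alpha> \<nu>\<close>, by symmetry under the reflection fixing \<open>\<nu>\<close> and the subordination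
  formula for powers of \<open>|z|\<close>. Testing \<open>D\<^sup>\<alpha>\<chi>\<^sub>E\<close> with Lipschitz approximations of \<open>\<chi>\<^sub>H v\<close> gives
  \<open>\<integral>\<^sub>E v \<bullet> \<nabla>\<^sup>\<alpha>\<chi>\<^sub>H dx = - v \<bullet> D\<^sup>\<alpha>\<chi>\<^sub>E(H)\<close>; for \<open>v = \<nu>\<close> the fractional divergences of the approximations
  are nonnegative, so Fatou's lemma yields the integrability that the passage to the limit needs.
  The weighted inequality is the average over \<open>\<nu>\<close> of the inequalities for the half-spaces tangent to
  \<open>B\<^sub>r(x\<^sub>0)\<close>. As the left-hand integrand is positive, \<open>D\<^sup>\<alpha>\<chi>\<^sub>E(H) = 0\<close> forces \<open>|E| = 0\<close>; hence
  \<open>|D\<^sup>\<alpha>\<chi>\<^sub>E|\<close> charges every half-space if \<open>|E| > 0\<close>, and it is concentrated on the reduced boundary by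
  the Besicovitch differentiation theorem. Existence of \<open>D\<^sup>\<alpha>\<chi>\<^sub>E\<close> is the Riesz representation theorem
  together with mollification, since the fractional variation is a supremum over smooth fields only.
\<close>

section \<open>Vector measures\<close>

text \<open>The integral of |t|^(-\<alpha>) over \<open>E\<close>, with t the signed distance to the
  hyperplane, is not known to be finite beforehand, and the field \<open>indicator H\<close> times v
  is neither Lipschitz nor compactly supported. The approximations are ramps of slope k + 1 in t.
  Cutoffs first extend the defining identity from \<open>Lip_c\<close> to bounded Lipschitz fields,
  ramps included. At a fixed point with t nonzero every ramp varies at scale |t|/2, uniformly in k:
  either it is not steep, or it is already constant near t. Hence all the fractional divergences are
  at most a constant times |t|^(-\<alpha>), the very power that occurs in the limit. The
  integrability that Fatou yields for v = \<nu> is therefore the domination required for every v.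
  The differentiation theorem is reduced to density points: in the polar form of D the unit density
  is localised to countably many small balls of values. The exponent (n - 3) / 2 in the weight is
  that of the distribution of one coordinate on the unit sphere, and the prefactor (n-1) omega_(n-1)
  / (n omega_n) normalises this distribution.\<close>

lemma vector_measure_sums:
  assumes "vector_measure D" "\<And>i::nat. A i \<in> sets borel" "disjoint_family A"
  shows "(\<lambda>i. D (A i)) sums D (\<Union>i. A i)"
proof -
  have "range A \<subseteq> sets borel" using assms(2) by auto
  with assms(1,3) show ?thesis unfolding vector_measure_def by simp
qed

lemma vector_measure_empty [simp]:
  assumes "vector_measure D" shows "D {} = 0"
proof -
  have "(\<lambda>i::nat. D {}) sums D {}"
    using vector_measure_sums[OF assms, of "\<lambda>_. {}"] by (auto simp: disjoint_family_on_def)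
  then have "(\<lambda>i::nat. D {}) \<longlonglongrightarrow> 0" by (intro summable_LIMSEQ_zero sums_summable)
  then show ?thesis by (simp add: LIMSEQ_const_iff)
qed

lemma vector_measure_Un:
  assumes D: "vector_measure D" and "A \<in> sets borel" "B \<in> sets borel" "A \<inter> B = {}"
  shows "D (A \<union> B) = D A + D B"
proof -
  have "(\<lambda>i. D (binaryset A B i)) sums D (\<Union>i. binaryset A B i)"
    using assms by (intro vector_measure_sums) (auto simp: binaryset_def disjoint_family_on_def)
  moreover have "(\<lambda>i. D (binaryset A B i)) sums (D A + D B)"
    using D by (intro binaryset_sums) simp
  ultimately show ?thesis by (metis UN_binaryset_eq sums_unique2)
qed

lemma vector_measure_finite_UN:
  assumes D: "vector_measure D" and "finite I" "\<And>i. i \<in> I \<Longrightarrow> A i \<in> sets borel"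
    and "disjoint_family_on A I"
  shows "D (\<Union>i\<in>I. A i) = (\<Sum>i\<in>I. D (A i))"
  using assms(2-)
proof (induction I)
  case (insert i I)
  have "D (A i \<union> (\<Union>i\<in>I. A i)) = D (A i) + D (\<Union>i\<in>I. A i)"
    using insert by (intro vector_measure_Un[OF D]) (auto simp: disjoint_family_on_def)
  with insert show ?case by (auto simp: disjoint_family_on_def)
qed (use D in simp)

lemma vector_measure_Diff:
  assumes D: "vector_measure D" and "A \<in> sets borel" "B \<in> sets borel" "B \<subseteq> A"
  shows "D (A - B) = D A - D B"
proof -
  have "A - B \<union> B = A" "(A - B) \<inter> B = {}" using assms by auto
  then show ?thesis using vector_measure_Un[OF D, of "A - B" B] assms by simp
qed

lemma vector_measure_uminus:
  "vector_measure D \<Longrightarrow> vector_measure (\<lambda>X. - D X)"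
  unfolding vector_measure_def by (auto intro: sums_minus)

lemma vector_measure_nth:
  assumes D: "vector_measure D" shows "vector_measure (\<lambda>X. D X $ i)"
  unfolding vector_measure_def
proof (intro conjI allI impI)
  show "D X $ i = 0" if "X \<notin> sets borel" for X
    using D that by (simp add: vector_measure_def)
  show "(\<lambda>j. D (A j) $ i) sums (D (\<Union> (range A)) $ i)"
    if "range A \<subseteq> sets borel \<and> disjoint_family A" for A :: "nat \<Rightarrow> _"
    using that by (intro bounded_linear.sums[OF bounded_linear_vec_nth] vector_measure_sums[OF D]) auto
qed

subsection \<open>Total variation\<close>

definition borel_partitions :: "'a::topological_space set \<Rightarrow> (nat \<Rightarrow> 'a set) set" where
  "borel_partitions X = {A. range A \<subseteq> sets borel \<and> disjoint_family A \<and> (\<Union>i. A i) = X}"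

text \<open>The set function handed to \<open>measure_of\<close> in \<open>total_variation\<close>.
  Since \<open>measure_of\<close> gives every set the value 0 unless its argument is a measure,
  countable additivity comes before any statement about
  \<open>emeasure (total_variation D)\<close>.\<close>

definition variation ::
    "('a::topological_space set \<Rightarrow> 'b::real_normed_vector) \<Rightarrow> 'a set \<Rightarrow> ennreal" where
  "variation D X = (SUP A \<in> borel_partitions X. \<Sum>i. ennreal (norm (D (A i))))"

lemma variation_upper: "A \<in> borel_partitions X \<Longrightarrow> (\<Sum>i. ennreal (norm (D (A i)))) \<le> variation D X"
  unfolding variation_def by (rule SUP_upper)

lemma borel_partitions_binaryset:
  "A \<in> sets borel \<Longrightarrow> B \<in> sets borel \<Longrightarrow> A \<inter> B = {} \<Longrightarrow> binaryset A B \<in> borel_partitions (A \<union> B)"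
  by (auto simp: borel_partitions_def binaryset_def disjoint_family_on_def split: if_splits)

lemma norm_le_variation:
  assumes "vector_measure D" "X \<in> sets borel"
  shows "ennreal (norm (D X)) \<le> variation D X"
proof -
  have "(\<lambda>i. ennreal (norm (D (binaryset X {} i)))) sums (ennreal (norm (D X)) + ennreal (norm (D {})))"
    using assms by (intro binaryset_sums) simp
  then have "(\<Sum>i. ennreal (norm (D (binaryset X {} i)))) = ennreal (norm (D X))"
    using assms by (simp add: sums_iff)
  with variation_upper[OF borel_partitions_binaryset[of X "{}"], of D] assms show ?thesis by simp
qed

lemma variation_empty: "vector_measure D \<Longrightarrow> variation D {} = 0"
  unfolding variation_def
  by (subst bot_ennreal[symmetric], rule antisym, rule SUP_least) (auto simp: borel_partitions_def bot_ennreal)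

lemma norm_suminf_le_ennreal:
  assumes "f sums s" shows "ennreal (norm s) \<le> (\<Sum>i. ennreal (norm (f i)))"
proof -
  have "(\<lambda>n. ennreal (norm (\<Sum>i<n. f i))) \<longlonglongrightarrow> ennreal (norm s)"
    using assms unfolding sums_def by (intro tendsto_ennrealI tendsto_norm)
  moreover have "ennreal (norm (\<Sum>i<n. f i)) \<le> (\<Sum>i. ennreal (norm (f i)))" for n
  proof -
    have "ennreal (norm (\<Sum>i<n. f i)) \<le> ennreal (\<Sum>i<n. norm (f i))"
      by (intro ennreal_leI norm_sum)
    also have "\<dots> = (\<Sum>i<n. ennreal (norm (f i)))" by (simp add: sum_ennreal)
    also have "\<dots> \<le> (\<Sum>i. ennreal (norm (f i)))" by (intro sum_le_suminf) auto
    finally show ?thesis .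
  qed
  ultimately show ?thesis using LIMSEQ_le_const2 by blast
qed

lemma ennreal_suminf_commute:
  fixes f :: "nat \<Rightarrow> nat \<Rightarrow> ennreal"
  shows "(\<Sum>i. \<Sum>j. f i j) = (\<Sum>j. \<Sum>i. f i j)"
proof -
  have "(\<Sum>i. \<Sum>j. f i j) = integral\<^sup>N (count_space UNIV) (\<lambda>i. integral\<^sup>N (count_space UNIV) (f i))"
    by (simp add: nn_integral_count_space_nat)
  also have "\<dots> = integral\<^sup>N (count_space UNIV) (\<lambda>j. integral\<^sup>N (count_space UNIV) (\<lambda>i. f i j))"
    by (rule nn_integral_count_space_nn_integral) auto
  also have "\<dots> = (\<Sum>j. \<Sum>i. f i j)" by (simp add: nn_integral_count_space_nat)
  finally show ?thesis .
qed

text \<open>A partition \<open>A\<close> of the union is cut along the sets \<open>X j\<close>. The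
  triangle inequality for series bounds each \<open>D (A i)\<close> by its pieces; exchanging the
  sums leaves, for every \<open>j\<close>, a partition of \<open>X j\<close>.\<close>

lemma variation_UN_le:
  fixes X :: "nat \<Rightarrow> 'a::topological_space set"
  assumes D: "vector_measure D" and X: "\<And>i. X i \<in> sets borel" "disjoint_family X"
  shows "variation D (\<Union>i. X i) \<le> (\<Sum>i. variation D (X i))"
  unfolding variation_def[of D "\<Union>i. X i"]
proof (rule SUP_least)
  fix A assume "A \<in> borel_partitions (\<Union>i. X i)"
  then have A: "\<And>i. A i \<in> sets borel" "disjoint_family A" "(\<Union>i. A i) = (\<Union>i. X i)"
    by (auto simp: borel_partitions_def)
  have "(\<Sum>i. ennreal (norm (D (A i)))) \<le> (\<Sum>i. \<Sum>j. ennreal (norm (D (A i \<inter> X j))))"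
  proof (intro suminf_le norm_suminf_le_ennreal)
    fix i
    have "A i = (\<Union>j. A i \<inter> X j)" using A(3) by blast
    moreover have "(\<lambda>j. D (A i \<inter> X j)) sums D (\<Union>j. A i \<inter> X j)"
      using A(1) X by (intro vector_measure_sums[OF D]) (auto intro: disjoint_family_subset)
    ultimately show "(\<lambda>j. D (A i \<inter> X j)) sums D (A i)" by simp
  qed auto
  also have "\<dots> = (\<Sum>j. \<Sum>i. ennreal (norm (D (A i \<inter> X j))))"
    by (rule ennreal_suminf_commute)
  also have "\<dots> \<le> (\<Sum>j. variation D (X j))"
  proof (intro suminf_le)
    fix j
    have "(\<Union>i. A i \<inter> X j) = X j" using A(3) by blast
    then have "(\<lambda>i. A i \<inter> X j) \<in> borel_partitions (X j)"
      using A(1) X(1) disjoint_family_subset[OF A(2)] by (auto simp: borel_partitions_def)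
    then show "(\<Sum>i. ennreal (norm (D (A i \<inter> X j)))) \<le> variation D (X j)"
      by (rule variation_upper)
  qed auto
  finally show "(\<Sum>i. ennreal (norm (D (A i)))) \<le> (\<Sum>j. variation D (X j))" .
qed

text \<open>Merges two countable partitions into one indexed by \<open>nat\<close>: even places for
  the first, odd places for the second.\<close>

lemma suminf_interleave_ennreal:
  fixes f g :: "nat \<Rightarrow> ennreal"
  shows "(\<Sum>i. if even i then f (i div 2) else g (i div 2)) = (\<Sum>i. f i) + (\<Sum>i. g i)"
  (is "(\<Sum>i. ?h i) = _")
proof -
  have "bij_betw (\<lambda>i. (i mod 2, i div 2)) UNIV ({..<2::nat} \<times> UNIV)"
    by (rule bij_betw_byWitness[where f' = "\<lambda>(a, b). a + 2 * b"]) auto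
  have *: "(\<Sum>i<2 * n. ?h i) = (\<Sum>i<n. f i) + (\<Sum>i<n. g i)" for n
    by (induction n) (auto simp: algebra_simps)
  have "(\<lambda>n. \<Sum>i<n. ?h i) \<longlonglongrightarrow> (\<Sum>i. ?h i)" by (intro summable_LIMSEQ) auto
  then have "(\<lambda>n. \<Sum>i<2 * n. ?h i) \<longlonglongrightarrow> (\<Sum>i. ?h i)"
    using LIMSEQ_subseq_LIMSEQ[of _ _ "\<lambda>n. 2 * n"] by (auto simp: strict_mono_def o_def)
  moreover have "(\<lambda>n. (\<Sum>i<n. f i) + (\<Sum>i<n. g i)) \<longlonglongrightarrow> (\<Sum>i. f i) + (\<Sum>i. g i)"
    by (intro tendsto_add summable_LIMSEQ) auto
  ultimately show ?thesis unfolding * by (rule LIMSEQ_unique)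
qed

lemma borel_partitions_nonempty: "X \<in> sets borel \<Longrightarrow> borel_partitions X \<noteq> {}"
  using borel_partitions_binaryset[of X "{}"] by auto

text \<open>Interleaving a partition of \<open>X\<close> with one of \<open>Y\<close> gives a
  partition of the union. The two suprema are then taken one after the other, each commuting with
  the addition of a constant because its index set is nonempty.\<close>

lemma variation_superadditive:
  assumes "X \<in> sets borel" "Y \<in> sets borel" "X \<inter> Y = {}"
  shows "variation D X + variation D Y \<le> variation D (X \<union> Y)"
proof -
  have 1: "(\<Sum>i. ennreal (norm (D (A i)))) + (\<Sum>i. ennreal (norm (D (B i)))) \<le> variation D (X \<union> Y)"
    if A: "A \<in> borel_partitions X" and B: "B \<in> borel_partitions Y" for A B
  proof -
    define C where "C = (\<lambda>i::nat. if even i then A (i div 2) else B (i div 2))"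
    have AB: "\<And>i. A i \<subseteq> X" "\<And>i. B i \<subseteq> Y" using A B by (auto simp: borel_partitions_def)
    have "(\<Union>i. C i) = X \<union> Y"
    proof -
      have "A i \<subseteq> (\<Union>i. C i)" "B i \<subseteq> (\<Union>i. C i)" for i
        using UN_upper[of "2 * i" UNIV C] UN_upper[of "2 * i + 1" UNIV C] by (simp_all add: C_def)
      then have "(\<Union>i. A i) \<union> (\<Union>i. B i) \<subseteq> (\<Union>i. C i)" by (simp add: UN_subset_iff)
      moreover have "(\<Union>i. A i) = X" "(\<Union>i. B i) = Y" using A B by (simp_all add: borel_partitions_def)
      ultimately have "X \<union> Y \<subseteq> (\<Union>i. C i)" by simp
      then show ?thesis using AB by (auto simp: C_def split: if_splits)
    qed
    moreover have "disjoint_family C"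
      unfolding disjoint_family_on_def
    proof (intro ballI impI)
      fix i j :: nat assume "i \<noteq> j"
      then have ij: "even i \<noteq> even j \<or> i div 2 \<noteq> j div 2"
      proof (rule contrapos_np)
        assume "\<not> ?thesis"
        then have "i div 2 = j div 2" "i mod 2 = j mod 2" by (simp_all add: mod_2_eq_odd)
        then show "i = j" by (metis div_mult_mod_eq)
      qed
      have "A (i div 2) \<inter> A (j div 2) = {}" "B (i div 2) \<inter> B (j div 2) = {}"
        if "i div 2 \<noteq> j div 2"
        using A B that by (simp_all add: borel_partitions_def disjoint_family_on_def)
      moreover have "A k \<inter> B l = {}" "B k \<inter> A l = {}" for k l
        using AB[of k] AB[of l] assms(3) by blast+
      ultimately show "C i \<inter> C j = {}"
        using ij by (auto simp: C_def split: if_splits)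
    qed
    ultimately have "C \<in> borel_partitions (X \<union> Y)"
      using A B by (auto simp: borel_partitions_def C_def)
    then have "(\<Sum>i. ennreal (norm (D (C i)))) \<le> variation D (X \<union> Y)" by (rule variation_upper)
    moreover have "(\<lambda>i. ennreal (norm (D (C i)))) =
       (\<lambda>i. if even i then ennreal (norm (D (A (i div 2)))) else ennreal (norm (D (B (i div 2)))))"
      by (auto simp: C_def)
    ultimately show ?thesis
      using suminf_interleave_ennreal[of "\<lambda>i. ennreal (norm (D (A i)))" "\<lambda>i. ennreal (norm (D (B i)))"]
      by simp
  qed
  have "variation D X + (\<Sum>i. ennreal (norm (D (B i)))) \<le> variation D (X \<union> Y)"
    if B: "B \<in> borel_partitions Y" for B
    unfolding variation_def[of D X]
    unfolding ennreal_SUP_add_left[OF borel_partitions_nonempty[OF assms(1)], symmetric]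
    using 1[OF _ B] by (rule SUP_least)
  then show ?thesis
    unfolding variation_def[of D Y] ennreal_SUP_add_right[OF borel_partitions_nonempty[OF assms(2)]]
    by (rule SUP_least)
qed

lemma variation_mono:
  assumes "X \<in> sets borel" "Y \<in> sets borel" "X \<subseteq> Y"
  shows "variation D X \<le> variation D Y"
proof -
  have "variation D X \<le> variation D X + variation D (Y - X)" by simp
  also have "\<dots> \<le> variation D (X \<union> (Y - X))" using assms by (intro variation_superadditive) auto
  also have "X \<union> (Y - X) = Y" using assms by auto
  finally show ?thesis .
qed

lemma sets_total_variation [simp, measurable_cong]: "sets (total_variation D) = sets borel"
  and space_total_variation [simp]: "space (total_variation D) = UNIV"
  unfolding total_variation_def using sets.sets_measure_of_eq[of borel] by simp_all

lemma emeasure_total_variation: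
  fixes D :: "'a::topological_space set \<Rightarrow> 'b::real_normed_vector"
  assumes D: "vector_measure D" and X: "X \<in> sets borel"
  shows "emeasure (total_variation D) X = variation D X"
proof -
  have "countably_additive (sets borel) (variation D)"
  proof (rule countably_additiveI)
    fix A :: "nat \<Rightarrow> 'a set" assume A: "range A \<subseteq> sets borel" "disjoint_family A"
    \<comment> \<open>Superadditivity bounds the finite sums, and monotonicity compares them with
      the whole union; the opposite inequality is \<open>variation_UN_le\<close>.\<close>
    have fin: "(\<Sum>i<n. variation D (A i)) \<le> variation D (\<Union>i<n. A i)" for n
    proof (induction n)
      case (Suc n)
      have "(\<Sum>i<Suc n. variation D (A i)) \<le> variation D (\<Union>i<n. A i) + variation D (A n)"
        using Suc by (auto intro: add_mono)
      also have "\<dots> \<le> variation D ((\<Union>i<n. A i) \<union> A n)"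
      proof (rule variation_superadditive)
        show "(\<Union>i<n. A i) \<in> sets borel" "A n \<in> sets borel" using A by auto
        have "A i \<inter> A n = {}" if "i < n" for i
          using A(2) that by (simp add: disjoint_family_on_def)
        then show "(\<Union>i<n. A i) \<inter> A n = {}" by blast
      qed
      also have "(\<Union>i<n. A i) \<union> A n = (\<Union>i<Suc n. A i)" by (auto simp: less_Suc_eq)
      finally show ?case .
    qed simp
    show "(\<Sum>i. variation D (A i)) = variation D (\<Union> (range A))"
    proof (rule antisym)
      show "(\<Sum>i. variation D (A i)) \<le> variation D (\<Union> (range A))"
      proof (rule suminf_le_const)
        fix n
        have "variation D (\<Union>i<n. A i) \<le> variation D (\<Union> (range A))"
          using A by (intro variation_mono) auto
        then show "(\<Sum>i<n. variation D (A i)) \<le> variation D (\<Union> (range A))"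
          using fin order_trans by blast
      qed auto
      show "variation D (\<Union> (range A)) \<le> (\<Sum>i. variation D (A i))"
        using variation_UN_le[OF D] A by auto
    qed
  qed
  then show ?thesis
    unfolding total_variation_def borel_partitions_def[symmetric] variation_def[symmetric]
    using X variation_empty[OF D] sets.sigma_algebra_axioms[of borel]
    by (intro emeasure_measure_of_sigma) (auto simp: positive_def)
qed

lemma norm_le_total_variation:
  "vector_measure D \<Longrightarrow> X \<in> sets borel \<Longrightarrow> ennreal (norm (D X)) \<le> emeasure (total_variation D) X"
  by (simp add: emeasure_total_variation norm_le_variation)

lemma variation_additive:
  assumes D: "vector_measure D" and "X \<in> sets borel" "Y \<in> sets borel" "X \<inter> Y = {}"
  shows "variation D (X \<union> Y) = variation D X + variation D Y"
proof -
  have "emeasure (total_variation D) X + emeasure (total_variation D) Y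
      = emeasure (total_variation D) (X \<union> Y)"
    using assms by (intro plus_emeasure) auto
  then show ?thesis
    using emeasure_total_variation[OF D assms(2)] emeasure_total_variation[OF D assms(3)]
      emeasure_total_variation[OF D sets.Un[OF assms(2,3)]] by simp
qed

text \<open>The argument of Rudin, Real and Complex Analysis, 6.4: a set of infinite variation splits off a
  piece of measure larger than 1 while leaving a remainder of infinite variation.\<close>

lemma signed_variation_split:
  fixes m :: "'a::topological_space set \<Rightarrow> real"
  assumes m: "vector_measure m" and X: "X \<in> sets borel" and inf: "variation m X = \<infinity>"
  shows "\<exists>Y\<in>sets borel. Y \<subseteq> X \<and> variation m Y = \<infinity> \<and> 1 < \<bar>m (X - Y)\<bar>"
proof -
  \<comment> \<open>The factor 2 is spent on choosing the larger of the positive and the negative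
    pieces. What remains is \<open>1 + \<bar>m X\<bar>\<close>, so that after subtracting
    \<open>m X\<close> the complement of \<open>Z\<close> still has measure above 1 in absolute
    value.\<close>
  define t where "t = 2 * (1 + \<bar>m X\<bar>)"
  have "ennreal t < variation m X" using inf by simp
  then obtain A where A: "A \<in> borel_partitions X" "ennreal t < (\<Sum>i. ennreal (norm (m (A i))))"
    unfolding variation_def less_SUP_iff by blast
  then obtain n where n: "ennreal t < (\<Sum>i<n. ennreal (norm (m (A i))))"
    unfolding suminf_eq_SUP less_SUP_iff by blast
  then have n: "t < (\<Sum>i<n. \<bar>m (A i)\<bar>)"
    using ennreal_less_iff[of t "\<Sum>i<n. \<bar>m (A i)\<bar>"] by (simp add: sum_ennreal t_def del: ennreal_plus)
  define P N where "P = {i\<in>{..<n}. 0 \<le> m (A i)}" and "N = {i\<in>{..<n}. m (A i) < 0}"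
  have Ab: "\<And>i. A i \<in> sets borel" "disjoint_family A" "\<And>i. A i \<subseteq> X"
    using A(1) by (auto simp: borel_partitions_def)
  have dis: "disjoint_family_on A I" for I using Ab(2) by (auto simp: disjoint_family_on_def)
  have "(\<Sum>i<n. \<bar>m (A i)\<bar>) = (\<Sum>i\<in>P. m (A i)) - (\<Sum>i\<in>N. m (A i))"
  proof -
    have "{..<n} = P \<union> N" "P \<inter> N = {}" by (auto simp: P_def N_def)
    moreover have "finite P" "finite N" by (auto simp: P_def N_def)
    ultimately have "(\<Sum>i<n. \<bar>m (A i)\<bar>) = (\<Sum>i\<in>P. \<bar>m (A i)\<bar>) + (\<Sum>i\<in>N. \<bar>m (A i)\<bar>)"
      by (simp add: sum.union_disjoint)
    also have "\<dots> = (\<Sum>i\<in>P. m (A i)) - (\<Sum>i\<in>N. m (A i))"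
      by (simp add: P_def N_def sum_negf[symmetric])
    finally show ?thesis .
  qed
  also have "\<dots> = m (\<Union>i\<in>P. A i) - m (\<Union>i\<in>N. A i)"
    using Ab dis by (simp add: vector_measure_finite_UN[OF m] P_def N_def)
  finally have "1 + \<bar>m X\<bar> < \<bar>m (\<Union>i\<in>P. A i)\<bar> \<or> 1 + \<bar>m X\<bar> < \<bar>m (\<Union>i\<in>N. A i)\<bar>"
    using n unfolding t_def by (smt (verit))
  moreover have "(\<Union>i\<in>I. A i) \<in> sets borel" "(\<Union>i\<in>I. A i) \<subseteq> X" for I :: "nat set"
    using Ab(1,3) by auto
  ultimately obtain Z where Z: "Z \<in> sets borel" "Z \<subseteq> X" "1 + \<bar>m X\<bar> < \<bar>m Z\<bar>"
    by blast
  have "m (X - Z) = m X - m Z" using Z X by (intro vector_measure_Diff[OF m]) auto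
  then have big: "1 < \<bar>m (X - Z)\<bar>" "1 < \<bar>m Z\<bar>" using Z by linarith+
  have "variation m Z + variation m (X - Z) = \<infinity>"
    using inf variation_additive[OF m, of Z "X - Z"] Z X by (simp add: Un_absorb1)
  then consider "variation m Z = \<infinity>" | "variation m (X - Z) = \<infinity>" by fastforce
  then show ?thesis
  proof cases
    case 1 then show ?thesis using Z big by blast
  next
    case 2
    moreover have "X - (X - Z) = Z" using Z by blast
    ultimately show ?thesis using Z X big by (intro bexI[of _ "X - Z"]) auto
  qed
qed

text \<open>If the variation were infinite, repeated splitting would give a decreasing sequence of
  sets whose successive differences are disjoint and have measure above 1 in absolute value, so that
  their series could not converge.\<close>

lemma variation_signed_finite:
  fixes m :: "'a::topological_space set \<Rightarrow> real"
  assumes m: "vector_measure m"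
  shows "variation m UNIV < \<infinity>"
proof (rule ccontr)
  assume "\<not> ?thesis"
  then have inf: "variation m UNIV = \<infinity>" by (metis infinity_ennreal_def less_top)
  define Q where "Q = (\<lambda>X. X \<in> sets borel \<and> variation m X = \<infinity>)"
  define R where "R = (\<lambda>X Y. Y \<subseteq> X \<and> 1 < \<bar>m (X - Y)\<bar>)"
  have "\<exists>f. \<forall>n. Q (f n) \<and> R (f n) (f (Suc n))"
    using dependent_nat_choice[where P = "\<lambda>n. Q" and Q = "\<lambda>n. R"]
      signed_variation_split[OF m] inf unfolding Q_def R_def by (metis sets.top space_borel)
  then obtain f where f: "\<And>n. Q (f n)" "\<And>n. R (f n) (f (Suc n))" by blast
  have dec: "decseq f" using f(2) by (auto simp: R_def intro: decseq_SucI)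
  have dj: "disjoint_family (\<lambda>n. f n - f (Suc n))"
    unfolding disjoint_family_on_def
  proof (intro ballI impI)
    have *: "(f i - f (Suc i)) \<inter> (f j - f (Suc j)) = {}" if "i < j" for i j
      using that decseqD[OF dec, of "Suc i" j] by auto
    fix i j :: nat assume "i \<noteq> j"
    then show "(f i - f (Suc i)) \<inter> (f j - f (Suc j)) = {}"
      using *[of i j] *[of j i] by (cases "i < j") auto
  qed
  have "(\<lambda>n. m (f n - f (Suc n))) sums m (\<Union>n. f n - f (Suc n))"
    using f dj by (intro vector_measure_sums[OF m]) (auto simp: Q_def)
  then have "(\<lambda>n. m (f n - f (Suc n))) \<longlonglongrightarrow> 0" by (intro summable_LIMSEQ_zero sums_summable)
  then obtain n where "\<bar>m (f n - f (Suc n))\<bar> < 1"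
    unfolding LIMSEQ_iff by (metis diff_zero real_norm_def zero_less_one order_refl)
  with f(2)[of n] show False by (auto simp: R_def)
qed

text \<open>Reduction to the signed components: the norm is at most the sum of their absolute
  values.\<close>

lemma finite_measure_total_variation:
  fixes D :: "'a::topological_space set \<Rightarrow> real^'n"
  assumes D: "vector_measure D"
  shows "finite_measure (total_variation D)"
proof (rule finite_measureI)
  have "variation D UNIV \<le> (\<Sum>i\<in>UNIV. variation (\<lambda>X. D X $ i) UNIV)"
    unfolding variation_def[of D]
  proof (rule SUP_least)
    fix A :: "nat \<Rightarrow> 'a set" assume A: "A \<in> borel_partitions UNIV"
    have "(\<Sum>j. ennreal (norm (D (A j)))) \<le> (\<Sum>j. \<Sum>i\<in>UNIV. ennreal (norm (D (A j) $ i)))"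
      by (intro suminf_le) (auto simp: sum_ennreal intro!: ennreal_leI norm_le_l1_cart)
    also have "\<dots> = (\<Sum>i\<in>UNIV. \<Sum>j. ennreal (norm (D (A j) $ i)))" by (rule suminf_sum) auto
    also have "\<dots> \<le> (\<Sum>i\<in>UNIV. variation (\<lambda>X. D X $ i) UNIV)"
      using A by (intro sum_mono variation_upper[where D = "\<lambda>X. D X $ _"])
    finally show "(\<Sum>j. ennreal (norm (D (A j)))) \<le> (\<Sum>i\<in>UNIV. variation (\<lambda>X. D X $ i) UNIV)" .
  qed
  also have "\<dots> < \<infinity>"
    using variation_signed_finite[OF vector_measure_nth[OF D]]
    by (simp add: less_top)
  finally show "emeasure (total_variation D) (space (total_variation D)) \<noteq> \<infinity>"
    using D by (simp add: emeasure_total_variation)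
qed

subsection \<open>Jordan decomposition\<close>

lemma finite_measure_total_variation_real:
  fixes m :: "'a::topological_space set \<Rightarrow> real"
  assumes "vector_measure m"
  shows "finite_measure (total_variation m)"
proof (rule finite_measureI)
  show "emeasure (total_variation m) (space (total_variation m)) \<noteq> \<infinity>"
    using variation_signed_finite[OF assms] by (simp add: emeasure_total_variation[OF assms])
qed

lemma sets_upper_variation [simp, measurable_cong]: "sets (upper_variation m) = sets borel"
  and space_upper_variation [simp]: "space (upper_variation m) = UNIV"
  unfolding upper_variation_def using sets.sets_measure_of_eq[of borel] by simp_all

text \<open>Writing 2 m B = m X + (m B - m (X - B)) bounds every candidate. Conversely, given a
  partition of \<open>X\<close>, let \<open>B\<close> be the union of the pieces of nonnegative
  measure; the sum of the absolute values is then 2 m B - m X, and its supremum is the total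
  variation. Countable additivity can be read off from the closed form.\<close>

lemma upper_variation_SUP:
  fixes m :: "'a::topological_space set \<Rightarrow> real"
  assumes m: "vector_measure m" and X: "X \<in> sets borel"
  shows "(SUP B \<in> {B \<in> sets borel. B \<subseteq> X}. ennreal (m B)) =
           ennreal ((measure (total_variation m) X + m X) / 2)"
proof -
  interpret T: finite_measure "total_variation m" by (rule finite_measure_total_variation_real[OF m])
  have le: "\<bar>m B\<bar> \<le> measure (total_variation m) B" if "B \<in> sets borel" for B
    using norm_le_total_variation[OF m that] by (simp add: T.emeasure_eq_measure)
  show ?thesis
  proof (rule antisym)
    show "(SUP B \<in> {B \<in> sets borel. B \<subseteq> X}. ennreal (m B)) \<le>
        ennreal ((measure (total_variation m) X + m X) / 2)"
    proof (intro SUP_least ennreal_leI, clarsimp)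
      fix B :: "'a set" assume B: "B \<in> sets borel" "B \<subseteq> X"
      have "m (X - B) = m X - m B" using B X by (intro vector_measure_Diff[OF m]) auto
      moreover have "measure (total_variation m) (X - B) =
          measure (total_variation m) X - measure (total_variation m) B"
        using B X by (intro T.finite_measure_Diff) auto
      moreover have "\<bar>m B\<bar> \<le> measure (total_variation m) B"
        "\<bar>m (X - B)\<bar> \<le> measure (total_variation m) (X - B)" using B X le by auto
      ultimately show "m B * 2 \<le> measure (total_variation m) X + m X" by linarith
    qed
    have key: "measure (total_variation m) X \<le> 2 * s - m X"
      if s: "(SUP B \<in> {B \<in> sets borel. B \<subseteq> X}. ennreal (m B)) = ennreal s" "0 \<le> s" for s
    proof -
      have ms: "m B \<le> s" if "B \<in> sets borel" "B \<subseteq> X" for B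
      proof -
        have "ennreal (m B) \<le> ennreal s" unfolding s(1)[symmetric] using that by (intro SUP_upper) auto
        then show ?thesis using s(2) by (simp add: ennreal_le_iff)
      qed
      have "variation m X \<le> ennreal (2 * s - m X)"
        unfolding variation_def
      proof (rule SUP_least)
        fix A assume A: "A \<in> borel_partitions X"
        then have Ab: "\<And>i. A i \<in> sets borel" "disjoint_family A" "(\<Union>i. A i) = X"
          by (auto simp: borel_partitions_def)
        define B where "B = (\<lambda>i. if 0 \<le> m (A i) then A i else {})"
        have "(\<lambda>i. m (B i)) sums m (\<Union>i. B i)"
          using Ab by (intro vector_measure_sums[OF m]) (auto simp: B_def disjoint_family_on_def)
        moreover have "(\<lambda>i. m (A i)) sums m X"
          using vector_measure_sums[OF m Ab(1,2)] Ab(3) by simp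
        ultimately have "(\<lambda>i. 2 * m (B i) - m (A i)) sums (2 * m (\<Union>i. B i) - m X)"
          by (intro sums_diff sums_mult)
        moreover have "(\<lambda>i. 2 * m (B i) - m (A i)) = (\<lambda>i. \<bar>m (A i)\<bar>)"
          using m by (auto simp: B_def)
        ultimately have "(\<lambda>i. \<bar>m (A i)\<bar>) sums (2 * m (\<Union>i. B i) - m X)" by simp
        then have "(\<Sum>i. ennreal (norm (m (A i)))) = ennreal (2 * m (\<Union>i. B i) - m X)"
          by (simp add: suminf_ennreal2 sums_iff)
        moreover have "m (\<Union>i. B i) \<le> s"
          using Ab by (intro ms) (auto simp: B_def split: if_splits)
        ultimately show "(\<Sum>i. ennreal (norm (m (A i)))) \<le> ennreal (2 * s - m X)"
          by (metis ennreal_leI diff_right_mono mult_le_cancel_left_pos zero_less_numeral)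
      qed
      then have "ennreal (measure (total_variation m) X) \<le> ennreal (2 * s - m X)"
        using emeasure_total_variation[OF m X] T.emeasure_eq_measure[of X] by simp
      moreover have "0 \<le> 2 * s - m X" using ms[OF X] s(2) by simp
      ultimately show ?thesis by simp
    qed
    show "ennreal ((measure (total_variation m) X + m X) / 2) \<le>
       (SUP B \<in> {B \<in> sets borel. B \<subseteq> X}. ennreal (m B))" (is "_ \<le> ?S")
    proof (cases ?S)
      case (real s)
      then show ?thesis using key[of s] by (auto intro!: ennreal_leI)
    next
      case top
      then show ?thesis by (metis top_greatest)
    qed
  qed
qed

lemma emeasure_upper_variation:
  fixes m :: "'a::topological_space set \<Rightarrow> real"
  assumes m: "vector_measure m" and X: "X \<in> sets borel"
  shows "emeasure (upper_variation m) X = ennreal ((measure (total_variation m) X + m X) / 2)"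
proof -
  interpret T: finite_measure "total_variation m" by (rule finite_measure_total_variation_real[OF m])
  let ?g = "\<lambda>X. (measure (total_variation m) X + m X) / 2"
  let ?S = "\<lambda>X. SUP B \<in> {B \<in> sets borel. B \<subseteq> X}. ennreal (m B)"
  have nn: "0 \<le> ?g A" if "A \<in> sets borel" for A
    using norm_le_total_variation[OF m that] by (simp add: T.emeasure_eq_measure)
  have "countably_additive (sets borel) ?S"
  proof (rule countably_additiveI)
    fix A :: "nat \<Rightarrow> 'a set"
    assume A: "range A \<subseteq> sets borel" "disjoint_family A" "\<Union> (range A) \<in> sets borel"
    have "(\<lambda>i. ?g (A i)) sums ?g (\<Union> (range A))"
      using A by (intro sums_divide sums_add T.finite_measure_UNION vector_measure_sums[OF m]) auto
    then have "(\<Sum>i. ennreal (?g (A i))) = ennreal (?g (\<Union> (range A)))"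
      using A nn by (intro suminf_ennreal_eq) auto
    then show "(\<Sum>i. ?S (A i)) = ?S (\<Union> (range A))"
      using A by (subst (1 2) upper_variation_SUP[OF m]) auto
  qed
  moreover have "?S {} = 0" using m by (subst upper_variation_SUP[OF m]) auto
  ultimately have "emeasure (upper_variation m) X = ?S X"
    unfolding upper_variation_def using X sets.sigma_algebra_axioms[of borel]
    by (intro emeasure_measure_of_sigma) (auto simp: positive_def)
  then show ?thesis by (simp add: upper_variation_SUP[OF m X])
qed

lemma finite_measure_upper_variation:
  "vector_measure (m :: _ \<Rightarrow> real) \<Longrightarrow> finite_measure (upper_variation m)"
  by (intro finite_measureI) (simp add: emeasure_upper_variation)

lemma total_variation_uminus: "total_variation (\<lambda>X. - D X) = total_variation D"
  by (simp add: total_variation_def)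

lemma Jordan_decomposition:
  fixes m :: "'a::topological_space set \<Rightarrow> real"
  assumes m: "vector_measure m" and X: "X \<in> sets borel"
  shows "m X = measure (upper_variation m) X - measure (upper_variation (\<lambda>X. - m X)) X"
proof -
  interpret T: finite_measure "total_variation m" by (rule finite_measure_total_variation_real[OF m])
  have "\<bar>m X\<bar> \<le> measure (total_variation m) X"
    using norm_le_total_variation[OF m X] by (simp add: T.emeasure_eq_measure)
  then show ?thesis
    using m X by (simp add: measure_def[of "upper_variation _"] emeasure_upper_variation
        vector_measure_uminus total_variation_uminus field_simps)
qed

lemma emeasure_upper_variation_le:
  fixes m :: "'a::topological_space set \<Rightarrow> real"
  assumes m: "vector_measure m" and X: "X \<in> sets borel"
  shows "emeasure (upper_variation m) X \<le> emeasure (total_variation m) X"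
proof -
  interpret T: finite_measure "total_variation m" by (rule finite_measure_total_variation_real[OF m])
  have "\<bar>m X\<bar> \<le> measure (total_variation m) X"
    using norm_le_total_variation[OF m X] by (simp add: T.emeasure_eq_measure)
  then show ?thesis
    by (auto simp: emeasure_upper_variation[OF m X] T.emeasure_eq_measure intro!: ennreal_leI)
qed

subsection \<open>Polar decomposition\<close>

text \<open>The dominating measure \<open>T\<close> is left free because all components of a vector
  measure must receive densities with respect to one measure, its total variation. Both Jordan parts
  are below \<open>T\<close>, so Radon-Nikodym applies to each.\<close>

lemma signed_measure_density:
  fixes m :: "'a::topological_space set \<Rightarrow> real"
  assumes m: "vector_measure m" and T: "finite_measure T" and sT: "sets T = sets borel"
    and le: "\<And>X. X \<in> sets borel \<Longrightarrow> emeasure (total_variation m) X \<le> emeasure T X"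
  shows "\<exists>f. integrable T f \<and> (\<forall>X\<in>sets borel. m X = (LINT x:X|T. f x))"
proof -
  interpret T: finite_measure T by fact
  have dens: "\<exists>f. integrable T f \<and> (\<forall>X\<in>sets borel. measure (upper_variation k) X = (LINT x:X|T. f x))"
    if k: "vector_measure k" and kle: "\<And>X. X \<in> sets borel \<Longrightarrow> emeasure (total_variation k) X \<le> emeasure T X"
    for k :: "'a set \<Rightarrow> real"
  proof -
    let ?P = "upper_variation k"
    interpret P: finite_measure ?P by (rule finite_measure_upper_variation[OF k])
    have le': "emeasure ?P X \<le> emeasure T X" if "X \<in> sets borel" for X
      using emeasure_upper_variation_le[OF k that] kle[OF that] by simp
    have ac: "absolutely_continuous T ?P"
      unfolding absolutely_continuous_def
    proof
      fix X assume X: "X \<in> null_sets T"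
      then have "X \<in> sets borel" "emeasure T X = 0" using sT by auto
      with le'[of X] show "X \<in> null_sets ?P" by (simp add: null_sets_def)
    qed
    obtain f where f: "f \<in> borel_measurable T" "AE x in T. RN_deriv T ?P x = ennreal (f x)"
        "\<And>x. 0 \<le> f x"
      using T.real_RN_deriv[OF P.finite_measure_axioms ac] sT by (metis sets_upper_variation)
    have eq: "emeasure ?P X = (\<integral>\<^sup>+x. ennreal (indicator X x * f x) \<partial>T)" if X: "X \<in> sets borel" for X
    proof -
      have "emeasure ?P X = emeasure (density T (RN_deriv T ?P)) X"
        using T.density_RN_deriv[OF ac] sT by simp
      also have "\<dots> = (\<integral>\<^sup>+x. RN_deriv T ?P x * indicator X x \<partial>T)"
        using X sT by (intro emeasure_density) auto
      also have "\<dots> = (\<integral>\<^sup>+x. ennreal (indicator X x * f x) \<partial>T)"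
        using f(2) by (intro nn_integral_cong_AE) (auto split: split_indicator)
      finally show ?thesis .
    qed
    have "(\<integral>\<^sup>+x. ennreal (norm (f x)) \<partial>T) = emeasure ?P UNIV" using eq[of UNIV] f(3) by simp
    then have int: "integrable T f"
      using f(1) by (intro integrableI_bounded) (auto simp: less_top[symmetric])
    show ?thesis
    proof (intro exI[of _ f] conjI ballI int)
      fix X :: "'a set" assume X: "X \<in> sets borel"
      have "(LINT x:X|T. f x) = enn2real (\<integral>\<^sup>+x. ennreal (indicator X x * f x) \<partial>T)"
        unfolding set_lebesgue_integral_def real_scaleR_def
        using X f sT by (intro integral_eq_nn_integral) auto
      then show "measure ?P X = (LINT x:X|T. f x)" using eq[OF X] by (simp add: measure_def)
    qed
  qed
  obtain p where p: "integrable T p" "\<forall>X\<in>sets borel. measure (upper_variation m) X = (LINT x:X|T. p x)"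
    using dens[OF m le] by blast
  obtain n where n: "integrable T n"
      "\<forall>X\<in>sets borel. measure (upper_variation (\<lambda>X. - m X)) X = (LINT x:X|T. n x)"
    using dens[OF vector_measure_uminus[OF m]] le by (auto simp: total_variation_uminus)
  show ?thesis
  proof (intro exI[of _ "\<lambda>x. p x - n x"] conjI ballI)
    fix X :: "'a set" assume X: "X \<in> sets borel"
    have "set_integrable T X p" "set_integrable T X n"
      unfolding set_integrable_def using p(1) n(1) X sT by (intro integrable_mult_indicator; simp)+
    then show "m X = (LINT x:X|T. p x - n x)"
      using p n X by (simp add: Jordan_decomposition[OF m X] set_integral_diff(2))
  qed (use p n in auto)
qed

lemma total_variation_nth_le:
  assumes D: "vector_measure (D :: 'a::topological_space set \<Rightarrow> real^'n)" and X: "X \<in> sets borel"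
  shows "emeasure (total_variation (\<lambda>X. D X $ i)) X \<le> emeasure (total_variation D) X"
  unfolding emeasure_total_variation[OF D X] emeasure_total_variation[OF vector_measure_nth[OF D] X]
    variation_def
  by (intro SUP_mono bexI suminf_le ennreal_leI) (auto simp: component_le_norm_cart)

lemma UNIV_borel: "UNIV \<in> sets borel" by simp

text \<open>The averages of \<open>s\<close> over sets of positive measure are quotients of
  \<open>D A\<close> by the variation of \<open>A\<close>, hence in the closed unit ball; this gives
  norm at most 1 almost everywhere. Conversely, every sum of \<open>norm (D (A i))\<close> over a
  partition is at most the integral of \<open>norm (s x)\<close>, hence so is the total mass, and
  equality is forced almost everywhere.\<close>

lemma polar_decomposition:
  fixes D :: "'a::topological_space set \<Rightarrow> real^'n"
  assumes D: "vector_measure D"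
  shows "\<exists>s. integrable (total_variation D) s \<and> (AE x in total_variation D. norm (s x) = 1) \<and>
     (\<forall>X\<in>sets borel. D X = (LINT x:X|total_variation D. s x))"
proof -
  let ?T = "total_variation D"
  interpret T: finite_measure ?T by (rule finite_measure_total_variation[OF D])
  have "\<exists>f. integrable ?T f \<and> (\<forall>X\<in>sets borel. D X $ i = (LINT x:X|?T. f x))" for i
    by (rule signed_measure_density[OF vector_measure_nth[OF D]])
       (auto intro: total_variation_nth_le[OF D] T.finite_measure_axioms)
  then obtain f where f: "\<And>i. integrable ?T (f i)" "\<And>i X. X \<in> sets borel \<Longrightarrow> D X $ i = (LINT x:X|?T. f i x)"
    by metis
  define s where "s = (\<lambda>x. \<Sum>i\<in>UNIV. f i x *\<^sub>R axis i (1::real))"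
  have s: "integrable ?T s" unfolding s_def using f by auto
  have rep: "D X = (LINT x:X|?T. s x)" if X: "X \<in> sets borel" for X
  proof -
    have int: "integrable ?T (\<lambda>x. indicator X x *\<^sub>R f i x)" for i
      using X f by (intro integrable_mult_indicator) auto
    have "(LINT x:X|?T. s x) = (LINT x|?T. (\<Sum>i\<in>UNIV. (indicator X x *\<^sub>R f i x) *\<^sub>R axis i (1::real)))"
      unfolding set_lebesgue_integral_def s_def by (simp add: scaleR_sum_right)
    also have "\<dots> = (\<Sum>i\<in>UNIV. (LINT x:X|?T. f i x) *\<^sub>R axis i (1::real))"
      unfolding set_lebesgue_integral_def using int by (subst Bochner_Integration.integral_sum) auto
    also have "\<dots> = D X"
      by (simp add: f(2)[OF X, symmetric] vec_eq_iff axis_def if_distrib if_distribR cong: if_cong)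
    finally show ?thesis by simp
  qed
  have le1: "AE x in ?T. s x \<in> cball 0 1"
  proof (rule T.averaging_theorem[OF s closed_cball])
    fix A assume A: "A \<in> sets ?T" "0 < measure ?T A"
    have "norm (LINT x:A|?T. s x) \<le> measure ?T A"
      using norm_le_total_variation[OF D, of A] rep[of A] A by (simp add: T.emeasure_eq_measure)
    then show "(1 / measure ?T A) *\<^sub>R (LINT x:A|?T. s x) \<in> cball 0 1"
      using A by (simp add: field_simps)
  qed
  have "emeasure ?T UNIV \<le> (\<integral>\<^sup>+x. norm (s x) \<partial>?T)"
    unfolding emeasure_total_variation[OF D UNIV_borel] variation_def
  proof (rule SUP_least)
    fix A :: "nat \<Rightarrow> 'a set" assume "A \<in> borel_partitions UNIV"
    then have A: "\<And>i. A i \<in> sets borel" "disjoint_family A" "(\<Union>i. A i) = UNIV"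
      by (auto simp: borel_partitions_def)
    have "(\<Sum>i. ennreal (norm (D (A i)))) \<le> (\<Sum>i. \<integral>\<^sup>+x\<in>A i. norm (s x) \<partial>?T)"
    proof (intro suminf_le)
      fix i
      have "ennreal (norm (LINT x|?T. indicator (A i) x *\<^sub>R s x)) \<le> (\<integral>\<^sup>+x. norm (indicator (A i) x *\<^sub>R s x) \<partial>?T)"
        using s A by (intro integral_norm_bound_ennreal integrable_mult_indicator) auto
      also have "\<dots> = (\<integral>\<^sup>+x\<in>A i. norm (s x) \<partial>?T)"
        by (intro nn_integral_cong) (auto split: split_indicator)
      finally show "ennreal (norm (D (A i))) \<le> (\<integral>\<^sup>+x\<in>A i. norm (s x) \<partial>?T)"
        using rep[OF A(1)] by (simp add: set_lebesgue_integral_def)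
    qed auto
    also have "\<dots> = (\<integral>\<^sup>+x\<in>(\<Union>i. A i). norm (s x) \<partial>?T)"
      using A s by (intro nn_integral_disjoint_family[symmetric]) auto
    finally show "(\<Sum>i. ennreal (norm (D (A i)))) \<le> (\<integral>\<^sup>+x. norm (s x) \<partial>?T)" using A by simp
  qed
  also have "\<dots> = ennreal (LINT x|?T. norm (s x))"
    using s by (intro nn_integral_eq_integral) auto
  finally have "measure ?T UNIV \<le> (LINT x|?T. norm (s x))"
    by (simp add: T.emeasure_eq_measure Bochner_Integration.integral_nonneg)
  then have "(LINT x|?T. 1 - norm (s x)) \<le> 0"
    using s by (subst Bochner_Integration.integral_diff) auto
  moreover have nn: "AE x in ?T. 0 \<le> 1 - norm (s x)" using le1 by auto
  ultimately have "(LINT x|?T. 1 - norm (s x)) = 0"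
    using integral_nonneg_AE[OF nn] by linarith
  then have "AE x in ?T. 1 - norm (s x) = 0"
    using s nn by (subst (asm) integral_nonneg_eq_0_iff_AE) auto
  then show ?thesis using s rep by (intro exI[of _ s]) auto
qed

subsection \<open>A covering lemma of Besicovitch type\<close>

text \<open>Cover \<open>U\<close> by finitely many balls of radius \<open>b / 2\<close>; each of
  them contains at most one point of a \<open>b\<close>-separated set.\<close>

lemma separated_card_bound:
  fixes U :: "'a::euclidean_space set"
  assumes "bounded U" "0 < b"
  shows "\<exists>k. \<forall>T\<subseteq>U. (\<forall>x\<in>T. \<forall>y\<in>T. x \<noteq> y \<longrightarrow> b \<le> dist x y) \<longrightarrow> finite T \<and> card T \<le> k"
proof -
  have "compact (closure U)" using assms by (simp add: compact_closure)
  then obtain K where K: "finite K" "closure U \<subseteq> (\<Union>x\<in>K. ball x (b / 2))"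
    using assms compact_imp_seq_compact seq_compact_imp_totally_bounded
    by (metis half_gt_zero)
  show ?thesis
  proof (intro exI[of _ "card K"] allI impI)
    fix T assume T: "T \<subseteq> U" "\<forall>x\<in>T. \<forall>y\<in>T. x \<noteq> y \<longrightarrow> b \<le> dist x y"
    have "\<forall>x\<in>T. \<exists>c\<in>K. x \<in> ball c (b / 2)" using T K closure_subset[of U] by blast
    then obtain c where c: "\<And>x. x \<in> T \<Longrightarrow> c x \<in> K" "\<And>x. x \<in> T \<Longrightarrow> x \<in> ball (c x) (b / 2)"
      by metis
    have "inj_on c T"
    proof (rule inj_onI, rule ccontr)
      fix x y assume xy: "x \<in> T" "y \<in> T" "c x = c y" "x \<noteq> y"
      have "dist x y \<le> dist (c x) x + dist (c y) y"
        using dist_triangle[of x y "c x"] xy(3) by (simp add: dist_commute)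
      also have "\<dots> < b" using c(2)[OF xy(1)] c(2)[OF xy(2)] by simp
      finally show False using T xy by force
    qed
    then show "finite T \<and> card T \<le> card K"
      using c(1) K(1) by (metis card_inj_on_le finite_imageD finite_subset image_subset_iff)
  qed
qed

text \<open>A separated subset of greatest cardinality works: a point outside all its balls could be
  added to it.\<close>

lemma maximal_separated:
  fixes U :: "'a::euclidean_space set"
  assumes "bounded U" "0 < b"
  shows "\<exists>T\<subseteq>U. finite T \<and> (\<forall>x\<in>T. \<forall>y\<in>T. x \<noteq> y \<longrightarrow> b \<le> dist x y) \<and> U \<subseteq> (\<Union>x\<in>T. ball x b)"
proof -
  define P where "P = (\<lambda>T. T \<subseteq> U \<and> (\<forall>x\<in>T. \<forall>y\<in>T. x \<noteq> y \<longrightarrow> b \<le> dist x y))"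
  obtain k where k: "\<And>T. P T \<Longrightarrow> finite T \<and> card T \<le> k"
    using separated_card_bound[OF assms] unfolding P_def by blast
  have "P {}" by (simp add: P_def)
  then obtain T where T: "P T" "\<And>T'. P T' \<Longrightarrow> card T' \<le> card T"
    using Lattices_Big.ex_has_greatest_nat[of P "{}" card "Suc k"] k by (metis less_Suc_eq_le)
  have "U \<subseteq> (\<Union>x\<in>T. ball x b)"
  proof (rule subsetI, rule ccontr)
    fix y assume y: "y \<in> U" "y \<notin> (\<Union>x\<in>T. ball x b)"
    then have "P (insert y T)" using T(1) by (auto simp: P_def dist_commute not_less)
    moreover have "y \<notin> T" using y assms(2) by auto
    ultimately show False using T(2)[of "insert y T"] k[OF T(1)] by simp
  qed
  then show ?thesis using T(1) k[OF T(1)] unfolding P_def by blast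
qed

text \<open>Since only finitely many radii occur, the greedy choice can be made exactly, by decreasing radius;
  this is what gives the clean separation property in the conclusion.\<close>

lemma besicovitch_greedy:
  fixes A :: "'a::euclidean_space set" and r :: "'a \<Rightarrow> real"
  assumes A: "bounded A" and fin: "finite (r ` A)" and pos: "\<And>x. x \<in> A \<Longrightarrow> 0 < r x"
  shows "\<exists>S\<subseteq>A. finite S \<and> A \<subseteq> (\<Union>x\<in>S. ball x (r x)) \<and>
     (\<forall>x\<in>S. \<forall>y\<in>S. x \<noteq> y \<longrightarrow> r x \<le> dist x y)"
proof -
  have "\<exists>S\<subseteq>{x\<in>A. r x \<in> R}. finite S \<and> {x\<in>A. r x \<in> R} \<subseteq> (\<Union>x\<in>S. ball x (r x)) \<and>
     (\<forall>x\<in>S. \<forall>y\<in>S. x \<noteq> y \<longrightarrow> r x \<le> dist x y)" if "finite R" for R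
    using that
  proof (induction R rule: finite_linorder_min_induct)
    case empty
    then show ?case by auto
  next
    case (insert b R)
    then obtain S where S: "S \<subseteq> {x\<in>A. r x \<in> R}" "finite S" "{x\<in>A. r x \<in> R} \<subseteq> (\<Union>x\<in>S. ball x (r x))"
      "\<And>x y. x \<in> S \<Longrightarrow> y \<in> S \<Longrightarrow> x \<noteq> y \<Longrightarrow> r x \<le> dist x y" by blast
    \<comment> \<open>The induction inserts minima, so \<open>b\<close> is below every radius in
      \<open>R\<close>. The centres of radius \<open>b\<close> that are still uncovered are thinned
      to a maximal \<open>b\<close>-separated set; lying outside the earlier, larger balls, they
      keep the required distance from the earlier centres.\<close>
    define U where "U = {x\<in>A. r x = b} - (\<Union>x\<in>S. ball x (r x))"
    show ?case
    proof (cases "U = {}")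
      case True
      have "{x\<in>A. r x \<in> insert b R} \<subseteq> (\<Union>x\<in>S. ball x (r x))" using S(3) True unfolding U_def by blast
      then show ?thesis using S by (intro exI[of _ S]) auto
    next
      case False
      then have "0 < b" using pos unfolding U_def by blast
      moreover have "bounded U" using A by (rule bounded_subset) (auto simp: U_def)
      ultimately obtain T where T: "T \<subseteq> U" "finite T" "U \<subseteq> (\<Union>x\<in>T. ball x b)"
        "\<And>x y. x \<in> T \<Longrightarrow> y \<in> T \<Longrightarrow> x \<noteq> y \<Longrightarrow> b \<le> dist x y"
        using maximal_separated[of U b] by metis
      have rT: "r x = b" if "x \<in> T" for x using that T(1) by (auto simp: U_def)
      have ST: "r x \<le> dist x y \<and> b < r x" if "x \<in> S" "y \<in> T" for x y
      proof -
        have "y \<notin> ball x (r x)" using T(1) that by (auto simp: U_def)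
        moreover have "r x \<in> R" using S(1) that by auto
        ultimately show ?thesis using insert.hyps by (auto simp: not_less)
      qed
      show ?thesis
      proof (intro exI[of _ "S \<union> T"] conjI ballI impI)
        show "S \<union> T \<subseteq> {x \<in> A. r x \<in> insert b R}" using S(1) T(1) by (auto simp: U_def)
        show "finite (S \<union> T)" using S T by simp
        have "U \<subseteq> (\<Union>x\<in>T. ball x (r x))" using T(3) rT by auto
        then show "{x \<in> A. r x \<in> insert b R} \<subseteq> (\<Union>x\<in>S \<union> T. ball x (r x))"
          using S(3) unfolding U_def by blast
        fix x y assume xy: "x \<in> S \<union> T" "y \<in> S \<union> T" "x \<noteq> y"
        then consider "x \<in> S" "y \<in> S" | "x \<in> S" "y \<in> T" | "x \<in> T" "y \<in> S" | "x \<in> T" "y \<in> T" by blast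
        then show "r x \<le> dist x y"
        proof cases
          case 1 then show ?thesis using S(4) xy by blast
        next
          case 2 then show ?thesis using ST by blast
        next
          case 3 then show ?thesis using ST[of y x] rT by (simp add: dist_commute)
        next
          case 4 then show ?thesis using T(4) xy rT by simp
        qed
      qed
    qed
  qed
  moreover have "{x\<in>A. r x \<in> r ` A} = A" by auto
  ultimately show ?thesis using fin by metis
qed

text \<open>Two balls of the family containing a common point \<open>x\<close> have centres seen from \<open>x\<close> under an
  angle of at least 60 degrees.\<close>

lemma unit_vectors_separated:
  fixes p q :: "'a::real_inner"
  assumes "p \<noteq> 0" "q \<noteq> 0" "norm p \<le> norm (p - q)" "norm q \<le> norm (p - q)"
  shows "1 \<le> dist (p /\<^sub>R norm p) (q /\<^sub>R norm q)"
proof -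
  have n: "(norm (p - q))\<^sup>2 = (norm p)\<^sup>2 + (norm q)\<^sup>2 - 2 * (p \<bullet> q)"
    by (simp add: power2_norm_eq_inner inner_diff inner_commute)
  have "2 * (p \<bullet> q) \<le> (min (norm p) (norm q))\<^sup>2"
    using n power_mono[OF assms(3), of 2] power_mono[OF assms(4), of 2] by (auto simp: min_def)
  also have "\<dots> \<le> norm p * norm q"
    unfolding power2_eq_square by (intro mult_mono) auto
  finally have pq: "2 * (p \<bullet> q) \<le> norm p * norm q" .
  have "(dist (p /\<^sub>R norm p) (q /\<^sub>R norm q))\<^sup>2
      = (norm (p /\<^sub>R norm p))\<^sup>2 + (norm (q /\<^sub>R norm q))\<^sup>2 - 2 * ((p /\<^sub>R norm p) \<bullet> (q /\<^sub>R norm q))"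
    unfolding dist_norm power2_norm_eq_inner by (simp only: inner_diff inner_commute)
  also have "\<dots> = 2 - 2 * (p \<bullet> q) / (norm p * norm q)"
    using assms(1,2) by (simp add: divide_inverse)
  also have "\<dots> \<ge> 1" using pq assms(1,2) by (simp add: divide_simps)
  finally show ?thesis by (metis one_power2 power2_le_imp_le zero_le_dist)
qed

text \<open>Seen from \<open>x\<close>, the directions of the centres other than \<open>x\<close>
  are 1-separated points of the unit sphere, whose number is bounded in terms of the space alone.
  \<open>Suc k\<close> allows for \<open>x\<close> itself being a centre.\<close>

lemma besicovitch_overlap:
  "\<exists>N::nat. \<forall>(S::'a::euclidean_space set) r x. finite S \<longrightarrow>
     (\<forall>y\<in>S. \<forall>z\<in>S. y \<noteq> z \<longrightarrow> r y \<le> dist y z) \<longrightarrow> card {y\<in>S. x \<in> ball y (r y)} \<le> N"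
proof -
  obtain k where k: "\<And>T::'a set. T \<subseteq> sphere 0 1 \<Longrightarrow> (\<And>x y. x \<in> T \<Longrightarrow> y \<in> T \<Longrightarrow> x \<noteq> y \<Longrightarrow> 1 \<le> dist x y) \<Longrightarrow>
       finite T \<and> card T \<le> k"
    using separated_card_bound[of "sphere (0::'a) 1" 1] by (metis bounded_sphere zero_less_one)
  show ?thesis
  proof (intro exI[of _ "Suc k"] allI impI)
    fix S :: "'a set" and r x assume S: "finite S" "\<forall>y\<in>S. \<forall>z\<in>S. y \<noteq> z \<longrightarrow> r y \<le> dist y z"
    define V where "V = {y\<in>S. x \<in> ball y (r y)} - {x}"
    define u where "u = (\<lambda>y. (y - x) /\<^sub>R norm (y - x))"
    have sep: "1 \<le> dist (u y) (u z)" if "y \<in> V" "z \<in> V" "y \<noteq> z" for y z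
      unfolding u_def
    proof (rule unit_vectors_separated)
      have "dist y x < r y" "r y \<le> dist y z" "dist z x < r z" "r z \<le> dist z y"
        using that S(2) by (auto simp: V_def)
      then show "norm (y - x) \<le> norm (y - x - (z - x))" "norm (z - x) \<le> norm (y - x - (z - x))"
        by (auto simp: dist_norm norm_minus_commute)
    qed (use that in \<open>auto simp: V_def\<close>)
    have inj: "inj_on u V" by (rule inj_onI) (use sep in force)
    have "card (u ` V) \<le> k"
    proof (rule conjunct2[OF k])
      show "u ` V \<subseteq> sphere 0 1" by (auto simp: u_def V_def intro!: left_inverse)
      show "1 \<le> dist a b" if "a \<in> u ` V" "b \<in> u ` V" "a \<noteq> b" for a b
        using that sep by blast
    qed
    then have "card V \<le> k" using inj by (simp add: card_image)
    moreover have "card {y\<in>S. x \<in> ball y (r y)} \<le> Suc (card V)"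
    proof -
      have "{y\<in>S. x \<in> ball y (r y)} \<subseteq> insert x V" by (auto simp: V_def)
      then have "card {y\<in>S. x \<in> ball y (r y)} \<le> card (insert x V)"
        using S(1) by (intro card_mono) (auto simp: V_def)
      also have "\<dots> \<le> Suc (card V)" by (rule card_insert_le_m1[of "Suc (card V)" V, simplified])
      finally show ?thesis .
    qed
    ultimately show "card {y\<in>S. x \<in> ball y (r y)} \<le> Suc k" by simp
  qed
qed

text \<open>The argument of type \<open>itself\<close> records the space: the constant depends on
  nothing else, in particular not on the family of balls.\<close>

definition overlap_const :: "'a::euclidean_space itself \<Rightarrow> nat" where
  "overlap_const _ = (SOME N. \<forall>(S::'a set) r x. finite S \<longrightarrow>
     (\<forall>y\<in>S. \<forall>z\<in>S. y \<noteq> z \<longrightarrow> r y \<le> dist y z) \<longrightarrow> card {y\<in>S. x \<in> ball y (r y)} \<le> N)"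

lemma card_overlap_le:
  fixes S :: "'a::euclidean_space set"
  assumes "finite S" "\<forall>y\<in>S. \<forall>z\<in>S. y \<noteq> z \<longrightarrow> r y \<le> dist y z"
  shows "card {y\<in>S. x \<in> ball y (r y)} \<le> overlap_const TYPE('a)"
proof -
  have *: "\<forall>(S::'a set) r x. finite S \<longrightarrow> (\<forall>y\<in>S. \<forall>z\<in>S. y \<noteq> z \<longrightarrow> r y \<le> dist y z) \<longrightarrow>
      card {y\<in>S. x \<in> ball y (r y)} \<le> overlap_const TYPE('a)"
    unfolding overlap_const_def by (rule someI_ex[OF besicovitch_overlap])
  show ?thesis using spec[OF spec[OF spec[OF *, of S], of r], of x] assms by (rule mp[OF mp])
qed

text \<open>Every point of \<open>A\<close> is the centre of a ball on which \<open>V\<close>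
  controls \<open>M\<close>. After greedy selection the balls still cover \<open>A\<close>, and the
  sum of their \<open>V\<close>-measures is the integral of the overlap count.\<close>

lemma emeasure_greedy_bound:
  fixes M V :: "'a::euclidean_space measure"
  assumes sM: "sets M = sets borel" and sV: "sets V = sets borel"
    and A: "bounded A" and R: "finite R" "\<And>q. q \<in> R \<Longrightarrow> 0 < q"
    and ex: "\<And>x. x \<in> A \<Longrightarrow> \<exists>q\<in>R. c * emeasure M (ball x q) \<le> emeasure V (ball x q)"
    and Ab: "A \<in> sets borel"
  shows "c * emeasure M A \<le> of_nat (overlap_const TYPE('a)) * emeasure V UNIV"
proof -
  obtain r where r: "\<And>x. x \<in> A \<Longrightarrow> r x \<in> R \<and> c * emeasure M (ball x (r x)) \<le> emeasure V (ball x (r x))"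
    using ex by metis
  have "finite (r ` A)" using r by (intro finite_subset[OF _ R(1)]) auto
  then obtain S where S: "S \<subseteq> A" "finite S" "A \<subseteq> (\<Union>x\<in>S. ball x (r x))"
      "\<And>x y. x \<in> S \<Longrightarrow> y \<in> S \<Longrightarrow> x \<noteq> y \<Longrightarrow> r x \<le> dist x y"
    using besicovitch_greedy[OF A, of r] r R(2) by metis
  have "emeasure M A \<le> emeasure M (\<Union>x\<in>S. ball x (r x))"
    using S(2,3) sM by (intro emeasure_mono) auto
  also have "\<dots> \<le> (\<Sum>x\<in>S. emeasure M (ball x (r x)))"
    using S(2) sM by (intro emeasure_subadditive_finite) (simp_all add: image_subset_iff)
  finally have "c * emeasure M A \<le> c * (\<Sum>x\<in>S. emeasure M (ball x (r x)))"
    by (rule mult_left_mono) simp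
  also have "\<dots> = (\<Sum>x\<in>S. c * emeasure M (ball x (r x)))" by (rule sum_distrib_left)
  also have "\<dots> \<le> (\<Sum>x\<in>S. emeasure V (ball x (r x)))"
    using S(1) r by (intro sum_mono) auto
  also have "\<dots> = (\<integral>\<^sup>+z. (\<Sum>x\<in>S. indicator (ball x (r x)) z) \<partial>V)"
    by (subst nn_integral_sum) (auto simp: sV intro!: borel_measurable_indicator)
  also have "\<dots> \<le> (\<integral>\<^sup>+z. of_nat (overlap_const TYPE('a)) \<partial>V)"
  proof (rule nn_integral_mono)
    fix z
    have "(\<Sum>x\<in>S. indicator (ball x (r x)) z) = (of_nat (card {x\<in>S. z \<in> ball x (r x)}) :: ennreal)"
    proof -
      have "(\<Sum>x\<in>S. indicator (ball x (r x)) z) = (\<Sum>x\<in>{x\<in>S. z \<in> ball x (r x)}. 1 :: ennreal)"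
        unfolding sum.inter_filter[OF S(2)] by (intro sum.cong) (auto simp: indicator_def)
      then show ?thesis by simp
    qed
    also have "\<dots> \<le> of_nat (overlap_const TYPE('a))" using card_overlap_le[OF S(2), of r z] S(4) by simp
    finally show "(\<Sum>x\<in>S. indicator (ball x (r x)) z) \<le> (of_nat (overlap_const TYPE('a)) :: ennreal)" .
  qed
  also have "\<dots> = of_nat (overlap_const TYPE('a)) * emeasure V UNIV" using sets_eq_imp_space_eq[OF sV] by simp
  finally show ?thesis .
qed

section \<open>Weak type maximal inequality and density points\<close>

lemma borel_measurable_emeasure_ball:
  fixes M :: "'a::euclidean_space measure"
  assumes "finite_measure M" "sets M = sets borel"
  shows "(\<lambda>x. emeasure M (ball x q)) \<in> borel_measurable borel"
proof -
  interpret finite_measure M by fact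
  have "open {z::'a \<times> 'a. dist (fst z) (snd z) < q}"
    by (intro open_Collect_less continuous_intros)
  then have "{z::'a \<times> 'a. dist (fst z) (snd z) < q} \<in> sets (borel \<Otimes>\<^sub>M M)"
    unfolding sets_pair_measure_cong[OF refl assms(2)] borel_prod by (rule borel_open)
  from measurable_emeasure_Pair[OF this]
  show ?thesis by (simp add: ball_def vimage_def)
qed

text \<open>On \<open>G\<close> the maximal function of \<open>V\<close> relative to
  \<open>M\<close> exceeds \<open>c\<close>. Greedy selection asks for a bounded set of centres and
  finitely many radii, so \<open>G\<close> is exhausted by the sets \<open>H n\<close>, which use
  the ball of radius \<open>n\<close> and the first \<open>n + 1\<close> radii of an enumeration.
  Rational radii make this a countable union.\<close>

lemma maximal_weak_type:
  fixes M V :: "'a::euclidean_space measure" and c :: ennreal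
  assumes M: "finite_measure M" "sets M = sets borel" and V: "finite_measure V" "sets V = sets borel"
  defines "G \<equiv> {x. \<exists>q\<in>\<rat>. 0 < q \<and> c * emeasure M (ball x q) < emeasure V (ball x q)}"
  shows "G \<in> sets borel" "c * emeasure M G \<le> of_nat (overlap_const TYPE('a)) * emeasure V UNIV"
proof -
  define q where "q = from_nat_into ({q. 0 < q} \<inter> \<rat> :: real set)"
  have cq: "countable ({q. 0 < q} \<inter> \<rat> :: real set)" using countable_rat by blast
  have "(1::real) \<in> {q. 0 < q} \<inter> \<rat>" by simp
  then have q: "range q = {q. 0 < q} \<inter> \<rat>"
    unfolding q_def using cq by (metis empty_iff range_from_nat_into)
  have qpos: "0 < q i" for i using q by (metis IntD1 mem_Collect_eq rangeI)
  define H where "H = (\<lambda>n. {x. dist 0 x < real n \<and> (\<exists>i\<in>{..n}. c * emeasure M (ball x (q i)) < emeasure V (ball x (q i)))})"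
  have H[measurable]: "H n \<in> sets borel" for n
  proof -
    have "{x\<in>space borel. c * emeasure M (ball x (q i)) < emeasure V (ball x (q i))} \<in> sets borel" for i
      by (intro borel_measurable_less borel_measurable_times_ennreal borel_measurable_const
          borel_measurable_emeasure_ball M V)
    then have "ball 0 (real n) \<inter> (\<Union>i\<in>{..n}. {x. c * emeasure M (ball x (q i)) < emeasure V (ball x (q i))}) \<in> sets borel"
      by (intro sets.Int sets.finite_UN) auto
    also have "ball 0 (real n) \<inter> (\<Union>i\<in>{..n}. {x. c * emeasure M (ball x (q i)) < emeasure V (ball x (q i))}) = H n"
      unfolding H_def by auto
    finally show ?thesis .
  qed
  have G: "G = (\<Union>n. H n)"
  proof (intro equalityI subsetI)
    fix x assume "x \<in> G"
    then obtain t where t: "t \<in> \<rat>" "0 < t" "c * emeasure M (ball x t) < emeasure V (ball x t)" by (auto simp: G_def)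
    then obtain i where i: "t = q i" using q by (metis (mono_tags) IntI imageE mem_Collect_eq)
    obtain n where "dist 0 x < real n" using reals_Archimedean2 by blast
    then have "x \<in> H (max n i)" unfolding H_def using t i by auto
    then show "x \<in> (\<Union>n. H n)" by blast
  next
    fix x assume "x \<in> (\<Union>n. H n)"
    then obtain i where "c * emeasure M (ball x (q i)) < emeasure V (ball x (q i))" unfolding H_def by blast
    moreover have "q i \<in> \<rat>" using q by blast
    ultimately show "x \<in> G" unfolding G_def using qpos by blast
  qed
  show "G \<in> sets borel" unfolding G by measurable
  have "c * emeasure M (H n) \<le> of_nat (overlap_const TYPE('a)) * emeasure V UNIV" for n
  proof (rule emeasure_greedy_bound[OF M(2) V(2)])
    show "bounded (H n)" by (rule bounded_subset[OF bounded_ball[of 0 "real n"]]) (auto simp: H_def)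
    show "finite (q ` {..n})" by simp
    show "\<exists>t\<in>q ` {..n}. c * emeasure M (ball x t) \<le> emeasure V (ball x t)" if "x \<in> H n" for x
      using that unfolding H_def by (auto intro: less_imp_le)
  qed (use qpos in auto)
  moreover have "emeasure M G = (SUP n. emeasure M (H n))"
    unfolding G
  proof (rule SUP_emeasure_incseq[symmetric])
    show "incseq H" unfolding H_def incseq_def by force
    show "range H \<subseteq> sets M" unfolding M(2) using H by blast
  qed
  ultimately show "c * emeasure M G \<le> of_nat (overlap_const TYPE('a)) * emeasure V UNIV"
    by (simp only: SUP_mult_left_ennreal SUP_le_iff) blast
qed

text \<open>Passes from an arbitrary radius to the rational radii of the maximal function: an open
  ball is an increasing union of smaller concentric ones.\<close>

lemma emeasure_ball_approx:
  fixes M :: "'a::euclidean_space measure"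
  assumes "sets M = sets borel" and less: "a < emeasure M (ball x r)"
  shows "\<exists>q\<in>\<rat>. 0 < q \<and> q \<le> r \<and> a < emeasure M (ball x q)"
proof -
  have r: "0 < r" using less by (cases "0 < r") (auto simp: ball_empty)
  define f where "f = (\<lambda>n::nat. ball x (r - r / real (n + 2)))"
  have "incseq f" unfolding f_def incseq_def
    using r by (auto intro!: subset_ball divide_left_mono)
  moreover have "(\<Union>n. f n) = ball x r"
  proof (intro equalityI subsetI)
    fix y assume "y \<in> ball x r"
    then have "0 < (r - dist x y) / r" using r by auto
    then obtain n where n: "inverse (real (Suc n)) < (r - dist x y) / r" using reals_Archimedean by blast
    then have "r / real (Suc n) < r - dist x y" using r by (simp add: field_simps)
    moreover have "r / real (n + 2) \<le> r / real (Suc n)" using r by (intro divide_left_mono) auto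
    ultimately have "y \<in> f n" by (simp add: f_def)
    then show "y \<in> (\<Union>n. f n)" by blast
  next
    fix y assume "y \<in> (\<Union>n. f n)"
    then obtain n where n: "dist x y < r - r / real (n + 2)" by (auto simp: f_def)
    have "0 < r / real (n + 2)" using r by simp
    then show "y \<in> ball x r" using n by simp
  qed
  ultimately have "(SUP n. emeasure M (f n)) = emeasure M (ball x r)"
    using SUP_emeasure_incseq[of f M] assms(1) by (simp add: f_def image_subset_iff)
  then obtain n where n: "a < emeasure M (f n)" using less by (metis less_SUP_iff)
  have "r / real (n + 2) < r / 1" using r by (intro divide_strict_left_mono) auto
  then have "max 0 (r - r / real (n + 2)) < r" using r by (simp add: max_def)
  then obtain q where q: "q \<in> \<rat>" "max 0 (r - r / real (n + 2)) < q" "q < r" using Rats_dense_in_real by blast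
  have "emeasure M (f n) \<le> emeasure M (ball x q)"
    unfolding f_def using q assms(1) by (intro emeasure_mono subset_ball) auto
  then show ?thesis using n q by (intro bexI[of _ q]) auto
qed

text \<open>Enclose \<open>B\<close> in open sets \<open>U k\<close> whose excess has measure below
  \<open>1 / (k + 1)\<close>, and apply the weak type inequality to \<open>M\<close> restricted to
  \<open>U k - B\<close>. A point of \<open>B\<close> that violates the estimate at arbitrarily
  small radii belongs to every \<open>G k\<close>, since small balls around it lie in
  \<open>U k\<close>; and the measure of \<open>G k\<close> tends to 0.\<close>

lemma AE_density_point_eps:
  fixes M :: "'a::euclidean_space measure"
  assumes M: "finite_measure M" "sets M = sets borel" and B: "B \<in> sets borel" and e: "0 < e"
  shows "AE x in M. x \<in> B \<longrightarrow> (\<exists>d>0. \<forall>r. 0 < r \<and> r < d \<longrightarrow> measure M (ball x r - B) \<le> e * measure M (ball x r))"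
proof -
  interpret finite_measure M by fact
  define N where "N = overlap_const TYPE('a)"
  have "\<exists>U. open U \<and> B \<subseteq> U \<and> emeasure M (U - B) < ennreal (1 / Suc k)" for k :: nat
  proof -
    have "emeasure M B = (INF U \<in> {U. B \<subseteq> U \<and> open U}. emeasure M U)"
      using M(2) B by (intro outer_regular) auto
    then have "(INF U \<in> {U. B \<subseteq> U \<and> open U}. emeasure M U) = emeasure M B" by (rule sym)
    also have "emeasure M B < emeasure M B + ennreal (1 / Suc k)"
      unfolding emeasure_eq_measure by (subst ennreal_plus[symmetric]) (auto intro!: ennreal_lessI add_nonneg_pos)
    finally have "\<exists>U\<in>{U. B \<subseteq> U \<and> open U}. emeasure M U < emeasure M B + ennreal (1 / Suc k)"
      by (simp only: INF_less_iff)
    then obtain U where U: "B \<subseteq> U" "open U" "emeasure M U < emeasure M B + ennreal (1 / Suc k)" by blast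
    have "measure M (U - B) = measure M U - measure M B"
      using U B M(2) by (intro finite_measure_Diff) auto
    moreover have "measure M U < measure M B + 1 / Suc k"
      using U(3) by (simp add: emeasure_eq_measure ennreal_plus[symmetric] ennreal_less_iff del: ennreal_plus)
    ultimately have "emeasure M (U - B) < ennreal (1 / Suc k)"
      unfolding emeasure_eq_measure by (intro ennreal_lessI) auto
    then show ?thesis using U by blast
  qed
  then obtain U where U: "\<And>k::nat. open (U k)" "\<And>k. B \<subseteq> U k" "\<And>k. emeasure M (U k - B) < ennreal (1 / Suc k)"
    by metis
  define V where "V = (\<lambda>k. density M (indicator (U k - B)))"
  have UB: "U k - B \<in> sets M" for k using U(1)[of k] B M(2) by auto
  have V: "emeasure (V k) X = emeasure M ((U k - B) \<inter> X)" if "X \<in> sets borel" for k X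
  proof -
    have X: "X \<in> sets M" using that M(2) by simp
    have "emeasure (V k) X = (\<integral>\<^sup>+x. indicator (U k - B) x * indicator X x \<partial>M)"
      unfolding V_def using X UB by (intro emeasure_density) auto
    also have "\<dots> = (\<integral>\<^sup>+x. indicator ((U k - B) \<inter> X) x \<partial>M)"
      by (simp only: indicator_inter_arith)
    also have "\<dots> = emeasure M ((U k - B) \<inter> X)"
      using X UB by (intro nn_integral_indicator) auto
    finally show ?thesis .
  qed
  have sV: "sets (V k) = sets borel" for k using M(2) by (simp add: V_def)
  have fV: "finite_measure (V k)" for k
    using V[of UNIV k] sets_eq_imp_space_eq[OF sV[of k]] by (intro finite_measureI) simp
  define G where "G = (\<lambda>k. {x. \<exists>q\<in>\<rat>. 0 < q \<and> ennreal e * emeasure M (ball x q) < emeasure (V k) (ball x q)})"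
  have G: "G k \<in> sets borel" "ennreal e * emeasure M (G k) \<le> of_nat N * emeasure (V k) UNIV" for k
    using maximal_weak_type[OF M fV sV, of "ennreal e" k] unfolding G_def N_def by blast+
  have "measure M (\<Inter>k. G k) \<le> real N / e * (1 / Suc k)" for k
  proof -
    have "ennreal e * emeasure M (\<Inter>k. G k) \<le> ennreal e * emeasure M (G k)"
      using G(1) M(2) by (intro mult_left_mono emeasure_mono) auto
    also have "\<dots> \<le> of_nat N * emeasure (V k) UNIV" by (rule G)
    also have "\<dots> \<le> of_nat N * ennreal (1 / Suc k)"
      using U(3)[of k] by (intro mult_left_mono) (simp_all add: V less_imp_le)
    finally have "ennreal (e * measure M (\<Inter>k. G k)) \<le> ennreal (real N * (1 / Suc k))"
      using e by (simp add: emeasure_eq_measure ennreal_mult ennreal_of_nat_eq_real_of_nat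
          del: times_divide_eq_right)
    then have "e * measure M (\<Inter>k. G k) \<le> real N * (1 / Suc k)"
      by (subst (asm) ennreal_le_iff) auto
    then have "measure M (\<Inter>k. G k) \<le> (real N * (1 / Suc k)) / e"
      using e by (subst pos_le_divide_eq) (simp_all add: mult.commute)
    then show ?thesis by (simp add: mult.commute)
  qed
  note le = this
  have lim: "(\<lambda>k. real N / e * (1 / real (Suc k))) \<longlonglongrightarrow> 0"
    by (intro tendsto_mult_right_zero LIMSEQ_Suc[OF lim_1_over_n])
  have "measure M (\<Inter>k. G k) \<le> 0"
    by (rule LIMSEQ_le_const[OF lim]) (use le in blast)
  then have "measure M (\<Inter>k. G k) = 0" using measure_nonneg[of M "\<Inter>k. G k"] by linarith
  then have null: "(\<Inter>k. G k) \<in> null_sets M"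
    using G(1) M(2) by (auto simp: null_sets_def emeasure_eq_measure)
  show ?thesis
  proof (rule AE_I'[OF null], rule subsetI, rule ccontr)
    fix x assume x: "x \<in> {x \<in> space M. \<not> (x \<in> B \<longrightarrow> (\<exists>d>0. \<forall>r. 0 < r \<and> r < d \<longrightarrow> measure M (ball x r - B) \<le> e * measure M (ball x r)))}"
      and "x \<notin> (\<Inter>k. G k)"
    then obtain k where k: "x \<notin> G k" by blast
    have "x \<in> U k" using x U(2) by blast
    then obtain d where d: "0 < d" "ball x d \<subseteq> U k" using U(1) by (meson open_contains_ball)
    have "measure M (ball x r - B) \<le> e * measure M (ball x r)" if "0 < r" "r < d" for r
    proof (rule ccontr)
      assume "\<not> ?thesis"
      then have "ennreal (e * measure M (ball x r)) < ennreal (measure M (ball x r - B))"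
        using e by (simp add: ennreal_less_iff)
      moreover have "ball x r - B = (U k - B) \<inter> ball x r"
        using d(2) that subset_ball[of r d x] by auto
      ultimately have "ennreal e * emeasure M (ball x r) < emeasure (V k) (ball x r)"
        using V[of "ball x r" k] e by (simp add: emeasure_eq_measure ennreal_mult')
      then obtain q where q: "q \<in> \<rat>" "0 < q" "q \<le> r" "ennreal e * emeasure M (ball x r) < emeasure (V k) (ball x q)"
        using emeasure_ball_approx[OF sV] by blast
      have "ennreal e * emeasure M (ball x q) \<le> ennreal e * emeasure M (ball x r)"
        using q M(2) by (intro mult_left_mono emeasure_mono subset_ball) auto
      then have "x \<in> G k" unfolding G_def using q order_le_less_trans by blast
      then show False using k by blast
    qed
    then show False using x d by blast
  qed
qed

subsection \<open>Differentiation of vector measures\<close>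

text \<open>The complement of the support is covered by the null members of a countable
  basis.\<close>

lemma AE_measure_support:
  fixes M :: "'a::second_countable_topology measure"
  assumes M: "sets M = sets borel"
  shows "AE x in M. x \<in> measure_support M"
proof -
  obtain K :: "'a set set" where K: "countable K" "topological_basis K"
    using ex_countable_basis by blast
  define Z where "Z = {U\<in>K. emeasure M U = 0}"
  have "(\<Union>U\<in>Z. U) \<in> null_sets M"
    using K M topological_basis_open[OF K(2)]
    by (intro null_sets_UN') (auto simp: Z_def null_sets_def intro: countable_subset)
  moreover have "{x\<in>space M. x \<notin> measure_support M} \<subseteq> (\<Union>U\<in>Z. U)"
  proof
    fix x assume "x \<in> {x\<in>space M. x \<notin> measure_support M}"
    then obtain U where U: "open U" "x \<in> U" "emeasure M U = 0" by (auto simp: measure_support_def)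
    obtain W where W: "W \<in> K" "x \<in> W" "W \<subseteq> U" using topological_basisE[OF K(2) U(1,2)] by blast
    have "emeasure M W \<le> emeasure M U" using W U M by (intro emeasure_mono) auto
    then show "x \<in> (\<Union>U\<in>Z. U)" using W U by (auto simp: Z_def)
  qed
  ultimately show ?thesis by (rule AE_I')
qed

lemma emeasure_zero_outside_support:
  fixes M :: "'a::second_countable_topology measure"
  assumes M: "sets M = sets borel" "measure_support M \<inter> X = {}" "X \<in> sets borel"
  shows "emeasure M X = 0"
proof -
  have "AE x in M. x \<notin> X" using AE_measure_support[OF M(1)] M(2) by (auto elim: eventually_mono)
  then show ?thesis using M by (simp add: AE_iff_measurable[OF _ refl] sets_eq_imp_space_eq[OF M(1)])
qed

text \<open>Almost every \<open>x\<close> lies in the support, has \<open>norm (s x) = 1\<close> and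
  is a density point of every set \<open>B c k\<close> that contains it. Near such a point
  \<open>s\<close> is close to \<open>s x\<close> up to a set of small relative measure, so the
  averages of \<open>s\<close> over balls converge to \<open>s x\<close>.\<close>

theorem AE_reduced_boundary:
  fixes D :: "'a::euclidean_space set \<Rightarrow> real^'n"
  assumes D: "vector_measure D"
  shows "AE x in total_variation D. x \<in> measure_support (total_variation D) \<and>
     (\<exists>\<nu>\<in>sphere 0 1. ((\<lambda>r. D (ball x r) /\<^sub>R measure (total_variation D) (ball x r)) \<longlongrightarrow> \<nu>) (at_right 0))"
proof -
  let ?T = "total_variation D"
  interpret T: finite_measure ?T by (rule finite_measure_total_variation[OF D])
  obtain s where s: "integrable ?T s" "AE x in ?T. norm (s x) = 1"
      "\<And>X. X \<in> sets borel \<Longrightarrow> D X = (LINT x:X|?T. s x)"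
    using polar_decomposition[OF D] by blast
  obtain C :: "(real^'n) set" where C: "countable C" "\<And>U. open U \<Longrightarrow> U \<noteq> {} \<Longrightarrow> \<exists>c\<in>C. c \<in> U"
    using countable_dense_setE by metis
  \<comment> \<open>These sets localise the values of \<open>s\<close> to balls of radius
    \<open>1 / (k + 1)\<close>. With \<open>c\<close> in a countable dense set there are countably
    many of them, so one null set serves for all.\<close>
  define B where "B = (\<lambda>c (k::nat). {x. dist c (s x) < 1 / Suc k \<and> norm (s x) = 1})"
  have [measurable]: "s \<in> borel_measurable borel" using borel_measurable_integrable[OF s(1)]
    unfolding measurable_cong_sets[OF sets_total_variation refl] .
  have B: "B c k \<in> sets borel" for c k unfolding B_def by measurable
  have "AE x in ?T. \<forall>c\<in>C. \<forall>k\<in>UNIV. x \<in> B c k \<longrightarrow>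
      (\<exists>d>0. \<forall>r. 0 < r \<and> r < d \<longrightarrow> measure ?T (ball x r - B c k) \<le> 1 / real (Suc k) * measure ?T (ball x r))"
    using C(1) B by (intro AE_ball_countable[THEN iffD2] ballI AE_density_point_eps T.finite_measure_axioms) auto
  with s(2) AE_measure_support[OF sets_total_variation[of D]]
  show ?thesis
  proof eventually_elim
    case (elim x)
    have pos: "0 < measure ?T (ball x r)" if "0 < r" for r
    proof -
      have "0 < emeasure ?T (ball x r)"
        using elim(2) that unfolding measure_support_def by (auto elim!: allE[of _ "ball x r"])
      then show ?thesis unfolding T.emeasure_eq_measure by simp
    qed
    have "((\<lambda>r. D (ball x r) /\<^sub>R measure ?T (ball x r)) \<longlongrightarrow> s x) (at_right 0)"
    proof (rule tendstoI)
      fix e :: real assume "0 < e"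
      then have "0 < e / 4" by simp
      \<comment> \<open>There are two contributions of size \<open>2 / (k + 1)\<close>: the
        oscillation of \<open>s\<close> on \<open>B c k\<close>, and the bound 2 for the difference
        of unit vectors times the relative measure of the rest of the ball.\<close>
      then obtain k :: nat where k: "1 / Suc k < e / 4" using nat_approx_posE by blast
      obtain c where c: "c \<in> C" "dist (s x) c < 1 / Suc k"
        using C(2)[of "ball (s x) (1 / Suc k)"] by auto
      then have "x \<in> B c k" using elim(1) by (auto simp: B_def dist_commute)
      then obtain d where d: "0 < d" "\<And>r. 0 < r \<Longrightarrow> r < d \<Longrightarrow>
          measure ?T (ball x r - B c k) \<le> 1 / real (Suc k) * measure ?T (ball x r)"
        using elim(3) c(1) by blast
      have "dist (D (ball x r) /\<^sub>R measure ?T (ball x r)) (s x) < e" if r: "0 < r" "r < d" for r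
      proof -
        let ?b = "ball x r"
        have int: "integrable ?T (\<lambda>y. indicator ?b y *\<^sub>R s y)" "integrable ?T (\<lambda>y. indicator ?b y *\<^sub>R s x)"
          using s(1) by (auto intro!: integrable_mult_indicator)
        have int2: "integrable ?T (\<lambda>y. 2 / Suc k * indicator ?b y + 2 * indicator (?b - B c k) y)"
          by (intro Bochner_Integration.integrable_add integrable_mult_right integrable_real_indicator)
             (use B in \<open>auto simp: T.emeasure_eq_measure\<close>)
        have sx: "measure ?T ?b *\<^sub>R s x = (LINT y|?T. indicator ?b y *\<^sub>R s x)"
          by (subst integral_scaleR_left) (auto simp: T.emeasure_eq_measure)
        have "D ?b - measure ?T ?b *\<^sub>R s x = (LINT y|?T. indicator ?b y *\<^sub>R s y - indicator ?b y *\<^sub>R s x)"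
          unfolding sx using s(3)[of ?b] int by (subst Bochner_Integration.integral_diff) (auto simp: set_lebesgue_integral_def)
        also have "norm \<dots> \<le> (LINT y|?T. norm (indicator ?b y *\<^sub>R s y - indicator ?b y *\<^sub>R s x))"
          by (rule integral_norm_bound)
        also have "\<dots> \<le> (LINT y|?T. 2 / Suc k * indicator ?b y + 2 * indicator (?b - B c k) y)"
        proof (rule integral_mono_AE)
          show "AE y in ?T. norm (indicator ?b y *\<^sub>R s y - indicator ?b y *\<^sub>R s x) \<le>
              2 / Suc k * indicator ?b y + 2 * indicator (?b - B c k) y"
            using s(2)
          proof eventually_elim
            case (elim y)
            have 2: "norm (s y - s x) \<le> 2" using norm_triangle_ineq4[of "s y" "s x"] elim \<open>norm (s x) = 1\<close> by simp
            moreover have "norm (s y - s x) \<le> 2 / Suc k" if "y \<in> B c k"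
              using that c(2) dist_triangle[of "s y" "s x" c] by (auto simp: B_def dist_norm norm_minus_commute)
            moreover have "norm (s y - s x) \<le> 2 / real (Suc k) + 2"
              using 2 by (rule add_increasing[rotated]) simp
            ultimately show ?case by (auto simp: indicator_def simp del: of_nat_Suc)
          qed
        qed (use int int2 in auto)
        also have "\<dots> = 2 / Suc k * measure ?T ?b + 2 * measure ?T (?b - B c k)"
          using B by (subst Bochner_Integration.integral_add) (auto simp: T.emeasure_eq_measure)
        also have "\<dots> \<le> 4 / Suc k * measure ?T ?b" using d(2)[OF r] by simp
        also have "\<dots> < e * measure ?T ?b" using k pos[OF r(1)] by (intro mult_strict_right_mono) auto
        finally have *: "norm (D ?b - measure ?T ?b *\<^sub>R s x) < e * measure ?T ?b" .
        have "D ?b /\<^sub>R measure ?T ?b - s x = (D ?b - measure ?T ?b *\<^sub>R s x) /\<^sub>R measure ?T ?b"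
          using pos[OF r(1)] by (simp add: scaleR_diff_right)
        then have "dist (D ?b /\<^sub>R measure ?T ?b) (s x) = norm (D ?b - measure ?T ?b *\<^sub>R s x) / measure ?T ?b"
          using pos[OF r(1)] by (simp add: dist_norm divide_inverse mult.commute)
        then show ?thesis using * pos[OF r(1)] by (simp add: pos_divide_less_eq)
      qed
      then show "\<forall>\<^sub>F r in at_right 0. dist (D (ball x r) /\<^sub>R measure ?T (ball x r)) (s x) < e"
        using d(1) by (auto simp: eventually_at_right_field)
    qed
    then show ?case using elim by auto
  qed
qed

section \<open>Compactly supported Lipschitz functions\<close>

lemma compactly_supported_iff:
  fixes f :: "'a::euclidean_space \<Rightarrow> 'b::zero"
  shows "compactly_supported f \<longleftrightarrow> (\<exists>R. \<forall>x. R < norm x \<longrightarrow> f x = 0)"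
  unfolding compactly_supported_def compact_closure bounded_iff by (auto simp: not_less[symmetric])

lemma Lip_cI:
  fixes f :: "'a::euclidean_space \<Rightarrow> 'b::real_normed_vector"
  assumes "L-lipschitz_on UNIV f" "\<And>x. R < norm x \<Longrightarrow> f x = 0"
  shows "f \<in> Lip_c"
  using assms unfolding Lip_c_def compactly_supported_iff by blast

lemma Lip_c_support:
  fixes f :: "'a::euclidean_space \<Rightarrow> 'b::real_normed_vector"
  assumes "f \<in> Lip_c"
  obtains R where "0 < R" "\<And>x. R < norm x \<Longrightarrow> f x = 0"
proof -
  obtain R where "\<forall>x. R < norm x \<longrightarrow> f x = 0"
    using assms unfolding Lip_c_def compactly_supported_iff by blast
  then show ?thesis using that[of "max 1 R"] by auto
qed

lemma Lip_c_lipschitz: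
  assumes "f \<in> Lip_c" obtains L where "0 \<le> L" "L-lipschitz_on UNIV f"
  using assms lipschitz_on_nonneg unfolding Lip_c_def by blast

lemma Lip_c_continuous: "f \<in> Lip_c \<Longrightarrow> continuous_on UNIV f"
  unfolding Lip_c_def using lipschitz_on_continuous_on by blast

lemma Lip_c_bounded:
  fixes f :: "'a::euclidean_space \<Rightarrow> 'b::real_normed_vector"
  assumes f: "f \<in> Lip_c"
  obtains M where "0 < M" "\<And>x. norm (f x) \<le> M"
proof -
  obtain R where R: "0 < R" "\<And>x. R < norm x \<Longrightarrow> f x = 0" using Lip_c_support[OF f] by blast
  have "compact (f ` cball 0 R)"
    by (intro compact_continuous_image continuous_on_subset[OF Lip_c_continuous[OF f]]) auto
  then obtain M where M: "0 < M" "\<And>y. y \<in> f ` cball 0 R \<Longrightarrow> norm y \<le> M"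
    using compact_imp_bounded bounded_pos by metis
  have "norm (f x) \<le> M" for x
    using M R(2)[of x] by (cases "norm x \<le> R") auto
  then show ?thesis using that M(1) by blast
qed

lemma lipschitz_on_scaleR:
  fixes u :: "'a::metric_space \<Rightarrow> real" and f :: "'a \<Rightarrow> 'b::real_normed_vector"
  assumes u: "L-lipschitz_on UNIV u" "\<And>x. \<bar>u x\<bar> \<le> A" and f: "M-lipschitz_on UNIV f" "\<And>x. norm (f x) \<le> B"
  shows "(A * M + B * L)-lipschitz_on UNIV (\<lambda>x. u x *\<^sub>R f x)"
proof (rule lipschitz_onI)
  have A: "0 \<le> A" using u(2)[of undefined] by linarith
  have B: "0 \<le> B" using f(2)[of undefined] norm_ge_zero order_trans by blast
  show "0 \<le> A * M + B * L" using A B u f by (auto simp: lipschitz_on_nonneg)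
  fix x y
  have "u x *\<^sub>R f x - u y *\<^sub>R f y = u x *\<^sub>R (f x - f y) + (u x - u y) *\<^sub>R f y"
    by (simp add: algebra_simps)
  then have "dist (u x *\<^sub>R f x) (u y *\<^sub>R f y) \<le> norm (u x *\<^sub>R (f x - f y)) + norm ((u x - u y) *\<^sub>R f y)"
    by (metis dist_norm norm_triangle_ineq)
  also have "\<dots> = \<bar>u x\<bar> * dist (f x) (f y) + dist (u x) (u y) * norm (f y)"
    by (simp add: dist_norm)
  also have "\<dots> \<le> A * (M * dist x y) + (L * dist x y) * B"
    using A B u f lipschitz_on_nonneg[OF u(1)]
    by (intro add_mono mult_mono) (auto intro: lipschitz_onD[OF u(1)] lipschitz_onD[OF f(1)])
  finally show "dist (u x *\<^sub>R f x) (u y *\<^sub>R f y) \<le> (A * M + B * L) * dist x y"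
    by (simp add: algebra_simps)
qed

lemma Lip_c_scaleR_bounded:
  fixes f :: "'a::euclidean_space \<Rightarrow> 'b::real_normed_vector"
  assumes u: "L-lipschitz_on UNIV u" "\<And>x. \<bar>u x\<bar> \<le> A" and f: "f \<in> Lip_c"
  shows "(\<lambda>x. u x *\<^sub>R f x) \<in> Lip_c"
proof -
  obtain M where M: "M-lipschitz_on UNIV f" using Lip_c_lipschitz[OF f] by blast
  obtain B where B: "\<And>x. norm (f x) \<le> B" using Lip_c_bounded[OF f] by blast
  obtain R where R: "\<And>x. R < norm x \<Longrightarrow> f x = 0" using Lip_c_support[OF f] by blast
  show ?thesis using lipschitz_on_scaleR[OF u M B] by (rule Lip_cI[where R = R]) (simp add: R)
qed

lemma Lip_c_add:
  fixes f g :: "'a::euclidean_space \<Rightarrow> 'b::real_normed_vector"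
  assumes f: "f \<in> Lip_c" and g: "g \<in> Lip_c"
  shows "(\<lambda>x. f x + g x) \<in> Lip_c"
proof -
  obtain M where M: "M-lipschitz_on UNIV f" using Lip_c_lipschitz[OF f] by blast
  obtain L where L: "L-lipschitz_on UNIV g" using Lip_c_lipschitz[OF g] by blast
  obtain R where R: "\<And>x. R < norm x \<Longrightarrow> f x = 0" using Lip_c_support[OF f] by blast
  obtain S where S: "\<And>x. S < norm x \<Longrightarrow> g x = 0" using Lip_c_support[OF g] by blast
  show ?thesis using lipschitz_on_add[OF M L] by (rule Lip_cI[where R = "max R S"]) (simp add: R S)
qed

lemma Lip_c_scaleR:
  fixes f :: "'a::euclidean_space \<Rightarrow> 'b::real_normed_vector"
  shows "f \<in> Lip_c \<Longrightarrow> (\<lambda>x. c *\<^sub>R f x) \<in> Lip_c"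
  by (rule Lip_c_scaleR_bounded[of 0 "\<lambda>_. c" "\<bar>c\<bar>"]) (auto simp: lipschitz_on_constant)

lemma Lip_c_cmult: "f \<in> Lip_c \<Longrightarrow> (\<lambda>x. c * f x) \<in> Lip_c" for f :: "'a::euclidean_space \<Rightarrow> real"
  using Lip_c_scaleR[of f c] by simp

lemma Lip_c_diff:
  fixes f g :: "'a::euclidean_space \<Rightarrow> 'b::real_normed_vector"
  assumes f: "f \<in> Lip_c" and g: "g \<in> Lip_c"
  shows "(\<lambda>x. f x - g x) \<in> Lip_c"
  using Lip_c_add[OF f Lip_c_scaleR[OF g, of "-1"]] by simp

lemma Lip_c_zero: "(\<lambda>x. 0) \<in> (Lip_c :: ('a::euclidean_space \<Rightarrow> 'b::real_normed_vector) set)"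
  by (rule Lip_cI[where L = 0 and R = 0]) (auto simp: lipschitz_on_constant)

lemma Lip_c_sum:
  fixes f :: "'i \<Rightarrow> 'a::euclidean_space \<Rightarrow> 'b::real_normed_vector"
  shows "(\<And>i. i \<in> I \<Longrightarrow> f i \<in> Lip_c) \<Longrightarrow> (\<lambda>x. \<Sum>i\<in>I. f i x) \<in> Lip_c"
  by (induction I rule: infinite_finite_induct) (simp_all add: Lip_c_zero Lip_c_add)

lemma Lip_c_compose:
  fixes f :: "'a::euclidean_space \<Rightarrow> 'b::real_normed_vector" and h :: "'b \<Rightarrow> 'c::real_normed_vector"
  assumes f: "f \<in> Lip_c" and h: "L-lipschitz_on UNIV h" "h 0 = 0"
  shows "(\<lambda>x. h (f x)) \<in> Lip_c"
proof -
  obtain M where M: "M-lipschitz_on UNIV f" using Lip_c_lipschitz[OF f] by blast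
  obtain R where R: "\<And>x. R < norm x \<Longrightarrow> f x = 0" using Lip_c_support[OF f] by blast
  have "L-lipschitz_on (range f) h" using h(1) by (rule lipschitz_on_subset) auto
  from lipschitz_on_compose2[OF M this]
  show ?thesis by (rule Lip_cI[where R = R]) (simp add: R h(2))
qed

lemma Lip_c_abs: "f \<in> Lip_c \<Longrightarrow> (\<lambda>x. \<bar>f x\<bar>) \<in> Lip_c" for f :: "'a::euclidean_space \<Rightarrow> real"
  by (rule Lip_c_compose[where L = 1]) (auto intro!: lipschitz_onI simp: dist_real_def)

lemma Lip_c_max:
  fixes f g :: "'a::euclidean_space \<Rightarrow> real"
  assumes f: "f \<in> Lip_c" and g: "g \<in> Lip_c"
  shows "(\<lambda>x. max (f x) (g x)) \<in> Lip_c"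
proof -
  have "(\<lambda>x. (1/2) * ((f x + g x) + \<bar>f x - g x\<bar>)) \<in> Lip_c"
    by (intro Lip_c_cmult Lip_c_add Lip_c_abs Lip_c_diff f g)
  moreover have "(\<lambda>x. (1/2) * ((f x + g x) + \<bar>f x - g x\<bar>)) = (\<lambda>x. max (f x) (g x))"
    by (auto simp: max_def)
  ultimately show ?thesis by simp
qed

lemma Lip_c_min:
  fixes f g :: "'a::euclidean_space \<Rightarrow> real"
  assumes f: "f \<in> Lip_c" and g: "g \<in> Lip_c"
  shows "(\<lambda>x. min (f x) (g x)) \<in> Lip_c"
proof -
  have "(\<lambda>x. f x + g x - max (f x) (g x)) \<in> Lip_c"
    by (intro Lip_c_diff Lip_c_add Lip_c_max f g)
  moreover have "(\<lambda>x. f x + g x - max (f x) (g x)) = (\<lambda>x. min (f x) (g x))"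
    by (auto simp: max_def min_def)
  ultimately show ?thesis by simp
qed

definition cutoff :: "real \<Rightarrow> 'a::euclidean_space \<Rightarrow> real" where
  "cutoff R x = max 0 (min 1 (R + 1 - norm x))"

lemma cutoff_bounds: "0 \<le> cutoff R x" "cutoff R x \<le> 1" "\<bar>cutoff R x\<bar> \<le> 1"
  by (auto simp: cutoff_def)

lemma cutoff_eq_1: "norm x \<le> R \<Longrightarrow> cutoff R x = 1"
  by (auto simp: cutoff_def)

lemma cutoff_eq_0: "R + 1 < norm x \<Longrightarrow> cutoff R x = 0"
  by (auto simp: cutoff_def)

lemma lipschitz_cutoff: "1-lipschitz_on UNIV (cutoff R)"
proof (rule lipschitz_onI)
  fix x y :: 'a
  have "\<bar>norm x - norm y\<bar> \<le> dist x y" by (simp add: dist_norm norm_triangle_ineq3)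
  then show "dist (cutoff R x) (cutoff R y) \<le> 1 * dist x y"
    unfolding cutoff_def dist_real_def by linarith
qed simp

lemma cutoff_Lip_c: "cutoff R \<in> Lip_c"
  by (rule Lip_cI[OF lipschitz_cutoff, of "R + 1"]) (rule cutoff_eq_0)

lemma cutoff_mono: "R \<le> S \<Longrightarrow> cutoff R x \<le> cutoff S x"
  by (auto simp: cutoff_def)

section \<open>A Riesz representation theorem\<close>

text \<open>Additivity is asked on nonnegative functions, which is where the positive part of a
  functional is additive. Multiples by natural numbers follow from it, and the estimates below are
  arranged to use only such multiples.\<close>

locale positive_functional =
  fixes \<Lambda> :: "('a::euclidean_space \<Rightarrow> real) \<Rightarrow> real" and C :: real
  assumes add: "\<And>f g. f \<in> Lip_c \<Longrightarrow> g \<in> Lip_c \<Longrightarrow> (\<And>x. 0 \<le> f x) \<Longrightarrow> (\<And>x. 0 \<le> g x) \<Longrightarrow>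
      \<Lambda> (\<lambda>x. f x + g x) = \<Lambda> f + \<Lambda> g"
    and nonneg: "\<And>f. f \<in> Lip_c \<Longrightarrow> (\<And>x. 0 \<le> f x) \<Longrightarrow> 0 \<le> \<Lambda> f"
    and bdd: "\<And>f. f \<in> Lip_c \<Longrightarrow> (\<And>x. 0 \<le> f x) \<Longrightarrow> (\<And>x. f x \<le> 1) \<Longrightarrow> \<Lambda> f \<le> C"
begin

definition Pos :: "('a \<Rightarrow> real) set" where "Pos = {f \<in> Lip_c. \<forall>x. 0 \<le> f x}"

lemma Pos_D: "f \<in> Pos \<Longrightarrow> f \<in> Lip_c" "f \<in> Pos \<Longrightarrow> 0 \<le> f x"
  by (auto simp: Pos_def)

lemma Pos_add: "f \<in> Pos \<Longrightarrow> g \<in> Pos \<Longrightarrow> (\<lambda>x. f x + g x) \<in> Pos"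
  by (auto simp: Pos_def Lip_c_add)

lemma Pos_diff: "f \<in> Pos \<Longrightarrow> g \<in> Pos \<Longrightarrow> (\<And>x. g x \<le> f x) \<Longrightarrow> (\<lambda>x. f x - g x) \<in> Pos"
  by (auto simp: Pos_def Lip_c_diff)

lemma Pos_zero: "(\<lambda>x. 0) \<in> Pos"
  by (auto simp: Pos_def Lip_c_zero)

lemma Pos_cmult: "f \<in> Pos \<Longrightarrow> 0 \<le> c \<Longrightarrow> (\<lambda>x. c * f x) \<in> Pos"
  by (auto simp: Pos_def Lip_c_cmult)

lemma Pos_sum: "(\<And>i. i \<in> I \<Longrightarrow> f i \<in> Pos) \<Longrightarrow> (\<lambda>x. \<Sum>i\<in>I. f i x) \<in> Pos"
  by (auto simp: Pos_def intro!: Lip_c_sum sum_nonneg)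

lemma Pos_mult_bounded:
  "f \<in> Pos \<Longrightarrow> L-lipschitz_on UNIV u \<Longrightarrow> (\<And>x. 0 \<le> u x) \<Longrightarrow> (\<And>x. u x \<le> 1) \<Longrightarrow> (\<lambda>x. f x * u x) \<in> Pos"
  using Lip_c_scaleR_bounded[of L u 1 f] by (auto simp: Pos_def mult.commute)

lemma \<Lambda>_add: "f \<in> Pos \<Longrightarrow> g \<in> Pos \<Longrightarrow> \<Lambda> (\<lambda>x. f x + g x) = \<Lambda> f + \<Lambda> g"
  using add by (auto simp: Pos_def)

lemma \<Lambda>_nonneg: "f \<in> Pos \<Longrightarrow> 0 \<le> \<Lambda> f"
  using nonneg by (auto simp: Pos_def)

lemma \<Lambda>_diff: "f \<in> Pos \<Longrightarrow> g \<in> Pos \<Longrightarrow> (\<And>x. g x \<le> f x) \<Longrightarrow> \<Lambda> (\<lambda>x. f x - g x) = \<Lambda> f - \<Lambda> g"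
  using \<Lambda>_add[OF Pos_diff, of f g g] by simp

lemma \<Lambda>_mono: "f \<in> Pos \<Longrightarrow> g \<in> Pos \<Longrightarrow> (\<And>x. g x \<le> f x) \<Longrightarrow> \<Lambda> g \<le> \<Lambda> f"
  using \<Lambda>_diff[of f g] \<Lambda>_nonneg[OF Pos_diff, of f g] by simp

lemma \<Lambda>_zero: "\<Lambda> (\<lambda>x. 0) = 0"
  using \<Lambda>_add[OF Pos_zero Pos_zero] by simp

lemma \<Lambda>_sum: "finite I \<Longrightarrow> (\<And>i. i \<in> I \<Longrightarrow> f i \<in> Pos) \<Longrightarrow> \<Lambda> (\<lambda>x. \<Sum>i\<in>I. f i x) = (\<Sum>i\<in>I. \<Lambda> (f i))"
proof (induction I rule: finite_induct)
  case (insert i I)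
  then show ?case using \<Lambda>_add[of "f i" "\<lambda>x. \<Sum>i\<in>I. f i x"] Pos_sum[of I f] by simp
qed (simp add: \<Lambda>_zero)

lemma \<Lambda>_of_nat: "f \<in> Pos \<Longrightarrow> \<Lambda> (\<lambda>x. real n * f x) = real n * \<Lambda> f"
  using \<Lambda>_sum[of "{..<n}" "\<lambda>_. f"] by simp

lemma C_nonneg: "0 \<le> C"
  using bdd[OF Lip_c_zero] \<Lambda>_zero by simp

text \<open>A Dini type argument on the compact support of \<open>g\<close>.\<close>

lemma \<Lambda>_le_suminf:
  assumes g: "g \<in> Pos" and h: "\<And>k. h k \<in> Pos"
    and le: "\<And>x. ennreal (g x) \<le> (\<Sum>k. ennreal (h k x))"
  shows "ennreal (\<Lambda> g) \<le> (\<Sum>k. ennreal (\<Lambda> (h k)))"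
proof (cases "(\<Sum>k. ennreal (\<Lambda> (h k)))")
  case (real S)
  obtain R where R: "\<And>x. R < norm x \<Longrightarrow> g x = 0" using Lip_c_support[OF Pos_D(1)[OF g]] by blast
  have "real N * \<Lambda> g \<le> real N * S + C" for N :: nat
  proof -
    define s where "s = (\<lambda>m x. \<Sum>k<m. h k x)"
    \<comment> \<open>\<open>g\<close> is compared with the partial sums after multiplication by
      \<open>N\<close>, with slack 1. On the support of \<open>g\<close> the slack is paid by
      \<open>cutoff R\<close>, on which the functional is at most \<open>C\<close>; dividing by
      \<open>N\<close> makes it negligible.\<close>
    define U where "U = (\<lambda>m. {x. real N * g x < real N * s m x + 1})"
    have s_mono: "s m x \<le> s n x" if "m \<le> n" for m n x
      unfolding s_def using that Pos_D(2)[OF h] by (intro sum_mono2) auto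
    have "open (U m)" for m
      unfolding U_def s_def using Lip_c_continuous[OF Pos_D(1)[OF g]] Lip_c_continuous[OF Pos_D(1)[OF h]]
      by (intro open_Collect_less continuous_intros) auto
    moreover have "cball 0 R \<subseteq> (\<Union>m. U m)"
    proof
      fix x assume "x \<in> cball (0::'a) R"
      show "x \<in> (\<Union>m. U m)"
      proof (cases "N = 0")
        case False
        have "ennreal (g x - 1 / N) < ennreal (g x) \<or> g x = 0"
          using Pos_D(2)[OF g, of x] False by (auto simp: ennreal_less_iff intro!: ennreal_lessI)
        then consider "ennreal (g x - 1 / N) < (\<Sum>k. ennreal (h k x))" | "g x = 0"
          using le[of x] by (meson order_less_le_trans)
        then show ?thesis
        proof cases
          case 1
          then obtain m where "ennreal (g x - 1 / N) < (\<Sum>k<m. ennreal (h k x))"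
            unfolding suminf_eq_SUP less_SUP_iff by blast
          also have "\<dots> = ennreal (s m x)" unfolding s_def using Pos_D(2)[OF h] by (simp add: sum_ennreal)
          finally have "g x - 1 / N < s m x"
            by (metis ennreal_leI not_less)
          then have "real N * (g x - 1 / N) < real N * s m x" using False by (intro mult_strict_left_mono) auto
          then have "x \<in> U m" unfolding U_def using False by (simp add: algebra_simps)
          then show ?thesis by blast
        next
          case 2
          then have "x \<in> U 0" by (simp add: U_def s_def)
          then show ?thesis by blast
        qed
      qed (auto simp: U_def)
    qed
    ultimately obtain F where F: "finite F" "cball 0 R \<subseteq> (\<Union>m\<in>F. U m)"
      using compactE_image[of "cball 0 R" UNIV U] by (metis compact_cball)
    define M where "M = Max (insert 0 F)"
    have "real N * g x \<le> real N * s M x + cutoff R x" for x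
    proof (cases "norm x \<le> R")
      case True
      then obtain m where m: "m \<in> F" "x \<in> U m" using F(2) by auto
      then have "m \<le> M" unfolding M_def using F(1) by simp
      then have "real N * s m x \<le> real N * s M x" using s_mono by (intro mult_left_mono) auto
      then show ?thesis using m cutoff_eq_1[OF True] unfolding U_def by simp
    next
      case False
      then show ?thesis using R[of x] cutoff_bounds(1)[of R x] Pos_D(2)[OF h] by (simp add: s_def sum_nonneg)
    qed
    moreover have sP: "s M \<in> Pos" unfolding s_def using h by (rule Pos_sum)
    moreover have cP: "cutoff R \<in> Pos" by (simp add: Pos_def cutoff_Lip_c cutoff_bounds)
    moreover have NP: "(\<lambda>x. real N * f x) \<in> Pos" if "f \<in> Pos" for f using that by (intro Pos_cmult) auto
    ultimately have "\<Lambda> (\<lambda>x. real N * g x) \<le> \<Lambda> (\<lambda>x. real N * s M x + cutoff R x)"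
      using g by (intro \<Lambda>_mono Pos_add) auto
    also have "\<dots> = real N * \<Lambda> (s M) + \<Lambda> (cutoff R)"
      using sP cP NP by (simp add: \<Lambda>_add \<Lambda>_of_nat)
    also have "\<Lambda> (cutoff R) \<le> C" using bdd cutoff_Lip_c cutoff_bounds by blast
    also have "\<Lambda> (s M) = (\<Sum>k<M. \<Lambda> (h k))" unfolding s_def using h by (intro \<Lambda>_sum) auto
    also have "\<dots> \<le> S"
    proof -
      have "ennreal (\<Sum>k<M. \<Lambda> (h k)) = (\<Sum>k<M. ennreal (\<Lambda> (h k)))"
        using \<Lambda>_nonneg[OF h] by (simp add: sum_ennreal)
      also have "\<dots> \<le> (\<Sum>k. ennreal (\<Lambda> (h k)))" by (intro sum_le_suminf) auto
      also have "\<dots> = ennreal S" by (rule real)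
      finally show ?thesis using real by (simp add: ennreal_le_iff)
    qed
    finally show ?thesis using \<Lambda>_of_nat[OF g, of N] by (simp add: mult_left_mono)
  qed
  then have "\<Lambda> g \<le> S + C / real (Suc N)" for N
  proof -
    assume "\<And>N. real N * \<Lambda> g \<le> real N * S + C"
    from this[of "Suc N"] have "real (Suc N) * \<Lambda> g \<le> real (Suc N) * (S + C / real (Suc N))"
      by (simp add: distrib_left del: of_nat_Suc)
    then show ?thesis by (simp del: of_nat_Suc)
  qed
  moreover have "(\<lambda>N. S + C / real (Suc N)) \<longlonglongrightarrow> S + 0"
    by (intro tendsto_add tendsto_const LIMSEQ_Suc[OF lim_const_over_n])
  ultimately have "\<Lambda> g \<le> S + 0" using LIMSEQ_le_const by blast
  then show ?thesis using real by (simp add: ennreal_leI)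
qed simp

text \<open>A Daniell type outer measure: a set is covered by a series of nonnegative Lipschitz
  functions, and the cost of the cover is the sum of the values of \<Lambda>. Series instead of
  single functions reduce countable subadditivity to reindexing a double series.\<close>

definition outer :: "'a set \<Rightarrow> ennreal" where
  "outer A = (INF h \<in> {h. (\<forall>k::nat. h k \<in> Pos) \<and> (\<forall>x\<in>A. 1 \<le> (\<Sum>k. ennreal (h k x)))}. \<Sum>k. ennreal (\<Lambda> (h k)))"

lemma outer_close:
  "outer A < b \<Longrightarrow> \<exists>h. (\<forall>k::nat. h k \<in> Pos) \<and> (\<forall>x\<in>A. 1 \<le> (\<Sum>k. ennreal (h k x))) \<and>
      (\<Sum>k. ennreal (\<Lambda> (h k))) < b"
  unfolding outer_def INF_less_iff by auto

lemma outer_le: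
  assumes "\<And>k::nat. h k \<in> Pos" "\<And>x. x \<in> A \<Longrightarrow> 1 \<le> (\<Sum>k. ennreal (h k x))"
  shows "outer A \<le> (\<Sum>k. ennreal (\<Lambda> (h k)))"
  unfolding outer_def using assms by (intro INF_lower) auto

lemma outer_le2:
  assumes h: "\<And>k l::nat. h k l \<in> Pos" and A: "\<And>x. x \<in> A \<Longrightarrow> 1 \<le> (\<Sum>k. \<Sum>l. ennreal (h k l x))"
  shows "outer A \<le> (\<Sum>k. \<Sum>l. ennreal (\<Lambda> (h k l)))"
proof -
  have eq: "(\<Sum>i. F (prod_decode i)) = (\<Sum>k. \<Sum>l. F (k, l))" for F :: "nat \<times> nat \<Rightarrow> ennreal"
    by (rule suminf_ennreal_2dimen) simp
  let ?h = "\<lambda>i. h (fst (prod_decode i)) (snd (prod_decode i))"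
  have "outer A \<le> (\<Sum>i. ennreal (\<Lambda> (?h i)))"
    using h A eq[of "\<lambda>p. ennreal (h (fst p) (snd p) x)" for x] by (intro outer_le) auto
  also have "\<dots> = (\<Sum>k. \<Sum>l. ennreal (\<Lambda> (h k l)))"
    using eq[of "\<lambda>p. ennreal (\<Lambda> (h (fst p) (snd p)))"] by simp
  finally show ?thesis .
qed

lemma suminf_single_ennreal: "(\<Sum>k::nat. if k = 0 then c else 0) = (c :: ennreal)"
  using suminf_finite[of "{0}" "\<lambda>k. if k = 0 then c else 0"] by simp

lemma outer_le1:
  assumes "g \<in> Pos" "\<And>x. x \<in> A \<Longrightarrow> 1 \<le> g x"
  shows "outer A \<le> ennreal (\<Lambda> g)"
proof -
  let ?h = "\<lambda>k::nat. if k = 0 then g else (\<lambda>x. 0)"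
  have h: "?h k \<in> Pos" for k using assms Pos_zero by auto
  have e: "(\<lambda>k. ennreal (?h k x)) = (\<lambda>k. if k = 0 then ennreal (g x) else 0)" for x by auto
  have "1 \<le> (\<Sum>k. ennreal (?h k x))" if "x \<in> A" for x
    unfolding e suminf_single_ennreal using assms(2)[OF that] by (metis ennreal_1 ennreal_leI)
  with h have "outer A \<le> (\<Sum>k. ennreal (\<Lambda> (?h k)))" by (rule outer_le)
  also have "(\<lambda>k. ennreal (\<Lambda> (?h k))) = (\<lambda>k. if k = 0 then ennreal (\<Lambda> g) else 0)"
    by (auto simp: \<Lambda>_zero)
  finally show ?thesis by (simp add: suminf_single_ennreal)
qed

lemma outer_empty: "outer {} = 0"
  using outer_le1[OF Pos_zero, of "{}"] by (simp add: \<Lambda>_zero)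

lemma outer_mono: "A \<subseteq> B \<Longrightarrow> outer A \<le> outer B"
  unfolding outer_def by (intro INF_superset_mono) auto

lemma outer_subadditive: "outer (\<Union>i::nat. A i) \<le> (\<Sum>i. outer (A i))"
proof (rule ennreal_le_epsilon)
  fix e :: real assume e: "0 < e" and fin: "(\<Sum>i. outer (A i)) < top"
  have "outer (A i) < outer (A i) + e * (1/2)^Suc i" for i
    using fin e by (auto simp: less_top dest!: ennreal_suminf_lessD)
  then have "\<exists>h. (\<forall>k::nat. h k \<in> Pos) \<and> (\<forall>x\<in>A i. 1 \<le> (\<Sum>k. ennreal (h k x))) \<and>
      (\<Sum>k. ennreal (\<Lambda> (h k))) < outer (A i) + e * (1/2)^Suc i" for i
    by (intro outer_close)
  then obtain h where h: "\<And>i k::nat. h i k \<in> Pos" "\<And>i x. x \<in> A i \<Longrightarrow> 1 \<le> (\<Sum>k. ennreal (h i k x))"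
     "\<And>i. (\<Sum>k. ennreal (\<Lambda> (h i k))) < outer (A i) + e * (1/2)^Suc i" by metis
  have "outer (\<Union>i. A i) \<le> (\<Sum>i. \<Sum>k. ennreal (\<Lambda> (h i k)))"
  proof (rule outer_le2[OF h(1)])
    fix x assume "x \<in> (\<Union>i. A i)"
    then obtain i where "x \<in> A i" by blast
    then have "1 \<le> (\<Sum>k. ennreal (h i k x))" by (rule h(2))
    also have "\<dots> = (\<Sum>j\<in>{i}. \<Sum>k. ennreal (h j k x))" by simp
    also have "\<dots> \<le> (\<Sum>j. \<Sum>k. ennreal (h j k x))" by (intro sum_le_suminf) auto
    finally show "1 \<le> (\<Sum>j. \<Sum>k. ennreal (h j k x))" .
  qed
  also have "\<dots> \<le> (\<Sum>i. outer (A i) + e * (1/2) ^ Suc i)"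
    using h(3) by (intro suminf_le) (auto intro: less_imp_le)
  also have "\<dots> = (\<Sum>i. outer (A i)) + (\<Sum>i. ennreal e * ennreal ((1/2) ^ Suc i))"
    using e by (subst suminf_add[symmetric])
               (auto simp del: ennreal_suminf_cmult simp add: ennreal_mult[symmetric])
  also have "\<dots> = (\<Sum>i. outer (A i)) + e"
    unfolding ennreal_suminf_cmult
    by (subst suminf_ennreal_eq[OF zero_le_power power_half_series]) auto
  finally show "outer (\<Union>i. A i) \<le> (\<Sum>i. outer (A i)) + e" .
qed

lemma telescope_ennreal:
  fixes v :: "nat \<Rightarrow> real"
  assumes "v 0 = 0" "\<And>j. v j \<le> v (Suc j)"
  shows "(\<Sum>j. ennreal (v (Suc j) - v j)) = (SUP J. ennreal (v J))"
proof -
  have "(\<Sum>j<J. ennreal (v (Suc j) - v j)) = ennreal (v J)" for J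
  proof -
    have "(\<Sum>j<J. ennreal (v (Suc j) - v j)) = ennreal (\<Sum>j<J. v (Suc j) - v j)"
      using assms(2) by (intro sum_ennreal) (simp add: le_diff_eq)
    also have "(\<Sum>j<J. v (Suc j) - v j) = v J" using assms(1) by (simp add: sum_lessThan_telescope)
    finally show ?thesis .
  qed
  then show ?thesis by (simp add: suminf_eq_SUP)
qed

text \<open>A cover of \<open>A\<close> is split along an open set \<open>U\<close> by the functions \<open>min 1 (j d(x, - U))\<close>, which
  increase to the indicator of \<open>U\<close>.\<close>

lemma outer_split_open:
  assumes U: "open U" "U \<noteq> UNIV"
  shows "outer (U \<inter> A) + outer (A - U) \<le> outer A"
  unfolding outer_def[of A]
proof (rule INF_greatest)
  fix h assume "h \<in> {h. (\<forall>k::nat. h k \<in> Pos) \<and> (\<forall>x\<in>A. 1 \<le> (\<Sum>k. ennreal (h k x)))}"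
  then have h: "\<And>k. h k \<in> Pos" "\<And>x. x \<in> A \<Longrightarrow> 1 \<le> (\<Sum>k. ennreal (h k x))" by auto
  define u where "u = (\<lambda>(j::nat) x. min 1 (real j * infdist x (- U)))"
  have u01: "0 \<le> u j x" "u j x \<le> 1" for j x by (auto simp: u_def infdist_nonneg)
  have uL: "(real j)-lipschitz_on UNIV (u j)" for j
  proof (rule lipschitz_onI)
    fix x y
    have "\<bar>infdist x (- U) - infdist y (- U)\<bar> \<le> dist x y"
      using infdist_triangle_abs[of x "- U" y] .
    then have "\<bar>real j * infdist x (- U) - real j * infdist y (- U)\<bar> \<le> real j * dist x y"
      unfolding right_diff_distrib[symmetric] abs_mult by (simp add: mult_left_mono)
    then show "dist (u j x) (u j y) \<le> real j * dist x y"
      unfolding u_def dist_real_def by linarith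
  qed simp
  have u_mono: "u i x \<le> u j x" if "i \<le> j" for i j x
  proof -
    have "real i * infdist x (- U) \<le> real j * infdist x (- U)"
      using that by (intro mult_right_mono) (auto simp: infdist_nonneg)
    then show ?thesis unfolding u_def by linarith
  qed
  have uU: "(SUP J. ennreal (c * u J x)) = ennreal c" if "x \<in> U" "0 \<le> c" for x c
  proof (rule antisym)
    show "(SUP J. ennreal (c * u J x)) \<le> ennreal c"
      using u01 that by (intro SUP_least ennreal_leI mult_left_le) auto
    have "infdist x (- U) \<noteq> 0"
      using in_closed_iff_infdist_zero[of "- U" x] U that by auto
    then have "0 < infdist x (- U)" using infdist_nonneg[of x "- U"] by linarith
    then obtain J where "1 < real J * infdist x (- U)" using reals_Archimedean3 by blast
    then have "u J x = 1" by (simp add: u_def)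
    then show "ennreal c \<le> (SUP J. ennreal (c * u J x))" by (intro SUP_upper2[of J]) auto
  qed
  have hu: "(\<lambda>x. h k x * u J x) \<in> Pos" for k J
    by (rule Pos_mult_bounded[OF h(1) uL u01])
  have hu_le: "h k x * u i x \<le> h k x * u j x" if "i \<le> j" for k i j x
    using u_mono[OF that] Pos_D(2)[OF h(1)] by (intro mult_left_mono)
  \<comment> \<open>\<open>a J k\<close> is the cost of the truncated function
    \<open>h k * u J\<close>. The increments of these functions in \<open>J\<close> add up to
    \<open>h k\<close> on \<open>U\<close>, so they cover \<open>U \<inter> A\<close>; the
    remainders \<open>h k - h k * u J\<close> cover \<open>A - U\<close> because \<open>u J\<close>
    vanishes off \<open>U\<close>. For each \<open>J\<close> the two costs together are the cost of
    \<open>h\<close>.\<close>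
  define a where "a = (\<lambda>J k. ennreal (\<Lambda> (\<lambda>x. h k x * u J x)))"
  have "outer (U \<inter> A) \<le> (\<Sum>k. \<Sum>j. ennreal (\<Lambda> (\<lambda>x. h k x * u (Suc j) x - h k x * u j x)))"
  proof (rule outer_le2)
    show "(\<lambda>x. h k x * u (Suc j) x - h k x * u j x) \<in> Pos" for k j
      using hu hu_le by (intro Pos_diff) auto
    fix x assume x: "x \<in> U \<inter> A"
    have "(\<Sum>j. ennreal (h k x * u (Suc j) x - h k x * u j x)) = ennreal (h k x)" for k
      using x Pos_D(2)[OF h(1)] hu_le by (subst telescope_ennreal) (auto simp: uU, simp add: u_def)
    then show "1 \<le> (\<Sum>k. \<Sum>j. ennreal (h k x * u (Suc j) x - h k x * u j x))" using h(2) x by simp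
  qed
  also have "\<dots> = (\<Sum>k. SUP J. a J k)"
  proof (intro suminf_cong)
    fix k
    have "(\<Sum>j. ennreal (\<Lambda> (\<lambda>x. h k x * u (Suc j) x - h k x * u j x)))
        = (\<Sum>j. ennreal (\<Lambda> (\<lambda>x. h k x * u (Suc j) x) - \<Lambda> (\<lambda>x. h k x * u j x)))"
      using hu hu_le by (subst \<Lambda>_diff) auto
    also have "\<dots> = (SUP J. a J k)"
      unfolding a_def by (intro telescope_ennreal \<Lambda>_mono hu hu_le) (simp_all add: u_def \<Lambda>_zero)
    finally show "(\<Sum>j. ennreal (\<Lambda> (\<lambda>x. h k x * u (Suc j) x - h k x * u j x))) = (SUP J. a J k)" .
  qed
  also have "\<dots> = (SUP J. \<Sum>k. a J k)"
  proof (rule ennreal_suminf_SUP_eq)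
    show "incseq (\<lambda>J. a J k)" for k
      unfolding a_def incseq_def using hu hu_le by (auto intro!: ennreal_leI \<Lambda>_mono)
  qed
  finally have "outer (U \<inter> A) + outer (A - U) \<le> (SUP J. \<Sum>k. a J k) + outer (A - U)"
    by (rule add_right_mono)
  also have "\<dots> = (SUP J. (\<Sum>k. a J k) + outer (A - U))"
    by (rule ennreal_SUP_add_left[symmetric]) simp
  also have "\<dots> \<le> (\<Sum>k. ennreal (\<Lambda> (h k)))"
  proof (rule SUP_least)
    fix J
    have hv: "(\<lambda>x. h k x - h k x * u J x) \<in> Pos" for k
      using h(1) hu u01 Pos_D(2)[OF h(1)] by (intro Pos_diff) (auto intro: mult_left_le)
    have "outer (A - U) \<le> (\<Sum>k. ennreal (\<Lambda> (\<lambda>x. h k x - h k x * u J x)))"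
    proof (rule outer_le[OF hv])
      fix x assume x: "x \<in> A - U"
      then have "u J x = 0" by (simp add: u_def)
      then show "1 \<le> (\<Sum>k. ennreal (h k x - h k x * u J x))" using h(2) x by simp
    qed
    then have "(\<Sum>k. a J k) + outer (A - U) \<le> (\<Sum>k. a J k) + (\<Sum>k. ennreal (\<Lambda> (\<lambda>x. h k x - h k x * u J x)))"
      by (rule add_left_mono)
    also have "\<dots> = (\<Sum>k. a J k + ennreal (\<Lambda> (\<lambda>x. h k x - h k x * u J x)))"
      by (rule suminf_add) auto
    also have "\<dots> = (\<Sum>k. ennreal (\<Lambda> (h k)))"
    proof (intro suminf_cong)
      fix k
      have "\<Lambda> (\<lambda>x. h k x - h k x * u J x) = \<Lambda> (h k) - \<Lambda> (\<lambda>x. h k x * u J x)"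
        using h(1) hu u01 Pos_D(2)[OF h(1)] by (intro \<Lambda>_diff) (auto intro: mult_left_le)
      then show "a J k + ennreal (\<Lambda> (\<lambda>x. h k x - h k x * u J x)) = ennreal (\<Lambda> (h k))"
        unfolding a_def using \<Lambda>_nonneg[OF hu, of k J] \<Lambda>_nonneg[OF hv, of k]
        by (subst ennreal_plus[symmetric]) auto
    qed
    finally show "(\<Sum>k. a J k) + outer (A - U) \<le> (\<Sum>k. ennreal (\<Lambda> (h k)))" .
  qed
  finally show "outer (U \<inter> A) + outer (A - U) \<le> (\<Sum>k. ennreal (\<Lambda> (h k)))" .
qed

lemma outer_Un_le: "outer (A \<union> B) \<le> outer A + outer B"
proof -
  have "outer (\<Union>i. binaryset A B i) \<le> (\<Sum>i. outer (binaryset A B i))" by (rule outer_subadditive)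
  also have "\<dots> = outer A + outer B"
    using binaryset_sums[of outer A B] outer_empty by (simp add: sums_iff)
  finally show ?thesis by (simp add: UN_binaryset_eq)
qed

lemma outer_measure_space: "measure_space UNIV (sets borel) outer"
proof -
  interpret S: sigma_algebra UNIV "Pow UNIV :: 'a set set" by (rule sigma_algebra_Pow)
  let ?L = "lambda_system UNIV (Pow UNIV) outer"
  have "outer_measure_space (Pow UNIV) outer"
    unfolding outer_measure_space_def positive_def increasing_def countably_subadditive_def
    using outer_empty outer_mono outer_subadditive by auto
  then have L: "measure_space UNIV ?L outer" by (rule S.caratheodory_lemma)
  then interpret L: sigma_algebra UNIV ?L by (simp add: measure_space_def)
  have "U \<in> ?L" if "open U" for U :: "'a set"
  \<comment> \<open>\<open>infdist x {}\<close> is 0 by convention, so for \<open>U = UNIV\<close>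
    the splitting functions would vanish instead of increasing to 1.\<close>
  proof (cases "U = UNIV")
    case True
    then show ?thesis using L.top by simp
  next
    case False
    have "outer (U \<inter> A) + outer ((UNIV - U) \<inter> A) = outer A" for A
    proof (rule antisym)
      have "(UNIV - U) \<inter> A = A - U" by auto
      then show "outer (U \<inter> A) + outer ((UNIV - U) \<inter> A) \<le> outer A"
        using outer_split_open[OF that False] by simp
      have "U \<inter> A \<union> (UNIV - U) \<inter> A = A" by auto
      then show "outer A \<le> outer (U \<inter> A) + outer ((UNIV - U) \<inter> A)"
        using outer_Un_le[of "U \<inter> A" "(UNIV - U) \<inter> A"] by simp
    qed
    then show ?thesis by (simp add: lambda_system_def)
  qed
  then have "sigma_sets UNIV {S. open S} \<subseteq> ?L" by (intro L.sigma_sets_subset) auto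
  then have "sets borel \<subseteq> ?L" by (simp add: borel_def)
  then show ?thesis using L sets.sigma_algebra_axioms[of borel] by (auto intro: measure_down)
qed

section \<open>The representing measure of a positive functional\<close>

definition rep :: "'a measure" where "rep = measure_of UNIV (sets borel) outer"

lemma sets_rep [simp, measurable_cong]: "sets rep = sets borel"
  and space_rep [simp]: "space rep = UNIV"
  unfolding rep_def using sets.sets_measure_of_eq[of borel] by simp_all

lemma emeasure_rep: "X \<in> sets borel \<Longrightarrow> emeasure rep X = outer X"
  unfolding rep_def using outer_measure_space
  by (intro emeasure_measure_of_sigma) (auto simp: measure_space_def)

text \<open>No single compactly supported function covers the whole space. The increments of the
  cutoffs do, and their costs telescope to values of \<Lambda> at cutoffs. The zero function at the
  head of \<open>v\<close> makes the telescope start at 0.\<close>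

lemma outer_UNIV_le: "outer UNIV \<le> ennreal C"
proof -
  define v where "v = (\<lambda>j. case j of 0 \<Rightarrow> (\<lambda>x::'a. 0) | Suc i \<Rightarrow> cutoff (real i))"
  have v: "v j \<in> Pos" for j by (cases j) (auto simp: v_def Lip_c_zero Pos_def cutoff_Lip_c cutoff_bounds)
  have v0: "v 0 = (\<lambda>x. 0)" by (simp add: v_def)
  have v_mono: "v j x \<le> v (Suc j) x" for j x
    by (auto simp: v_def cutoff_bounds cutoff_mono split: nat.split)
  have "outer UNIV \<le> (\<Sum>j. ennreal (\<Lambda> (\<lambda>x. v (Suc j) x - v j x)))"
  proof (rule outer_le)
    show "(\<lambda>x. v (Suc j) x - v j x) \<in> Pos" for j using v v_mono by (intro Pos_diff)
    fix x :: 'a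
    obtain i where "norm x \<le> real i" using real_arch_simple by blast
    then have "v (Suc i) x = 1" by (simp add: v_def cutoff_eq_1)
    then have "1 \<le> (SUP J. ennreal (v J x))" by (intro SUP_upper2[of "Suc i"]) auto
    also have "\<dots> = (\<Sum>j. ennreal (v (Suc j) x - v j x))"
      using v_mono by (intro telescope_ennreal[symmetric]) (auto simp: v_def)
    finally show "1 \<le> (\<Sum>j. ennreal (v (Suc j) x - v j x))" .
  qed
  also have "\<dots> = (\<Sum>j. ennreal (\<Lambda> (v (Suc j)) - \<Lambda> (v j)))"
    using v v_mono by (subst \<Lambda>_diff) auto
  also have "\<dots> = (SUP J. ennreal (\<Lambda> (v J)))"
    using v v_mono by (intro telescope_ennreal \<Lambda>_mono) (auto simp: v0 \<Lambda>_zero)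
  also have "\<dots> \<le> ennreal C"
  proof (intro SUP_least ennreal_leI)
    fix J show "\<Lambda> (v J) \<le> C"
      using bdd[OF cutoff_Lip_c cutoff_bounds(1,2)] C_nonneg by (auto simp: v_def \<Lambda>_zero split: nat.split)
  qed
  finally show ?thesis .
qed

lemma finite_measure_rep: "finite_measure rep"
proof (rule finite_measureI)
  show "emeasure rep (space rep) \<noteq> \<infinity>"
    using outer_UNIV_le by (auto simp: emeasure_rep top_unique)
qed

lemma clamp_sum:
  fixes t :: real
  assumes "0 \<le> t" shows "(\<Sum>i<K. max 0 (min 1 (t - real i))) = min t (real K)"
  using assms by (induction K) (auto simp: min_def max_def)

text \<open>\<open>N * g\<close> is cut into horizontal slices \<open>G i\<close> of height 1. Both
  \<Lambda> and the integral of \<open>G i\<close> lie between the measures \<open>m (Suc i)\<close>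
  and \<open>m i\<close> of superlevel sets, so the errors telescope to at most
  \<open>m 0 - m K\<close>, which is below \<open>C\<close> whatever \<open>N\<close> is. Division
  by \<open>N\<close> concludes.\<close>

theorem integral_rep:
  assumes g: "g \<in> Pos"
  shows "integral\<^sup>L rep g = \<Lambda> g"
proof -
  interpret R: finite_measure rep by (rule finite_measure_rep)
  obtain B where B: "\<And>x. norm (g x) \<le> B" using Lip_c_bounded[OF Pos_D(1)[OF g]] by blast
  have gb[measurable]: "g \<in> borel_measurable borel"
    using Lip_c_continuous[OF Pos_D(1)[OF g]] by (rule borel_measurable_continuous_onI)
  have "\<bar>real N * \<Lambda> g - real N * integral\<^sup>L rep g\<bar> \<le> C" for N :: nat
  proof -
    obtain K :: nat where K: "real N * B \<le> real K" using real_arch_simple by blast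
    define G where "G = (\<lambda>i x. max 0 (min 1 (real N * g x - real i)))"
    have G01: "0 \<le> G i x" "G i x \<le> 1" for i x by (auto simp: G_def)
    have GP: "G i \<in> Pos" for i
    proof -
      have "(\<lambda>x. (\<lambda>t. max 0 (min 1 (real N * t - real i))) (g x)) \<in> Lip_c"
      proof (rule Lip_c_compose[OF Pos_D(1)[OF g]])
        show "(real N)-lipschitz_on UNIV (\<lambda>t. max 0 (min 1 (real N * t - real i)))"
        proof (rule lipschitz_onI)
          fix x y :: real
          have "\<bar>real N * x - real N * y\<bar> \<le> real N * dist x y"
            unfolding right_diff_distrib[symmetric] abs_mult by (simp add: dist_real_def)
          then show "dist (max 0 (min 1 (real N * x - real i))) (max 0 (min 1 (real N * y - real i))) \<le> real N * dist x y"
            unfolding dist_real_def by linarith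
        qed simp
      qed auto
      then show ?thesis using G01 by (simp add: Pos_def G_def)
    qed
    have Gsum: "(\<Sum>i<K. G i x) = real N * g x" for x
    proof -
      have "real N * g x \<le> real K" using B[of x] K by (smt (verit) mult_left_mono of_nat_0_le_iff real_norm_def)
      then show ?thesis unfolding G_def using clamp_sum[of "real N * g x" K] Pos_D(2)[OF g, of x] by simp
    qed
    define m where "m = (\<lambda>i::nat. measure rep {x. real i < real N * g x})"
    have [measurable]: "{x. real i < real N * g x} \<in> sets borel" for i by measurable
    have m: "outer {x. real i < real N * g x} = ennreal (m i)" for i
      unfolding m_def by (simp add: R.emeasure_eq_measure[symmetric] emeasure_rep)
    have L1: "m (Suc i) \<le> \<Lambda> (G i)" for i
    proof -
      have "outer {x. real (Suc i) < real N * g x} \<le> ennreal (\<Lambda> (G i))"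
        by (rule outer_le1[OF GP]) (auto simp: G_def)
      then show ?thesis unfolding m using \<Lambda>_nonneg[OF GP] by (simp add: ennreal_le_iff)
    qed
    have L2: "\<Lambda> (G i) \<le> m i" for i
    proof -
      have "ennreal (\<Lambda> (G i)) \<le> outer {x. real i < real N * g x}"
        unfolding outer_def
      proof (rule INF_greatest, clarify)
        fix h assume h: "\<forall>k::nat. h k \<in> Pos" "\<forall>x\<in>{x. real i < real N * g x}. 1 \<le> (\<Sum>k. ennreal (h k x))"
        show "ennreal (\<Lambda> (G i)) \<le> (\<Sum>k. ennreal (\<Lambda> (h k)))"
        proof (rule \<Lambda>_le_suminf[OF GP])
          fix x show "ennreal (G i x) \<le> (\<Sum>k. ennreal (h k x))"
          proof (cases "real i < real N * g x")
            case True
            then have "1 \<le> (\<Sum>k. ennreal (h k x))" using h(2) by simp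
            moreover have "ennreal (G i x) \<le> 1" using G01 by (metis ennreal_1 ennreal_leI)
            ultimately show ?thesis by (rule order_trans[rotated])
          next
            case False
            then have "G i x = 0" by (simp add: G_def)
            then show ?thesis by simp
          qed
        qed (use h in auto)
      qed
      then show ?thesis unfolding m by (simp add: m_def ennreal_le_iff)
    qed
    have [measurable]: "G i \<in> borel_measurable borel" for i
      using Lip_c_continuous[OF Pos_D(1)[OF GP]] by (rule borel_measurable_continuous_onI)
    have Gint: "integrable rep (G i)" for i
      using G01 by (intro R.integrable_const_bound[of _ 1]) auto
    have I1: "m (Suc i) \<le> integral\<^sup>L rep (G i)" for i
    proof -
      have "m (Suc i) = integral\<^sup>L rep (indicator {x. real (Suc i) < real N * g x})"
        unfolding m_def by simp
      also have "\<dots> \<le> integral\<^sup>L rep (G i)"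
        using Gint G01 by (intro integral_mono) (auto simp: G_def indicator_def R.emeasure_eq_measure)
      finally show ?thesis .
    qed
    have I2: "integral\<^sup>L rep (G i) \<le> m i" for i
    proof -
      have "integral\<^sup>L rep (G i) \<le> integral\<^sup>L rep (indicator {x. real i < real N * g x})"
        using Gint G01 by (intro integral_mono) (auto simp: G_def indicator_def R.emeasure_eq_measure)
      also have "\<dots> = m i" unfolding m_def by simp
      finally show ?thesis .
    qed
    have "real N * \<Lambda> g = (\<Sum>i<K. \<Lambda> (G i))"
      using \<Lambda>_sum[of "{..<K}" G] GP \<Lambda>_of_nat[OF g, of N] by (simp add: Gsum)
    moreover have "real N * integral\<^sup>L rep g = (\<Sum>i<K. integral\<^sup>L rep (G i))"
      using Gint Bochner_Integration.integral_sum[of "{..<K}" rep G] by (simp add: Gsum)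
    ultimately have "\<bar>real N * \<Lambda> g - real N * integral\<^sup>L rep g\<bar>
        \<le> (\<Sum>i<K. \<bar>\<Lambda> (G i) - integral\<^sup>L rep (G i)\<bar>)"
      by (simp add: sum_subtractf[symmetric] sum_abs)
    also have "\<dots> \<le> (\<Sum>i<K. m i - m (Suc i))"
    proof (rule sum_mono)
      fix i show "\<bar>\<Lambda> (G i) - integral\<^sup>L rep (G i)\<bar> \<le> m i - m (Suc i)"
        using L1[of i] L2[of i] I1[of i] I2[of i] by linarith
    qed
    also have "\<dots> = m 0 - m K" by (rule sum_lessThan_telescope')
    also have "\<dots> \<le> m 0" by (simp add: m_def)
    also have "\<dots> \<le> measure rep UNIV" unfolding m_def by (intro R.finite_measure_mono) auto
    also have "\<dots> \<le> C"
      using outer_UNIV_le C_nonneg by (simp add: emeasure_rep[symmetric] R.emeasure_eq_measure ennreal_le_iff)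
    finally show ?thesis .
  qed
  then have "\<bar>\<Lambda> g - integral\<^sup>L rep g\<bar> \<le> C / real (Suc N)" for N
  proof -
    assume "\<And>N. \<bar>real N * \<Lambda> g - real N * integral\<^sup>L rep g\<bar> \<le> C"
    from this[of "Suc N"] have "real (Suc N) * \<bar>\<Lambda> g - integral\<^sup>L rep g\<bar> \<le> C"
      unfolding right_diff_distrib[symmetric] abs_mult by simp
    then show ?thesis by (simp add: pos_le_divide_eq mult.commute del: of_nat_Suc)
  qed
  moreover have "(\<lambda>N. C / real (Suc N)) \<longlonglongrightarrow> 0" by (rule LIMSEQ_Suc[OF lim_const_over_n])
  ultimately have "\<bar>\<Lambda> g - integral\<^sup>L rep g\<bar> \<le> 0" using LIMSEQ_le_const by blast
  then show ?thesis by simp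
qed

end

subsection \<open>Bounded linear functionals\<close>

locale bounded_functional =
  fixes L :: "('a::euclidean_space \<Rightarrow> real) \<Rightarrow> real" and C :: real
  assumes add: "\<And>f g. f \<in> Lip_c \<Longrightarrow> g \<in> Lip_c \<Longrightarrow> L (\<lambda>x. f x + g x) = L f + L g"
    and scale: "\<And>c f. f \<in> Lip_c \<Longrightarrow> L (\<lambda>x. c * f x) = c * L f"
    and bdd: "\<And>f. f \<in> Lip_c \<Longrightarrow> (\<And>x. \<bar>f x\<bar> \<le> 1) \<Longrightarrow> L f \<le> C"
begin

definition minorants :: "('a \<Rightarrow> real) \<Rightarrow> ('a \<Rightarrow> real) set" where
  "minorants g = {h \<in> Lip_c. \<forall>x. 0 \<le> h x \<and> h x \<le> g x}"

definition Lp :: "('a \<Rightarrow> real) \<Rightarrow> real" where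
  "Lp g = (SUP h \<in> minorants g. L h)"

lemma L_diff: "f \<in> Lip_c \<Longrightarrow> g \<in> Lip_c \<Longrightarrow> L (\<lambda>x. f x - g x) = L f - L g"
  using add[of f "\<lambda>x. -1 * g x"] scale[of g "-1"] Lip_c_cmult[of g "-1"] by simp

lemma L_zero: "L (\<lambda>x. 0) = 0"
  using scale[OF Lip_c_zero, of 0] by simp

lemma L_le:
  assumes f: "f \<in> Lip_c" and M: "0 < M" "\<And>x. \<bar>f x\<bar> \<le> M" shows "L f \<le> M * C"
proof -
  have "L (\<lambda>x. (1 / M) * f x) \<le> C"
    using M by (intro bdd Lip_c_cmult f) (simp add: abs_mult)
  then have "(1 / M) * L f \<le> C" by (simp only: scale[OF f])
  then have "M * ((1 / M) * L f) \<le> M * C" using M(1) by (intro mult_left_mono) auto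
  then show ?thesis using M(1) by simp
qed

lemma bdd_above_minorants:
  assumes "g \<in> Lip_c" shows "bdd_above (L ` minorants g)"
proof -
  obtain M where M: "0 < M" "\<And>x. norm (g x) \<le> M" using Lip_c_bounded[OF assms] by blast
  show ?thesis
  proof (rule bdd_aboveI2[of _ _ "M * C"])
    fix h assume h: "h \<in> minorants g"
    show "L h \<le> M * C"
    proof (rule L_le)
      fix x have "0 \<le> h x" "h x \<le> g x" "norm (g x) \<le> M" using h M(2) by (auto simp: minorants_def)
      then show "\<bar>h x\<bar> \<le> M" by simp
    qed (use h M in \<open>auto simp: minorants_def\<close>)
  qed
qed

lemma minorants_zero: "(\<And>x. 0 \<le> g x) \<Longrightarrow> (\<lambda>x. 0) \<in> minorants g"
  by (simp add: minorants_def Lip_c_zero)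

lemma minorants_self: "g \<in> Lip_c \<Longrightarrow> (\<And>x. 0 \<le> g x) \<Longrightarrow> g \<in> minorants g"
  by (simp add: minorants_def)

lemma Lp_upper: "g \<in> Lip_c \<Longrightarrow> h \<in> minorants g \<Longrightarrow> L h \<le> Lp g"
  unfolding Lp_def by (intro cSUP_upper bdd_above_minorants)

lemma Lp_least: "(\<And>x. 0 \<le> g x) \<Longrightarrow> (\<And>h. h \<in> minorants g \<Longrightarrow> L h \<le> c) \<Longrightarrow> Lp g \<le> c"
  unfolding Lp_def using minorants_zero by (intro cSUP_least) auto

text \<open>The Riesz decomposition property: a minorant \<open>h\<close> of the sum splits into the
  pointwise minimum of \<open>h\<close> and \<open>f\<close>, a minorant of \<open>f\<close>, and a
  remainder that is a minorant of \<open>g\<close>.\<close>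

lemma Lp_add:
  assumes f: "f \<in> Lip_c" "\<And>x. 0 \<le> f x" and g: "g \<in> Lip_c" "\<And>x. 0 \<le> g x"
  shows "Lp (\<lambda>x. f x + g x) = Lp f + Lp g"
proof (rule antisym)
  have fg: "(\<lambda>x. f x + g x) \<in> Lip_c" using f g by (intro Lip_c_add)
  show "Lp (\<lambda>x. f x + g x) \<le> Lp f + Lp g"
  proof (rule Lp_least)
    fix h assume "h \<in> minorants (\<lambda>x. f x + g x)"
    then have h: "h \<in> Lip_c" "\<And>x. 0 \<le> h x" "\<And>x. h x \<le> f x + g x" by (auto simp: minorants_def)
    define k where "k = (\<lambda>x. min (h x) (f x))"
    have k: "k \<in> Lip_c" unfolding k_def using h f by (intro Lip_c_min)
    have "k \<in> minorants f" using k h f by (auto simp: minorants_def k_def)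
    moreover have "(\<lambda>x. h x - k x) \<in> minorants g"
      using Lip_c_diff[OF h(1) k] h(3) g(2) by (auto simp: minorants_def k_def min_def algebra_simps)
    ultimately have "L k + L (\<lambda>x. h x - k x) \<le> Lp f + Lp g"
      using f g by (intro add_mono Lp_upper)
    then show "L h \<le> Lp f + Lp g" using L_diff[OF h(1) k] by simp
  qed (use f g in \<open>simp add: add_nonneg_nonneg\<close>)
  have 1: "L h + L k \<le> Lp (\<lambda>x. f x + g x)" if "h \<in> minorants f" "k \<in> minorants g" for h k
  proof -
    have "(\<lambda>x. h x + k x) \<in> minorants (\<lambda>x. f x + g x)"
      using that by (auto simp: minorants_def intro!: Lip_c_add add_mono)
    then have "L (\<lambda>x. h x + k x) \<le> Lp (\<lambda>x. f x + g x)" by (rule Lp_upper[OF fg])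
    then show ?thesis using that add[of h k] by (simp add: minorants_def)
  qed
  have "Lp f \<le> Lp (\<lambda>x. f x + g x) - L k" if "k \<in> minorants g" for k
    using f(2) 1[OF _ that] by (intro Lp_least) (auto simp: le_diff_eq)
  then have "L k \<le> Lp (\<lambda>x. f x + g x) - Lp f" if "k \<in> minorants g" for k
    using that by (simp add: le_diff_eq add.commute)
  then have "Lp g \<le> Lp (\<lambda>x. f x + g x) - Lp f" using g(2) by (intro Lp_least)
  then show "Lp f + Lp g \<le> Lp (\<lambda>x. f x + g x)" by simp
qed

lemma Lp_nonneg: "f \<in> Lip_c \<Longrightarrow> (\<And>x. 0 \<le> f x) \<Longrightarrow> 0 \<le> Lp f"
  using Lp_upper[OF _ minorants_zero, of f] L_zero by simp

lemma L_le_Lp: "f \<in> Lip_c \<Longrightarrow> (\<And>x. 0 \<le> f x) \<Longrightarrow> L f \<le> Lp f"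
  by (intro Lp_upper minorants_self)

lemma Lp_bdd:
  assumes "f \<in> Lip_c" "\<And>x. 0 \<le> f x" "\<And>x. f x \<le> 1" shows "Lp f \<le> C"
proof (rule Lp_least[OF assms(2)])
  fix h assume h: "h \<in> minorants f"
  show "L h \<le> C"
  proof (rule bdd)
    fix x have "0 \<le> h x" "h x \<le> f x" "f x \<le> 1" using h assms by (auto simp: minorants_def)
    then show "\<bar>h x\<bar> \<le> 1" by simp
  qed (use h in \<open>simp add: minorants_def\<close>)
qed

theorem representation:
  "\<exists>P N. finite_measure P \<and> finite_measure N \<and> sets P = sets borel \<and> sets N = sets borel \<and>
     (\<forall>g\<in>Lip_c. L g = integral\<^sup>L P g - integral\<^sup>L N g)"
proof -
  interpret P: positive_functional Lp C
    using Lp_add Lp_nonneg Lp_bdd by unfold_locales auto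
  \<comment> \<open>The negative part. Its bound is \<open>2 * C\<close> because
    \<open>Lp f \<le> C\<close> and, testing with the negative of \<open>f\<close>, also
    \<open>- L f \<le> C\<close>.\<close>
  interpret N: positive_functional "\<lambda>f. Lp f - L f" "2 * C"
  proof
    fix f :: "'a \<Rightarrow> real" assume f: "f \<in> Lip_c" "\<And>x. 0 \<le> f x"
    show "0 \<le> Lp f - L f" using L_le_Lp[OF f] by simp
    assume f1: "\<And>x. f x \<le> 1"
    have "L (\<lambda>x. -1 * f x) \<le> C" using f f1 Lip_c_cmult[OF f(1), of "-1"] by (intro bdd) auto
    then have "- L f \<le> C" using scale[OF f(1), of "-1"] by simp
    then show "Lp f - L f \<le> 2 * C" using Lp_bdd[OF f f1] by simp
  qed (simp add: Lp_add add)
  have int: "integrable M f" if "finite_measure M" "sets M = sets borel" "f \<in> Lip_c" for M and f :: "'a \<Rightarrow> real"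
  proof -
    interpret M: finite_measure M by fact
    obtain B where "\<And>x. norm (f x) \<le> B" using Lip_c_bounded[OF \<open>f \<in> Lip_c\<close>] by blast
    moreover have "f \<in> borel_measurable M"
      using borel_measurable_continuous_onI[OF Lip_c_continuous[OF \<open>f \<in> Lip_c\<close>]]
      by (simp add: measurable_cong_sets[OF \<open>sets M = sets borel\<close> refl])
    ultimately show ?thesis by (intro M.integrable_const_bound[of _ B]) auto
  qed
  have "L g = integral\<^sup>L P.rep g - integral\<^sup>L N.rep g" if g: "g \<in> Lip_c" for g
  proof -
    define p n where "p = (\<lambda>x. max (g x) 0)" and "n = (\<lambda>x. max (- g x) 0)"
    have pn: "p \<in> Lip_c" "n \<in> Lip_c" "\<And>x. 0 \<le> p x" "\<And>x. 0 \<le> n x"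
      unfolding p_def n_def using Lip_c_max[OF g Lip_c_zero] Lip_c_max[OF _ Lip_c_zero, of "\<lambda>x. - g x"]
        Lip_c_cmult[OF g, of "-1"] by auto
    have gpn: "g = (\<lambda>x. p x - n x)" by (auto simp: p_def n_def)
    have pos: "L f = integral\<^sup>L P.rep f - integral\<^sup>L N.rep f" if "f \<in> Lip_c" "\<And>x. 0 \<le> f x" for f
      using P.integral_rep[of f] N.integral_rep[of f] that by (simp add: P.Pos_def N.Pos_def)
    have "integral\<^sup>L M g = integral\<^sup>L M p - integral\<^sup>L M n" if "finite_measure M" "sets M = sets borel" for M
      unfolding gpn using int[OF that] pn by (intro Bochner_Integration.integral_diff)
    then show ?thesis
      using L_diff[OF pn(1,2)] pos[OF pn(1,3)] pos[OF pn(2,4)] P.finite_measure_rep N.finite_measure_rep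
      by (simp add: gpn[symmetric])
  qed
  then show ?thesis using P.finite_measure_rep N.finite_measure_rep P.sets_rep N.sets_rep by blast
qed

end

section \<open>Invariance of Lebesgue measure\<close>

lemma lborel_distr_affine_unit:
  fixes t :: "'a::euclidean_space"
  assumes "\<bar>c\<bar> = 1"
  shows "distr lborel borel (\<lambda>x. t + c *\<^sub>R x) = lborel"
proof -
  have "c \<noteq> 0" using assms by auto
  from lborel_affine[OF this, of t] have "lborel = density (distr lborel borel (\<lambda>x. t + c *\<^sub>R x)) (\<lambda>_. 1)"
    by (simp add: assms)
  then show ?thesis by (simp add: density_1)
qed

lemma nn_integral_lborel_reflect:
  fixes x :: "'a::euclidean_space"
  assumes [measurable]: "f \<in> borel_measurable borel"
  shows "(\<integral>\<^sup>+y. f (x - y) \<partial>lborel) = (\<integral>\<^sup>+y. f y \<partial>lborel)"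
proof -
  have "(\<integral>\<^sup>+y. f y \<partial>lborel) = (\<integral>\<^sup>+y. f y \<partial>distr lborel borel (\<lambda>y. x + (-1) *\<^sub>R y))"
    by (simp only: lborel_distr_affine_unit[of "-1"] abs_minus_cancel abs_one)
  also have "\<dots> = (\<integral>\<^sup>+y. f (x - y) \<partial>lborel)" by (subst nn_integral_distr) auto
  finally show ?thesis by simp
qed

lemma nn_integral_lborel_shift:
  fixes x :: "'a::euclidean_space"
  assumes [measurable]: "f \<in> borel_measurable borel"
  shows "(\<integral>\<^sup>+y. f (x + y) \<partial>lborel) = (\<integral>\<^sup>+y. f y \<partial>lborel)"
proof -
  have "(\<integral>\<^sup>+y. f y \<partial>lborel) = (\<integral>\<^sup>+y. f y \<partial>distr lborel borel (\<lambda>y. x + 1 *\<^sub>R y))"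
    by (simp only: lborel_distr_affine_unit[of 1] abs_one)
  also have "\<dots> = (\<integral>\<^sup>+y. f (x + y) \<partial>lborel)" by (subst nn_integral_distr) auto
  finally show ?thesis by simp
qed

lemma lborel_integral_reflect:
  fixes x :: "'a::euclidean_space" and f :: "'a \<Rightarrow> 'b::{banach, second_countable_topology}"
  assumes [measurable]: "f \<in> borel_measurable borel"
  shows "(LINT y|lborel. f (x - y)) = (LINT y|lborel. f y)"
proof -
  have "(LINT y|lborel. f y) = (LINT y|distr lborel borel (\<lambda>y. x + (-1) *\<^sub>R y). f y)"
    by (simp only: lborel_distr_affine_unit[of "-1"] abs_minus_cancel abs_one)
  also have "\<dots> = (LINT y|lborel. f (x - y))" by (subst integral_distr) auto
  finally show ?thesis by simp
qed

lemma lborel_integral_shift: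
  fixes x :: "'a::euclidean_space" and f :: "'a \<Rightarrow> 'b::{banach, second_countable_topology}"
  assumes [measurable]: "f \<in> borel_measurable borel"
  shows "(LINT y|lborel. f (x + y)) = (LINT y|lborel. f y)"
proof -
  have "(LINT y|lborel. f y) = (LINT y|distr lborel borel (\<lambda>y. x + 1 *\<^sub>R y). f y)"
    by (simp only: lborel_distr_affine_unit[of 1] abs_one)
  also have "\<dots> = (LINT y|lborel. f (x + y))" by (subst integral_distr) auto
  finally show ?thesis by simp
qed

text \<open>Uniqueness of Haar measure: Tonelli and translation invariance give
  \<open>|f\<^sup>-\<^sup>1 A| |B| = |A| |f\<^sup>-\<^sup>1 B|\<close>, where \<open>B\<close> is the unit ball.\<close>

lemma lborel_distr_orthogonal:
  fixes f :: "'a::euclidean_space \<Rightarrow> 'a"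
  assumes f: "orthogonal_transformation f"
  shows "distr lborel borel f = lborel"
proof -
  have lin: "linear f" using f by (rule orthogonal_transformation_linear)
  have [measurable]: "f \<in> borel \<rightarrow>\<^sub>M borel"
    using lin by (intro borel_measurable_continuous_onI linear_continuous_on linear_conv_bounded_linear[THEN iffD1])
  have "surj f" using f by (rule orthogonal_transformation_surj)
  then obtain g where g: "\<And>y. f (g y) = y" by (metis surjD)
  show ?thesis
  proof (rule measure_eqI)
    fix A :: "'a set" assume "A \<in> sets (distr lborel borel f)"
    then have A[measurable]: "A \<in> sets borel" by simp
    let ?B = "{x. norm x < 1} :: 'a set"
    have B_ball: "?B = ball 0 1" by auto
    have fB: "indicator ?B (f z) = (indicator ?B z :: ennreal)" for z
      using f by (simp add: indicator_def orthogonal_transformation_norm)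
    have eA: "emeasure (distr lborel borel f) A = (\<integral>\<^sup>+z. indicator A (f z) \<partial>lborel)"
    proof -
      have "(\<integral>\<^sup>+z. indicator A (f z) \<partial>lborel) = (\<integral>\<^sup>+z. indicator A z \<partial>distr lborel borel f)"
        by (rule nn_integral_distr[symmetric]) measurable
      then show ?thesis by simp
    qed
    have "emeasure (distr lborel borel f) A * emeasure lborel ?B
        = (\<integral>\<^sup>+z. indicator A (f z) * (\<integral>\<^sup>+y. indicator ?B y \<partial>lborel) \<partial>lborel)"
      unfolding eA by (simp add: nn_integral_multc)
    also have "\<dots> = (\<integral>\<^sup>+z. indicator A (f z) * (\<integral>\<^sup>+y. indicator ?B (f z - y) \<partial>lborel) \<partial>lborel)"
      by (subst nn_integral_lborel_reflect) (auto intro!: borel_measurable_indicator)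
    also have "\<dots> = (\<integral>\<^sup>+z. \<integral>\<^sup>+y. indicator A (f z) * indicator ?B (f z - y) \<partial>lborel \<partial>lborel)"
    proof (rule nn_integral_cong, rule nn_integral_cmult[symmetric])
      show "(\<lambda>y. indicator ?B (f z - y) :: ennreal) \<in> borel_measurable lborel" for z
        by (rule measurable_compose[where g = "indicator ?B" and N = borel])
           (auto intro!: borel_measurable_indicator)
    qed
    also have "\<dots> = (\<integral>\<^sup>+y. \<integral>\<^sup>+z. indicator A (f z) * indicator ?B (f z - y) \<partial>lborel \<partial>lborel)"
      by (rule lborel_pair.Fubini') measurable
    \<comment> \<open>Shift \<open>z\<close> by the preimage \<open>g y\<close> of \<open>y\<close>:
      by linearity \<open>f (g y + z) - y = f z\<close>, and the unit ball is invariant under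
      \<open>f\<close>, so the second factor no longer depends on \<open>y\<close>.\<close>
    also have "\<dots> = (\<integral>\<^sup>+y. \<integral>\<^sup>+z. indicator A (f (g y + z)) * indicator ?B (f (g y + z) - y) \<partial>lborel \<partial>lborel)"
    proof (rule nn_integral_cong)
      fix y
      have "(\<lambda>z. indicator A (f z) * indicator ?B (f z - y) :: ennreal) \<in> borel_measurable borel" by measurable
      from nn_integral_lborel_shift[OF this, of "g y"]
      show "(\<integral>\<^sup>+z. indicator A (f z) * indicator ?B (f z - y) \<partial>lborel)
          = (\<integral>\<^sup>+z. indicator A (f (g y + z)) * indicator ?B (f (g y + z) - y) \<partial>lborel)" by simp
    qed
    also have "\<dots> = (\<integral>\<^sup>+y. \<integral>\<^sup>+z. indicator A (f z + y) * indicator ?B z \<partial>lborel \<partial>lborel)"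
      by (simp add: linear_add[OF lin] g fB add.commute)
    also have "\<dots> = (\<integral>\<^sup>+z. \<integral>\<^sup>+y. indicator A (f z + y) * indicator ?B z \<partial>lborel \<partial>lborel)"
      by (rule lborel_pair.Fubini') measurable
    also have "\<dots> = (\<integral>\<^sup>+z. (\<integral>\<^sup>+y. indicator A (f z + y) \<partial>lborel) * indicator ?B z \<partial>lborel)"
      by (subst nn_integral_multc) auto
    also have "\<dots> = (\<integral>\<^sup>+z. (\<integral>\<^sup>+y. indicator A y \<partial>lborel) * indicator ?B z \<partial>lborel)"
      by (subst nn_integral_lborel_shift) auto
    also have "\<dots> = emeasure lborel A * emeasure lborel ?B" by (simp add: nn_integral_cmult)
    finally have "emeasure (distr lborel borel f) A * emeasure lborel ?B = emeasure lborel A * emeasure lborel ?B" .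
    moreover have "0 < unit_ball_vol (real DIM('a))" by simp
    then have "unit_ball_vol (real DIM('a)) \<noteq> 0" by linarith
    then have "emeasure lborel ?B \<noteq> 0" "emeasure lborel ?B \<noteq> \<infinity>"
      unfolding B_ball using emeasure_bounded_finite[OF bounded_ball, of "0::'a" 1]
      by (auto simp: emeasure_ball)
    ultimately show "emeasure (distr lborel borel f) A = emeasure lborel A"
      by (metis ennreal_mult_cancel_left infinity_ennreal_def mult.commute)
  qed simp
qed

section \<open>Smooth bump functions and mollification\<close>

text \<open>The powers of \<open>t\<close> in the denominator are carried along so that derivatives
  stay in the span of the family; exponential decay at 0+ makes all its members flat there.\<close>

definition bump :: "nat \<Rightarrow> real \<Rightarrow> real" where
  "bump k t = (if t \<le> 0 then 0 else exp (- 1 / t) / t ^ k)"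

lemma bump_zero_limit: "((\<lambda>h. bump k h / h) \<longlongrightarrow> 0) (at 0)"
proof -
  have "((\<lambda>x. x ^ Suc k / exp x) \<longlongrightarrow> (0::real)) at_top" by (rule tendsto_power_div_exp_0)
  moreover have "\<forall>\<^sub>F x in at_top. x ^ Suc k / exp x = bump k (inverse x) / inverse x"
    using eventually_gt_at_top[of 0]
    by eventually_elim (simp add: bump_def exp_minus field_simps)
  ultimately have "((\<lambda>x. bump k (inverse x) / inverse x) \<longlongrightarrow> 0) at_top"
    by (rule Lim_transform_eventually)
  then have "((\<lambda>h. bump k h / h) \<longlongrightarrow> 0) (at_right 0)"
    unfolding filterlim_at_right_to_top .
  moreover have "((\<lambda>h. bump k h / h) \<longlongrightarrow> 0) (at_left 0)"
  proof (rule tendsto_eventually)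
    show "\<forall>\<^sub>F h in at_left 0. bump k h / h = 0"
      by (auto simp: eventually_at_left_field bump_def intro!: exI[of _ "- 1"])
  qed
  ultimately show ?thesis by (simp add: filterlim_split_at)
qed

lemma bump_deriv: "(bump k has_real_derivative bump (k + 2) t - real k * bump (k + 1) t) (at t)"
proof -
  consider "t < 0" | "t = 0" | "0 < t" by linarith
  then show ?thesis
  proof cases
    case 1
    have "((\<lambda>_. 0) has_real_derivative 0) (at t)" by simp
    then have "(bump k has_real_derivative 0) (at t)"
      by (rule has_field_derivative_transform_within_open[where S = "{..<0}"]) (use 1 in \<open>auto simp: bump_def\<close>)
    then show ?thesis using 1 by (simp add: bump_def)
  next
    case 2
    then show ?thesis using bump_zero_limit[of k] by (simp add: has_field_derivative_iff bump_def[of _ 0])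
  next
    case 3
    have "((\<lambda>t. exp (- 1 / t) / t ^ k) has_real_derivative bump (k + 2) t - real k * bump (k + 1) t) (at t)"
    proof (cases k)
      case 0
      show ?thesis unfolding 0 using 3
        by (auto intro!: derivative_eq_intros simp: bump_def field_simps power2_eq_square)
    next
      case (Suc j)
      show ?thesis unfolding Suc using 3
        by (auto intro!: derivative_eq_intros simp: bump_def)
           (simp add: field_simps power2_eq_square, cases j, simp_all)
    qed
    then show ?thesis
      by (rule has_field_derivative_transform_within_open[where S = "{0<..}"]) (use 3 in \<open>auto simp: bump_def\<close>)
  qed
qed

lemma bump_nonneg: "0 \<le> bump k t"
  by (simp add: bump_def)

lemma bump_pos: "0 < t \<Longrightarrow> 0 < bump k t"
  by (simp add: bump_def)

text \<open>A class of functions that contains a bump function and is closed under directional derivatives,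
  hence consists of smooth functions.\<close>

inductive_set bump_algebra :: "('a::euclidean_space \<Rightarrow> real) set" where
  const: "(\<lambda>x. c) \<in> bump_algebra"
| inner: "(\<lambda>x. x \<bullet> v) \<in> bump_algebra"
| bump: "(\<lambda>x. bump k (c - x \<bullet> x)) \<in> bump_algebra"
| add: "f \<in> bump_algebra \<Longrightarrow> g \<in> bump_algebra \<Longrightarrow> (\<lambda>x. f x + g x) \<in> bump_algebra"
| mult: "f \<in> bump_algebra \<Longrightarrow> g \<in> bump_algebra \<Longrightarrow> (\<lambda>x. f x * g x) \<in> bump_algebra"

lemma bump_algebra_derivative:
  "f \<in> bump_algebra \<Longrightarrow> \<exists>f'. (\<forall>x. (f has_derivative f' x) (at x)) \<and> (\<forall>v. (\<lambda>x. f' x v) \<in> bump_algebra)"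
proof (induction rule: bump_algebra.induct)
  case (const c)
  have "\<forall>x. ((\<lambda>x. c) has_derivative (\<lambda>v. 0)) (at x)" by simp
  moreover have "(\<lambda>x. 0) \<in> bump_algebra" by (rule bump_algebra.const)
  ultimately show ?case by (intro exI[of _ "\<lambda>x v. 0"]) auto
next
  case (inner v)
  have "\<forall>x. ((\<lambda>x. x \<bullet> v) has_derivative (\<lambda>w. w \<bullet> v)) (at x)" by (auto intro!: derivative_eq_intros)
  then show ?case by (intro exI[of _ "\<lambda>x w. w \<bullet> v"]) (auto intro: bump_algebra.const)
next
  case (bump k c)
  let ?d = "\<lambda>t. bump (k + 2) t - real k * bump (k + 1) t"
  have "((\<lambda>x. bump k (c - x \<bullet> x)) has_derivative (\<lambda>v. ?d (c - x \<bullet> x) * (- 2 * (x \<bullet> v)))) (at x)" for x :: 'a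
  proof -
    have "((\<lambda>x. c - x \<bullet> x) has_derivative (\<lambda>v. - 2 * (x \<bullet> v))) (at x)"
      by (auto intro!: derivative_eq_intros simp: inner_commute)
    from has_derivative_compose[OF this has_field_derivative_imp_has_derivative[OF bump_deriv[of k]]]
    show ?thesis by simp
  qed
  moreover have "(\<lambda>x. ?d (c - x \<bullet> x) * (- 2 * (x \<bullet> v))) \<in> bump_algebra" for v :: 'a
  proof -
    have "(\<lambda>x. (bump (k + 2) (c - x \<bullet> x) + (- real k) * bump (k + 1) (c - x \<bullet> x)) * (- 2 * (x \<bullet> v))) \<in> bump_algebra"
      by (intro bump_algebra.intros)
    then show ?thesis by simp
  qed
  ultimately show ?case
    by (intro exI[of _ "\<lambda>x v. ?d (c - x \<bullet> x) * (- 2 * (x \<bullet> v))"]) blast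
next
  case (add f g)
  then obtain f' g' where "\<forall>x. (f has_derivative f' x) (at x)" "\<forall>v. (\<lambda>x. f' x v) \<in> bump_algebra"
    "\<forall>x. (g has_derivative g' x) (at x)" "\<forall>v. (\<lambda>x. g' x v) \<in> bump_algebra" by blast
  then show ?case
    by (intro exI[of _ "\<lambda>x v. f' x v + g' x v"]) (auto intro: has_derivative_add bump_algebra.intros)
next
  case (mult f g)
  then obtain f' g' where fg: "\<forall>x. (f has_derivative f' x) (at x)" "\<forall>v. (\<lambda>x. f' x v) \<in> bump_algebra"
    "\<forall>x. (g has_derivative g' x) (at x)" "\<forall>v. (\<lambda>x. g' x v) \<in> bump_algebra" by blast
  show ?case
  proof (intro exI[of _ "\<lambda>x v. f x * g' x v + f' x v * g x"] conjI allI)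
    show "((\<lambda>x. f x * g x) has_derivative (\<lambda>v. f x * g' x v + f' x v * g x)) (at x)" for x
      using fg by (intro has_derivative_mult) auto
    show "(\<lambda>x. f x * g' x v + f' x v * g x) \<in> bump_algebra" for v
      using fg mult by (intro bump_algebra.intros) auto
  qed
qed

lemma bump_algebra_continuous: "f \<in> bump_algebra \<Longrightarrow> continuous_on S f"
  using bump_algebra_derivative[of f] has_derivative_continuous
  by (metis continuous_at_imp_continuous_on)

section \<open>Smoothness of convolutions and mollification of Lipschitz fields\<close>

lemma k_times_cont_diff_closed:
  assumes S: "\<And>f. f \<in> S \<Longrightarrow> \<exists>f'. (\<forall>x. (f has_derivative f' x) (at x)) \<and> (\<forall>v. (\<lambda>x. f' x v) \<in> S)"
  shows "f \<in> S \<Longrightarrow> k_times_cont_diff k f"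
proof (induction k arbitrary: f)
  case 0
  then obtain f' where "\<forall>x. (f has_derivative f' x) (at x)" using S by blast
  then show ?case by (auto intro!: continuous_at_imp_continuous_on dest: has_derivative_continuous)
next
  case (Suc k)
  then obtain f' where f': "\<forall>x. (f has_derivative f' x) (at x)" "\<forall>v. (\<lambda>x. f' x v) \<in> S" using S by blast
  have "frechet_derivative f (at x) = f' x" for x
    using f'(1) by (metis frechet_derivative_at)
  then show ?case using f' Suc.IH by (auto simp: differentiable_def)
qed

text \<open>Integration over a fixed box, later chosen to contain the support of \<phi>, permits the
  Leibniz rule on a compact domain. Differentiation in \<open>x\<close> falls on \<rho> alone, so
  continuity of \<phi> suffices for smoothness.\<close>

definition convolve :: "'a::euclidean_space \<Rightarrow> 'a \<Rightarrow> ('a \<Rightarrow> 'b::euclidean_space) \<Rightarrow> ('a \<Rightarrow> real) \<Rightarrow> 'a \<Rightarrow> 'b" where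
  "convolve a b \<phi> \<rho> x = integral (cbox a b) (\<lambda>y. \<rho> (x - y) *\<^sub>R \<phi> y)"

lemma convolve_derivative:
  fixes \<phi> :: "'a::euclidean_space \<Rightarrow> 'b::euclidean_space"
  assumes \<phi>: "continuous_on UNIV \<phi>" and \<rho>: "\<rho> \<in> bump_algebra"
  shows "\<exists>f'. (\<forall>x. (convolve a b \<phi> \<rho> has_derivative f' x) (at x)) \<and>
     (\<forall>v. (\<lambda>x. f' x v) \<in> convolve a b \<phi> ` bump_algebra)"
proof -
  obtain \<rho>' where \<rho>': "\<And>x. (\<rho> has_derivative \<rho>' x) (at x)" "\<And>v. (\<lambda>x. \<rho>' x v) \<in> bump_algebra"
    using bump_algebra_derivative[OF \<rho>] by blast
  \<comment> \<open>The Leibniz rule takes the derivative as a jointly continuous family of bounded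
    linear maps, hence the type of bounded linear functions; continuity is then checked on basis
    vectors.\<close>
  define F where "F = (\<lambda>x y. Blinfun (\<lambda>v. \<rho>' (x - y) v *\<^sub>R \<phi> y))"
  have bl: "bounded_linear (\<lambda>v. \<rho>' (x - y) v *\<^sub>R \<phi> y)" for x y
    using \<rho>'(1)[of "x - y", THEN has_derivative_bounded_linear] by (rule bounded_linear_scaleR_const)
  have F: "blinfun_apply (F x y) = (\<lambda>v. \<rho>' (x - y) v *\<^sub>R \<phi> y)" for x y
    unfolding F_def by (rule bounded_linear_Blinfun_apply[OF bl])
  have comp: "continuous_on S (\<lambda>z. g (f z))" if "continuous_on UNIV g" "continuous_on S f"
    for g :: "'a \<Rightarrow> 'c::topological_space" and S :: "'d::topological_space set" and f
    using that by (rule continuous_on_compose2) simp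
  have cont: "continuous_on (UNIV \<times> cbox a b) (\<lambda>(x, y). F x y)"
    unfolding split_beta
  proof (rule continuous_on_blinfun_componentwise)
    fix i :: 'a
    show "continuous_on (UNIV \<times> cbox a b) (\<lambda>z. blinfun_apply (F (fst z) (snd z)) i)"
      unfolding F
      by (intro continuous_on_scaleR comp[OF bump_algebra_continuous[OF \<rho>'(2)[of i]]] comp[OF \<phi>] continuous_intros)
  qed
  have der: "(convolve a b \<phi> \<rho> has_derivative blinfun_apply (integral (cbox a b) (F x))) (at x)" for x
  proof -
    have "((\<lambda>x. integral (cbox a b) (\<lambda>y. \<rho> (x - y) *\<^sub>R \<phi> y)) has_derivative
        blinfun_apply (integral (cbox a b) (F x))) (at x within UNIV)"
    proof (rule leibniz_rule[OF _ _ cont])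
      fix x y :: 'a
      have "((\<lambda>x. x - y) has_derivative (\<lambda>v. v)) (at x)" by (auto intro!: derivative_eq_intros)
      from has_derivative_compose[OF this \<rho>'(1)]
      have "((\<lambda>x. \<rho> (x - y)) has_derivative \<rho>' (x - y)) (at x)" .
      then show "((\<lambda>x. \<rho> (x - y) *\<^sub>R \<phi> y) has_derivative blinfun_apply (F x y)) (at x within UNIV)"
        unfolding F by (rule has_derivative_scaleR_left)
    next
      fix x
      show "(\<lambda>y. \<rho> (x - y) *\<^sub>R \<phi> y) integrable_on cbox a b"
        by (intro integrable_continuous continuous_on_scaleR comp[OF bump_algebra_continuous[OF \<rho>]]
            continuous_intros continuous_on_subset[OF \<phi>]) simp
    qed auto
    then show ?thesis by (simp add: convolve_def[abs_def])
  qed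
  have "(\<lambda>x. blinfun_apply (integral (cbox a b) (F x)) v) = convolve a b \<phi> (\<lambda>x. \<rho>' x v)" for v
  proof
    fix x
    have "continuous_on (cbox a b) (\<lambda>y. (\<lambda>(x, y). F x y) (x, y))"
      by (rule continuous_on_compose2[OF cont]) (auto intro!: continuous_intros)
    then have "continuous_on (cbox a b) (F x)" by simp
    then have "F x integrable_on cbox a b" by (rule integrable_continuous)
    then show "blinfun_apply (integral (cbox a b) (F x)) v = convolve a b \<phi> (\<lambda>x. \<rho>' x v) x"
      by (simp add: blinfun_apply_integral F convolve_def)
  qed
  then show ?thesis
    using der \<rho>'(2) by (intro exI[of _ "\<lambda>x. blinfun_apply (integral (cbox a b) (F x))"]) auto
qed

lemma convolve_smooth:
  fixes \<phi> :: "'a::euclidean_space \<Rightarrow> 'b::euclidean_space"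
  assumes "continuous_on UNIV \<phi>" "\<rho> \<in> bump_algebra"
  shows "k_times_cont_diff k (convolve a b \<phi> \<rho>)"
  by (rule k_times_cont_diff_closed[where S = "convolve a b \<phi> ` bump_algebra"])
     (use convolve_derivative[OF assms(1)] assms(2) in auto)

lemma mollifier_exists:
  assumes e: "0 < e"
  shows "\<exists>\<rho>::'a::euclidean_space \<Rightarrow> real. \<rho> \<in> bump_algebra \<and> (\<forall>x. 0 \<le> \<rho> x) \<and> (\<forall>x. e < norm x \<longrightarrow> \<rho> x = 0) \<and>
     integrable lborel \<rho> \<and> (LINT x|lborel. \<rho> x) = 1"
proof -
  define g where "g = (\<lambda>x::'a. bump 0 (e\<^sup>2 - x \<bullet> x))"
  have g: "g \<in> bump_algebra" unfolding g_def by (rule bump_algebra.bump)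
  have sq: "e\<^sup>2 - x \<bullet> x \<le> 0 \<longleftrightarrow> e \<le> norm x" for x :: 'a
    using e by (simp add: power2_norm_eq_inner[symmetric] power_mono_iff)
  have g0: "g x = 0" if "e \<le> norm x" for x
    using that sq[of x] by (simp add: g_def bump_def)
  have gpos: "0 < g x" if "norm x < e" for x
    unfolding g_def by (rule bump_pos) (use that sq[of x] in linarith)
  have "integrable lborel (\<lambda>x. indicator (cball 0 e) x *\<^sub>R g x)"
    using bump_algebra_continuous[OF g] by (intro borel_integrable_compact) auto
  moreover have "(\<lambda>x. indicator (cball 0 e) x *\<^sub>R g x) = g"
  proof
    fix x show "indicator (cball 0 e) x *\<^sub>R g x = g x"
      using g0[of x] by (cases "norm x \<le> e") (auto simp: indicator_def)
  qed
  ultimately have int: "integrable lborel g" by simp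
  define c where "c = (LINT x|lborel. g x)"
  have nn: "0 \<le> g x" for x by (simp add: g_def bump_nonneg)
  have "c \<noteq> 0"
  proof
    assume "c = 0"
    then have "AE x in lborel. g x = 0"
      using integral_nonneg_eq_0_iff_AE[OF int] nn by (simp add: c_def)
    then have "AE x in lborel. x \<notin> ball (0::'a) e" by eventually_elim (use gpos in force)
    then have "emeasure lborel (ball (0::'a) e) = 0"
      by (simp add: AE_iff_measurable[OF _ refl] ball_def)
    then show False using e unit_ball_vol_pos[of "real DIM('a)"] by (simp add: emeasure_ball)
  qed
  moreover have "0 \<le> c" unfolding c_def using nn by (intro Bochner_Integration.integral_nonneg) auto
  ultimately have c: "0 < c" by simp
  have "(\<lambda>x. (1 / c) * g x) \<in> bump_algebra" by (intro bump_algebra.intros g)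
  moreover have "(LINT x|lborel. (1 / c) * g x) = 1" using c by (simp add: c_def)
  ultimately show ?thesis
    using c int nn g0 by (intro exI[of _ "\<lambda>x. (1 / c) * g x"]) auto
qed

text \<open>Each value of \<psi> is an average of values \<open>\<phi> (x - z)\<close> with
  \<open>norm z \<le> e\<close>, and averaging preserves the Lipschitz constant and the sup bound.
  With bound 1 the field is admissible in \<open>frac_total_variation\<close>; the common Lipschitz
  constant later supplies a domination uniform in \<open>e\<close>.\<close>

theorem mollify:
  fixes \<phi> :: "'a::euclidean_space \<Rightarrow> 'b::euclidean_space"
  assumes \<phi>: "\<phi> \<in> Lip_c" and L: "L-lipschitz_on UNIV \<phi>" and M: "\<And>x. norm (\<phi> x) \<le> M" and e: "0 < e"
  shows "\<exists>\<psi>\<in>Cinf_c. L-lipschitz_on UNIV \<psi> \<and> (\<forall>x. norm (\<psi> x) \<le> M) \<and> (\<forall>x. dist (\<psi> x) (\<phi> x) \<le> L * e)"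
proof -
  obtain \<rho> :: "'a \<Rightarrow> real" where \<rho>: "\<rho> \<in> bump_algebra" "\<And>x. 0 \<le> \<rho> x" "\<And>x. e < norm x \<Longrightarrow> \<rho> x = 0"
    "integrable lborel \<rho>" "(LINT x|lborel. \<rho> x) = 1"
    using mollifier_exists[OF e] by metis
  obtain R where R: "0 < R" "\<And>x. R < norm x \<Longrightarrow> \<phi> x = 0" using Lip_c_support[OF \<phi>] by blast
  obtain a where a: "cball (0::'a) R \<subseteq> cbox (- a) a"
    using bounded_subset_cbox_symmetric[OF bounded_cball] by blast
  define \<psi> where "\<psi> = convolve (- a) a \<phi> \<rho>"
  have c\<phi>: "continuous_on UNIV \<phi>" by (rule Lip_c_continuous[OF \<phi>])
  have [measurable]: "\<phi> \<in> borel_measurable borel" "\<rho> \<in> borel_measurable borel"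
    using c\<phi> bump_algebra_continuous[OF \<rho>(1)] by (auto intro: borel_measurable_continuous_onI)
  have int: "integrable lborel (\<lambda>z. \<rho> z *\<^sub>R \<phi> (x - z))" for x
    using integrable_mult_right[OF \<rho>(4), of M]
  proof (rule Bochner_Integration.integrable_bound)
    show "AE z in lborel. norm (\<rho> z *\<^sub>R \<phi> (x - z)) \<le> norm (M * \<rho> z)"
    proof (rule AE_I2)
      fix z
      have "norm (\<rho> z *\<^sub>R \<phi> (x - z)) \<le> \<rho> z * M" using \<rho>(2) M by (simp add: mult_left_mono)
      then show "norm (\<rho> z *\<^sub>R \<phi> (x - z)) \<le> norm (M * \<rho> z)" by (simp add: mult.commute)
    qed
  qed measurable
  have \<psi>: "\<psi> x = (LINT z|lborel. \<rho> z *\<^sub>R \<phi> (x - z))" for x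
  proof -
    have z: "\<phi> y = 0" if "y \<notin> cbox (- a) a" for y
      using a that R(2)[of y] by (auto simp: subset_iff not_le[symmetric])
    have "continuous_on (cbox (- a) a) (\<lambda>y. \<rho> (x - y) *\<^sub>R \<phi> y)"
      by (intro continuous_on_scaleR continuous_on_compose2[OF bump_algebra_continuous[OF \<rho>(1), of UNIV]]
          continuous_intros continuous_on_subset[OF c\<phi>]) auto
    then have "integrable lborel (\<lambda>y. indicator (cbox (- a) a) y *\<^sub>R (\<rho> (x - y) *\<^sub>R \<phi> y))"
      by (intro borel_integrable_compact) auto
    then have "set_integrable lborel (cbox (- a) a) (\<lambda>y. \<rho> (x - y) *\<^sub>R \<phi> y)"
      by (simp add: set_integrable_def)
    then have "\<psi> x = (LINT y:cbox (- a) a|lborel. \<rho> (x - y) *\<^sub>R \<phi> y)"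
      unfolding \<psi>_def convolve_def by (rule set_borel_integral_eq_integral(2)[symmetric])
    also have "\<dots> = (LINT y|lborel. \<rho> (x - y) *\<^sub>R \<phi> (x - (x - y)))"
      unfolding set_lebesgue_integral_def using z by (intro Bochner_Integration.integral_cong) (auto simp: indicator_def)
    also have "\<dots> = (LINT z|lborel. \<rho> z *\<^sub>R \<phi> (x - z))"
      by (rule lborel_integral_reflect[of "\<lambda>z. \<rho> z *\<^sub>R \<phi> (x - z)" x]) measurable
    finally show ?thesis .
  qed
  have bound: "norm (LINT z|lborel. \<rho> z *\<^sub>R h z) \<le> K"
    if "\<And>z. norm z \<le> e \<Longrightarrow> norm (h z) \<le> K" "integrable lborel (\<lambda>z. \<rho> z *\<^sub>R h z)" for h :: "'a \<Rightarrow> 'b" and K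
  proof -
    have "norm (LINT z|lborel. \<rho> z *\<^sub>R h z) \<le> (LINT z|lborel. norm (\<rho> z *\<^sub>R h z))"
      by (rule integral_norm_bound)
    also have "\<dots> \<le> (LINT z|lborel. \<rho> z * K)"
    proof (rule integral_mono)
      fix z show "norm (\<rho> z *\<^sub>R h z) \<le> \<rho> z * K"
        using that(1)[of z] \<rho>(2,3)[of z] by (cases "norm z \<le> e") (auto intro: mult_left_mono)
      show "integrable lborel (\<lambda>z. norm (\<rho> z *\<^sub>R h z))" using that(2) by (rule integrable_norm)
    qed (use \<rho>(4) in simp)
    also have "\<dots> = K" using \<rho>(5) by simp
    finally show ?thesis .
  qed
  have "L-lipschitz_on UNIV \<psi>"
  proof (rule lipschitz_onI)
    show "0 \<le> L" using L by (rule lipschitz_on_nonneg)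
    fix x y
    have "\<psi> x - \<psi> y = (LINT z|lborel. \<rho> z *\<^sub>R (\<phi> (x - z) - \<phi> (y - z)))"
      unfolding \<psi> using int by (simp add: scaleR_diff_right)
    also have "norm \<dots> \<le> L * dist x y"
    proof (rule bound)
      fix z
      show "norm (\<phi> (x - z) - \<phi> (y - z)) \<le> L * dist x y"
        using lipschitz_onD[OF L, of "x - z" "y - z"] by (simp add: dist_norm)
    qed (use int in \<open>simp add: scaleR_diff_right\<close>)
    finally show "dist (\<psi> x) (\<psi> y) \<le> L * dist x y" by (simp add: dist_norm)
  qed
  moreover have "norm (\<psi> x) \<le> M" for x
    unfolding \<psi> by (rule bound) (use M int in auto)
  moreover have "dist (\<psi> x) (\<phi> x) \<le> L * e" for x
  proof -
    have \<phi>x: "\<phi> x = (LINT z|lborel. \<rho> z *\<^sub>R \<phi> x)" using \<rho>(4,5) by simp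
    have "\<psi> x - \<phi> x = (LINT z|lborel. \<rho> z *\<^sub>R \<phi> (x - z)) - (LINT z|lborel. \<rho> z *\<^sub>R \<phi> x)"
      using \<psi> \<phi>x by simp
    also have "\<dots> = (LINT z|lborel. \<rho> z *\<^sub>R (\<phi> (x - z) - \<phi> x))"
      unfolding scaleR_diff_right using int \<rho>(4) by (intro Bochner_Integration.integral_diff[symmetric]) auto
    also have "norm \<dots> \<le> L * e"
    proof (rule bound)
      fix z :: 'a assume "norm z \<le> e"
      then have "L * norm z \<le> L * e" using lipschitz_on_nonneg[OF L] by (intro mult_left_mono)
      then show "norm (\<phi> (x - z) - \<phi> x) \<le> L * e"
        using lipschitz_onD[OF L, of "x - z" x] by (simp add: dist_norm)
    qed (use int \<rho>(4) in \<open>simp add: scaleR_diff_right\<close>)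
    finally show ?thesis by (simp add: dist_norm)
  qed
  moreover have "\<psi> \<in> Cinf_c"
  proof -
    have "\<psi> x = 0" if "R + e < norm x" for x
    proof -
      have "\<rho> z *\<^sub>R \<phi> (x - z) = 0" for z
      proof (cases "e < norm z")
        case False
        then have "R < norm (x - z)" using that norm_triangle_ineq2[of x z] by linarith
        then show ?thesis using R(2) by simp
      qed (simp add: \<rho>(3))
      then have "(\<lambda>z. \<rho> z *\<^sub>R \<phi> (x - z)) = (\<lambda>z. 0)" by blast
      then show ?thesis unfolding \<psi> by simp
    qed
    then have "compactly_supported \<psi>" unfolding compactly_supported_iff by blast
    then show ?thesis using convolve_smooth[OF c\<phi> \<rho>(1)] by (simp add: Cinf_c_def \<psi>_def)
  qed
  ultimately show ?thesis by blast
qed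

section \<open>Radial integrals\<close>

lemma nn_integral_powr_0:
  assumes "-1 < p" "0 \<le> a"
  shows "(\<integral>\<^sup>+r\<in>{0..a}. ennreal (r powr p) \<partial>lborel) = ennreal (a powr (p + 1) / (p + 1))"
  using has_integral_powr_from_0[OF assms] by (intro nn_integral_has_integral_lebesgue') auto

lemma nn_integral_powr_inf:
  assumes "p < -1" "0 < a"
  shows "(\<integral>\<^sup>+r\<in>{a..}. ennreal (r powr p) \<partial>lborel) = ennreal (- (a powr (p + 1)) / (p + 1))"
  using has_integral_powr_to_inf[OF assms] by (intro nn_integral_has_integral_lebesgue') auto

text \<open>The integral sees only the distribution of \<open>R\<close>, which is determined by its
  finite values on the half-lines \<open>{..a}\<close>. Applied to the norm on the whole space, to
  the square on the line, and to the norm of all coordinates but one.\<close>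

lemma nn_integral_radial:
  fixes R :: "'a \<Rightarrow> real" and k c :: real
  assumes R[measurable]: "R \<in> borel_measurable M" and k: "0 < k" and c: "0 \<le> c"
    and em: "\<And>r. 0 < r \<Longrightarrow> emeasure M {x\<in>space M. R x \<le> r} = ennreal (c * r powr k)"
    and F: "F \<in> borel_measurable borel"
  shows "(\<integral>\<^sup>+x. F (R x) \<partial>M) = (\<integral>\<^sup>+r\<in>{0..}. ennreal (c * k * r powr (k - 1)) * F r \<partial>lborel)"
proof -
  let ?D = "density lborel (\<lambda>r. ennreal (c * k * r powr (k - 1)) * indicator {0..} r)"
  have D: "emeasure ?D {..a} = ennreal (c * max 0 a powr k)" for a
  proof -
    have "emeasure ?D {..a} = (\<integral>\<^sup>+r. ennreal (c * k) * (ennreal (r powr (k - 1)) * indicator {0..a} r) \<partial>lborel)"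
      using k c by (subst emeasure_density) (auto intro!: nn_integral_cong simp: indicator_def ennreal_mult)
    also have "\<dots> = ennreal (c * k) * (\<integral>\<^sup>+r\<in>{0..a}. ennreal (r powr (k - 1)) \<partial>lborel)"
      by (rule nn_integral_cmult) measurable
    also have "\<dots> = ennreal (c * max 0 a powr k)"
    proof (cases "0 \<le> a")
      case True
      have "ennreal (c * k) * ennreal (a powr k / k) = ennreal (c * k * (a powr k / k))"
        using k c by (intro ennreal_mult[symmetric]) auto
      then show ?thesis using True k nn_integral_powr_0[of "k - 1" a] by simp
    next
      case False
      then show ?thesis using k by simp
    qed
    finally show ?thesis .
  qed
  have M: "emeasure (distr M borel R) {..a} = ennreal (c * max 0 a powr k)" for a
  proof -
    have e: "emeasure (distr M borel R) {..a} = emeasure M {x\<in>space M. R x \<le> a}"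
      by (subst emeasure_distr) (auto intro!: arg_cong[where f = "emeasure M"])
    show ?thesis
    proof (cases "0 < a")
      case True
      then show ?thesis using em e by simp
    next
      case False
      have "emeasure M {x\<in>space M. R x \<le> a} \<le> 0"
      \<comment> \<open>The hypothesis concerns positive radii; for \<open>a \<le> 0\<close> the
        radius \<open>r\<close> is sent to 0.\<close>
      proof (rule tendsto_lowerbound)
        have "((\<lambda>r. r powr k) \<longlongrightarrow> 0) (at_right 0)"
          using eventually_at_right_less[of "0::real"]
          by (intro tendsto_zero_powrI[OF tendsto_ident_at tendsto_const _ k]) (auto elim: eventually_mono)
        then have "((\<lambda>r. c * r powr k) \<longlongrightarrow> 0) (at_right 0)" by (rule tendsto_mult_right_zero)
        then show "((\<lambda>r. ennreal (c * r powr k)) \<longlongrightarrow> 0) (at_right (0::real))"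
          by (subst ennreal_0[symmetric], intro tendsto_ennrealI) simp
        show "\<forall>\<^sub>F r in at_right (0::real). emeasure M {x\<in>space M. R x \<le> a} \<le> ennreal (c * r powr k)"
          using eventually_at_right_less[of 0]
        proof eventually_elim
          case (elim r)
          then have "{x\<in>space M. R x \<le> a} \<subseteq> {x\<in>space M. R x \<le> r}" using False by auto
          then have "emeasure M {x\<in>space M. R x \<le> a} \<le> emeasure M {x\<in>space M. R x \<le> r}"
            by (rule emeasure_mono) measurable
          then show ?case using em[OF elim] by simp
        qed
      qed simp
      then show ?thesis using e False by (simp add: max_def)
    qed
  qed
  have "distr M borel R = ?D"
  proof (rule measure_eqI_generator_eq[where E = "range atMost" and \<Omega> = UNIV and A = "\<lambda>i::nat. {..real i}"])
    show "Int_stable (range atMost :: real set set)" by (auto simp: Int_stable_def)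
    show "(\<Union>i. {..real i}) = UNIV" using real_arch_simple by auto
    show "emeasure (distr M borel R) X = emeasure ?D X" if "X \<in> range atMost" for X
      using that M D by auto
    show "sets (distr M borel R) = sigma_sets UNIV (range atMost)" "sets ?D = sigma_sets UNIV (range atMost)"
      by (simp_all add: borel_eq_atMost)
  qed (auto simp: M)
  then have "(\<integral>\<^sup>+r. F r \<partial>distr M borel R) = (\<integral>\<^sup>+r. F r \<partial>?D)" by simp
  also have "(\<integral>\<^sup>+r. F r \<partial>distr M borel R) = (\<integral>\<^sup>+x. F (R x) \<partial>M)"
    using F by (intro nn_integral_distr) auto
  also have "(\<integral>\<^sup>+r. F r \<partial>?D) = (\<integral>\<^sup>+r\<in>{0..}. ennreal (c * k * r powr (k - 1)) * F r \<partial>lborel)"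
    using F by (subst nn_integral_density) (auto intro!: nn_integral_cong simp: mult_ac)
  finally show ?thesis .
qed

lemma nn_integral_norm:
  fixes F :: "real \<Rightarrow> ennreal"
  assumes F: "F \<in> borel_measurable borel"
  shows "(\<integral>\<^sup>+z. F (norm (z::'a::euclidean_space)) \<partial>lborel) =
    (\<integral>\<^sup>+r\<in>{0..}. ennreal (unit_ball_vol (real DIM('a)) * real DIM('a) * r powr (real DIM('a) - 1)) * F r \<partial>lborel)"
proof (rule nn_integral_radial[OF _ _ _ _ F, where k = "real DIM('a)" and c = "unit_ball_vol (real DIM('a))"])
  fix r :: real assume r: "0 < r"
  have "{x \<in> space lborel. norm (x::'a) \<le> r} = cball 0 r" by auto
  then show "emeasure lborel {x \<in> space lborel. norm (x::'a) \<le> r} = ennreal (unit_ball_vol (real DIM('a)) * r powr real DIM('a))"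
    using r emeasure_cball[of r "0::'a"] by (simp add: powr_realpow)
qed (auto simp: DIM_positive)

text \<open>A majorant for the singular integrands of functions that are regular at scale
  \<open>e\<close>: their increments contribute the factor \<open>min 1 (norm z / e)\<close>, which
  makes the singularity at 0 integrable since \<alpha> < 1. By scaling, the mass is a multiple of
  \<open>e powr (- \<alpha>)\<close>.\<close>

definition riesz_kernel :: "real \<Rightarrow> real \<Rightarrow> 'a::euclidean_space \<Rightarrow> real" where
  "riesz_kernel \<alpha> e z = min 1 (norm z / e) / norm z powr (real DIM('a) + \<alpha>)"

lemma riesz_kernel_nonneg: "0 < e \<Longrightarrow> 0 \<le> riesz_kernel \<alpha> e z"
  by (simp add: riesz_kernel_def)

lemma borel_measurable_riesz_kernel[measurable]: "riesz_kernel \<alpha> e \<in> borel_measurable borel"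
  unfolding riesz_kernel_def by measurable

text \<open>In polar coordinates the radial density is a multiple of
  \<open>r powr (- \<alpha>) / e\<close> below \<open>e\<close> and of
  \<open>r powr (- 1 - \<alpha>)\<close> above it; the two parts give the summands
  \<open>1 / (1 - \<alpha>)\<close> and \<open>1 / \<alpha>\<close>.\<close>

lemma nn_integral_riesz_kernel:
  fixes \<alpha> e :: real
  assumes \<alpha>: "0 < \<alpha>" "\<alpha> < 1" and e: "0 < e"
  shows "(\<integral>\<^sup>+z. ennreal (riesz_kernel \<alpha> e (z::'a::euclidean_space)) \<partial>lborel) =
     ennreal (unit_ball_vol (real DIM('a)) * real DIM('a) * (1 / (1 - \<alpha>) + 1 / \<alpha>) * e powr (- \<alpha>))"
proof -
  let ?n = "real DIM('a)" and ?c = "unit_ball_vol (real DIM('a)) * real DIM('a)"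
  let ?F = "\<lambda>r. ennreal (min 1 (r / e) / r powr (?n + \<alpha>))"
  have c: "0 \<le> ?c" by simp
  have "(\<integral>\<^sup>+z. ennreal (riesz_kernel \<alpha> e (z::'a)) \<partial>lborel)
      = (\<integral>\<^sup>+r\<in>{0..}. ennreal (?c * r powr (?n - 1)) * ?F r \<partial>lborel)"
    unfolding riesz_kernel_def by (rule nn_integral_norm) measurable
  also have "\<dots> = (\<integral>\<^sup>+r. ennreal (?c / e) * (ennreal (r powr (- \<alpha>)) * indicator {0..e} r) +
      ennreal ?c * (ennreal (r powr (- 1 - \<alpha>)) * indicator {e..} r) \<partial>lborel)"
  proof (rule nn_integral_cong_AE)
    have "AE r in lborel. r \<noteq> 0 \<and> r \<noteq> e" using AE_lborel_singleton[of 0] AE_lborel_singleton[of e] by auto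
    then show "AE r in lborel. ennreal (?c * r powr (?n - 1)) * ?F r * indicator {0..} r =
       ennreal (?c / e) * (ennreal (r powr (- \<alpha>)) * indicator {0..e} r) +
       ennreal ?c * (ennreal (r powr (- 1 - \<alpha>)) * indicator {e..} r)"
    proof eventually_elim
      case (elim r)
      consider "r < 0" | "0 < r" "r < e" | "e < r" using elim by linarith
      then show ?case
      proof cases
        case 1 then show ?thesis using e by (simp add: indicator_def)
      next
        case 2
        have "r powr (?n - 1) * (r / e / r powr (?n + \<alpha>)) = (1 / e) * (r powr (?n - 1) * r powr 1 / r powr (?n + \<alpha>))"
          using 2 by simp
        also have "\<dots> = (1 / e) * r powr (- \<alpha>)"
          unfolding powr_add[symmetric] powr_diff[symmetric] by simp
        finally have e1: "r powr (?n - 1) * (r / e / r powr (?n + \<alpha>)) = (1 / e) * r powr (- \<alpha>)" .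
        have "?c * r powr (?n - 1) * (min 1 (r / e) / r powr (?n + \<alpha>))
            = ?c * (r powr (?n - 1) * (r / e / r powr (?n + \<alpha>)))"
          using 2 by (simp add: min_def)
        also have "\<dots> = (?c / e) * r powr (- \<alpha>)" unfolding e1 by simp
        finally have "?c * r powr (?n - 1) * (min 1 (r / e) / r powr (?n + \<alpha>)) = (?c / e) * r powr (- \<alpha>)" .
        then have "ennreal (?c * r powr (?n - 1)) * ?F r = ennreal (?c / e) * ennreal (r powr (- \<alpha>))"
          using 2 e c by (simp add: ennreal_mult[symmetric])
        then show ?thesis using 2 by (simp add: indicator_def)
      next
        case 3
        have "r powr (?n - 1) * (1 / r powr (?n + \<alpha>)) = r powr (- 1 - \<alpha>)"
          using powr_diff[of r "?n - 1" "?n + \<alpha>"] by simp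
        moreover have "?c * r powr (?n - 1) * (min 1 (r / e) / r powr (?n + \<alpha>)) = ?c * (r powr (?n - 1) * (1 / r powr (?n + \<alpha>)))"
          using 3 e by (simp add: min_def)
        ultimately have "?c * r powr (?n - 1) * (min 1 (r / e) / r powr (?n + \<alpha>)) = ?c * r powr (- 1 - \<alpha>)"
          by (simp only:)
        then have "ennreal (?c * r powr (?n - 1)) * ?F r = ennreal ?c * ennreal (r powr (- 1 - \<alpha>))"
          using 3 e c by (simp add: ennreal_mult[symmetric])
        then show ?thesis using 3 e by (simp add: indicator_def)
      qed
    qed
  qed
  also have "\<dots> = ennreal (?c / e) * (\<integral>\<^sup>+r\<in>{0..e}. ennreal (r powr (- \<alpha>)) \<partial>lborel) +
      ennreal ?c * (\<integral>\<^sup>+r\<in>{e..}. ennreal (r powr (- 1 - \<alpha>)) \<partial>lborel)"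
    by (subst nn_integral_add) (auto simp: nn_integral_cmult)
  also have "\<dots> = ennreal (?c / e) * ennreal (e powr (1 - \<alpha>) / (1 - \<alpha>)) + ennreal ?c * ennreal (e powr (- \<alpha>) / \<alpha>)"
    using nn_integral_powr_0[of "- \<alpha>" e] nn_integral_powr_inf[of "- 1 - \<alpha>" e] \<alpha> e by simp
  also have "\<dots> = ennreal (?c / e * (e powr (1 - \<alpha>) / (1 - \<alpha>)) + ?c * (e powr (- \<alpha>) / \<alpha>))"
    using \<alpha> e c by (simp add: ennreal_mult[symmetric] ennreal_plus[symmetric] del: ennreal_plus)
  also have "e powr (1 - \<alpha>) = e * e powr (- \<alpha>)" using e by (simp add: powr_diff powr_minus divide_inverse)
  also have "?c / e * (e * e powr (- \<alpha>) / (1 - \<alpha>)) + ?c * (e powr (- \<alpha>) / \<alpha>)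
      = ?c * (1 / (1 - \<alpha>) + 1 / \<alpha>) * e powr (- \<alpha>)"
  proof -
    have "?c / e * (e * e powr (- \<alpha>) / (1 - \<alpha>)) = ?c * (e powr (- \<alpha>) / (1 - \<alpha>))" using e by simp
    then show ?thesis by (simp only:) (simp add: algebra_simps)
  qed
  finally show ?thesis .
qed

lemma integrable_riesz_kernel:
  assumes "0 < \<alpha>" "\<alpha> < 1" "0 < e"
  shows "integrable lborel (riesz_kernel \<alpha> e :: 'a::euclidean_space \<Rightarrow> real)"
    and "(LINT z|lborel. riesz_kernel \<alpha> e (z::'a)) =
      unit_ball_vol (real DIM('a)) * real DIM('a) * (1 / (1 - \<alpha>) + 1 / \<alpha>) * e powr (- \<alpha>)"
proof -
  have nn: "0 \<le> riesz_kernel \<alpha> e z" for z :: 'a using assms riesz_kernel_nonneg by blast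
  show "integrable lborel (riesz_kernel \<alpha> e :: 'a \<Rightarrow> real)"
    using nn nn_integral_riesz_kernel[OF assms, where 'a = 'a] by (intro integrableI_bounded) auto
  have "0 \<le> unit_ball_vol (real DIM('a)) * real DIM('a) * (1 / (1 - \<alpha>) + 1 / \<alpha>) * e powr (- \<alpha>)"
    using assms by auto
  then show "(LINT z|lborel. riesz_kernel \<alpha> e (z::'a)) =
      unit_ball_vol (real DIM('a)) * real DIM('a) * (1 / (1 - \<alpha>) + 1 / \<alpha>) * e powr (- \<alpha>)"
    using integral_eq_nn_integral[of "riesz_kernel \<alpha> e :: 'a \<Rightarrow> real" lborel] nn
      nn_integral_riesz_kernel[OF assms, where 'a = 'a] by simp
qed

section \<open>The half-space integral\<close>

lemma nn_integral_Gamma_scaled: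
  assumes a: "0 < a" and c: "0 < c"
  shows "(\<integral>\<^sup>+t\<in>{0..}. ennreal (t powr (a - 1) * exp (- c * t)) \<partial>lborel) = ennreal (Gamma a * c powr (- a))"
proof -
  have "ennreal (Gamma a) = (\<integral>\<^sup>+t. ennreal (indicator {0..} t * t powr (a - 1) / exp t) \<partial>lborel)"
    by (rule Gamma_conv_nn_integral_real[OF a])
  also have "\<dots> = ennreal \<bar>c\<bar> * (\<integral>\<^sup>+t. ennreal (indicator {0..} (0 + c * t) * (0 + c * t) powr (a - 1) / exp (0 + c * t)) \<partial>lborel)"
    using c by (intro nn_integral_real_affine[of "\<lambda>t. ennreal (indicator {0..} t * t powr (a - 1) / exp t)" c 0]) auto
  also have "\<dots> = ennreal c * (\<integral>\<^sup>+t. ennreal (c powr (a - 1)) * (ennreal (t powr (a - 1) * exp (- c * t)) * indicator {0..} t) \<partial>lborel)"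
  proof -
    have "ennreal (indicator {0..} (c * t) * (c * t) powr (a - 1) / exp (c * t))
        = ennreal (c powr (a - 1)) * (ennreal (t powr (a - 1) * exp (- c * t)) * indicator {0..} t)" for t
    proof (cases "0 \<le> t")
      case True
      have "(c * t) powr (a - 1) / exp (c * t) = c powr (a - 1) * (t powr (a - 1) * exp (- c * t))"
        using c True by (simp add: powr_mult exp_minus divide_inverse)
      then show ?thesis using True c by (simp add: ennreal_mult)
    next
      case False
      then show ?thesis using c by (simp add: zero_le_mult_iff)
    qed
    then show ?thesis using c by simp
  qed
  also have "\<dots> = ennreal c * (ennreal (c powr (a - 1)) * (\<integral>\<^sup>+t\<in>{0..}. ennreal (t powr (a - 1) * exp (- c * t)) \<partial>lborel))"
    by (subst nn_integral_cmult) auto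
  also have "\<dots> = ennreal (c powr a) * (\<integral>\<^sup>+t\<in>{0..}. ennreal (t powr (a - 1) * exp (- c * t)) \<partial>lborel)"
    using c by (simp add: mult.assoc[symmetric] ennreal_mult[symmetric] powr_diff)
  finally have "ennreal (c powr (- a)) * ennreal (Gamma a)
      = ennreal (c powr (- a)) * ennreal (c powr a) * (\<integral>\<^sup>+t\<in>{0..}. ennreal (t powr (a - 1) * exp (- c * t)) \<partial>lborel)"
    by (simp add: mult.assoc)
  also have "ennreal (c powr (- a)) * ennreal (c powr a) = 1"
    using c by (simp add: ennreal_mult[symmetric] powr_add[symmetric])
  finally show ?thesis using Gamma_real_pos[OF a] by (simp add: ennreal_mult[symmetric] mult.commute)
qed

lemma nn_integral_gaussian:
  assumes c: "0 < c"
  shows "(\<integral>\<^sup>+t. ennreal (exp (- c * t\<^sup>2)) \<partial>lborel) = ennreal (sqrt (pi / c))"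
proof -
  have "(\<integral>\<^sup>+t. ennreal (exp (- c * t\<^sup>2)) \<partial>lborel)
      = (\<integral>\<^sup>+r\<in>{0..}. ennreal (2 * (1/2) * r powr (1/2 - 1)) * ennreal (exp (- c * r)) \<partial>lborel)"
  proof (rule nn_integral_radial[where R = "\<lambda>t. t\<^sup>2"])
    fix r :: real assume r: "0 < r"
    have "{x \<in> space lborel. x\<^sup>2 \<le> r} = {- sqrt r..sqrt r}"
    proof -
      have sq: "x\<^sup>2 \<le> r \<longleftrightarrow> \<bar>x\<bar> \<le> sqrt r" for x using abs_le_square_iff[of x "sqrt r"] r by simp
      show ?thesis unfolding sq by (auto simp only: space_lborel space_borel abs_le_iff mem_Collect_eq atLeastAtMost_iff)
    qed
    then show "emeasure lborel {x \<in> space lborel. x\<^sup>2 \<le> r} = ennreal (2 * r powr (1/2))"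
      using r by (simp add: powr_half_sqrt)
  qed auto
  also have "\<dots> = (\<integral>\<^sup>+r\<in>{0..}. ennreal (r powr (1/2 - 1) * exp (- c * r)) \<partial>lborel)"
    by (simp add: ennreal_mult[symmetric])
  also have "\<dots> = ennreal (Gamma (1/2) * c powr (- (1/2)))"
    using c by (intro nn_integral_Gamma_scaled) auto
  also have "Gamma (1/2) * c powr (- (1/2)) = sqrt (pi / c)"
  proof -
    have "c powr (- (1/2)) = 1 / sqrt c" using c by (simp add: powr_minus_divide powr_half_sqrt)
    then show ?thesis by (simp add: Gamma_one_half_real real_sqrt_divide)
  qed
  finally show ?thesis .
qed

lemma nn_integral_gaussian_moment:
  assumes c: "0 < c" and s: "0 < s"
  shows "(\<integral>\<^sup>+t. ennreal (indicator {s<..} t * t * exp (- c * t\<^sup>2)) \<partial>lborel) = ennreal (exp (- c * s\<^sup>2) / (2 * c))"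
proof -
  have "(\<integral>\<^sup>+t. ennreal (indicator {s<..} t * t * exp (- c * t\<^sup>2)) \<partial>lborel)
      = (\<integral>\<^sup>+t. ennreal (t * exp (- c * t\<^sup>2)) * indicator {s..} t \<partial>lborel)"
    using AE_lborel_singleton[of s]
    by (intro nn_integral_cong_AE) (auto elim!: eventually_mono simp: indicator_def)
  also have "\<dots> = ennreal (0 - (- exp (- c * s\<^sup>2) / (2 * c)))"
  proof (rule nn_integral_FTC_atLeast)
    show "((\<lambda>t. - exp (- c * t\<^sup>2) / (2 * c)) has_real_derivative t * exp (- c * t\<^sup>2)) (at t)" for t
      using c by (auto intro!: derivative_eq_intros simp: power2_eq_square)
    have "LIM t at_top. c * t\<^sup>2 :> at_top"
      using c by (intro filterlim_tendsto_pos_mult_at_top[OF tendsto_const] filterlim_pow_at_top filterlim_ident) auto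
    then have "LIM t at_top. - (c * t\<^sup>2) :> at_bot" by (simp add: filterlim_uminus_at_top[symmetric] filterlim_uminus_at_bot)
    then have "((\<lambda>t. exp (- (c * t\<^sup>2))) \<longlongrightarrow> 0) at_top" by (rule filterlim_compose[OF exp_at_bot])
    then have "((\<lambda>t. - exp (- (c * t\<^sup>2)) / (2 * c)) \<longlongrightarrow> - 0 / (2 * c)) at_top" by (intro tendsto_intros) (use c in auto)
    then show "((\<lambda>t. - exp (- c * t\<^sup>2) / (2 * c)) \<longlongrightarrow> 0) at_top" by simp
  qed (use s in auto)
  finally show ?thesis by simp
qed

lemma orthogonal_transformation_to_Basis:
  fixes \<nu> b :: "'a::euclidean_space"
  assumes "norm \<nu> = 1" "b \<in> Basis"
  shows "\<exists>f. orthogonal_transformation f \<and> f b = \<nu>"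
proof (cases "\<nu> = b")
  case True
  then show ?thesis using orthogonal_transformation_id by (metis eq_id_iff)
next
  case False
  define w where "w = \<nu> - b"
  \<comment> \<open>The Householder reflection along \<open>\<nu> - b\<close>, which exchanges the
    two unit vectors.\<close>
  define f where "f = (\<lambda>z. z - (2 * (z \<bullet> w) / (w \<bullet> w)) *\<^sub>R w)"
  have w: "w \<bullet> w \<noteq> 0" using False by (simp add: w_def)
  have "linear f"
    by (rule linearI) (simp_all add: f_def inner_add_left algebra_simps add_divide_distrib)
  moreover have "f z \<bullet> f z = z \<bullet> z" for z
    using w by (simp add: f_def inner_diff inner_commute field_simps power2_eq_square)
  then have "norm (f z) = norm z" for z by (simp add: norm_eq_sqrt_inner)
  ultimately have "orthogonal_transformation f" by (simp add: orthogonal_transformation)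
  moreover have "f b = \<nu>"
  proof -
    have bb: "b \<bullet> b = 1" using assms(2) by (simp add: inner_Basis)
    have vv: "\<nu> \<bullet> \<nu> = 1" using assms(1) by (simp add: power2_norm_eq_inner[symmetric])
    have "w \<bullet> w = 2 - 2 * (\<nu> \<bullet> b)" by (simp add: w_def inner_diff inner_commute bb vv)
    moreover have "b \<bullet> w = (\<nu> \<bullet> b) - 1" by (simp add: w_def inner_diff inner_commute bb)
    ultimately have "2 * (b \<bullet> w) = - (w \<bullet> w)" by simp
    then have "2 * (b \<bullet> w) / (w \<bullet> w) = -1" using w by (simp add: field_simps)
    then show ?thesis by (simp add: f_def w_def)
  qed
  ultimately show ?thesis by blast
qed

lemma nn_integral_rotate:
  fixes \<nu> b :: "'a::euclidean_space"
  assumes "norm \<nu> = 1" "b \<in> Basis" and F: "case_prod F \<in> borel_measurable (borel \<Otimes>\<^sub>M borel)"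
  shows "(\<integral>\<^sup>+z. F (z \<bullet> \<nu>) (norm z) \<partial>lborel) = (\<integral>\<^sup>+z. F (z \<bullet> b) (norm z) \<partial>lborel)"
proof -
  obtain f where f: "orthogonal_transformation f" "f b = \<nu>"
    using orthogonal_transformation_to_Basis[OF assms(1,2)] by blast
  have [measurable]: "(\<lambda>z. F (z \<bullet> v) (norm z)) \<in> borel_measurable borel" for v :: 'a
  proof -
    have "(\<lambda>z. (z \<bullet> v, norm z)) \<in> borel \<rightarrow>\<^sub>M borel \<Otimes>\<^sub>M borel" by measurable
    from measurable_compose[OF this F] show ?thesis by simp
  qed
  have [measurable]: "f \<in> borel \<rightarrow>\<^sub>M borel"
    using orthogonal_transformation_linear[OF f(1)]
    by (intro borel_measurable_continuous_onI linear_continuous_on linear_conv_bounded_linear[THEN iffD1])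
  have "(\<integral>\<^sup>+z. F (z \<bullet> \<nu>) (norm z) \<partial>lborel) = (\<integral>\<^sup>+z. F (z \<bullet> \<nu>) (norm z) \<partial>distr lborel borel f)"
    by (simp add: lborel_distr_orthogonal[OF f(1)])
  also have "\<dots> = (\<integral>\<^sup>+z. F (f z \<bullet> f b) (norm (f z)) \<partial>lborel)"
    unfolding f(2) by (subst nn_integral_distr) auto
  also have "\<dots> = (\<integral>\<^sup>+z. F (z \<bullet> b) (norm z) \<partial>lborel)"
    using f(1) by (simp add: orthogonal_transformation_norm orthogonal_transformation_def)
  finally show ?thesis .
qed

text \<open>The subordination formula \<open>|z|\<^sup>-\<^sup>2\<^sup>\<beta> = \<Gamma>(\<beta>)\<^sup>-\<^sup>1 \<integral> \<tau>\<^sup>\<beta>\<^sup>-\<^sup>1 exp(- \<tau>|z|\<^sup>2) d\<tau>\<close> reduces the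
  integral to one-dimensional Gaussians.\<close>

lemma nn_integral_half_space:
  fixes \<nu> :: "'a::euclidean_space" and s \<alpha> :: real
  assumes \<nu>: "norm \<nu> = 1" and s: "0 < s" and \<alpha>: "0 < \<alpha>"
  defines "n \<equiv> real DIM('a)"
  shows "(\<integral>\<^sup>+z. ennreal (indicator {s<..} (z \<bullet> \<nu>) * (z \<bullet> \<nu>) / norm z powr (n + \<alpha> + 1)) \<partial>lborel)
     = ennreal (pi powr ((n - 1) / 2) * Gamma (\<alpha> / 2) / (2 * Gamma ((n + \<alpha> + 1) / 2)) * s powr (- \<alpha>))"
proof -
  define \<beta> where "\<beta> = (n + \<alpha> + 1) / 2"
  have \<beta>2: "2 * \<beta> = n + \<alpha> + 1" by (simp add: \<beta>_def)
  have n: "1 \<le> n" unfolding n_def using DIM_positive[where 'a = 'a] by (simp add: Suc_le_eq)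
  have \<beta>: "0 < \<beta>" using n \<alpha> by (simp add: \<beta>_def)
  obtain b :: 'a where b: "b \<in> Basis" using SOME_Basis by blast
  let ?h = "\<lambda>t. indicator {s<..} t * t :: real"
  have h: "0 \<le> ?h t" for t using s by (simp add: indicator_def)
  have "(\<integral>\<^sup>+z. ennreal (?h (z \<bullet> \<nu>) / norm z powr (n + \<alpha> + 1)) \<partial>lborel)
      = (\<integral>\<^sup>+z. ennreal (?h (z \<bullet> b) / norm z powr (n + \<alpha> + 1)) \<partial>lborel)"
    by (rule nn_integral_rotate[OF \<nu> b]) measurable
  also have "\<dots> = (\<integral>\<^sup>+z. \<integral>\<^sup>+\<tau>. ennreal (1 / Gamma \<beta>) * (ennreal (?h (z \<bullet> b)) *
      (ennreal (\<tau> powr (\<beta> - 1) * exp (- (norm z)\<^sup>2 * \<tau>)) * indicator {0..} \<tau>)) \<partial>lborel \<partial>lborel)"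
  proof (rule nn_integral_cong)
    fix z :: 'a
    have "(\<integral>\<^sup>+\<tau>. ennreal (1 / Gamma \<beta>) * (ennreal (?h (z \<bullet> b)) *
      (ennreal (\<tau> powr (\<beta> - 1) * exp (- (norm z)\<^sup>2 * \<tau>)) * indicator {0..} \<tau>)) \<partial>lborel)
       = ennreal (1 / Gamma \<beta>) * (ennreal (?h (z \<bullet> b)) * (\<integral>\<^sup>+\<tau>\<in>{0..}. ennreal (\<tau> powr (\<beta> - 1) * exp (- (norm z)\<^sup>2 * \<tau>)) \<partial>lborel))"
      by (simp add: nn_integral_cmult)
    also have "\<dots> = ennreal (?h (z \<bullet> b) / norm z powr (n + \<alpha> + 1))"
    proof (cases "s < z \<bullet> b")
      case True
      then have z: "0 < norm z" using s by auto
      have "((norm z)\<^sup>2) powr (- \<beta>) = norm z powr (2 * - \<beta>)"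
        using z by (simp add: powr_powr flip: powr_numeral)
      also have "\<dots> = 1 / norm z powr (n + \<alpha> + 1)"
        unfolding \<beta>2[symmetric] by (simp add: powr_minus_divide)
      finally have e: "((norm z)\<^sup>2) powr (- \<beta>) = 1 / norm z powr (n + \<alpha> + 1)" .
      have G: "0 < Gamma \<beta>" by (rule Gamma_real_pos[OF \<beta>])
      have "(\<integral>\<^sup>+\<tau>\<in>{0..}. ennreal (\<tau> powr (\<beta> - 1) * exp (- (norm z)\<^sup>2 * \<tau>)) \<partial>lborel)
          = ennreal (Gamma \<beta> * (1 / norm z powr (n + \<alpha> + 1)))"
        using nn_integral_Gamma_scaled[OF \<beta>, of "(norm z)\<^sup>2"] z e by simp
      then show ?thesis using G h[of "z \<bullet> b"] by (simp add: ennreal_mult[symmetric])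
    qed simp
    finally show "ennreal (?h (z \<bullet> b) / norm z powr (n + \<alpha> + 1)) = (\<integral>\<^sup>+\<tau>. ennreal (1 / Gamma \<beta>) * (ennreal (?h (z \<bullet> b)) *
      (ennreal (\<tau> powr (\<beta> - 1) * exp (- (norm z)\<^sup>2 * \<tau>)) * indicator {0..} \<tau>)) \<partial>lborel)" by simp
  qed
  also have "\<dots> = (\<integral>\<^sup>+\<tau>. \<integral>\<^sup>+z. ennreal (1 / Gamma \<beta>) * (ennreal (?h (z \<bullet> b)) *
      (ennreal (\<tau> powr (\<beta> - 1) * exp (- (norm z)\<^sup>2 * \<tau>)) * indicator {0..} \<tau>)) \<partial>lborel \<partial>lborel)"
    by (rule lborel_pair.Fubini') measurable
  \<comment> \<open>The exponents of \<tau> are \<beta> - 1 from subordination, -1 from the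
    one-dimensional moment and -(n - 1) / 2 from the remaining Gaussians, in all \<alpha> / 2 - 1.
    What is left is again a Gamma integral.\<close>
  also have "\<dots> = (\<integral>\<^sup>+\<tau>. ennreal (pi powr ((n - 1) / 2) / (2 * Gamma \<beta>)) *
      (ennreal (\<tau> powr (\<alpha> / 2 - 1) * exp (- s\<^sup>2 * \<tau>)) * indicator {0..} \<tau>) \<partial>lborel)"
  proof (rule nn_integral_cong_AE)
    show "AE \<tau> in lborel. (\<integral>\<^sup>+z. ennreal (1 / Gamma \<beta>) * (ennreal (?h (z \<bullet> b)) *
      (ennreal (\<tau> powr (\<beta> - 1) * exp (- (norm z)\<^sup>2 * \<tau>)) * indicator {0..} \<tau>)) \<partial>lborel)
      = ennreal (pi powr ((n - 1) / 2) / (2 * Gamma \<beta>)) *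
      (ennreal (\<tau> powr (\<alpha> / 2 - 1) * exp (- s\<^sup>2 * \<tau>)) * indicator {0..} \<tau>)"
      using AE_lborel_singleton[of 0]
    proof eventually_elim
      case (elim \<tau>)
      show ?case
      proof (cases "0 < \<tau>")
        case True
        have G: "0 < Gamma \<beta>" by (rule Gamma_real_pos[OF \<beta>])
        \<comment> \<open>The exponential factors over the coordinates; the coordinate along
          \<open>b\<close> also carries the truncated factor \<open>?h\<close>.\<close>
        define f where "f = (\<lambda>(i::'a) t. if i = b then ennreal (?h t * exp (- \<tau> * t\<^sup>2)) else ennreal (exp (- \<tau> * t\<^sup>2)))"
        have prod: "ennreal (?h (z \<bullet> b)) * ennreal (exp (- (norm z)\<^sup>2 * \<tau>)) = (\<Prod>i\<in>Basis. f i (z \<bullet> i))" for z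
        proof -
          have nz: "(norm z)\<^sup>2 = (\<Sum>i\<in>Basis. (z \<bullet> i)\<^sup>2)"
            unfolding power2_norm_eq_inner by (subst euclidean_inner) (simp add: power2_eq_square)
          have "exp (- (norm z)\<^sup>2 * \<tau>) = exp (\<Sum>i\<in>Basis. - \<tau> * (z \<bullet> i)\<^sup>2)"
            unfolding nz by (simp add: sum_distrib_left sum_negf mult.commute)
          also have "\<dots> = (\<Prod>i\<in>Basis. exp (- \<tau> * (z \<bullet> i)\<^sup>2))" by (rule exp_sum) simp
          finally have "ennreal (exp (- (norm z)\<^sup>2 * \<tau>)) = (\<Prod>i\<in>Basis. ennreal (exp (- \<tau> * (z \<bullet> i)\<^sup>2)))"
            by (simp add: prod_ennreal)
          also have "\<dots> = ennreal (exp (- \<tau> * (z \<bullet> b)\<^sup>2)) * (\<Prod>i\<in>Basis - {b}. ennreal (exp (- \<tau> * (z \<bullet> i)\<^sup>2)))"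
            using b by (simp add: prod.remove)
          finally have ez: "ennreal (exp (- (norm z)\<^sup>2 * \<tau>)) = ennreal (exp (- \<tau> * (z \<bullet> b)\<^sup>2)) * (\<Prod>i\<in>Basis - {b}. ennreal (exp (- \<tau> * (z \<bullet> i)\<^sup>2)))" .
          have "ennreal (?h (z \<bullet> b)) * ennreal (exp (- (norm z)\<^sup>2 * \<tau>))
             = f b (z \<bullet> b) * (\<Prod>i\<in>Basis - {b}. ennreal (exp (- \<tau> * (z \<bullet> i)\<^sup>2)))"
          proof -
            have "f b (z \<bullet> b) = ennreal (?h (z \<bullet> b)) * ennreal (exp (- \<tau> * (z \<bullet> b)\<^sup>2))"
              unfolding f_def by (simp only: if_True simp_thms) (rule ennreal_mult[OF h], simp)
            then show ?thesis unfolding ez by (simp only: mult.assoc)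
          qed
          also have "(\<Prod>i\<in>Basis - {b}. ennreal (exp (- \<tau> * (z \<bullet> i)\<^sup>2))) = (\<Prod>i\<in>Basis - {b}. f i (z \<bullet> i))"
            by (rule prod.cong) (auto simp: f_def)
          finally show ?thesis using b by (simp add: prod.remove)
        qed
        have [measurable]: "f i \<in> borel_measurable borel" for i
          unfolding f_def by (cases "i = b") simp_all
        have "(\<integral>\<^sup>+z. ennreal (?h (z \<bullet> b)) * ennreal (exp (- (norm z)\<^sup>2 * \<tau>)) \<partial>lborel)
            = (\<integral>\<^sup>+z. (\<Prod>i\<in>Basis. f i (z \<bullet> i)) \<partial>lborel)"
          unfolding prod ..
        also have "\<dots> = (\<Prod>i\<in>Basis. \<integral>\<^sup>+t. f i t \<partial>lborel)"
          by (rule nn_integral_lborel_prod) auto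
        also have "\<dots> = (\<integral>\<^sup>+t. f b t \<partial>lborel) * (\<Prod>i\<in>Basis - {b}. \<integral>\<^sup>+t. f i t \<partial>lborel)"
          using b by (simp add: prod.remove)
        also have "(\<integral>\<^sup>+t. f b t \<partial>lborel) = ennreal (exp (- \<tau> * s\<^sup>2) / (2 * \<tau>))"
          unfolding f_def using nn_integral_gaussian_moment[OF True s] by simp
        also have "(\<Prod>i\<in>Basis - {b}. \<integral>\<^sup>+t. f i t \<partial>lborel) = (\<Prod>i\<in>Basis - {b}. ennreal (sqrt (pi / \<tau>)))"
          using nn_integral_gaussian[OF True] by (intro prod.cong) (auto simp: f_def)
        also have "\<dots> = ennreal ((pi / \<tau>) powr ((n - 1) / 2))"
        proof -
          have "card (Basis - {b}) = DIM('a) - 1" using b by simp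
          moreover have "real (DIM('a) - 1) = n - 1" using DIM_positive[where 'a = 'a] by (simp add: n_def)
          ultimately have "sqrt (pi / \<tau>) ^ card (Basis - {b}) = (pi / \<tau>) powr ((n - 1) / 2)"
            using True by (simp add: powr_half_sqrt[symmetric] powr_realpow[symmetric] powr_powr)
          then show ?thesis using True by (simp add: ennreal_power)
        qed
        finally have I: "(\<integral>\<^sup>+z. ennreal (?h (z \<bullet> b)) * ennreal (exp (- (norm z)\<^sup>2 * \<tau>)) \<partial>lborel)
            = ennreal (exp (- \<tau> * s\<^sup>2) / (2 * \<tau>)) * ennreal ((pi / \<tau>) powr ((n - 1) / 2))" .
        have "(\<integral>\<^sup>+z. ennreal (1 / Gamma \<beta>) * (ennreal (?h (z \<bullet> b)) *
            (ennreal (\<tau> powr (\<beta> - 1) * exp (- (norm z)\<^sup>2 * \<tau>)) * indicator {0..} \<tau>)) \<partial>lborel)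
          = (\<integral>\<^sup>+z. ennreal (1 / Gamma \<beta>) * ennreal (\<tau> powr (\<beta> - 1)) *
             (ennreal (?h (z \<bullet> b)) * ennreal (exp (- (norm z)\<^sup>2 * \<tau>))) \<partial>lborel)"
          using True by (intro nn_integral_cong) (simp add: ennreal_mult mult_ac)
        also have "\<dots> = ennreal (1 / Gamma \<beta>) * ennreal (\<tau> powr (\<beta> - 1)) *
             (ennreal (exp (- \<tau> * s\<^sup>2) / (2 * \<tau>)) * ennreal ((pi / \<tau>) powr ((n - 1) / 2)))"
          unfolding I[symmetric] by (rule nn_integral_cmult) measurable
        also have "\<dots> = ennreal (1 / Gamma \<beta> * \<tau> powr (\<beta> - 1) * (exp (- \<tau> * s\<^sup>2) / (2 * \<tau>) * (pi / \<tau>) powr ((n - 1) / 2)))"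
        proof -
          have "ennreal x * ennreal y * (ennreal z * ennreal w) = ennreal (x * y * (z * w))"
            if "0 \<le> x" "0 \<le> y" "0 \<le> z" "0 \<le> w" for x y z w using that by (simp add: ennreal_mult)
          then show ?thesis using G True by simp
        qed
        also have "1 / Gamma \<beta> * \<tau> powr (\<beta> - 1) * (exp (- \<tau> * s\<^sup>2) / (2 * \<tau>) * (pi / \<tau>) powr ((n - 1) / 2))
           = pi powr ((n - 1) / 2) / (2 * Gamma \<beta>) * (\<tau> powr (\<alpha> / 2 - 1) * exp (- s\<^sup>2 * \<tau>))"
        proof -
          have "\<tau> powr (\<beta> - 1) * (1 / \<tau>) * (1 / \<tau> powr ((n - 1) / 2)) = \<tau> powr (\<beta> - 1 - 1 - (n - 1) / 2)"
          proof -
            have "1 / \<tau> = \<tau> powr (- 1)" "1 / \<tau> powr ((n - 1) / 2) = \<tau> powr (- ((n - 1) / 2))"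
              using True by (simp_all add: powr_minus_divide)
            then show ?thesis by (simp only: powr_add[symmetric] diff_conv_add_uminus)
          qed
          also have "\<beta> - 1 - 1 - (n - 1) / 2 = \<alpha> / 2 - 1" by (simp add: \<beta>_def field_simps)
          finally have e: "\<tau> powr (\<alpha> / 2 - 1) = \<tau> powr (\<beta> - 1) * (1 / \<tau>) * (1 / \<tau> powr ((n - 1) / 2))" ..
          have pd: "(pi / \<tau>) powr ((n - 1) / 2) = pi powr ((n - 1) / 2) / \<tau> powr ((n - 1) / 2)"
            using True by (simp add: powr_divide)
          have ex: "exp (- \<tau> * s\<^sup>2) = exp (- s\<^sup>2 * \<tau>)" by (simp add: mult.commute)
          show ?thesis unfolding e pd ex
            by (simp only: divide_inverse inverse_mult_distrib mult_1_left mult_1_right mult.assoc mult.commute mult.left_commute)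
        qed
        also have "ennreal \<dots> = ennreal (pi powr ((n - 1) / 2) / (2 * Gamma \<beta>)) *
            (ennreal (\<tau> powr (\<alpha> / 2 - 1) * exp (- s\<^sup>2 * \<tau>)) * indicator {0..} \<tau>)"
        proof -
          have i1: "indicator {0..} \<tau> = (1::ennreal)" using True by simp
          show ?thesis unfolding i1 mult_1_right using G by (intro ennreal_mult) auto
        qed
        finally show ?thesis .
      qed (use elim in \<open>simp add: indicator_def\<close>)
    qed
  qed
  also have "\<dots> = ennreal (pi powr ((n - 1) / 2) / (2 * Gamma \<beta>)) *
      (\<integral>\<^sup>+\<tau>\<in>{0..}. ennreal (\<tau> powr (\<alpha> / 2 - 1) * exp (- s\<^sup>2 * \<tau>)) \<partial>lborel)"
    by (rule nn_integral_cmult) measurable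
  also have "\<dots> = ennreal (pi powr ((n - 1) / 2) / (2 * Gamma \<beta>)) * ennreal (Gamma (\<alpha> / 2) * (s\<^sup>2) powr (- (\<alpha> / 2)))"
    using nn_integral_Gamma_scaled[of "\<alpha> / 2" "s\<^sup>2"] \<alpha> s by simp
  also have "(s\<^sup>2) powr (- (\<alpha> / 2)) = s powr (- \<alpha>)"
    using s powr_powr[of s 2 "- (\<alpha> / 2)"] by simp
  also have "ennreal (pi powr ((n - 1) / 2) / (2 * Gamma \<beta>)) * ennreal (Gamma (\<alpha> / 2) * s powr (- \<alpha>))
     = ennreal (pi powr ((n - 1) / 2) * Gamma (\<alpha> / 2) / (2 * Gamma \<beta>) * s powr (- \<alpha>))"
  proof -
    have "ennreal (pi powr ((n - 1) / 2) / (2 * Gamma \<beta>)) * ennreal (Gamma (\<alpha> / 2) * s powr (- \<alpha>))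
      = ennreal (pi powr ((n - 1) / 2) / (2 * Gamma \<beta>) * (Gamma (\<alpha> / 2) * s powr (- \<alpha>)))"
      using Gamma_real_pos[OF \<beta>] Gamma_real_pos[of "\<alpha> / 2"] \<alpha> by (intro ennreal_mult[symmetric]) auto
    then show ?thesis by (simp add: mult.assoc)
  qed
  finally show ?thesis unfolding \<beta>_def by simp
qed

section \<open>Spherical averages\<close>

text \<open>The averages over the sphere are written as averages over the unit ball of functions of
  \<open>z / |z|\<close>.\<close>

lemma nn_integral_cylindrical:
  fixes b :: "'a::euclidean_space" and F :: "real \<Rightarrow> real \<Rightarrow> ennreal"
  assumes b: "b \<in> Basis" and n: "2 \<le> DIM('a)" and F: "case_prod F \<in> borel_measurable (borel \<Otimes>\<^sub>M borel)"
  defines "m \<equiv> real DIM('a) - 1"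
  shows "(\<integral>\<^sup>+z. F (z \<bullet> b) ((norm z)\<^sup>2 - (z \<bullet> b)\<^sup>2) \<partial>lborel)
     = (\<integral>\<^sup>+s. (\<integral>\<^sup>+r\<in>{0..}. ennreal (unit_ball_vol m * m * r powr (m - 1)) * F s (r\<^sup>2) \<partial>lborel) \<partial>lborel)"
proof -
  interpret product_sigma_finite "\<lambda>_::'a. lborel :: real measure" by standard
  let ?B = "Basis - {b}" and ?e = "\<lambda>f. \<Sum>i\<in>Basis. f i *\<^sub>R (i::'a)"
  have cB: "real (card ?B) = m" using b n by (simp add: m_def)
  have m: "0 < m" using n by (simp add: m_def)
  have [measurable]: "(\<lambda>z::'a. F (z \<bullet> b) ((norm z)\<^sup>2 - (z \<bullet> b)\<^sup>2)) \<in> borel_measurable borel"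
  proof -
    have "(\<lambda>z::'a. (z \<bullet> b, (norm z)\<^sup>2 - (z \<bullet> b)\<^sup>2)) \<in> borel \<rightarrow>\<^sub>M borel \<Otimes>\<^sub>M borel" by measurable
    from measurable_compose[OF this F] show ?thesis by simp
  qed
  have e: "?e f \<bullet> i = f i" if "i \<in> Basis" for f i using that by (simp add: inner_sum_left inner_Basis if_distrib cong: if_cong)
  have e2: "(norm (?e f))\<^sup>2 - (f b)\<^sup>2 = (\<Sum>i\<in>?B. (f i)\<^sup>2)" for f
  proof -
    have "(norm (?e f))\<^sup>2 = (\<Sum>i\<in>Basis. (f i)\<^sup>2)"
      unfolding power2_norm_eq_inner by (subst euclidean_inner) (simp add: e power2_eq_square)
    also have "\<dots> = (f b)\<^sup>2 + (\<Sum>i\<in>?B. (f i)\<^sup>2)" using b by (simp add: sum.remove)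
    finally show ?thesis by simp
  qed
  have ins: "insert b ?B = Basis" using b by auto
  have Fm: "(\<lambda>f. F (f b) (\<Sum>i\<in>?B. (f i)\<^sup>2)) \<in> borel_measurable (Pi\<^sub>M (insert b ?B) (\<lambda>_. lborel))"
  proof -
    have "(\<lambda>f. (f b, \<Sum>i\<in>?B. (f i)\<^sup>2)) \<in> Pi\<^sub>M (insert b ?B) (\<lambda>_. lborel :: real measure) \<rightarrow>\<^sub>M borel \<Otimes>\<^sub>M borel"
    proof -
      have comp: "(\<lambda>f. f i) \<in> borel_measurable (Pi\<^sub>M (insert b ?B) (\<lambda>_. lborel :: real measure))" if "i \<in> Basis" for i
        using measurable_component_singleton[of i "insert b ?B" "\<lambda>_. lborel :: real measure"] that ins by simp
      have "(\<lambda>f. \<Sum>i\<in>?B. (f i)\<^sup>2) \<in> borel_measurable (Pi\<^sub>M (insert b ?B) (\<lambda>_. lborel :: real measure))"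
        by (rule borel_measurable_sum) (rule borel_measurable_power, rule comp, simp)
      with comp[OF b] show ?thesis by (rule measurable_Pair)
    qed
    from measurable_compose[OF this F] show ?thesis by simp
  qed
  have "(\<integral>\<^sup>+z. F (z \<bullet> b) ((norm z)\<^sup>2 - (z \<bullet> b)\<^sup>2) \<partial>lborel)
      = (\<integral>\<^sup>+f. F (?e f \<bullet> b) ((norm (?e f))\<^sup>2 - (?e f \<bullet> b)\<^sup>2) \<partial>Pi\<^sub>M Basis (\<lambda>_. lborel))"
    by (subst lborel_eq, rule nn_integral_distr) measurable
  also have "\<dots> = (\<integral>\<^sup>+f. F (f b) (\<Sum>i\<in>?B. (f i)\<^sup>2) \<partial>Pi\<^sub>M (insert b ?B) (\<lambda>_. lborel))"
    unfolding e[OF b] e2 ins ..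
  also have "\<dots> = (\<integral>\<^sup>+s. \<integral>\<^sup>+f. F ((f(b := s)) b) (\<Sum>i\<in>?B. ((f(b := s)) i)\<^sup>2) \<partial>Pi\<^sub>M ?B (\<lambda>_. lborel) \<partial>lborel)"
    by (rule product_nn_integral_insert_rev[OF _ _ Fm]) auto
  also have "\<dots> = (\<integral>\<^sup>+s. \<integral>\<^sup>+f. F s ((sqrt (\<Sum>i\<in>?B. (f i)\<^sup>2))\<^sup>2) \<partial>Pi\<^sub>M ?B (\<lambda>_. lborel) \<partial>lborel)"
  proof -
    have "(\<Sum>i\<in>?B. ((f(b := s)) i)\<^sup>2) = (sqrt (\<Sum>i\<in>?B. (f i)\<^sup>2))\<^sup>2" for f and s :: real
      by (simp add: sum_nonneg)
    then show ?thesis by (simp only: fun_upd_same)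
  qed
  also have "\<dots> = (\<integral>\<^sup>+s. (\<integral>\<^sup>+r\<in>{0..}. ennreal (unit_ball_vol m * m * r powr (m - 1)) * F s (r\<^sup>2) \<partial>lborel) \<partial>lborel)"
  proof (rule nn_integral_cong)
    fix s :: real
    have Fs: "(\<lambda>r. F s (r\<^sup>2)) \<in> borel_measurable borel"
    proof -
      have "(\<lambda>r::real. (s, r\<^sup>2)) \<in> borel \<rightarrow>\<^sub>M borel \<Otimes>\<^sub>M borel" by measurable
      from measurable_compose[OF this F] show ?thesis by simp
    qed
    show "(\<integral>\<^sup>+f. F s ((sqrt (\<Sum>i\<in>?B. (f i)\<^sup>2))\<^sup>2) \<partial>Pi\<^sub>M ?B (\<lambda>_. lborel))
      = (\<integral>\<^sup>+r\<in>{0..}. ennreal (unit_ball_vol m * m * r powr (m - 1)) * F s (r\<^sup>2) \<partial>lborel)"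
    proof (rule nn_integral_radial[OF _ m _ _ Fs])
      fix r :: real assume r: "0 < r"
      have "{f \<in> space (Pi\<^sub>M ?B (\<lambda>_. lborel)). sqrt (\<Sum>i\<in>?B. (f i)\<^sup>2) \<le> r}
          = {f. sqrt (\<Sum>i\<in>?B. (f i)\<^sup>2) \<le> r} \<inter> space (Pi\<^sub>M ?B (\<lambda>_. lborel))" by auto
      then show "emeasure (Pi\<^sub>M ?B (\<lambda>_. lborel)) {f \<in> space (Pi\<^sub>M ?B (\<lambda>_. lborel)). sqrt (\<Sum>i\<in>?B. (f i)\<^sup>2) \<le> r}
          = ennreal (unit_ball_vol m * r powr m)"
        using emeasure_cball_aux[of ?B r] r cB by (simp add: powr_realpow[symmetric])
    qed (use m in auto)
  qed
  finally show ?thesis .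
qed

text \<open>For fixed \<open>r\<close>, the substitution \<open>s = r u / sqrt (1 - u\<^sup>2)\<close> makes \<open>u = s / sqrt (s\<^sup>2 + r\<^sup>2)\<close>
  the cosine of the polar angle.\<close>

lemma nn_integral_angle_substitution:
  fixes f :: "real \<Rightarrow> real" and r :: real
  assumes [measurable]: "f \<in> borel_measurable borel" and r: "0 < r"
  shows "(\<integral>\<^sup>+s. ennreal (f s) \<partial>lborel) =
    (\<integral>\<^sup>+u\<in>{-1<..<1}. ennreal (f (r * u / sqrt (1 - u\<^sup>2)) * (r * (1 - u\<^sup>2) powr (- (3/2)))) \<partial>lborel)"
proof -
  define g g' where "g = (\<lambda>u. r * u / sqrt (1 - u\<^sup>2))" and "g' = (\<lambda>u. r * (1 - u\<^sup>2) powr (- (3/2)))"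
  \<comment> \<open>Compact intervals exhausting the open one: the substitution rule is applied on
    compact intervals, and the derivative \<open>g'\<close> blows up at both ends. The shift
    \<open>k + 2\<close> keeps every \<open>a k\<close> positive.\<close>
  define a where "a = (\<lambda>k::nat. 1 - 1 / real (k + 2))"
  have a: "0 < a k" "a k < 1" for k by (auto simp: a_def field_simps)
  have a_mono: "a j \<le> a k" if "j \<le> k" for j k unfolding a_def using that by (intro diff_left_mono divide_left_mono) auto
  have pos: "0 < 1 - u\<^sup>2" if "\<bar>u\<bar> < 1" for u :: real using that by (simp add: abs_square_less_1)
  have der: "(g has_real_derivative g' u) (at u)" if u: "\<bar>u\<bar> < 1" for u
  proof -
    have p: "0 < 1 - u\<^sup>2" by (rule pos[OF u])
    have "(g has_real_derivative (r * sqrt (1 - u\<^sup>2) - r * u * (- (2 * u) * (inverse (sqrt (1 - u\<^sup>2)) / 2))) / (sqrt (1 - u\<^sup>2) * sqrt (1 - u\<^sup>2))) (at u)"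
      unfolding g_def using p by (auto intro!: derivative_eq_intros)
    moreover have "(r * sqrt (1 - u\<^sup>2) - r * u * (- (2 * u) * (inverse (sqrt (1 - u\<^sup>2)) / 2))) / (sqrt (1 - u\<^sup>2) * sqrt (1 - u\<^sup>2)) = g' u"
    proof -
      let ?q = "sqrt (1 - u\<^sup>2)"
      have q: "0 < ?q" "?q * ?q = 1 - u\<^sup>2" using p by auto
      have "r * ?q - r * u * (- (2 * u) * (inverse ?q / 2)) = r * (?q * ?q + u\<^sup>2) / ?q"
        using q(1) by (simp add: field_simps power2_eq_square)
      also have "\<dots> = r / ?q" using q(2) by simp
      finally have "(r * ?q - r * u * (- (2 * u) * (inverse ?q / 2))) / (?q * ?q) = r / (?q * (1 - u\<^sup>2))"
        using q by simp
      also have "?q * (1 - u\<^sup>2) = (1 - u\<^sup>2) powr (1/2) * (1 - u\<^sup>2) powr 1" using p by (simp add: powr_half_sqrt)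
      also have "\<dots> = (1 - u\<^sup>2) powr (3/2)" unfolding powr_add[symmetric] by simp
      also have "r / (1 - u\<^sup>2) powr (3/2) = g' u" unfolding g'_def by (simp add: powr_minus_divide)
      finally show ?thesis .
    qed
    ultimately show ?thesis by simp
  qed
  have g'nn: "0 \<le> g' u" for u using r by (simp add: g'_def)
  have [measurable]: "g \<in> borel_measurable borel" "g' \<in> borel_measurable borel"
    unfolding g_def g'_def by measurable
  have inj: "g u \<le> g v" if "-1 < u" "u \<le> v" "v < 1" for u v
  proof (rule DERIV_nonneg_imp_nondecreasing[OF that(2)])
    fix x assume "u \<le> x" "x \<le> v"
    then have "\<bar>x\<bar> < 1" using that by auto
    then show "\<exists>y. (g has_real_derivative y) (at x) \<and> 0 \<le> y" using der g'nn by blast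
  qed
  have I: "(\<integral>\<^sup>+s. ennreal (f s) * indicator {g (- a k)..g (a k)} s \<partial>lborel)
      = (\<integral>\<^sup>+u. ennreal (f (g u) * g' u) * indicator {- a k..a k} u \<partial>lborel)" for k
  proof -
    have "(\<integral>\<^sup>+s. ennreal (f s * indicator {g (- a k)..g (a k)} s) \<partial>lborel)
      = (\<integral>\<^sup>+u. ennreal (f (g u) * g' u * indicator {- a k..a k} u) \<partial>lborel)"
    proof (rule nn_integral_substitution)
      show "set_borel_measurable borel {g (- a k)..g (a k)} f"
        unfolding set_borel_measurable_def by measurable
      show "(g has_real_derivative g' u) (at u)" if "u \<in> {- a k..a k}" for u
        using that a[of k] by (intro der) auto
      show "continuous_on {- a k..a k} g'"
        unfolding g'_def
      proof (intro continuous_intros ballI)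
        fix u assume "u \<in> {- a k..a k}"
        then have "\<bar>u\<bar> < 1" using a[of k] by auto
        then show "1 - u\<^sup>2 \<noteq> 0" using pos[of u] by simp
      qed
    qed (use a[of k] g'nn in auto)
    moreover have "ennreal (x * indicator S y) = ennreal x * indicator S y" for x and y :: real and S
      by (auto simp: indicator_def)
    ultimately show ?thesis by simp
  qed
  have lim1: "(\<Union>k. {g (- a k)..g (a k)}) = UNIV"
  proof (intro equalityI subsetI UNIV_I)
    fix s :: real
    \<comment> \<open>The inverse of the substitution; it shows that the images of the compact
      intervals exhaust the line.\<close>
    define u where "u = s / sqrt (s\<^sup>2 + r\<^sup>2)"
    have q: "0 < s\<^sup>2 + r\<^sup>2" using r by (simp add: add_nonneg_pos)
    have u2: "1 - u\<^sup>2 = r\<^sup>2 / (s\<^sup>2 + r\<^sup>2)" 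
  proof -
    have "1 - u\<^sup>2 = (s\<^sup>2 + r\<^sup>2) / (s\<^sup>2 + r\<^sup>2) - s\<^sup>2 / (s\<^sup>2 + r\<^sup>2)" using q r by (simp add: u_def power_divide)
    also have "\<dots> = r\<^sup>2 / (s\<^sup>2 + r\<^sup>2)" by (simp only: diff_divide_distrib[symmetric] add_diff_cancel_left')
    finally show ?thesis .
  qed
    then have "0 < 1 - u\<^sup>2" using q r by simp
    then have u1: "\<bar>u\<bar> < 1" by (simp add: abs_square_less_1)
    have "sqrt (1 - u\<^sup>2) = r / sqrt (s\<^sup>2 + r\<^sup>2)" unfolding u2 using r by (simp add: real_sqrt_divide)
    then have gu: "g u = s" using q r by (simp add: g_def u_def)
    obtain k :: nat where k: "1 / (1 - \<bar>u\<bar>) \<le> real k" using real_arch_simple by blast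
    then have "1 / real (k + 2) \<le> 1 - \<bar>u\<bar>" using u1 by (simp add: field_simps)
    then have "\<bar>u\<bar> \<le> a k" by (simp add: a_def)
    then have "g (- a k) \<le> g u" "g u \<le> g (a k)" using a[of k] u1 by (auto intro!: inj)
    then show "s \<in> (\<Union>k. {g (- a k)..g (a k)})" unfolding gu by auto
  qed
  have lim2: "(\<Union>k. {- a k..a k}) = {-1<..<1}"
  proof (intro equalityI subsetI)
    fix u :: real assume "u \<in> {-1<..<1}"
    then have u1: "\<bar>u\<bar> < 1" by auto
    obtain k :: nat where k: "1 / (1 - \<bar>u\<bar>) \<le> real k" using real_arch_simple by blast
    then have "1 / real (k + 2) \<le> 1 - \<bar>u\<bar>" using u1 by (simp add: field_simps)
    then have "\<bar>u\<bar> \<le> a k" by (simp add: a_def)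
    then have "u \<in> {- a k..a k}" by (auto simp: abs_le_iff)
    then show "u \<in> (\<Union>k. {- a k..a k})" by blast
  next
    fix u assume "u \<in> (\<Union>k. {- a k..a k})"
    then obtain k where "- a k \<le> u" "u \<le> a k" by auto
    then show "u \<in> {-1<..<1}" using a[of k] by auto
  qed
  have cont: "(SUP k. \<integral>\<^sup>+x. h x * indicator (S k) x \<partial>lborel) = (\<integral>\<^sup>+x. h x * indicator (\<Union>k. S k) x \<partial>lborel)"
    if [measurable]: "h \<in> borel_measurable borel" "\<And>k. S k \<in> sets borel" and S: "\<And>j k. j \<le> k \<Longrightarrow> S j \<subseteq> S k"
    for h :: "real \<Rightarrow> ennreal" and S :: "nat \<Rightarrow> real set"
  proof -
    have "(SUP k. emeasure (density lborel h) (S k)) = emeasure (density lborel h) (\<Union>k. S k)"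
      by (rule SUP_emeasure_incseq) (use S in \<open>auto simp: incseq_def\<close>)
    then show ?thesis by (simp add: emeasure_density)
  qed
  have "(\<integral>\<^sup>+s. ennreal (f s) \<partial>lborel) = (SUP k. \<integral>\<^sup>+s. ennreal (f s) * indicator {g (- a k)..g (a k)} s \<partial>lborel)"
  proof -
    have "(\<integral>\<^sup>+s. ennreal (f s) \<partial>lborel) = (\<integral>\<^sup>+s. ennreal (f s) * indicator (\<Union>k. {g (- a k)..g (a k)}) s \<partial>lborel)"
      unfolding lim1 by simp
    also have "\<dots> = (SUP k. \<integral>\<^sup>+s. ennreal (f s) * indicator {g (- a k)..g (a k)} s \<partial>lborel)"
    proof (rule cont[symmetric])
      fix j k :: nat assume "j \<le> k"
      then have "a j \<le> a k" by (rule a_mono)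
      then have "g (- a k) \<le> g (- a j)" "g (a j) \<le> g (a k)" using a[of j] a[of k] by (auto intro!: inj)
      then show "{g (- a j)..g (a j)} \<subseteq> {g (- a k)..g (a k)}" by auto
    qed auto
    finally show ?thesis .
  qed
  also have "\<dots> = (SUP k. \<integral>\<^sup>+u. ennreal (f (g u) * g' u) * indicator {- a k..a k} u \<partial>lborel)"
    unfolding I ..
  also have "\<dots> = (\<integral>\<^sup>+u. ennreal (f (g u) * g' u) * indicator (\<Union>k. {- a k..a k}) u \<partial>lborel)"
  proof (rule cont)
    fix j k :: nat assume "j \<le> k"
    then show "{- a j..a j} \<subseteq> {- a k..a k}" using a_mono[of j k] by auto
  qed auto
  finally show ?thesis unfolding lim2 g_def g'_def .
qed

text \<open>With \<open>s\<close> the component along the axis and \<open>r\<close> the distance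
  from it, fix \<open>r\<close> and replace \<open>s\<close> by the cosine \<open>u\<close>; the
  unit ball becomes \<open>r \<le> sqrt (1 - u\<^sup>2)\<close>. The Jacobian contributes the
  exponent -3/2 to 1 - u^2 and one power of \<open>r\<close>, and integrating
  \<open>r powr m\<close> adds the exponent (m + 1) / 2; the sum is (m - 2) / 2.\<close>

lemma nn_integral_sphere_average:
  fixes e :: "'a::euclidean_space" and G :: "real \<Rightarrow> real"
  assumes e: "norm e = 1" and n: "2 \<le> DIM('a)"
    and G[measurable]: "G \<in> borel_measurable borel" and Gnn: "\<And>s. 0 \<le> G s"
  defines "m \<equiv> real DIM('a) - 1"
  shows "(\<integral>\<^sup>+z\<in>cball 0 1. ennreal (G (z \<bullet> e / norm z)) \<partial>lborel)
    = ennreal (unit_ball_vol m * m / (m + 1)) *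
      (\<integral>\<^sup>+u\<in>{-1..1}. ennreal ((1 - u\<^sup>2) powr ((m - 2) / 2) * G u) \<partial>lborel)"
proof -
  obtain b :: 'a where b: "b \<in> Basis" using SOME_Basis by blast
  have m: "1 \<le> m" using n by (simp add: m_def)
  let ?c = "unit_ball_vol m * m"
  have c: "0 \<le> ?c" using m by simp
  let ?w = "\<lambda>u::real. 1 - u\<^sup>2"
  have "(\<integral>\<^sup>+z\<in>cball 0 1. ennreal (G (z \<bullet> e / norm z)) \<partial>lborel)
      = (\<integral>\<^sup>+z. ennreal (G (z \<bullet> e / norm z) * indicator {..1} (norm z)) \<partial>lborel)"
    by (intro nn_integral_cong) (auto simp: indicator_def)
  also have "\<dots> = (\<integral>\<^sup>+z. ennreal (G (z \<bullet> b / norm z) * indicator {..1} (norm z)) \<partial>lborel)"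
    by (rule nn_integral_rotate[OF e b, of "\<lambda>x y. ennreal (G (x / y) * indicator {..1} y)"]) measurable
  also have "\<dots> = (\<integral>\<^sup>+z. ennreal (G (z \<bullet> b / sqrt ((z \<bullet> b)\<^sup>2 + ((norm z)\<^sup>2 - (z \<bullet> b)\<^sup>2))) *
       indicator {..1} (sqrt ((z \<bullet> b)\<^sup>2 + ((norm z)\<^sup>2 - (z \<bullet> b)\<^sup>2)))) \<partial>lborel)"
    by simp
  also have "\<dots> = (\<integral>\<^sup>+s. (\<integral>\<^sup>+r\<in>{0..}. ennreal (?c * r powr (m - 1)) *
      ennreal (G (s / sqrt (s\<^sup>2 + r\<^sup>2)) * indicator {..1} (sqrt (s\<^sup>2 + r\<^sup>2))) \<partial>lborel) \<partial>lborel)"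
    unfolding m_def
    by (rule nn_integral_cylindrical[OF b n, of "\<lambda>s q. ennreal (G (s / sqrt (s\<^sup>2 + q)) * indicator {..1} (sqrt (s\<^sup>2 + q)))"]) measurable
  also have "\<dots> = (\<integral>\<^sup>+r. \<integral>\<^sup>+s. ennreal (?c * r powr (m - 1)) *
      ennreal (G (s / sqrt (s\<^sup>2 + r\<^sup>2)) * indicator {..1} (sqrt (s\<^sup>2 + r\<^sup>2))) * indicator {0..} r \<partial>lborel \<partial>lborel)"
    by (rule lborel_pair.Fubini'[symmetric]) measurable
  also have "\<dots> = (\<integral>\<^sup>+r. \<integral>\<^sup>+u. ennreal (?c * (?w u powr (- (3/2)) * G u)) * (ennreal (r powr m) * indicator {0..sqrt (?w u)} r)
       * indicator {-1<..<1} u \<partial>lborel \<partial>lborel)"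
  proof (rule nn_integral_cong_AE)
    show "AE r in lborel. (\<integral>\<^sup>+s. ennreal (?c * r powr (m - 1)) *
      ennreal (G (s / sqrt (s\<^sup>2 + r\<^sup>2)) * indicator {..1} (sqrt (s\<^sup>2 + r\<^sup>2))) * indicator {0..} r \<partial>lborel)
      = (\<integral>\<^sup>+u. ennreal (?c * (?w u powr (- (3/2)) * G u)) * (ennreal (r powr m) * indicator {0..sqrt (?w u)} r)
       * indicator {-1<..<1} u \<partial>lborel)"
      using AE_lborel_singleton[of 0]
    proof eventually_elim
      case (elim r)
      show ?case
      proof (cases "0 < r")
        case False
        then show ?thesis using elim by (simp add: indicator_def)
      next
        case True
        let ?f = "\<lambda>s. G (s / sqrt (s\<^sup>2 + r\<^sup>2)) * indicator {..1} (sqrt (s\<^sup>2 + r\<^sup>2)) :: real"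
        have "(\<integral>\<^sup>+s. ennreal (?c * r powr (m - 1)) * ennreal (?f s) * indicator {0..} r \<partial>lborel)
          = ennreal (?c * r powr (m - 1)) * (\<integral>\<^sup>+s. ennreal (?f s) \<partial>lborel)"
          using True by (subst nn_integral_cmult[symmetric]) auto
        also have "\<dots> = ennreal (?c * r powr (m - 1)) *
            (\<integral>\<^sup>+u\<in>{-1<..<1}. ennreal (?f (r * u / sqrt (?w u)) * (r * ?w u powr (- (3/2)))) \<partial>lborel)"
          by (subst nn_integral_angle_substitution[OF _ True]) auto
        also have "\<dots> = (\<integral>\<^sup>+u. ennreal (?c * r powr (m - 1)) *
            (ennreal (?f (r * u / sqrt (?w u)) * (r * ?w u powr (- (3/2)))) * indicator {-1<..<1} u) \<partial>lborel)"
          by (rule nn_integral_cmult[symmetric]) measurable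
        also have "\<dots> = (\<integral>\<^sup>+u. ennreal (?c * (?w u powr (- (3/2)) * G u)) * (ennreal (r powr m) * indicator {0..sqrt (?w u)} r)
             * indicator {-1<..<1} u \<partial>lborel)"
        proof (rule nn_integral_cong)
          fix u :: real
          show "ennreal (?c * r powr (m - 1)) * (ennreal (?f (r * u / sqrt (?w u)) * (r * ?w u powr (- (3/2)))) * indicator {-1<..<1} u)
             = ennreal (?c * (?w u powr (- (3/2)) * G u)) * (ennreal (r powr m) * indicator {0..sqrt (?w u)} r) * indicator {-1<..<1} u"
          proof (cases "u \<in> {-1<..<1}")
            case u: True
            then have w: "0 < ?w u" by (simp add: abs_square_less_1 abs_less_iff)
            let ?q = "sqrt (?w u)"
            have q: "0 < ?q" "?q\<^sup>2 = ?w u" using w by auto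
            have "(r * u / ?q)\<^sup>2 + r\<^sup>2 = r\<^sup>2 / ?q\<^sup>2"
            proof -
              have "(r * u / ?q)\<^sup>2 + r\<^sup>2 = (r\<^sup>2 * u\<^sup>2 + r\<^sup>2 * ?q\<^sup>2) / ?q\<^sup>2"
                using q(1) by (simp add: power_divide power_mult_distrib add_divide_distrib)
              also have "r\<^sup>2 * u\<^sup>2 + r\<^sup>2 * ?q\<^sup>2 = r\<^sup>2" unfolding q(2) by (simp add: algebra_simps)
              finally show ?thesis .
            qed
            then have sq: "sqrt ((r * u / ?q)\<^sup>2 + r\<^sup>2) = r / ?q"
              using True q(1) by (simp add: real_sqrt_divide)
            have "?f (r * u / ?q) = G u * indicator {..1} (r / ?q)"
              unfolding sq using True q(1) by simp
            also have "indicator {..1} (r / ?q) = (indicator {0..?q} r :: real)"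
              using True q(1) by (simp add: indicator_def divide_le_eq)
            finally have f: "?f (r * u / ?q) = G u * indicator {0..?q} r" .
            have rm: "r powr (m - 1) * r = r powr m" using True by (simp add: powr_diff)
            have "?c * r powr (m - 1) * (G u * indicator {0..?q} r * (r * ?w u powr (- (3/2))))
              = ?c * (?w u powr (- (3/2)) * G u) * ((r powr (m - 1) * r) * indicator {0..?q} r)" by simp
            then have "ennreal (?c * r powr (m - 1)) * ennreal (G u * indicator {0..?q} r * (r * ?w u powr (- (3/2))))
              = ennreal (?c * (?w u powr (- (3/2)) * G u) * (r powr m * indicator {0..?q} r))"
              using c Gnn True by (simp add: ennreal_mult[symmetric] rm)
            also have "\<dots> = ennreal (?c * (?w u powr (- (3/2)) * G u)) * (ennreal (r powr m) * indicator {0..?q} r)"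
              using c Gnn by (simp add: ennreal_mult ennreal_indicator)
            finally show ?thesis using u unfolding f by simp
          qed simp
        qed
        finally show ?thesis .
      qed
    qed
  qed
  also have "\<dots> = (\<integral>\<^sup>+u. \<integral>\<^sup>+r. ennreal (?c * (?w u powr (- (3/2)) * G u)) * (ennreal (r powr m) * indicator {0..sqrt (?w u)} r)
       * indicator {-1<..<1} u \<partial>lborel \<partial>lborel)"
  proof (rule lborel_pair.Fubini')
    have "(\<lambda>x. indicator {0..sqrt (?w (fst x))} (snd x) :: ennreal) \<in> borel_measurable (lborel \<Otimes>\<^sub>M lborel)"
      unfolding indicator_def atLeastAtMost_iff by measurable
    moreover have "(\<lambda>x. indicator {0..sqrt (?w (snd x))} (fst x) :: ennreal) \<in> borel_measurable (lborel \<Otimes>\<^sub>M lborel)"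
      unfolding indicator_def atLeastAtMost_iff by measurable
    ultimately show "(\<lambda>(u, r). ennreal (?c * (?w u powr (- (3/2)) * G u)) * (ennreal (r powr m) * indicator {0..sqrt (?w u)} r)
       * indicator {-1<..<1} u) \<in> borel_measurable (lborel \<Otimes>\<^sub>M lborel)"
      unfolding split_beta by measurable
  qed
  also have "\<dots> = (\<integral>\<^sup>+u. ennreal (?c / (m + 1)) * (ennreal (?w u powr ((m - 2) / 2) * G u) * indicator {-1..1} u) \<partial>lborel)"
  proof (rule nn_integral_cong_AE)
    have "AE u in lborel. u \<noteq> -1 \<and> u \<noteq> (1::real)" using AE_lborel_singleton[of 1] AE_lborel_singleton[of "-1"] by auto
    then show "AE u in lborel. (\<integral>\<^sup>+r. ennreal (?c * (?w u powr (- (3/2)) * G u)) * (ennreal (r powr m) * indicator {0..sqrt (?w u)} r)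
       * indicator {-1<..<1} u \<partial>lborel) = ennreal (?c / (m + 1)) * (ennreal (?w u powr ((m - 2) / 2) * G u) * indicator {-1..1} u)"
    proof eventually_elim
      case (elim u)
      show ?case
      proof (cases "u \<in> {-1<..<1}")
        case u: True
        then have w: "0 < ?w u" by (simp add: abs_square_less_1 abs_less_iff)
        have "(\<integral>\<^sup>+r. ennreal (?c * (?w u powr (- (3/2)) * G u)) * (ennreal (r powr m) * indicator {0..sqrt (?w u)} r)
           * indicator {-1<..<1} u \<partial>lborel)
          = ennreal (?c * (?w u powr (- (3/2)) * G u)) * (\<integral>\<^sup>+r\<in>{0..sqrt (?w u)}. ennreal (r powr m) \<partial>lborel)"
          using u by (simp add: nn_integral_cmult)
        also have "(\<integral>\<^sup>+r\<in>{0..sqrt (?w u)}. ennreal (r powr m) \<partial>lborel) = ennreal (sqrt (?w u) powr (m + 1) / (m + 1))"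
          using m w by (intro nn_integral_powr_0) auto
        also have "sqrt (?w u) powr (m + 1) = ?w u powr ((m + 1) / 2)"
          using w by (simp add: powr_half_sqrt[symmetric] powr_powr)
        also have "ennreal (?c * (?w u powr (- (3/2)) * G u)) * ennreal (?w u powr ((m + 1) / 2) / (m + 1))
          = ennreal (?c * (?w u powr (- (3/2)) * G u) * (?w u powr ((m + 1) / 2) / (m + 1)))"
          using c Gnn m by (intro ennreal_mult[symmetric]) auto
        also have "?c * (?w u powr (- (3/2)) * G u) * (?w u powr ((m + 1) / 2) / (m + 1))
          = ?c / (m + 1) * ((?w u powr (- (3/2)) * ?w u powr ((m + 1) / 2)) * G u)" by simp
        also have "?w u powr (- (3/2)) * ?w u powr ((m + 1) / 2) = ?w u powr ((m - 2) / 2)"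
        proof -
          have "- (3/2) + (m + 1) / 2 = (m - 2) / 2" by (simp add: field_simps)
          then show ?thesis unfolding powr_add[symmetric] by (simp only:)
        qed
        also have "ennreal (?c / (m + 1) * (?w u powr ((m - 2) / 2) * G u))
           = ennreal (?c / (m + 1)) * (ennreal (?w u powr ((m - 2) / 2) * G u) * indicator {-1..1} u)"
          using c Gnn m u by (subst ennreal_mult) auto
        finally show ?thesis .
      next
        case False
        then have "u \<notin> {-1..1}" "u \<notin> {-1<..<1}" using elim by auto
        then show ?thesis by simp
      qed
    qed
  qed
  also have "\<dots> = ennreal (?c / (m + 1)) * (\<integral>\<^sup>+u\<in>{-1..1}. ennreal (?w u powr ((m - 2) / 2) * G u) \<partial>lborel)"
    by (rule nn_integral_cmult) measurable
  finally show ?thesis .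
qed

section \<open>Integration against vector measures\<close>

text \<open>The identity \<open>A - B' = A' - B\<close> of signed measures, with the terms moved so
  that every summand is nonnegative. Monotone limits can then be taken in \<open>ennreal\<close>,
  infinite values included.\<close>

lemma nn_integral_sum_measures_eq:
  fixes F :: "'a::topological_space \<Rightarrow> ennreal"
  assumes s: "sets A = sets borel" "sets B = sets borel" "sets A' = sets borel" "sets B' = sets borel"
    and eq: "\<And>X. X \<in> sets borel \<Longrightarrow> emeasure A X + emeasure B X = emeasure A' X + emeasure B' X"
    and F: "F \<in> borel_measurable borel"
  shows "(\<integral>\<^sup>+x. F x \<partial>A) + (\<integral>\<^sup>+x. F x \<partial>B) = (\<integral>\<^sup>+x. F x \<partial>A') + (\<integral>\<^sup>+x. F x \<partial>B')"
  using F
proof (induction rule: borel_measurable_induct)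
  case (cong f g)
  then show ?case by (simp cong: nn_integral_cong)
next
  case (set X)
  then show ?case using eq[OF set] s by simp
next
  case (mult u c)
  have m: "u \<in> borel_measurable M" if "sets M = sets borel" for M
    using mult(2) by (simp add: measurable_cong_sets[OF that refl])
  show ?case using mult.IH by (simp add: nn_integral_cmult m s distrib_left[symmetric])
next
  case (add u v)
  have m: "u \<in> borel_measurable M" "v \<in> borel_measurable M" if "sets M = sets borel" for M
    using add.hyps(1,3) by (simp_all add: measurable_cong_sets[OF that refl])
  have ac: "(a + b) + (c + d) = (a + c) + (b + d)" for a b c d :: ennreal by (simp add: ac_simps)
  show ?case using add.IH by (simp add: nn_integral_add m s) (metis ac)
next
  case (seq U)
  have m: "U i \<in> borel_measurable M" if "sets M = sets borel" for M i
    using seq(1) by (simp add: measurable_cong_sets[OF that refl])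
  have i: "(\<integral>\<^sup>+x. (SUP i. U i) x \<partial>M) = (SUP i. \<integral>\<^sup>+x. U i x \<partial>M)" if "sets M = sets borel" for M
    unfolding SUP_apply by (rule nn_integral_monotone_convergence_SUP[OF seq(3) m[OF that]])
  have inc: "incseq (\<lambda>i. \<integral>\<^sup>+x. U i x \<partial>M)" for M
    using seq(3) by (auto simp: incseq_def le_fun_def intro!: nn_integral_mono)
  show ?case unfolding i[OF s(1)] i[OF s(2)] i[OF s(3)] i[OF s(4)]
    by (simp add: ennreal_SUP_add[OF inc inc, symmetric] seq.IH)
qed

lemma bounded_borel_integrable:
  fixes g :: "'a::topological_space \<Rightarrow> 'b::{banach, second_countable_topology}"
  assumes "finite_measure A" "sets A = sets borel" "g \<in> borel_measurable borel" "\<And>x. norm (g x) \<le> K"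
  shows "integrable A g"
proof -
  interpret A: finite_measure A by fact
  show ?thesis
    by (rule A.integrable_const_bound[of _ K])
       (use assms in \<open>auto simp: measurable_cong_sets[OF assms(2) refl]\<close>)
qed

text \<open>The Jordan parts U, V satisfy U + N = P + V as measures, so integrals of bounded
  nonnegative functions agree accordingly, and \<open>g\<close> splits into its positive and
  negative part. This links the measures from the Riesz theorem with
  \<open>signed_integral\<close>.\<close>

lemma signed_integral_eqI:
  fixes m :: "'a::topological_space set \<Rightarrow> real"
  assumes m: "vector_measure m"
    and P: "finite_measure P" "sets P = sets borel" and N: "finite_measure N" "sets N = sets borel"
    and eq: "\<And>X. X \<in> sets borel \<Longrightarrow> m X = measure P X - measure N X"
    and g: "g \<in> borel_measurable borel" "\<And>x. \<bar>g x\<bar> \<le> K"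
  shows "signed_integral m g = integral\<^sup>L P g - integral\<^sup>L N g"
proof -
  let ?U = "upper_variation m" and ?V = "upper_variation (\<lambda>X. - m X)"
  have U: "finite_measure ?U" by (rule finite_measure_upper_variation[OF m])
  have V: "finite_measure ?V" by (rule finite_measure_upper_variation[OF vector_measure_uminus[OF m]])
  interpret P: finite_measure P by fact
  interpret N: finite_measure N by fact
  interpret U: finite_measure ?U by fact
  interpret V: finite_measure ?V by fact
  have em: "emeasure ?U X + emeasure N X = emeasure P X + emeasure ?V X" if X: "X \<in> sets borel" for X
    using Jordan_decomposition[OF m X] eq[OF X]
    by (simp add: U.emeasure_eq_measure V.emeasure_eq_measure P.emeasure_eq_measure N.emeasure_eq_measure
        ennreal_plus[symmetric] del: ennreal_plus)
  have I: "integral\<^sup>L ?U h + integral\<^sup>L N h = integral\<^sup>L P h + integral\<^sup>L ?V h"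
    if h: "h \<in> borel_measurable borel" "\<And>x. 0 \<le> h x" "\<And>x. h x \<le> K'" for h :: "'a \<Rightarrow> real" and K'
  proof -
    have int: "integrable M h" if "finite_measure M" "sets M = sets borel" for M
      by (rule bounded_borel_integrable[OF that h(1), of K']) (use h in auto)
    have nn: "(\<integral>\<^sup>+x. ennreal (h x) \<partial>M) = ennreal (integral\<^sup>L M h)" if "finite_measure M" "sets M = sets borel" for M
      using int[OF that] h(2) by (intro nn_integral_eq_integral) auto
    have "(\<integral>\<^sup>+x. ennreal (h x) \<partial>?U) + (\<integral>\<^sup>+x. ennreal (h x) \<partial>N) = (\<integral>\<^sup>+x. ennreal (h x) \<partial>P) + (\<integral>\<^sup>+x. ennreal (h x) \<partial>?V)"
      by (rule nn_integral_sum_measures_eq[OF _ N(2) P(2) _ em]) (use h in auto)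
    moreover have "0 \<le> integral\<^sup>L M h" for M using h(2) by (intro Bochner_Integration.integral_nonneg)
    ultimately show ?thesis
      by (simp add: nn[OF U] nn[OF V] nn[OF P] nn[OF N] ennreal_plus[symmetric] del: ennreal_plus)
  qed
  have int: "integrable M g" if "finite_measure M" "sets M = sets borel" for M
    by (rule bounded_borel_integrable[OF that g(1), of K]) (use g in auto)
  define p n where "p = (\<lambda>x. max 0 (g x))" and "n = (\<lambda>x. max 0 (- g x))"
  have bnd: "0 \<le> p x" "p x \<le> K" "0 \<le> n x" "n x \<le> K" for x
    using g(2)[of x] by (auto simp: p_def n_def)
  have meas: "p \<in> borel_measurable borel" "n \<in> borel_measurable borel"
    unfolding p_def n_def using g(1) by measurable
  have pn: "integral\<^sup>L M g = integral\<^sup>L M p - integral\<^sup>L M n" if "finite_measure M" "sets M = sets borel" for M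
  proof -
    have "integrable M p" "integrable M n"
      using bounded_borel_integrable[OF that meas(1), of K] bounded_borel_integrable[OF that meas(2), of K] bnd by auto
    moreover have "g = (\<lambda>x. p x - n x)" by (auto simp: p_def n_def)
    ultimately show ?thesis by simp
  qed
  show ?thesis
    unfolding signed_integral_def using I[OF meas(1) bnd(1,2)] I[OF meas(2) bnd(3,4)]
    by (simp add: pn U V P N)
qed

lemma vector_measure_from_components:
  fixes P N :: "'n::finite \<Rightarrow> 'a::topological_space measure"
  assumes P: "\<And>i. finite_measure (P i)" "\<And>i. sets (P i) = sets borel"
    and N: "\<And>i. finite_measure (N i)" "\<And>i. sets (N i) = sets borel"
  defines "D \<equiv> (\<lambda>X. \<chi> i. if X \<in> sets borel then measure (P i) X - measure (N i) X else 0)"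
  shows "vector_measure D"
  unfolding vector_measure_def
proof (intro conjI allI impI)
  show "D X = 0" if "X \<notin> sets borel" for X using that by (simp add: D_def vec_eq_iff)
  fix A :: "nat \<Rightarrow> 'a set" assume A: "range A \<subseteq> sets borel \<and> disjoint_family A"
  have "(\<lambda>j. D (A j) $ i) sums (D (\<Union>(range A)) $ i)" for i
  proof -
    interpret Pi: finite_measure "P i" by (rule P)
    interpret Ni: finite_measure "N i" by (rule N)
    have "(\<lambda>j. measure (P i) (A j) - measure (N i) (A j)) sums (measure (P i) (\<Union>(range A)) - measure (N i) (\<Union>(range A)))"
      using A P(2) N(2) by (intro sums_diff Pi.finite_measure_UNION Ni.finite_measure_UNION) auto
    moreover have "A j \<in> sets borel" for j using A by auto
    moreover from this have "\<Union>(range A) \<in> sets borel" by auto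
    ultimately show ?thesis by (simp add: D_def)
  qed
  then show "(\<lambda>j. D (A j)) sums D (\<Union>(range A))"
    unfolding sums_def by (intro vec_tendstoI) (simp add: sum_component)
qed

lemma signed_integral_tendsto:
  fixes m :: "'a::topological_space set \<Rightarrow> real"
  assumes m: "vector_measure m"
    and meas: "\<And>k::nat. u k \<in> borel_measurable borel" "u' \<in> borel_measurable borel"
    and lim: "\<And>x. (\<lambda>k. u k x) \<longlonglongrightarrow> u' x" and bnd: "\<And>k x. \<bar>u k x\<bar> \<le> K"
  shows "(\<lambda>k. signed_integral m (u k)) \<longlonglongrightarrow> signed_integral m u'"
proof -
  have "(\<lambda>k. integral\<^sup>L M (u k)) \<longlonglongrightarrow> integral\<^sup>L M u'" if M: "finite_measure M" "sets M = sets borel" for M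
  proof (rule integral_dominated_convergence)
    interpret finite_measure M by fact
    show "integrable M (\<lambda>x. K)" by simp
  qed (use meas lim bnd in \<open>auto simp: measurable_cong_sets[OF M(2) refl]\<close>)
  then show ?thesis
    unfolding signed_integral_def
    using finite_measure_upper_variation[OF m] finite_measure_upper_variation[OF vector_measure_uminus[OF m]]
    by (intro tendsto_diff) auto
qed

lemma vector_integral_tendsto:
  fixes D :: "'a::topological_space set \<Rightarrow> real^'n"
  assumes D: "vector_measure D"
    and meas: "\<And>k::nat. u k \<in> borel_measurable borel" "u' \<in> borel_measurable borel"
    and lim: "\<And>x. (\<lambda>k. u k x) \<longlonglongrightarrow> u' x" and bnd: "\<And>k x. norm (u k x) \<le> K"
  shows "(\<lambda>k. vector_integral D (u k)) \<longlonglongrightarrow> vector_integral D u'"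
  unfolding vector_integral_def
proof (intro tendsto_sum signed_integral_tendsto vector_measure_nth D)
  fix i :: 'n
  have nth: "(\<lambda>v::real^'n. v $ i) \<in> borel_measurable borel"
    by (intro borel_measurable_continuous_onI continuous_intros)
  show "(\<lambda>x. u k x $ i) \<in> borel_measurable borel" for k using measurable_compose[OF meas(1) nth] .
  show "(\<lambda>x. u' x $ i) \<in> borel_measurable borel" using measurable_compose[OF meas(2) nth] .
  show "(\<lambda>k. u k x $ i) \<longlonglongrightarrow> u' x $ i" for x using lim by (intro tendsto_vec_nth)
  show "\<bar>u k x $ i\<bar> \<le> K" for k x using bnd[of k x] component_le_norm_cart[of "u k x" i] by linarith
qed

lemma vector_integral_indicator:
  fixes D :: "'a::topological_space set \<Rightarrow> real^'n"
  assumes D: "vector_measure D" and H: "H \<in> sets borel"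
  shows "vector_integral D (\<lambda>x. indicator H x *\<^sub>R v) = v \<bullet> D H"
proof -
  have "signed_integral (\<lambda>X. D X $ i) (\<lambda>x. (indicator H x *\<^sub>R v) $ i) = v $ i * D H $ i" for i
    unfolding signed_integral_def Jordan_decomposition[OF vector_measure_nth[OF D] H, of i] using H
    by (simp add: right_diff_distrib mult.commute)
  then show ?thesis by (simp add: vector_integral_def inner_vec_def)
qed

section \<open>The fractional divergence\<close>

lemma DIM_real_vec: "DIM(real^'n) = CARD('n)"
  by simp

lemma frac_const_pos:
  assumes "0 < \<alpha>" "\<alpha> < 1" shows "0 < frac_const n \<alpha>"
proof -
  have "0 < Gamma ((real n + \<alpha> + 1) / 2)" "0 < Gamma ((1 - \<alpha>) / 2)"
    using assms by (auto intro!: Gamma_real_pos divide_pos_pos add_nonneg_pos)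
  then show ?thesis unfolding frac_const_def by simp
qed

text \<open>Here \<open>w\<close> stands for an increment of the field. By Cauchy-Schwarz the inner
  product contributes a factor \<open>norm z\<close>, which lowers the exponent of the denominator
  to n + \<alpha>.\<close>

lemma frac_integrand_bound:
  fixes z w :: "real^'n"
  assumes e: "0 < e" and w: "norm w \<le> B * min 1 (norm z / e)"
  shows "\<bar>(z \<bullet> w) / norm z powr (real CARD('n) + \<alpha> + 1)\<bar> \<le> B * riesz_kernel \<alpha> e z"
proof (cases "z = 0")
  case False
  then have z: "0 < norm z" by simp
  have "norm z powr (real CARD('n) + \<alpha> + 1) = norm z powr (real CARD('n) + \<alpha>) * norm z"
    using z by (simp add: powr_add)
  then have "\<bar>(z \<bullet> w) / norm z powr (real CARD('n) + \<alpha> + 1)\<bar> = \<bar>z \<bullet> w\<bar> / (norm z powr (real CARD('n) + \<alpha>) * norm z)"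
    by (simp add: abs_mult)
  also have "\<dots> \<le> (norm z * norm w) / (norm z powr (real CARD('n) + \<alpha>) * norm z)"
    by (intro divide_right_mono Cauchy_Schwarz_ineq2) simp
  also have "\<dots> = norm w / norm z powr (real CARD('n) + \<alpha>)" using z by simp
  also have "\<dots> \<le> (B * min 1 (norm z / e)) / norm z powr (real CARD('n) + \<alpha>)"
    using w by (intro divide_right_mono) auto
  finally show ?thesis by (simp add: riesz_kernel_def)
qed (simp add: riesz_kernel_def)

definition kernel_mass :: "nat \<Rightarrow> real \<Rightarrow> real" where
  "kernel_mass n \<alpha> = unit_ball_vol (real n) * real n * (1 / (1 - \<alpha>) + 1 / \<alpha>)"

lemma riesz_kernel_shifted:
  fixes x :: "real^'n"
  assumes "0 < \<alpha>" "\<alpha> < 1" "0 < e"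
  shows "integrable lborel (\<lambda>y. riesz_kernel \<alpha> e (y - x))"
    and "(LINT y|lborel. riesz_kernel \<alpha> e (y - x)) = kernel_mass CARD('n) \<alpha> * e powr (- \<alpha>)"
proof -
  have [measurable]: "riesz_kernel \<alpha> e \<in> borel_measurable (borel :: (real^'n) measure)" by measurable
  have eq: "(\<lambda>y. riesz_kernel \<alpha> e (y - x)) = (\<lambda>y. riesz_kernel \<alpha> e (- x + y))" by simp
  have nn: "0 \<le> riesz_kernel \<alpha> e z" for z :: "real^'n" using assms riesz_kernel_nonneg by blast
  have "(\<integral>\<^sup>+y. ennreal (riesz_kernel \<alpha> e (- x + y)) \<partial>lborel) = (\<integral>\<^sup>+y. ennreal (riesz_kernel \<alpha> e (y::real^'n)) \<partial>lborel)"
    by (rule nn_integral_lborel_shift[of "\<lambda>y. ennreal (riesz_kernel \<alpha> e y)" "- x"]) measurable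
  also have "\<dots> < \<infinity>" using nn_integral_riesz_kernel[OF assms, where 'a = "real^'n"] by simp
  finally show "integrable lborel (\<lambda>y. riesz_kernel \<alpha> e (y - x))"
    unfolding eq using nn by (intro integrableI_bounded) auto
  show "(LINT y|lborel. riesz_kernel \<alpha> e (y - x)) = kernel_mass CARD('n) \<alpha> * e powr (- \<alpha>)"
    unfolding eq using lborel_integral_shift[of "riesz_kernel \<alpha> e" "- x"] integrable_riesz_kernel(2)[OF assms, where 'a = "real^'n"]
    by (simp add: kernel_mass_def)
qed

abbreviation frac_integrand :: "real \<Rightarrow> (real^'n \<Rightarrow> real^'n) \<Rightarrow> real^'n \<Rightarrow> real^'n \<Rightarrow> real" where
  "frac_integrand \<alpha> \<phi> x y \<equiv> ((y - x) \<bullet> (\<phi> y - \<phi> x)) / norm (y - x) powr (real CARD('n) + \<alpha> + 1)"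

text \<open>The division by 1 displays the scale \<open>e\<close> of the kernel estimates: bounded
  Lipschitz fields are regular at scale 1, uniformly in \<open>x\<close>.\<close>

lemma lipschitz_diff_bound:
  fixes \<phi> :: "real^'n \<Rightarrow> 'b::real_normed_vector"
  assumes "L-lipschitz_on UNIV \<phi>" "\<And>x. norm (\<phi> x) \<le> M"
  shows "norm (\<phi> y - \<phi> x) \<le> (max (2 * M) L) * min 1 (norm (y - x) / 1)"
proof -
  have L: "norm (\<phi> y - \<phi> x) \<le> L * norm (y - x)" using lipschitz_onD[OF assms(1), of y x] by (simp add: dist_norm)
  have "norm (\<phi> y - \<phi> x) \<le> 2 * M"
    using norm_triangle_ineq4[of "\<phi> y" "\<phi> x"] assms(2)[of x] assms(2)[of y] by linarith
  moreover have "L * norm (y - x) \<le> max (2 * M) L * norm (y - x)" by (intro mult_right_mono) auto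
  ultimately have m: "norm (\<phi> y - \<phi> x) \<le> max (2 * M) L" "norm (\<phi> y - \<phi> x) \<le> max (2 * M) L * norm (y - x)"
    using L by linarith+
  then show ?thesis
  proof (cases "1 \<le> norm (y - x)")
    case True
    then have "min 1 (norm (y - x) / 1) = 1" by simp
    then show ?thesis using m(1) by (simp only: mult_1_right)
  next
    case False
    then have "min 1 (norm (y - x) / 1) = norm (y - x)" by simp
    then show ?thesis using m(2) by (simp only:)
  qed
qed

locale fractional_order =
  fixes \<alpha> :: real
  assumes \<alpha>: "0 < \<alpha>" "\<alpha> < 1"
begin

lemma frac_div_lborel:
  fixes \<phi> :: "real^'n \<Rightarrow> real^'n"
  assumes [measurable]: "\<phi> \<in> borel_measurable borel"
  shows "frac_div \<alpha> \<phi> x = frac_const CARD('n) \<alpha> * (LINT y|lborel. frac_integrand \<alpha> \<phi> x y)"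
  unfolding frac_div_def by (subst integral_completion) simp_all

lemma frac_integrand_integrable:
  fixes \<phi> :: "real^'n \<Rightarrow> real^'n"
  assumes [measurable]: "\<phi> \<in> borel_measurable borel" and e: "0 < e"
    and bnd: "\<And>y. norm (\<phi> y - \<phi> x) \<le> B * min 1 (norm (y - x) / e)"
  shows "integrable lborel (frac_integrand \<alpha> \<phi> x)"
proof (rule Bochner_Integration.integrable_bound)
  show "integrable lborel (\<lambda>y. B * riesz_kernel \<alpha> e (y - x))"
    using riesz_kernel_shifted(1)[OF \<alpha> e, of x] by simp
  show "AE y in lborel. norm (frac_integrand \<alpha> \<phi> x y) \<le> norm (B * riesz_kernel \<alpha> e (y - x))"
    using frac_integrand_bound[OF e bnd] by (auto intro!: AE_I2 order_trans[OF _ abs_ge_self])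
qed measurable

text \<open>The hypothesis concerns a single point \<open>x\<close>, so the scale \<open>e\<close>
  may depend on it. For the ramps it will be half the distance to the hyperplane, and
  \<open>e powr (- \<alpha>)\<close> becomes the dominating function.\<close>

lemma frac_div_bound:
  fixes \<phi> :: "real^'n \<Rightarrow> real^'n"
  assumes \<phi>[measurable]: "\<phi> \<in> borel_measurable borel" and e: "0 < e"
    and bnd: "\<And>y. norm (\<phi> y - \<phi> x) \<le> B * min 1 (norm (y - x) / e)"
  shows "\<bar>frac_div \<alpha> \<phi> x\<bar> \<le> frac_const CARD('n) \<alpha> * (B * (kernel_mass CARD('n) \<alpha> * e powr (- \<alpha>)))"
proof -
  have "\<bar>LINT y|lborel. frac_integrand \<alpha> \<phi> x y\<bar> \<le> (LINT y|lborel. \<bar>frac_integrand \<alpha> \<phi> x y\<bar>)"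
    using integral_norm_bound[of lborel "frac_integrand \<alpha> \<phi> x"] by simp
  also have "\<dots> \<le> (LINT y|lborel. B * riesz_kernel \<alpha> e (y - x))"
    using frac_integrand_integrable[OF \<phi> e bnd] riesz_kernel_shifted(1)[OF \<alpha> e, of x] frac_integrand_bound[OF e bnd]
    by (intro integral_mono integrable_abs) auto
  also have "\<dots> = B * (kernel_mass CARD('n) \<alpha> * e powr (- \<alpha>))"
    using riesz_kernel_shifted(2)[OF \<alpha> e, of x] by simp
  finally show ?thesis
    using frac_const_pos[OF \<alpha>, of "CARD('n)"] by (simp add: frac_div_lborel abs_mult mult_left_mono)
qed

lemma frac_div_tendsto:
  fixes u :: "nat \<Rightarrow> real^'n \<Rightarrow> real^'n"
  assumes [measurable]: "\<And>k. u k \<in> borel_measurable borel" "u' \<in> borel_measurable borel" and e: "0 < e"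
    and bnd: "\<And>k y. norm (u k y - u k x) \<le> B * min 1 (norm (y - x) / e)"
    and lim: "\<And>y. (\<lambda>k. u k y) \<longlonglongrightarrow> u' y"
  shows "(\<lambda>k. frac_div \<alpha> (u k) x) \<longlonglongrightarrow> frac_div \<alpha> u' x"
proof -
  have "(\<lambda>k. LINT y|lborel. frac_integrand \<alpha> (u k) x y) \<longlonglongrightarrow> (LINT y|lborel. frac_integrand \<alpha> u' x y)"
  proof (rule integral_dominated_convergence)
    show "integrable lborel (\<lambda>y. B * riesz_kernel \<alpha> e (y - x))"
      using riesz_kernel_shifted(1)[OF \<alpha> e, of x] by simp
    show "AE y in lborel. norm (frac_integrand \<alpha> (u k) x y) \<le> B * riesz_kernel \<alpha> e (y - x)" for k
      using frac_integrand_bound[OF e bnd] by auto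
    show "AE y in lborel. (\<lambda>k. frac_integrand \<alpha> (u k) x y) \<longlonglongrightarrow> frac_integrand \<alpha> u' x y"
    proof (rule AE_I2)
      fix y show "(\<lambda>k. frac_integrand \<alpha> (u k) x y) \<longlonglongrightarrow> frac_integrand \<alpha> u' x y"
        unfolding divide_inverse by (intro tendsto_mult tendsto_inner tendsto_diff tendsto_const lim)
    qed
  qed measurable
  then show ?thesis by (simp add: frac_div_lborel tendsto_mult_left)
qed

lemma borel_measurable_frac_div:
  fixes \<phi> :: "real^'n \<Rightarrow> real^'n"
  assumes [measurable]: "\<phi> \<in> borel_measurable borel"
  shows "frac_div \<alpha> \<phi> \<in> borel_measurable borel"
proof -
  have "(\<lambda>x. LINT y|lborel. frac_integrand \<alpha> \<phi> x y) \<in> borel_measurable borel"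
    by (rule lborel.borel_measurable_lebesgue_integral) measurable
  then have "(\<lambda>x. frac_const CARD('n) \<alpha> * (LINT y|lborel. frac_integrand \<alpha> \<phi> x y)) \<in> borel_measurable borel"
    by measurable
  moreover have "frac_div \<alpha> \<phi> = (\<lambda>x. frac_const CARD('n) \<alpha> * (LINT y|lborel. frac_integrand \<alpha> \<phi> x y))"
    using frac_div_lborel[OF assms] by (rule ext)
  ultimately show ?thesis by (simp only:)
qed

lemma frac_div_add:
  fixes \<phi> \<psi> :: "real^'n \<Rightarrow> real^'n"
  assumes \<phi>: "\<phi> \<in> borel_measurable borel" "\<psi> \<in> borel_measurable borel" and e: "0 < e"
    and bnd: "\<And>y. norm (\<phi> y - \<phi> x) \<le> B * min 1 (norm (y - x) / e)" "\<And>y. norm (\<psi> y - \<psi> x) \<le> B' * min 1 (norm (y - x) / e)"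
  shows "frac_div \<alpha> (\<lambda>y. \<phi> y + \<psi> y) x = frac_div \<alpha> \<phi> x + frac_div \<alpha> \<psi> x"
proof -
  have "frac_integrand \<alpha> (\<lambda>y. \<phi> y + \<psi> y) x = (\<lambda>y. frac_integrand \<alpha> \<phi> x y + frac_integrand \<alpha> \<psi> x y)"
    by (simp add: inner_add_right inner_diff_right add_divide_distrib diff_divide_distrib fun_eq_iff)
  moreover have "(LINT y|lborel. frac_integrand \<alpha> \<phi> x y + frac_integrand \<alpha> \<psi> x y)
      = (LINT y|lborel. frac_integrand \<alpha> \<phi> x y) + (LINT y|lborel. frac_integrand \<alpha> \<psi> x y)"
    by (intro Bochner_Integration.integral_add frac_integrand_integrable[OF _ e bnd(1)] frac_integrand_integrable[OF _ e bnd(2)] \<phi>)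
  moreover have "(\<lambda>y. \<phi> y + \<psi> y) \<in> borel_measurable borel" using \<phi> by measurable
  ultimately show ?thesis using \<phi> by (simp add: frac_div_lborel distrib_left)
qed

lemma frac_div_scaleR:
  fixes \<phi> :: "real^'n \<Rightarrow> real^'n"
  assumes \<phi>[measurable]: "\<phi> \<in> borel_measurable borel"
  shows "frac_div \<alpha> (\<lambda>y. c *\<^sub>R \<phi> y) x = c * frac_div \<alpha> \<phi> x"
proof -
  have "frac_integrand \<alpha> (\<lambda>y. c *\<^sub>R \<phi> y) x = (\<lambda>y. c * frac_integrand \<alpha> \<phi> x y)"
    by (simp add: scaleR_diff_right[symmetric])
  then have "(LINT y|lborel. frac_integrand \<alpha> (\<lambda>y. c *\<^sub>R \<phi> y) x y) = c * (LINT y|lborel. frac_integrand \<alpha> \<phi> x y)"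
    by (simp only: integral_mult_right_zero)
  moreover have "(\<lambda>y. c *\<^sub>R \<phi> y) \<in> borel_measurable borel" by measurable
  ultimately show ?thesis by (simp only: frac_div_lborel \<phi> mult.left_commute)
qed

lemma frac_div_scaleR_vector:
  fixes f :: "real^'n \<Rightarrow> real"
  assumes [measurable]: "f \<in> borel_measurable borel" and e: "0 < e"
    and bnd: "\<And>y. \<bar>f y - f x\<bar> \<le> B * min 1 (norm (y - x) / e)"
  shows "frac_div \<alpha> (\<lambda>y. f y *\<^sub>R v) x = v \<bullet> frac_grad \<alpha> f x"
proof -
  let ?p = "real CARD('n) + \<alpha> + 1"
  let ?W = "\<lambda>y. ((f y - f x) / norm (y - x) powr ?p) *\<^sub>R (y - x)"
  have intW: "integrable lborel ?W"
  proof (rule Bochner_Integration.integrable_bound)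
    show "integrable lborel (\<lambda>y. B * riesz_kernel \<alpha> e (y - x))"
      using riesz_kernel_shifted(1)[OF \<alpha> e, of x] by simp
    show "AE y in lborel. norm (?W y) \<le> norm (B * riesz_kernel \<alpha> e (y - x))"
    proof (rule AE_I2)
      fix y
      show "norm (?W y) \<le> norm (B * riesz_kernel \<alpha> e (y - x))"
      proof (cases "y = x")
        case False
        \<comment> \<open>A vector parallel to \<open>y - x\<close> of length
          \<open>\<bar>f y - f x\<bar>\<close>: for it Cauchy-Schwarz is an equality, so the bound
          for the scalar integrand becomes one for the norm of the vector integrand.\<close>
        define w where "w = (f y - f x) *\<^sub>R ((y - x) /\<^sub>R norm (y - x))"
        have "norm w \<le> B * min 1 (norm (y - x) / e)" using bnd[of y] False by (simp add: w_def abs_mult mult.assoc)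
        from frac_integrand_bound[OF e this, of \<alpha>]
        have "\<bar>((y - x) \<bullet> w) / norm (y - x) powr ?p\<bar> \<le> B * riesz_kernel \<alpha> e (y - x)" .
        moreover have "(y - x) \<bullet> w = (f y - f x) * norm (y - x)"
          using False by (simp add: w_def power2_norm_eq_inner[symmetric] power2_eq_square)
        ultimately have "norm (?W y) \<le> B * riesz_kernel \<alpha> e (y - x)" by (simp add: abs_mult)
        also have "\<dots> \<le> norm (B * riesz_kernel \<alpha> e (y - x))" by simp
        finally show ?thesis .
      qed simp
    qed
  qed measurable
  have "(LINT y|lborel. frac_integrand \<alpha> (\<lambda>y. f y *\<^sub>R v) x y) = (LINT y|lborel. v \<bullet> ?W y)"
    by (intro Bochner_Integration.integral_cong) (simp_all add: scaleR_diff_left[symmetric] inner_commute)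
  also have "\<dots> = v \<bullet> (LINT y|lborel. ?W y)"
    using intW by (rule integral_inner_right)
  finally have "frac_div \<alpha> (\<lambda>y. f y *\<^sub>R v) x = frac_const CARD('n) \<alpha> * (v \<bullet> (LINT y|lborel. ?W y))"
    by (subst frac_div_lborel) auto
  also have "(LINT y|lborel. ?W y) = (LINT y|lebesgue. ?W y)"
    by (rule integral_completion[symmetric]) measurable
  finally show ?thesis by (simp add: frac_grad_def)
qed

end

subsection \<open>Existence of the fractional variation measure\<close>

locale fractional_order_set = fractional_order +
  fixes E :: "(real^'n) set"
  assumes E: "E \<in> sets lebesgue" and E_int: "integrable lebesgue (indicator E :: real^'n \<Rightarrow> real)"
begin

definition pairing :: "(real^'n \<Rightarrow> real^'n) \<Rightarrow> real" where
  "pairing \<phi> = (LINT x|lebesgue. indicator E x * frac_div \<alpha> \<phi> x)"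

lemma pairing_integrable:
  assumes \<phi>: "\<phi> \<in> borel_measurable borel" and e: "0 < e"
    and bnd: "\<And>x y. norm (\<phi> y - \<phi> x) \<le> B * min 1 (norm (y - x) / e)"
  shows "integrable lebesgue (\<lambda>x. indicator E x * frac_div \<alpha> \<phi> x)"
proof -
  have [measurable]: "frac_div \<alpha> \<phi> \<in> borel_measurable lebesgue"
    using borel_measurable_frac_div[OF \<phi>] by (intro measurable_completion) simp
  let ?K = "frac_const CARD('n) \<alpha> * (B * (kernel_mass CARD('n) \<alpha> * e powr (- \<alpha>)))"
  show ?thesis
  proof (rule Bochner_Integration.integrable_bound)
    show "integrable lebesgue (\<lambda>x. ?K * indicator E x)" using E_int by (rule integrable_mult_right)
    show "(\<lambda>x. indicator E x * frac_div \<alpha> \<phi> x) \<in> borel_measurable lebesgue" using E by measurable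
    have "\<bar>frac_div \<alpha> \<phi> x\<bar> \<le> \<bar>?K\<bar>" for x using frac_div_bound[OF \<phi> e bnd, of x] by linarith
    then show "AE x in lebesgue. norm (indicator E x * frac_div \<alpha> \<phi> x) \<le> norm (?K * indicator E x)"
      by (intro AE_I2) (simp add: indicator_def del: abs_mult)
  qed
qed

lemma pairing_tendsto:
  assumes u: "\<And>k. u k \<in> borel_measurable borel" "u' \<in> borel_measurable borel" and e: "0 < e"
    and bnd: "\<And>k x y. norm (u k y - u k x) \<le> B * min 1 (norm (y - x) / e)"
    and lim: "\<And>y. (\<lambda>k. u k y) \<longlonglongrightarrow> u' y"
  shows "(\<lambda>k::nat. pairing (u k)) \<longlonglongrightarrow> pairing u'"
  unfolding pairing_def
proof (rule integral_dominated_convergence)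
  let ?K = "frac_const CARD('n) \<alpha> * (B * (kernel_mass CARD('n) \<alpha> * e powr (- \<alpha>)))"
  have [measurable]: "frac_div \<alpha> (u k) \<in> borel_measurable lebesgue" "frac_div \<alpha> u' \<in> borel_measurable lebesgue" for k
    using borel_measurable_frac_div[OF u(1)] borel_measurable_frac_div[OF u(2)] by (auto intro!: measurable_completion)
  show "(\<lambda>x. indicator E x * frac_div \<alpha> (u k) x) \<in> borel_measurable lebesgue" for k using E by measurable
  show "(\<lambda>x. indicator E x * frac_div \<alpha> u' x) \<in> borel_measurable lebesgue" using E by measurable
  show "integrable lebesgue (\<lambda>x. ?K * indicator E x)" using E_int by (rule integrable_mult_right)
  show "AE x in lebesgue. norm (indicator E x * frac_div \<alpha> (u k) x) \<le> ?K * indicator E x" for k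
    using frac_div_bound[OF u(1) e bnd] by (auto intro!: AE_I2 simp: indicator_def)
  show "AE x in lebesgue. (\<lambda>k. indicator E x * frac_div \<alpha> (u k) x) \<longlonglongrightarrow> indicator E x * frac_div \<alpha> u' x"
  proof (rule AE_I2)
    fix x show "(\<lambda>k. indicator E x * frac_div \<alpha> (u k) x) \<longlonglongrightarrow> indicator E x * frac_div \<alpha> u' x"
      by (intro tendsto_mult tendsto_const frac_div_tendsto[OF u e bnd lim])
  qed
qed

lemma Lip_c_diff_bound:
  fixes \<phi> :: "real^'n \<Rightarrow> 'b::real_normed_vector"
  assumes "\<phi> \<in> Lip_c"
  obtains B where "\<And>x y. norm (\<phi> y - \<phi> x) \<le> B * min 1 (norm (y - x) / 1)"
  using lipschitz_diff_bound Lip_c_lipschitz[OF assms] Lip_c_bounded[OF assms] by metis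

lemma Lip_c_borel: "\<phi> \<in> Lip_c \<Longrightarrow> \<phi> \<in> borel_measurable borel" for \<phi> :: "real^'n \<Rightarrow> real^'n"
  using Lip_c_continuous by (rule borel_measurable_continuous_onI)

lemma pairing_add:
  assumes "\<phi> \<in> Lip_c" "\<psi> \<in> Lip_c"
  shows "pairing (\<lambda>x. \<phi> x + \<psi> x) = pairing \<phi> + pairing \<psi>"
proof -
  obtain B where B: "\<And>x y. norm (\<phi> y - \<phi> x) \<le> B * min 1 (norm (y - x) / 1)" using Lip_c_diff_bound[OF assms(1)] by blast
  obtain B' where B': "\<And>x y. norm (\<psi> y - \<psi> x) \<le> B' * min 1 (norm (y - x) / 1)" using Lip_c_diff_bound[OF assms(2)] by blast
  have "frac_div \<alpha> (\<lambda>x. \<phi> x + \<psi> x) x = frac_div \<alpha> \<phi> x + frac_div \<alpha> \<psi> x" for x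
    by (rule frac_div_add[OF _ _ zero_less_one B B']) (auto intro: Lip_c_borel assms)
  then show ?thesis
    unfolding pairing_def distrib_left
    using pairing_integrable[OF Lip_c_borel[OF assms(1)] zero_less_one B] pairing_integrable[OF Lip_c_borel[OF assms(2)] zero_less_one B']
    by simp (simp add: distrib_left)
qed

lemma pairing_scaleR:
  assumes "\<phi> \<in> Lip_c" shows "pairing (\<lambda>x. c *\<^sub>R \<phi> x) = c * pairing \<phi>"
proof -
  have "(\<lambda>x. indicator E x * frac_div \<alpha> (\<lambda>x. c *\<^sub>R \<phi> x) x) = (\<lambda>x. c * (indicator E x * frac_div \<alpha> \<phi> x))"
    using frac_div_scaleR[OF Lip_c_borel[OF assms]] by auto
  then show ?thesis unfolding pairing_def by simp
qed

lemma pairing_sum: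
  assumes "finite I" "\<And>i. i \<in> I \<Longrightarrow> \<phi> i \<in> Lip_c"
  shows "pairing (\<lambda>x. \<Sum>i\<in>I. \<phi> i x) = (\<Sum>i\<in>I. pairing (\<phi> i))"
  using assms
proof (induction I rule: finite_induct)
  case empty
  then show ?case using pairing_scaleR[OF Lip_c_zero, of 0] by simp
next
  case (insert i I)
  then show ?case using pairing_add[of "\<phi> i" "\<lambda>x. \<Sum>i\<in>I. \<phi> i x"] Lip_c_sum[of I \<phi>] by simp
qed

text \<open>Mollification at scale \<open>1 / (k + 1)\<close> keeps the Lipschitz constant and the
  bound 1. The pairings therefore converge by domination, and the bound for smooth fields persists
  in the limit.\<close>

lemma pairing_le:
  assumes C: "\<And>\<psi>. \<psi> \<in> Cinf_c \<Longrightarrow> (\<And>x. norm (\<psi> x) \<le> 1) \<Longrightarrow> pairing \<psi> \<le> C"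
    and \<phi>: "\<phi> \<in> Lip_c" "\<And>x. norm (\<phi> x) \<le> 1"
  shows "pairing \<phi> \<le> C"
proof -
  obtain L where L: "0 \<le> L" "L-lipschitz_on UNIV \<phi>" using Lip_c_lipschitz[OF \<phi>(1)] by blast
  have "\<exists>\<psi>\<in>Cinf_c. L-lipschitz_on UNIV \<psi> \<and> (\<forall>x. norm (\<psi> x) \<le> 1) \<and> (\<forall>x. dist (\<psi> x) (\<phi> x) \<le> L * (1 / real (Suc k)))" for k
    by (rule mollify[OF \<phi>(1) L(2) \<phi>(2)]) simp
  then obtain \<psi> where \<psi>: "\<And>k. \<psi> k \<in> Cinf_c" "\<And>k. L-lipschitz_on UNIV (\<psi> k)" "\<And>k x. norm (\<psi> k x) \<le> 1"
    "\<And>k x. dist (\<psi> k x) (\<phi> x) \<le> L * (1 / real (Suc k))" by metis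
  have m: "\<psi> k \<in> borel_measurable borel" for k
    using lipschitz_on_continuous_on[OF \<psi>(2)] by (rule borel_measurable_continuous_onI)
  have "(\<lambda>k. \<psi> k x) \<longlonglongrightarrow> \<phi> x" for x
  proof -
    have "(\<lambda>k. L * (1 / real (Suc k))) \<longlonglongrightarrow> 0"
      by (intro tendsto_mult_right_zero LIMSEQ_Suc[OF lim_1_over_n])
    then have "(\<lambda>k. dist (\<psi> k x) (\<phi> x)) \<longlonglongrightarrow> 0"
      by (rule Lim_null_comparison[rotated]) (use \<psi>(4) in auto)
    then show ?thesis by (rule tendsto_dist_iff[THEN iffD2])
  qed
  then have "(\<lambda>k. pairing (\<psi> k)) \<longlonglongrightarrow> pairing \<phi>"
    by (rule pairing_tendsto[OF m Lip_c_borel[OF \<phi>(1)] zero_less_one lipschitz_diff_bound[OF \<psi>(2,3)]])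
  then show ?thesis by (rule LIMSEQ_le_const2) (use C[OF \<psi>(1,3)] in blast)
qed

lemma frac_variation_measure_exists:
  assumes C: "\<And>\<psi>. \<psi> \<in> Cinf_c \<Longrightarrow> (\<And>x. norm (\<psi> x) \<le> 1) \<Longrightarrow> pairing \<psi> \<le> C"
  shows "\<exists>D. is_frac_variation_measure \<alpha> (indicator E) D"
proof -
  have ax: "(\<lambda>x. g x *\<^sub>R axis i (1::real)) \<in> Lip_c" if "g \<in> Lip_c" for g :: "real^'n \<Rightarrow> real" and i :: 'n
  proof (rule Lip_c_compose[OF that, where L = 1 and h = "\<lambda>t. t *\<^sub>R axis i (1::real)"])
    show "1-lipschitz_on UNIV (\<lambda>t. t *\<^sub>R axis i (1::real))"
      by (rule lipschitz_onI) (simp_all add: dist_norm scaleR_diff_left[symmetric])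
  qed simp
  \<comment> \<open>One scalar functional for each coordinate direction; the sign is that of the
    integration by parts formula.\<close>
  define L where "L = (\<lambda>i g. - pairing (\<lambda>x. g x *\<^sub>R axis (i::'n) 1))"
  have bf: "bounded_functional (L i) C" for i
  proof
    fix f g :: "real^'n \<Rightarrow> real" assume fg: "f \<in> Lip_c"
    show "L i (\<lambda>x. c * f x) = c * L i f" for c
      using pairing_scaleR[OF ax[OF fg], of c i] by (simp add: L_def)
    show "L i f \<le> C" if "\<And>x. \<bar>f x\<bar> \<le> 1"
    proof -
      have "pairing (\<lambda>x. (-1) *\<^sub>R (f x *\<^sub>R axis i 1)) \<le> C"
        using ax[OF fg] that by (intro pairing_le[OF C] Lip_c_scaleR) auto
      then show ?thesis using pairing_scaleR[OF ax[OF fg], of "-1" i] by (simp add: L_def)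
    qed
    assume g: "g \<in> Lip_c"
    show "L i (\<lambda>x. f x + g x) = L i f + L i g"
      using pairing_add[OF ax[OF fg] ax[OF g], of i i] by (simp add: L_def scaleR_add_left)
  qed
  have "\<exists>P N. finite_measure P \<and> finite_measure N \<and> sets P = sets borel \<and> sets N = sets borel \<and>
     (\<forall>g\<in>Lip_c. L i g = integral\<^sup>L P g - integral\<^sup>L N g)" for i
    by (rule bounded_functional.representation[OF bf])
  then obtain P N where PN: "\<And>i. finite_measure (P i)" "\<And>i. finite_measure (N i)"
    "\<And>i. sets (P i) = sets borel" "\<And>i. sets (N i) = sets borel"
    "\<And>i g. g \<in> Lip_c \<Longrightarrow> L i g = integral\<^sup>L (P i) g - integral\<^sup>L (N i) g" by metis
  define D where "D = (\<lambda>X. \<chi> i. if X \<in> sets borel then measure (P i) X - measure (N i) X else 0)"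
  have D: "vector_measure D" unfolding D_def using PN by (intro vector_measure_from_components)
  have "pairing \<phi> = - vector_integral D \<phi>" if \<phi>: "\<phi> \<in> Lip_c" for \<phi>
  proof -
    have nth: "(\<lambda>x. \<phi> x $ i) \<in> Lip_c" for i
    proof (rule Lip_c_compose[OF \<phi>, where L = 1 and h = "\<lambda>v. v $ i"])
      show "1-lipschitz_on UNIV (\<lambda>v::real^'n. v $ i)"
        by (rule lipschitz_onI) (simp_all add: dist_vec_nth_le)
    qed simp
    obtain K where K: "\<And>x. norm (\<phi> x) \<le> K" using Lip_c_bounded[OF \<phi>] by blast
    have "signed_integral (\<lambda>X. D X $ i) (\<lambda>x. \<phi> x $ i) = L i (\<lambda>x. \<phi> x $ i)" for i
      unfolding PN(5)[OF nth]
    proof (rule signed_integral_eqI[OF vector_measure_nth[OF D] PN(1) PN(3) PN(2) PN(4)])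
      show "D X $ i = measure (P i) X - measure (N i) X" if "X \<in> sets borel" for X using that by (simp add: D_def)
      show "(\<lambda>x. \<phi> x $ i) \<in> borel_measurable borel"
        using Lip_c_continuous[OF nth] by (rule borel_measurable_continuous_onI)
      show "\<bar>\<phi> x $ i\<bar> \<le> K" for x using K[of x] component_le_norm_cart[of "\<phi> x" i] by linarith
    qed
    then have "vector_integral D \<phi> = - (\<Sum>i\<in>UNIV. pairing (\<lambda>x. \<phi> x $ i *\<^sub>R axis i 1))"
      by (simp add: vector_integral_def L_def sum_negf)
    also have "(\<Sum>i\<in>UNIV. pairing (\<lambda>x. \<phi> x $ i *\<^sub>R axis i 1)) = pairing (\<lambda>x. \<Sum>i\<in>UNIV. \<phi> x $ i *\<^sub>R axis i 1)"
      using ax[OF nth] by (intro pairing_sum[symmetric]) auto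
    also have "(\<lambda>x. \<Sum>i\<in>UNIV. \<phi> x $ i *\<^sub>R axis i (1::real)) = \<phi>"
      by (auto simp: vec_eq_iff axis_def if_distrib cong: if_cong)
    finally show ?thesis by simp
  qed
  then show ?thesis using D unfolding is_frac_variation_measure_def pairing_def by blast
qed

end

section \<open>Half-spaces\<close>

lemma open_half_space: "open (half_space \<nu> x\<^sub>0)"
  unfolding half_space_def by (intro open_Collect_less continuous_intros)

lemma indicator_half_space: "indicator (half_space \<nu> x\<^sub>0) x = indicator {0<..} ((x - x\<^sub>0) \<bullet> \<nu>)"
  by (simp add: half_space_def indicator_def)

lemma AE_not_on_hyperplane:
  fixes \<nu> :: "'a::euclidean_space"
  assumes "\<nu> \<noteq> 0"
  shows "AE x in lebesgue. (x - x\<^sub>0) \<bullet> \<nu> \<noteq> c"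
proof -
  have "{x. \<nu> \<bullet> x = c + \<nu> \<bullet> x\<^sub>0} \<in> null_sets lebesgue"
    using negligible_hyperplane[of \<nu> "c + \<nu> \<bullet> x\<^sub>0"] assms by (simp add: negligible_iff_null_sets)
  then show ?thesis
    by (rule AE_not_in[THEN eventually_mono]) (simp add: inner_diff_left inner_commute[of \<nu>] eq_diff_eq diff_eq_eq)
qed

lemma orthogonal_transformation_reflection:
  fixes \<nu> :: "'a::euclidean_space"
  assumes "norm \<nu> = 1"
  shows "orthogonal_transformation (\<lambda>z. (2 * (z \<bullet> \<nu>)) *\<^sub>R \<nu> - z)"
proof -
  have n: "\<nu> \<bullet> \<nu> = 1" using assms by (simp add: norm_eq_sqrt_inner)
  have "linear (\<lambda>z. (2 * (z \<bullet> \<nu>)) *\<^sub>R \<nu> - z)"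
    by (rule linearI) (simp_all add: inner_add_left algebra_simps)
  moreover have "((2 * (v \<bullet> \<nu>)) *\<^sub>R \<nu> - v) \<bullet> ((2 * (w \<bullet> \<nu>)) *\<^sub>R \<nu> - w) = v \<bullet> w" for v w
    using n by (simp add: inner_diff_left inner_diff_right inner_commute[of \<nu> v] inner_commute[of \<nu> w])
  ultimately show ?thesis unfolding orthogonal_transformation_def by blast
qed

context fractional_order
begin

definition half_space_factor :: real where
  "half_space_factor = frac_const 1 \<alpha> / \<alpha>"

lemma half_space_factor_pos: "0 < half_space_factor"
  using frac_const_pos[OF \<alpha>, of 1] \<alpha> by (simp add: half_space_factor_def)

text \<open>The dimension cancels: the powers of pi leave pi^(-1/2), and the Gamma factors
  containing n drop out. The identity Gamma(\<alpha>/2 + 1) = (\<alpha>/2) Gamma(\<alpha>/2)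
  accounts for the division by \<alpha> in the one-dimensional constant.\<close>

lemma half_space_factor_eq:
  "frac_const n \<alpha> * (pi powr ((real n - 1) / 2) * Gamma (\<alpha> / 2) / (2 * Gamma ((real n + \<alpha> + 1) / 2)))
     = half_space_factor"
proof -
  have G: "Gamma ((real n + \<alpha> + 1) / 2) > 0" "Gamma ((1 - \<alpha>) / 2) > 0"
    using \<alpha> by (auto intro!: Gamma_real_pos divide_pos_pos add_nonneg_pos)
  have "\<alpha> / 2 \<notin> \<int>\<^sub>\<le>\<^sub>0" using \<alpha> nonpos_Ints_nonpos[of "\<alpha> / 2"] by auto
  then have G2: "Gamma ((1 + \<alpha> + 1) / 2) = \<alpha> / 2 * Gamma (\<alpha> / 2)"
    using Gamma_plus1[of "\<alpha> / 2"] by (simp add: add_divide_distrib algebra_simps)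
  have "pi powr (- real n / 2) * pi powr ((real n - 1) / 2) = pi powr (- 1 / 2)"
    by (simp add: powr_add[symmetric] diff_divide_distrib)
  then have p: "pi powr (- real n / 2) * (pi powr ((real n - 1) / 2) * c) = pi powr (- 1 / 2) * c" for c
    by (simp only: mult.assoc[symmetric])
  have "frac_const n \<alpha> * (pi powr ((real n - 1) / 2) * Gamma (\<alpha> / 2) / (2 * Gamma ((real n + \<alpha> + 1) / 2)))
     = 2 powr \<alpha> * (pi powr (- real n / 2) * (pi powr ((real n - 1) / 2) * (Gamma (\<alpha> / 2) / (2 * Gamma ((1 - \<alpha>) / 2)))))"
    unfolding frac_const_def using G by simp
  also have "\<dots> = 2 powr \<alpha> * (pi powr (- 1 / 2) * (Gamma (\<alpha> / 2) / (2 * Gamma ((1 - \<alpha>) / 2))))"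
    by (simp only: p)
  also have "\<dots> = half_space_factor"
    unfolding half_space_factor_def frac_const_def of_nat_1 G2 using \<alpha> by simp
  finally show ?thesis .
qed

lemma half_space_kernel:
  fixes \<nu> :: "real^'n"
  assumes \<nu>: "norm \<nu> = 1" and s: "0 < s"
  defines "W \<equiv> \<lambda>z::real^'n. (indicator {s<..} (z \<bullet> \<nu>) / norm z powr (real CARD('n) + \<alpha> + 1)) *\<^sub>R z"
  shows "frac_const CARD('n) \<alpha> *\<^sub>R (LINT z|lborel. W z) = (half_space_factor * s powr (- \<alpha>)) *\<^sub>R \<nu>"
proof -
  let ?p = "real CARD('n) + \<alpha> + 1"
  have n: "\<nu> \<bullet> \<nu> = 1" using \<nu> by (simp add: norm_eq_sqrt_inner)
  have meas[measurable]: "W \<in> borel_measurable borel" unfolding W_def by measurable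
  have int: "integrable lborel W"
  proof (rule Bochner_Integration.integrable_bound)
    \<comment> \<open>Where \<open>W\<close> does not vanish, \<open>norm z\<close> exceeds
      \<open>s\<close>, and there the kernel with \<open>e = s\<close> is exactly the norm of
      \<open>W\<close>.\<close>
    show "integrable lborel (riesz_kernel \<alpha> s :: real^'n \<Rightarrow> real)"
      using riesz_kernel_shifted(1)[OF \<alpha> s, of 0] by simp
    show "AE z in lborel. norm (W z) \<le> norm (riesz_kernel \<alpha> s z)"
    proof (rule AE_I2)
      fix z :: "real^'n"
      show "norm (W z) \<le> norm (riesz_kernel \<alpha> s z)"
      proof (cases "s < z \<bullet> \<nu>")
        case True
        then have z: "s < norm z" using norm_cauchy_schwarz[of z \<nu>] \<nu> by simp
        then have "norm z powr ?p = norm z powr (real CARD('n) + \<alpha>) * norm z"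
          using s by (simp add: powr_add)
        then have "norm (W z) = 1 / norm z powr (real CARD('n) + \<alpha>)"
          using True z s by (simp add: W_def)
        also have "\<dots> = riesz_kernel \<alpha> s z" using z s by (simp add: riesz_kernel_def min_def)
        finally show ?thesis by simp
      qed (simp add: W_def)
    qed
  qed measurable
  define J where "J = (LINT z|lborel. W z)"
  define R where "R = (\<lambda>z::real^'n. (2 * (z \<bullet> \<nu>)) *\<^sub>R \<nu> - z)"
  have R: "orthogonal_transformation R" unfolding R_def by (rule orthogonal_transformation_reflection[OF \<nu>])
  have [measurable]: "R \<in> borel \<rightarrow>\<^sub>M borel" unfolding R_def by measurable
  have WR: "W (R z) = (2 * (W z \<bullet> \<nu>)) *\<^sub>R \<nu> - W z" for z
  proof -
    have "R z \<bullet> \<nu> = z \<bullet> \<nu>" using n by (simp add: R_def inner_diff_left)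
    then have "W (R z) = (indicator {s<..} (z \<bullet> \<nu>) / norm z powr ?p) *\<^sub>R R z"
      unfolding W_def by (simp only: orthogonal_transformation_norm[OF R])
    then show ?thesis by (simp add: W_def R_def scaleR_diff_right mult.left_commute)
  qed
  \<comment> \<open>Invariance of the measure gives
    \<open>J = (2 * (J \<bullet> \<nu>)) *\<^sub>R \<nu> - J\<close>. So \<open>J\<close> is a
    multiple of \<nu>, and only the scalar integral of \<open>W z \<bullet> \<nu>\<close> remains to
    be computed.\<close>
  have "J = (LINT z|distr lborel borel R. W z)" unfolding J_def lborel_distr_orthogonal[OF R] ..
  also have "\<dots> = (LINT z|lborel. W (R z))" by (subst integral_distr) auto
  also have "\<dots> = (LINT z|lborel. (2 * (W z \<bullet> \<nu>)) *\<^sub>R \<nu>) - J"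
    unfolding WR J_def using int by (intro Bochner_Integration.integral_diff) auto
  also have "(LINT z|lborel. (2 * (W z \<bullet> \<nu>)) *\<^sub>R \<nu>) = (2 * (J \<bullet> \<nu>)) *\<^sub>R \<nu>"
    unfolding J_def using int by simp
  finally have "2 *\<^sub>R J = 2 *\<^sub>R ((J \<bullet> \<nu>) *\<^sub>R \<nu>)" by (simp add: scaleR_2 eq_diff_eq)
  then have J: "J = (J \<bullet> \<nu>) *\<^sub>R \<nu>" by (rule scaleR_left_imp_eq[rotated]) simp
  let ?c = "pi powr ((real CARD('n) - 1) / 2) * Gamma (\<alpha> / 2) / (2 * Gamma ((real CARD('n) + \<alpha> + 1) / 2))"
  have c: "0 \<le> ?c" using \<alpha>
    by (intro divide_nonneg_nonneg mult_nonneg_nonneg order_less_imp_le[OF Gamma_real_pos]) (auto intro!: divide_pos_pos add_nonneg_pos)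
  have W\<nu>: "W z \<bullet> \<nu> = indicator {s<..} (z \<bullet> \<nu>) * (z \<bullet> \<nu>) / norm z powr ?p" for z by (simp add: W_def)
  have nn: "0 \<le> W z \<bullet> \<nu>" for z unfolding W\<nu> using s by (auto simp: indicator_def)
  have "ennreal (LINT z|lborel. W z \<bullet> \<nu>) = (\<integral>\<^sup>+z. ennreal (W z \<bullet> \<nu>) \<partial>lborel)"
    using int nn by (intro nn_integral_eq_integral[symmetric]) auto
  also have "\<dots> = ennreal (?c * s powr (- \<alpha>))"
    unfolding W\<nu> using nn_integral_half_space[OF \<nu> s \<alpha>(1)] by simp
  finally have "(LINT z|lborel. W z \<bullet> \<nu>) = ?c * s powr (- \<alpha>)"
  proof (rule ennreal_inj[THEN iffD1, rotated 2])
    show "0 \<le> (LINT z|lborel. W z \<bullet> \<nu>)" using nn by (intro Bochner_Integration.integral_nonneg)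
    show "0 \<le> ?c * s powr (- \<alpha>)" using c by (intro mult_nonneg_nonneg) auto
  qed
  then have "J \<bullet> \<nu> = ?c * s powr (- \<alpha>)" unfolding J_def using int by simp
  then have "J = (?c * s powr (- \<alpha>)) *\<^sub>R \<nu>" using J by simp
  then have "frac_const CARD('n) \<alpha> *\<^sub>R J = (frac_const CARD('n) \<alpha> * ?c * s powr (- \<alpha>)) *\<^sub>R \<nu>"
    by (simp only: scaleR_scaleR mult.assoc)
  then show ?thesis unfolding half_space_factor_eq J_def .
qed

lemma frac_grad_half_space:
  fixes \<nu> :: "real^'n"
  assumes \<nu>: "norm \<nu> = 1" and t: "(x - x\<^sub>0) \<bullet> \<nu> \<noteq> 0"
  shows "frac_grad \<alpha> (indicator (half_space \<nu> x\<^sub>0)) x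
     = (half_space_factor * \<bar>(x - x\<^sub>0) \<bullet> \<nu>\<bar> powr (- \<alpha>)) *\<^sub>R \<nu>"
proof -
  let ?p = "real CARD('n) + \<alpha> + 1" and ?H = "half_space \<nu> x\<^sub>0" and ?t = "(x - x\<^sub>0) \<bullet> \<nu>"
  define G where "G = (\<lambda>z::real^'n. ((indicator ?H (x + z) - indicator ?H x) / norm z powr ?p) *\<^sub>R z)"
  define W where "W = (\<lambda>z::real^'n. (indicator {\<bar>?t\<bar><..} (z \<bullet> \<nu>) / norm z powr ?p) *\<^sub>R z)"
  have [measurable]: "?H \<in> sets borel" using open_half_space by (rule borel_open)
  have [measurable]: "G \<in> borel_measurable borel" "W \<in> borel_measurable borel"
    unfolding G_def W_def by measurable
  have "(LINT y|lebesgue. ((indicator ?H y - indicator ?H x) / norm (y - x) powr ?p) *\<^sub>R (y - x))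
     = (LINT y|lebesgue. G (- x + y))" by (simp add: G_def)
  also have "\<dots> = (LINT y|lborel. G (- x + y))" by (rule integral_completion) measurable
  also have "\<dots> = (LINT z|lborel. G z)" by (rule lborel_integral_shift) measurable
  also have "\<dots> = (LINT z|lborel. W z)"
  proof (cases "?t < 0")
    case True
    then have "G = W" unfolding G_def W_def indicator_half_space
      by (auto simp: fun_eq_iff indicator_def inner_add_left inner_diff_left)
    then show ?thesis by simp
  next
    case False
    \<comment> \<open>Inside the half-space, crossing the hyperplane changes the indicator by -1.
      Replacing \<open>z\<close> by \<open>- z\<close> turns this into the previous case, except on
      one hyperplane where strict and weak inequality differ.\<close>
    have "(LINT z|lborel. G z) = (LINT z|lborel. G (0 - z))" by (rule lborel_integral_reflect[symmetric]) measurable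
    also have "\<dots> = (LINT z|lborel. W z)"
    proof (rule integral_cong_AE)
      have "AE z in lborel. (z - 0) \<bullet> \<nu> \<noteq> ?t"
        using AE_not_on_hyperplane[of \<nu> 0 ?t] \<nu> unfolding AE_completion_iff by fastforce
      then show "AE z in lborel. G (0 - z) = W z"
      proof (rule eventually_mono)
        fix z assume z: "(z - 0) \<bullet> \<nu> \<noteq> ?t"
        have "indicator ?H (x + (0 - z)) - indicator ?H x = - (indicator {\<bar>?t\<bar><..} (z \<bullet> \<nu>) :: real)"
          unfolding indicator_half_space using False t z
          by (auto simp: indicator_def inner_add_left inner_diff_left)
        then show "G (0 - z) = W z" unfolding G_def W_def by simp
      qed
    qed measurable
    finally show ?thesis .
  qed
  finally show ?thesis
    unfolding frac_grad_def using half_space_kernel[OF \<nu>, of "\<bar>?t\<bar>"] t unfolding W_def by simp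
qed

end

text \<open>Vanishing for \<open>t \<le> 0\<close> makes the ramps converge at every point,
  \<open>t = 0\<close> included, to the indicator of the open half-line. This matters because the
  vector measure may charge the hyperplane. \<open>Suc k\<close> makes the slope positive from the
  start.\<close>

definition ramp :: "nat \<Rightarrow> real \<Rightarrow> real" where
  "ramp k t = max 0 (min 1 (real (Suc k) * t))"

lemma ramp_bounds: "0 \<le> ramp k t" "ramp k t \<le> 1"
  by (auto simp: ramp_def)

lemma ramp_mono: "s \<le> t \<Longrightarrow> ramp k s \<le> ramp k t"
  unfolding ramp_def by (intro max.mono min.mono mult_left_mono) auto

lemma ramp_lipschitz: "\<bar>ramp k s - ramp k t\<bar> \<le> real (Suc k) * \<bar>s - t\<bar>"
proof -
  have "real (Suc k) * \<bar>s - t\<bar> = \<bar>real (Suc k) * s - real (Suc k) * t\<bar>"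
    by (simp add: abs_mult right_diff_distrib[symmetric])
  then show ?thesis unfolding ramp_def by linarith
qed

lemma ramp_tendsto: "(\<lambda>k. ramp k t) \<longlonglongrightarrow> indicator {0<..} t"
proof (cases "0 < t")
  case True
  have "eventually (\<lambda>k. ramp k t = 1) sequentially"
  proof -
    obtain N where N: "1 / t < real N" using reals_Archimedean2 by blast
    have "ramp k t = 1" if "k \<ge> N" for k
    proof -
      have "1 / t \<le> real (Suc k)" using N that by linarith
      then have "1 \<le> real (Suc k) * t" using True by (simp add: divide_le_eq)
      then show ?thesis by (simp add: ramp_def)
    qed
    then show ?thesis unfolding eventually_sequentially by blast
  qed
  then show ?thesis using True by (simp add: tendsto_eventually)
next
  case False
  then have "ramp k t = 0" for k using mult_nonneg_nonpos[of "real (Suc k)" t] by (simp add: ramp_def)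
  then show ?thesis using False by simp
qed

text \<open>The bound does not depend on \<open>k\<close>. If \<open>s\<close> is within |t| / 2 of
  \<open>t\<close>, the two have the same sign: for negative sign both ramps vanish, and for
  positive sign either the slope is at most 2 / |t| or both values are already 1.\<close>

lemma ramp_diff_bound:
  assumes t: "t \<noteq> 0"
  shows "\<bar>ramp k s - ramp k t\<bar> \<le> min 1 (\<bar>s - t\<bar> / (\<bar>t\<bar> / 2))"
proof (cases "\<bar>t\<bar> / 2 \<le> \<bar>s - t\<bar>")
  case True
  then have "1 \<le> \<bar>s - t\<bar> / (\<bar>t\<bar> / 2)" using t by (simp add: le_divide_eq)
  then show ?thesis using ramp_bounds[of k s] ramp_bounds[of k t] by (simp add: min_def)
next
  case close: False
  have one: "\<bar>ramp k s - ramp k t\<bar> \<le> 1" using ramp_bounds[of k s] ramp_bounds[of k t] by linarith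
  have "\<bar>ramp k s - ramp k t\<bar> \<le> \<bar>s - t\<bar> / (\<bar>t\<bar> / 2)"
  proof (cases "real (Suc k) \<le> 2 / \<bar>t\<bar>")
    case True
    have "real (Suc k) * \<bar>s - t\<bar> \<le> 2 / \<bar>t\<bar> * \<bar>s - t\<bar>" using True by (intro mult_right_mono) auto
    then show ?thesis using ramp_lipschitz[of k s t] by (simp add: mult.commute)
  next
    case False
    have "ramp k s = ramp k t"
    proof (cases "0 < t")
      case True
      then have "2 < real (Suc k) * t" using False by (simp add: divide_less_eq not_le)
      moreover have "real (Suc k) * (t / 2) \<le> real (Suc k) * s" using close True by (intro mult_left_mono) linarith+
      moreover have "real (Suc k) * (t / 2) = real (Suc k) * t / 2" by simp
      ultimately have "1 \<le> real (Suc k) * s" "1 \<le> real (Suc k) * t" by linarith+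
      then show ?thesis by (simp add: ramp_def)
    next
      case nt: False
      then have "t < 0" "s < 0" using t close by linarith+
      then have "real (Suc k) * t \<le> 0" "real (Suc k) * s \<le> 0" by (auto intro: mult_nonneg_nonpos)
      then show ?thesis by (simp add: ramp_def)
    qed
    then show ?thesis by simp
  qed
  then show ?thesis using one by simp
qed

section \<open>Sets of finite fractional variation\<close>

locale fractional_variation_set = fractional_order_set \<alpha> E for \<alpha> and E :: "(real^'n) set" +
  fixes D :: "(real^'n) set \<Rightarrow> real^'n"
  assumes D: "is_frac_variation_measure \<alpha> (indicator E) D"
begin

lemma vector_measure_D: "vector_measure D"
  using D unfolding is_frac_variation_measure_def by blast

text \<open>The ramps do not have compact support. Multiplying by cutoffs costs only the Lipschitz
  constant \<open>L + M\<close>, uniformly in \<open>k\<close>; the pairings converge because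
  \<open>E\<close> has finite measure, the vector integrals because the variation of
  \<open>D\<close> is finite.\<close>

lemma pairing_bounded_lipschitz:
  assumes L: "L-lipschitz_on UNIV \<phi>" and M: "\<And>x. norm (\<phi> x) \<le> M"
  shows "pairing \<phi> = - vector_integral D \<phi>"
proof -
  define u where "u = (\<lambda>k::nat. \<lambda>x. cutoff (real k) x *\<^sub>R \<phi> x)"
  have uL: "(1 * L + M * 1)-lipschitz_on UNIV (u k)" for k
    unfolding u_def by (rule lipschitz_on_scaleR[OF lipschitz_cutoff cutoff_bounds(3) L M])
  have uM: "norm (u k x) \<le> M" for k x
  proof -
    have "\<bar>cutoff (real k) x\<bar> * norm (\<phi> x) \<le> 1 * norm (\<phi> x)"
      by (intro mult_right_mono cutoff_bounds) simp
    then show ?thesis using M[of x] by (simp add: u_def)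
  qed
  have uc: "u k \<in> Lip_c" for k
    by (rule Lip_cI[OF uL, of "real k + 1"]) (simp add: u_def cutoff_eq_0)
  have \<phi>_meas: "\<phi> \<in> borel_measurable borel"
    using lipschitz_on_continuous_on[OF L] by (rule borel_measurable_continuous_onI)
  have lim: "(\<lambda>k. u k x) \<longlonglongrightarrow> \<phi> x" for x
  proof -
    obtain N where N: "norm x \<le> real N" using real_arch_simple by blast
    have "u k x = \<phi> x" if "N \<le> k" for k
    proof -
      have "norm x \<le> real k" using N that by linarith
      then show ?thesis by (simp add: u_def cutoff_eq_1)
    qed
    then show ?thesis
      by (intro tendsto_eventually) (auto simp: eventually_sequentially)
  qed
  have "(\<lambda>k. pairing (u k)) \<longlonglongrightarrow> pairing \<phi>"
    by (rule pairing_tendsto[OF Lip_c_borel[OF uc] \<phi>_meas zero_less_one lipschitz_diff_bound[OF uL uM] lim])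
  moreover have "(\<lambda>k. - vector_integral D (u k)) \<longlonglongrightarrow> - vector_integral D \<phi>"
    by (intro tendsto_minus vector_integral_tendsto[OF vector_measure_D Lip_c_borel[OF uc] \<phi>_meas lim uM])
  moreover have "pairing (u k) = - vector_integral D (u k)" for k
    using D uc unfolding is_frac_variation_measure_def pairing_def by blast
  ultimately show ?thesis by (simp add: LIMSEQ_unique)
qed

lemma half_space_integral:
  assumes \<nu>: "norm \<nu> = 1"
  shows "integrable lebesgue (\<lambda>x. indicator E x * \<bar>(x - x\<^sub>0) \<bullet> \<nu>\<bar> powr (- \<alpha>))" (is "integrable _ ?I")
    and "D (half_space \<nu> x\<^sub>0) = - ((half_space_factor * (LINT x|lebesgue. indicator E x * \<bar>(x - x\<^sub>0) \<bullet> \<nu>\<bar> powr (- \<alpha>))) *\<^sub>R \<nu>)"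
proof -
  let ?H = "half_space \<nu> x\<^sub>0" and ?\<kappa> = half_space_factor
  let ?t = "\<lambda>x. (x - x\<^sub>0) \<bullet> \<nu>"
  define \<phi> where "\<phi> = (\<lambda>(v::real^'n) k x. ramp k (?t x) *\<^sub>R v)"
  have H[measurable]: "?H \<in> sets borel" using open_half_space by (rule borel_open)
  have \<nu>0: "\<nu> \<noteq> 0" using \<nu> by auto
  have n: "\<nu> \<bullet> \<nu> = 1" using \<nu> by (simp add: norm_eq_sqrt_inner)
  have AEt: "AE x in lebesgue. ?t x \<noteq> 0" by (rule AE_not_on_hyperplane[OF \<nu>0])
  have tdiff: "\<bar>?t y - ?t x\<bar> \<le> norm (y - x)" for x y
    using Cauchy_Schwarz_ineq2[of "y - x" \<nu>] \<nu> by (simp add: inner_diff_left)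
  have lip: "(real (Suc k) * norm v)-lipschitz_on UNIV (\<phi> v k)" for v k
  proof (rule lipschitz_onI)
    fix x y
    have "\<bar>ramp k (?t x) - ramp k (?t y)\<bar> * norm v \<le> (real (Suc k) * norm (x - y)) * norm v"
    proof (rule mult_right_mono)
      have "real (Suc k) * \<bar>?t x - ?t y\<bar> \<le> real (Suc k) * norm (x - y)" by (intro mult_left_mono tdiff) simp
      then show "\<bar>ramp k (?t x) - ramp k (?t y)\<bar> \<le> real (Suc k) * norm (x - y)"
        using ramp_lipschitz[of k "?t x" "?t y"] by linarith
    qed simp
    then show "dist (\<phi> v k x) (\<phi> v k y) \<le> real (Suc k) * norm v * dist x y"
      by (simp add: \<phi>_def dist_norm scaleR_diff_left[symmetric] mult_ac)
  qed simp
  have bdd: "norm (\<phi> v k x) \<le> norm v" for v k x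
    using mult_right_mono[OF ramp_bounds(2), of "norm v"] ramp_bounds(1) by (simp add: \<phi>_def)
  have meas: "\<phi> v k \<in> borel_measurable borel" for v k
    using lipschitz_on_continuous_on[OF lip] by (rule borel_measurable_continuous_onI)
  have lim: "(\<lambda>k. \<phi> v k x) \<longlonglongrightarrow> indicator ?H x *\<^sub>R v" for v x
    unfolding \<phi>_def indicator_half_space by (intro tendsto_scaleR ramp_tendsto tendsto_const)
  have pair_lim: "(\<lambda>k. pairing (\<phi> v k)) \<longlonglongrightarrow> - (v \<bullet> D ?H)" for v
  proof -
    have "(\<lambda>k. vector_integral D (\<phi> v k)) \<longlonglongrightarrow> vector_integral D (\<lambda>x. indicator ?H x *\<^sub>R v)"
      by (rule vector_integral_tendsto[OF vector_measure_D meas _ lim bdd]) measurable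
    then show ?thesis
      unfolding pairing_bounded_lipschitz[OF lip bdd] vector_integral_indicator[OF vector_measure_D H]
      by (rule tendsto_minus)
  qed
  have min_bound: "min 1 (\<bar>?t y - ?t x\<bar> / (\<bar>?t x\<bar> / 2)) \<le> min 1 (norm (y - x) / (\<bar>?t x\<bar> / 2))" for x y
    by (intro min.mono divide_right_mono tdiff) auto
  have diff: "norm (\<phi> v k y - \<phi> v k x) \<le> norm v * min 1 (norm (y - x) / (\<bar>?t x\<bar> / 2))" if "?t x \<noteq> 0" for v k x y
  proof -
    have "\<bar>ramp k (?t y) - ramp k (?t x)\<bar> \<le> min 1 (norm (y - x) / (\<bar>?t x\<bar> / 2))"
      using ramp_diff_bound[OF that, of k "?t y"] min_bound[of y x] by linarith
    then have "norm v * \<bar>ramp k (?t y) - ramp k (?t x)\<bar> \<le> norm v * min 1 (norm (y - x) / (\<bar>?t x\<bar> / 2))"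
      by (rule mult_left_mono) simp
    then show ?thesis by (simp add: \<phi>_def scaleR_diff_left[symmetric] mult.commute)
  qed
  have e: "0 < \<bar>?t x\<bar> / 2" if "?t x \<noteq> 0" for x using that by simp
  have div_lim: "(\<lambda>k. frac_div \<alpha> (\<phi> v k) x) \<longlonglongrightarrow> ?\<kappa> * \<bar>?t x\<bar> powr (- \<alpha>) * (v \<bullet> \<nu>)" if t: "?t x \<noteq> 0" for v x
  proof -
    have "(\<lambda>k. frac_div \<alpha> (\<phi> v k) x) \<longlonglongrightarrow> frac_div \<alpha> (\<lambda>x. indicator ?H x *\<^sub>R v) x"
      by (rule frac_div_tendsto[OF meas _ e[OF t] diff[OF t] lim]) measurable
    moreover have "frac_div \<alpha> (\<lambda>x. indicator ?H x *\<^sub>R v) x = v \<bullet> frac_grad \<alpha> (indicator ?H) x"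
    proof (rule frac_div_scaleR_vector[OF _ e[OF t]])
      fix y
      have "(\<lambda>k. \<bar>ramp k (?t y) - ramp k (?t x)\<bar>) \<longlonglongrightarrow> \<bar>indicator ?H y - indicator ?H x\<bar>"
        unfolding indicator_half_space by (intro tendsto_rabs tendsto_diff ramp_tendsto)
      then have "\<bar>indicator ?H y - indicator ?H x\<bar> \<le> min 1 (\<bar>?t y - ?t x\<bar> / (\<bar>?t x\<bar> / 2))"
        by (rule LIMSEQ_le_const2) (use ramp_diff_bound[OF t] in blast)
      then show "\<bar>indicator ?H y - indicator ?H x\<bar> \<le> 1 * min 1 (norm (y - x) / (\<bar>?t x\<bar> / 2))"
        using min_bound[of y x] by linarith
    qed measurable
    ultimately show ?thesis unfolding frac_grad_half_space[OF \<nu> t] by simp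
  qed
  define K where "K = frac_const CARD('n) \<alpha> * (kernel_mass CARD('n) \<alpha> * (1 / 2) powr (- \<alpha>))"
  have div_bound: "\<bar>frac_div \<alpha> (\<phi> \<nu>' k) x\<bar> \<le> K * norm \<nu>' * \<bar>?t x\<bar> powr (- \<alpha>)" if t: "?t x \<noteq> 0" for \<nu>' k x
  proof -
    have "(\<bar>?t x\<bar> / 2) powr (- \<alpha>) = \<bar>?t x\<bar> powr (- \<alpha>) * (1 / 2) powr (- \<alpha>)"
      using powr_mult[of "\<bar>?t x\<bar>" "1 / 2" "- \<alpha>"] by simp
    then show ?thesis
      using frac_div_bound[OF meas e[OF t] diff[OF t], of \<nu>' k] by (simp add: K_def mult_ac)
  qed
  \<comment> \<open>The field is \<nu> times a nondecreasing function of the component along \<nu>,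
    so its increments have nonnegative inner product with \<open>y - x\<close>.\<close>
  have div_nonneg: "0 \<le> frac_div \<alpha> (\<phi> \<nu> k) x" for k x
  proof -
    have "0 \<le> (y - x) \<bullet> (\<phi> \<nu> k y - \<phi> \<nu> k x)" for y
    proof -
      have "0 \<le> (ramp k (?t y) - ramp k (?t x)) * (?t y - ?t x)"
        using ramp_mono[of "?t x" "?t y" k] ramp_mono[of "?t y" "?t x" k]
        by (cases "?t x \<le> ?t y") (auto intro: mult_nonneg_nonneg mult_nonpos_nonpos)
      moreover have "(y - x) \<bullet> (\<phi> \<nu> k y - \<phi> \<nu> k x) = (ramp k (?t y) - ramp k (?t x)) * (?t y - ?t x)"
        by (simp add: \<phi>_def scaleR_diff_left[symmetric] inner_diff_left)
      ultimately show ?thesis by simp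
    qed
    then show ?thesis
      using frac_const_pos[OF \<alpha>, of "CARD('n)"] by (simp add: frac_div_lborel[OF meas] Bochner_Integration.integral_nonneg)
  qed
  have [measurable]: "E \<in> sets lebesgue" by (rule E)
  have div_meas[measurable]: "frac_div \<alpha> (\<phi> v k) \<in> borel_measurable lebesgue" for v k
    using borel_measurable_frac_div[OF meas] by (intro measurable_completion) simp
  have tmeas[measurable]: "(\<lambda>x. \<bar>?t x\<bar> powr (- \<alpha>)) \<in> borel_measurable lebesgue"
    by (intro measurable_completion) measurable
  have pint: "integrable lebesgue (\<lambda>x. indicator E x * frac_div \<alpha> (\<phi> v k) x)" for v k
    by (rule pairing_integrable[OF meas zero_less_one lipschitz_diff_bound[OF lip bdd]])

  \<comment> \<open>Fatou comes first: the limit of the pairings is known from the side of the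
    measure and is finite, so the weight is integrable on \<open>E\<close> before limit and integral
    are exchanged.\<close>
  have nn: "0 \<le> ?I x" for x by simp
  have "(\<integral>\<^sup>+x. ennreal (?\<kappa> * ?I x) \<partial>lebesgue)
      = (\<integral>\<^sup>+x. liminf (\<lambda>k. ennreal (indicator E x * frac_div \<alpha> (\<phi> \<nu> k) x)) \<partial>lebesgue)"
  proof (rule nn_integral_cong_AE, rule eventually_mono[OF AEt])
    fix x assume t: "?t x \<noteq> 0"
    have "(\<lambda>k. ennreal (indicator E x * frac_div \<alpha> (\<phi> \<nu> k) x)) \<longlonglongrightarrow> ennreal (indicator E x * (?\<kappa> * \<bar>?t x\<bar> powr (- \<alpha>) * (\<nu> \<bullet> \<nu>)))"
      by (intro tendsto_ennrealI tendsto_mult tendsto_const div_lim[OF t])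
    then show "ennreal (?\<kappa> * ?I x) = liminf (\<lambda>k. ennreal (indicator E x * frac_div \<alpha> (\<phi> \<nu> k) x))"
      using n by (subst lim_imp_Liminf) (auto simp: mult_ac)
  qed
  also have "\<dots> \<le> liminf (\<lambda>k. \<integral>\<^sup>+x. ennreal (indicator E x * frac_div \<alpha> (\<phi> \<nu> k) x) \<partial>lebesgue)"
    by (rule nn_integral_liminf) measurable
  also have "\<dots> = liminf (\<lambda>k. ennreal (pairing (\<phi> \<nu> k)))"
    unfolding pairing_def using pint div_nonneg by (subst nn_integral_eq_integral) auto
  also have "\<dots> = ennreal (- (\<nu> \<bullet> D ?H))"
    using tendsto_ennrealI[OF pair_lim[of \<nu>]] by (intro lim_imp_Liminf) auto
  finally have fin: "(\<integral>\<^sup>+x. ennreal (?\<kappa> * ?I x) \<partial>lebesgue) < \<infinity>"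
    by (rule order_le_less_trans) simp
  have "integrable lebesgue (\<lambda>x. ?\<kappa> * ?I x)"
    using fin half_space_factor_pos by (intro integrableI_nonneg) (auto simp: mult_nonneg_nonneg order_less_imp_le)
  then have "integrable lebesgue (\<lambda>x. 1 / ?\<kappa> * (?\<kappa> * ?I x))" by (rule integrable_mult_right)
  then show int: "integrable lebesgue ?I" using half_space_factor_pos by simp

  \<comment> \<open>From here on the weight itself dominates, for every direction \<open>v\<close>.
    All of them are tested because \<open>D ?H\<close> is a vector: its components orthogonal to
    \<nu> have to be shown to vanish.\<close>
  have key: "(?\<kappa> * integral\<^sup>L lebesgue ?I) * (v \<bullet> \<nu>) = - (v \<bullet> D ?H)" for v
  proof -
    have "(\<lambda>k. LINT x|lebesgue. indicator E x * frac_div \<alpha> (\<phi> v k) x)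
        \<longlonglongrightarrow> (LINT x|lebesgue. (?\<kappa> * (v \<bullet> \<nu>)) * ?I x)"
    proof (rule integral_dominated_convergence)
      show "integrable lebesgue (\<lambda>x. (K * norm v) * ?I x)" using int by (rule integrable_mult_right)
      show "AE x in lebesgue. norm (indicator E x * frac_div \<alpha> (\<phi> v k) x) \<le> (K * norm v) * ?I x" for k
        using AEt by (rule eventually_mono) (use div_bound in \<open>auto simp: indicator_def\<close>)
      show "AE x in lebesgue. (\<lambda>k. indicator E x * frac_div \<alpha> (\<phi> v k) x) \<longlonglongrightarrow> (?\<kappa> * (v \<bullet> \<nu>)) * ?I x"
        using AEt
      proof (rule eventually_mono)
        fix x assume t: "?t x \<noteq> 0"
        have "(\<lambda>k. indicator E x * frac_div \<alpha> (\<phi> v k) x) \<longlonglongrightarrow> indicator E x * (?\<kappa> * \<bar>?t x\<bar> powr (- \<alpha>) * (v \<bullet> \<nu>))"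
          by (intro tendsto_mult tendsto_const div_lim[OF t])
        then show "(\<lambda>k. indicator E x * frac_div \<alpha> (\<phi> v k) x) \<longlonglongrightarrow> (?\<kappa> * (v \<bullet> \<nu>)) * ?I x"
          by (simp add: mult_ac)
      qed
    qed measurable
    from LIMSEQ_unique[OF this[folded pairing_def] pair_lim]
    have "(?\<kappa> * (v \<bullet> \<nu>)) * integral\<^sup>L lebesgue ?I = - (v \<bullet> D ?H)"
      by (simp only: integral_mult_right_zero)
    then show ?thesis by (simp only: mult_ac)
  qed
  have "v \<bullet> D ?H = v \<bullet> - ((?\<kappa> * integral\<^sup>L lebesgue ?I) *\<^sub>R \<nu>)" for v
    using key[of v] by simp
  then show "D ?H = - ((?\<kappa> * integral\<^sup>L lebesgue ?I) *\<^sub>R \<nu>)" by (rule vector_eq_ldot[THEN iffD1, OF allI])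
qed

lemma nn_integral_half_space_weight:
  assumes \<nu>: "norm \<nu> = 1"
  shows "(\<integral>\<^sup>+x. ennreal (half_space_factor * \<bar>(x - x\<^sub>0) \<bullet> \<nu>\<bar> powr (- \<alpha>)) * indicator E x \<partial>lebesgue) = ennreal (norm (D (half_space \<nu> x\<^sub>0)))"
proof -
  let ?I = "\<lambda>x. indicator E x * \<bar>(x - x\<^sub>0) \<bullet> \<nu>\<bar> powr (- \<alpha>)"
  have "(\<integral>\<^sup>+x. ennreal (half_space_factor * \<bar>(x - x\<^sub>0) \<bullet> \<nu>\<bar> powr (- \<alpha>)) * indicator E x \<partial>lebesgue) = (\<integral>\<^sup>+x. ennreal (half_space_factor * ?I x) \<partial>lebesgue)"
    by (intro nn_integral_cong) (auto simp: indicator_def)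
  also have "\<dots> = ennreal (LINT x|lebesgue. half_space_factor * ?I x)"
    using half_space_integral(1)[OF \<nu>] half_space_factor_pos
    by (intro nn_integral_eq_integral integrable_mult_right AE_I2) auto
  also have "(LINT x|lebesgue. half_space_factor * ?I x) = norm (D (half_space \<nu> x\<^sub>0))"
    unfolding half_space_integral(2)[OF \<nu>] using \<nu> half_space_factor_pos
    by (simp add: Bochner_Integration.integral_nonneg abs_mult)
  finally show ?thesis .
qed

lemma nn_integral_half_space_weight_le:
  assumes \<nu>: "norm \<nu> = 1"
  shows "(\<integral>\<^sup>+x. ennreal (half_space_factor * \<bar>(x - x\<^sub>0) \<bullet> \<nu> - r\<bar> powr (- \<alpha>)) * indicator E x \<partial>lebesgue)
     \<le> emeasure (total_variation D) (UNIV - ball x\<^sub>0 r)"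
proof -
  have n: "\<nu> \<bullet> \<nu> = 1" using \<nu> by (simp add: norm_eq_sqrt_inner)
  \<comment> \<open>For \<open>r > 0\<close> this half-space is tangent to the ball at
    \<open>x\<^sub>0 + r *\<^sub>R \<nu>\<close>. It is disjoint from the ball, which gives all
    directions the same right-hand side.\<close>
  let ?H = "half_space \<nu> (x\<^sub>0 + r *\<^sub>R \<nu>)"
  have "(x - (x\<^sub>0 + r *\<^sub>R \<nu>)) \<bullet> \<nu> = (x - x\<^sub>0) \<bullet> \<nu> - r" for x
    using n by (simp add: inner_diff_left inner_add_left)
  then have "(\<integral>\<^sup>+x. ennreal (half_space_factor * \<bar>(x - x\<^sub>0) \<bullet> \<nu> - r\<bar> powr (- \<alpha>)) * indicator E x \<partial>lebesgue) = ennreal (norm (D ?H))"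
    using nn_integral_half_space_weight[OF \<nu>, of "x\<^sub>0 + r *\<^sub>R \<nu>"] by simp
  also have "\<dots> \<le> emeasure (total_variation D) ?H"
    using open_half_space by (intro norm_le_total_variation[OF vector_measure_D] borel_open)
  also have "\<dots> \<le> emeasure (total_variation D) (UNIV - ball x\<^sub>0 r)"
  proof (rule emeasure_mono)
    show "?H \<subseteq> UNIV - ball x\<^sub>0 r"
    proof (clarsimp simp: half_space_def)
      fix y assume "0 < (y - (x\<^sub>0 + r *\<^sub>R \<nu>)) \<bullet> \<nu>" "dist x\<^sub>0 y < r"
      then show False using norm_cauchy_schwarz[of "y - x\<^sub>0" \<nu>] \<nu> n
        by (simp add: inner_diff_left inner_add_left dist_norm norm_minus_commute)
    qed
  qed simp
  finally show ?thesis .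
qed

lemma null_set_if_half_space_zero:
  assumes \<nu>: "norm \<nu> = 1" and 0: "D (half_space \<nu> x\<^sub>0) = 0"
  shows "emeasure lebesgue E = 0"
proof -
  let ?I = "\<lambda>x. indicator E x * \<bar>(x - x\<^sub>0) \<bullet> \<nu>\<bar> powr (- \<alpha>)"
  have \<nu>0: "\<nu> \<noteq> 0" using \<nu> by auto
  have "integral\<^sup>L lebesgue ?I = 0"
    using half_space_integral(2)[OF \<nu>, of x\<^sub>0] 0 \<nu>0 half_space_factor_pos by simp
  then have "AE x in lebesgue. ?I x = 0"
    using integral_nonneg_eq_0_iff_AE[OF half_space_integral(1)[OF \<nu>, of x\<^sub>0]] by simp
  with AE_not_on_hyperplane[OF \<nu>0, of x\<^sub>0 0] have "AE x in lebesgue. x \<notin> E"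
    by eventually_elim (auto simp: indicator_def)
  then show ?thesis using E by (simp add: AE_iff_null_sets[symmetric] null_setsD1)
qed

end

section \<open>The weighted inequality as an average over directions\<close>

lemma ennreal_divide_powr:
  fixes a b :: real
  assumes "0 \<le> b" "a \<noteq> 0"
  shows "ennreal b / ennreal (\<bar>a\<bar> powr \<alpha>) = ennreal (b * \<bar>a\<bar> powr (- \<alpha>))"
  using assms by (subst divide_ennreal) (auto simp: powr_minus_divide)

context fractional_variation_set
begin

text \<open>For \<open>z\<close> in the unit ball the direction \<open>z /\<^sub>R norm z\<close> is
  uniformly distributed on the sphere, and its component along \<open>x - x\<^sub>0\<close> has the
  density that appears in the weight. The integral over the ball is not normalised, whence the
  volume on the right.\<close>

lemma frac_weight_sphere_average:
  fixes x x\<^sub>0 :: "real^'n"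
  assumes n: "2 \<le> CARD('n)" and x: "x \<noteq> x\<^sub>0"
  shows "(\<integral>\<^sup>+z\<in>cball (0::real^'n) 1. ennreal (half_space_factor * \<bar>(x - x\<^sub>0) \<bullet> (z /\<^sub>R norm z) - r\<bar> powr (- \<alpha>)) \<partial>lborel)
     = ennreal (unit_ball_vol (real CARD('n))) * frac_weight CARD('n) \<alpha> (norm (x - x\<^sub>0)) r"
proof -
  let ?t = "norm (x - x\<^sub>0)" and ?n = "real CARD('n)"
  have t: "0 < ?t" using x by simp
  have n': "2 \<le> ?n" using n by simp
  define e where "e = (x - x\<^sub>0) /\<^sub>R ?t"
  have e: "norm e = 1" using t by (simp add: e_def)
  define G where "G = (\<lambda>s. half_space_factor * \<bar>s * ?t - r\<bar> powr (- \<alpha>))"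
  have G[measurable]: "G \<in> borel_measurable borel" unfolding G_def by measurable
  have Gnn: "0 \<le> G s" for s using half_space_factor_pos by (simp add: G_def)
  have m: "?n - 1 - 2 = ?n - 3" by simp
  have arg: "(x - x\<^sub>0) \<bullet> (z /\<^sub>R norm z) = z \<bullet> e / norm z * ?t" for z
    using t by (simp add: e_def inner_commute divide_inverse)
  have "(\<integral>\<^sup>+z\<in>cball (0::real^'n) 1. ennreal (half_space_factor * \<bar>(x - x\<^sub>0) \<bullet> (z /\<^sub>R norm z) - r\<bar> powr (- \<alpha>)) \<partial>lborel)
     = (\<integral>\<^sup>+z\<in>cball (0::real^'n) 1. ennreal (G (z \<bullet> e / norm z)) \<partial>lborel)"
    unfolding G_def arg ..
  also have "\<dots> = ennreal (unit_ball_vol (?n - 1) * (?n - 1) / ?n) *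
      (\<integral>\<^sup>+u\<in>{-1..1}. ennreal ((1 - u\<^sup>2) powr ((?n - 3) / 2) * G u) \<partial>lborel)"
    using nn_integral_sphere_average[OF e _ G Gnn] n by (simp only: DIM_real_vec m) simp
  also have "(\<integral>\<^sup>+u\<in>{-1..1}. ennreal ((1 - u\<^sup>2) powr ((?n - 3) / 2) * G u) \<partial>lborel)
      = (\<integral>\<^sup>+u. ennreal half_space_factor * (ennreal ((1 - u\<^sup>2) powr ((?n - 3) / 2)) / ennreal (\<bar>u * ?t - r\<bar> powr \<alpha>) * indicator {-1..1} u) \<partial>lborel)"
  \<comment> \<open>At \<open>u * ?t = r\<close> the two expressions may disagree: division by 0
    gives infinity, while \<open>0 powr (- \<alpha>)\<close> is 0. A single value of
    \<open>u\<close> is negligible.\<close>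
  proof (rule nn_integral_cong_AE, rule eventually_mono[OF AE_lborel_singleton[of "r / ?t"]])
    fix u assume "u \<noteq> r / ?t"
    then have u: "u * ?t - r \<noteq> 0" using t by (simp add: eq_divide_eq)
    have "ennreal ((1 - u\<^sup>2) powr ((?n - 3) / 2) * G u)
        = ennreal half_space_factor * ennreal ((1 - u\<^sup>2) powr ((?n - 3) / 2) * \<bar>u * ?t - r\<bar> powr (- \<alpha>))"
      using half_space_factor_pos by (subst ennreal_mult[symmetric]) (auto simp: G_def mult_ac)
    then show "ennreal ((1 - u\<^sup>2) powr ((?n - 3) / 2) * G u) * indicator {-1..1} u
        = ennreal half_space_factor * (ennreal ((1 - u\<^sup>2) powr ((?n - 3) / 2)) / ennreal (\<bar>u * ?t - r\<bar> powr \<alpha>) * indicator {-1..1} u)"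
      using ennreal_divide_powr[of "(1 - u\<^sup>2) powr ((?n - 3) / 2)" "u * ?t - r" \<alpha>] u by (simp add: mult.assoc)
  qed
  also have "\<dots> = ennreal half_space_factor *
      (\<integral>\<^sup>+u\<in>{-1..1}. ennreal ((1 - u\<^sup>2) powr ((?n - 3) / 2)) / ennreal (\<bar>u * ?t - r\<bar> powr \<alpha>) \<partial>lborel)"
    by (rule nn_integral_cmult) measurable
  also have "ennreal (unit_ball_vol (?n - 1) * (?n - 1) / ?n) * \<dots> =
      ennreal (unit_ball_vol ?n) * frac_weight CARD('n) \<alpha> ?t r"
  proof -
    have ub: "0 < unit_ball_vol ?n" "0 \<le> unit_ball_vol (?n - 1)" using n' by auto
    have "ennreal (unit_ball_vol (?n - 1) * (?n - 1) / ?n) * ennreal half_space_factor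
       = ennreal (unit_ball_vol (?n - 1) * (?n - 1) / ?n * half_space_factor)"
      using ub n' half_space_factor_pos by (intro ennreal_mult[symmetric]) auto
    also have "\<dots> = ennreal (unit_ball_vol ?n * ((?n - 1) * unit_ball_vol (?n - 1) / (?n * unit_ball_vol ?n) * half_space_factor))"
    proof -
      have "b * c / d * h = a * (c * b / (d * a) * h)" if "a \<noteq> 0" for a b c d h :: real
        using that by simp
      then show ?thesis using ub(1) by (intro arg_cong[where f = ennreal]) (metis less_irrefl)
    qed
    also have "\<dots> = ennreal (unit_ball_vol ?n) * ennreal ((?n - 1) * unit_ball_vol (?n - 1) / (?n * unit_ball_vol ?n) * half_space_factor)"
      using ub n' half_space_factor_pos by (intro ennreal_mult) auto
    finally have c: "ennreal (unit_ball_vol (?n - 1) * (?n - 1) / ?n) * ennreal half_space_factor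
       = ennreal (unit_ball_vol ?n) * ennreal ((?n - 1) * unit_ball_vol (?n - 1) / (?n * unit_ball_vol ?n) * half_space_factor)" .
    have "frac_weight CARD('n) \<alpha> ?t r = ennreal ((?n - 1) * unit_ball_vol (?n - 1) / (?n * unit_ball_vol ?n) * half_space_factor) *
      (\<integral>\<^sup>+u\<in>{-1..1}. ennreal ((1 - u\<^sup>2) powr ((?n - 3) / 2)) / ennreal (\<bar>u * ?t - r\<bar> powr \<alpha>) \<partial>lborel)"
      using n unfolding frac_weight_def half_space_factor_def by simp
    then show ?thesis using c by (simp only: mult.assoc[symmetric])
  qed
  finally show ?thesis .
qed

text \<open>The half-space bound has the same right-hand side in every direction, so integrating it
  over the unit ball and exchanging the integrals multiplies it by the volume, which is then
  cancelled.\<close>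

lemma weight_inequality_ge2:
  assumes n: "2 \<le> CARD('n)"
  shows "(\<integral>\<^sup>+x\<in>E. frac_weight CARD('n) \<alpha> (norm (x - x\<^sub>0)) r \<partial>lebesgue)
     \<le> emeasure (total_variation D) (UNIV - ball x\<^sub>0 r)" (is "_ \<le> ?M")
proof -
  let ?n = "real CARD('n)" and ?\<omega> = "ennreal (unit_ball_vol (real CARD('n)))"
  have [measurable]: "(indicator E :: real^'n \<Rightarrow> ennreal) \<in> borel_measurable lebesgue" using E by measurable
  \<comment> \<open>Tonelli is applied to Borel functions on the product; the indicator of the
    Lebesgue measurable set \<open>E\<close> is replaced by a Borel function that equals it almost
    everywhere.\<close>
  obtain e :: "real^'n \<Rightarrow> ennreal" where e[measurable]: "e \<in> borel_measurable lborel" and eE: "AE x in lborel. indicator E x = e x"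
    using completion_ex_borel_measurable[of "indicator E :: real^'n \<Rightarrow> ennreal" lborel] by auto
  have [measurable]: "cball (0::real^'n) 1 \<in> sets borel" by simp
  have e'[measurable]: "e \<in> borel_measurable borel" using e by simp
  define k where "k = (\<lambda>(x::real^'n) z. ennreal (half_space_factor * \<bar>(x - x\<^sub>0) \<bullet> (z /\<^sub>R norm z) - r\<bar> powr (- \<alpha>)))"
  have km[measurable]: "(\<lambda>(x, z). k x z) \<in> borel_measurable (borel \<Otimes>\<^sub>M borel)" unfolding k_def by measurable
  have \<omega>: "?\<omega> \<noteq> 0" "?\<omega> \<noteq> top" using less_imp_neq[OF unit_ball_vol_pos[of ?n]] by auto
  have \<omega>_eq: "emeasure lborel (cball (0::real^'n) 1) = ?\<omega>"
    using emeasure_cball[of 1 "0::real^'n"] by simp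
  have toB: "(\<integral>\<^sup>+x. F x * indicator E x \<partial>lebesgue) = (\<integral>\<^sup>+x. F x * e x \<partial>lborel)" for F :: "real^'n \<Rightarrow> ennreal"
    unfolding nn_integral_completion
    by (rule nn_integral_cong_AE, rule eventually_mono[OF eE]) simp
  have slice: "(\<integral>\<^sup>+x. k x z * e x \<partial>lborel) \<le> ?M" if "z \<noteq> 0" for z
    using nn_integral_half_space_weight_le[of "z /\<^sub>R norm z" x\<^sub>0 r] that unfolding toB k_def by simp
  have "?\<omega> * (\<integral>\<^sup>+x\<in>E. frac_weight CARD('n) \<alpha> (norm (x - x\<^sub>0)) r \<partial>lebesgue)
      = (\<integral>\<^sup>+x. ?\<omega> * frac_weight CARD('n) \<alpha> (norm (x - x\<^sub>0)) r * e x \<partial>lborel)"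
  proof -
    \<comment> \<open>The constant is moved through the integral by means of \<open>F\<close>, whose
      measurability comes from the product integral; away from \<open>x\<^sub>0\<close> it is the
      volume times the weight.\<close>
    define F where "F = (\<lambda>x. \<integral>\<^sup>+z\<in>cball (0::real^'n) 1. k x z \<partial>lborel)"
    have "(\<lambda>x. \<integral>\<^sup>+z. k x z * indicator (cball 0 1) z \<partial>lborel) \<in> borel_measurable borel"
      by (rule lborel.borel_measurable_nn_integral) measurable
    then have [measurable]: "F \<in> borel_measurable borel" unfolding F_def .
    have AEx: "AE x in lborel. x \<noteq> x\<^sub>0" by (rule AE_lborel_singleton)
    have F: "F x = ?\<omega> * frac_weight CARD('n) \<alpha> (norm (x - x\<^sub>0)) r" if "x \<noteq> x\<^sub>0" for x
      unfolding F_def k_def by (rule frac_weight_sphere_average[OF n that])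
    have inv: "inverse ?\<omega> * ?\<omega> = 1" using ennreal_divide_self[of ?\<omega>] \<omega> unfolding divide_ennreal_def by (simp add: mult.commute)
    have "(\<integral>\<^sup>+x\<in>E. frac_weight CARD('n) \<alpha> (norm (x - x\<^sub>0)) r \<partial>lebesgue)
        = (\<integral>\<^sup>+x. inverse ?\<omega> * (F x * e x) \<partial>lborel)"
      unfolding toB by (rule nn_integral_cong_AE, rule eventually_mono[OF AEx]) (simp add: F mult.assoc[symmetric] inv)
    also have "\<dots> = inverse ?\<omega> * (\<integral>\<^sup>+x. F x * e x \<partial>lborel)" by (rule nn_integral_cmult) measurable
    also have "(\<integral>\<^sup>+x. F x * e x \<partial>lborel) = (\<integral>\<^sup>+x. ?\<omega> * frac_weight CARD('n) \<alpha> (norm (x - x\<^sub>0)) r * e x \<partial>lborel)"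
      by (rule nn_integral_cong_AE, rule eventually_mono[OF AEx]) (simp add: F)
    finally show ?thesis by (simp add: mult.assoc[symmetric] mult.commute[of ?\<omega>] inv)
  qed
  also have "\<dots> = (\<integral>\<^sup>+x. (\<integral>\<^sup>+z. k x z * e x * indicator (cball 0 1) z \<partial>lborel) \<partial>lborel)"
  proof (rule nn_integral_cong_AE, rule eventually_mono[OF AE_lborel_singleton[of x\<^sub>0]])
    fix x assume x: "x \<noteq> x\<^sub>0"
    have "(\<integral>\<^sup>+z. k x z * e x * indicator (cball 0 1) z \<partial>lborel) = (\<integral>\<^sup>+z. (k x z * indicator (cball 0 1) z) * e x \<partial>lborel)"
      by (simp add: mult_ac)
    also have "\<dots> = (\<integral>\<^sup>+z\<in>cball 0 1. k x z \<partial>lborel) * e x"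
      by (rule nn_integral_multc) measurable
    also have "\<dots> = ?\<omega> * frac_weight CARD('n) \<alpha> (norm (x - x\<^sub>0)) r * e x"
      unfolding k_def frac_weight_sphere_average[OF n x] ..
    finally show "?\<omega> * frac_weight CARD('n) \<alpha> (norm (x - x\<^sub>0)) r * e x
       = (\<integral>\<^sup>+z. k x z * e x * indicator (cball 0 1) z \<partial>lborel)" by simp
  qed
  also have "\<dots> = (\<integral>\<^sup>+z. (\<integral>\<^sup>+x. k x z * e x * indicator (cball 0 1) z \<partial>lborel) \<partial>lborel)"
    by (rule lborel_pair.Fubini'[symmetric]) measurable
  also have "\<dots> = (\<integral>\<^sup>+z. (\<integral>\<^sup>+x. k x z * e x \<partial>lborel) * indicator (cball 0 1) z \<partial>lborel)"
    by (intro nn_integral_cong nn_integral_multc) measurable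
  also have "\<dots> \<le> (\<integral>\<^sup>+z. ?M * indicator (cball (0::real^'n) 1) z \<partial>lborel)"
    by (rule nn_integral_mono_AE, rule eventually_mono[OF AE_lborel_singleton[of 0]]) (intro mult_right_mono slice, auto)
  also have "\<dots> = ?M * emeasure lborel (cball (0::real^'n) 1)" by (rule nn_integral_cmult_indicator) simp
  also have "\<dots> = ?\<omega> * ?M" unfolding \<omega>_eq by (rule mult.commute)
  finally show ?thesis using \<omega> by (simp add: ennreal_mult_le_mult_iff)
qed

text \<open>In dimension one the unit sphere is {b, -b}, and the average over directions is half the
  sum of the two half-line bounds.\<close>

lemma weight_inequality_1:
  assumes n: "CARD('n) = 1" and r: "0 < r"
  shows "(\<integral>\<^sup>+x\<in>E. frac_weight CARD('n) \<alpha> (norm (x - x\<^sub>0)) r \<partial>lebesgue)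
     \<le> emeasure (total_variation D) (UNIV - ball x\<^sub>0 r)" (is "_ \<le> ?M")
proof -
  obtain b where b: "(Basis :: (real^'n) set) = {b}"
    using n card_1_singletonE[of "Basis :: (real^'n) set"] by (metis DIM_real_vec)
  then have nb: "norm b = 1" using norm_Basis[of b] by blast
  have abs: "\<bar>z \<bullet> b\<bar> = norm z" for z
  proof -
    have "z = (z \<bullet> b) *\<^sub>R b" using euclidean_representation[of z] unfolding b by simp
    then have "norm z = \<bar>z \<bullet> b\<bar> * norm b" by (metis norm_scaleR)
    then show ?thesis using nb by simp
  qed
  define w where "w = (\<lambda>(c::real^'n) x. ennreal (half_space_factor * \<bar>(x - x\<^sub>0) \<bullet> c - r\<bar> powr (- \<alpha>)))"
  have w: "(\<integral>\<^sup>+x. w c x * indicator E x \<partial>lebesgue) \<le> ?M" if "norm c = 1" for c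
    unfolding w_def using that by (rule nn_integral_half_space_weight_le)
  have [measurable]: "E \<in> sets lebesgue" by (rule E)
  have [measurable]: "w c \<in> borel_measurable lebesgue" for c
    unfolding w_def by (intro measurable_completion) measurable
  \<comment> \<open>At distance \<open>r\<close> the weight is infinite by convention whereas the
    real power is 0; the sphere is a null set.\<close>
  have "AE x in lebesgue. norm (x - x\<^sub>0) \<noteq> r"
  proof -
    have "sphere x\<^sub>0 r \<in> null_sets lebesgue" using negligible_sphere by (simp add: negligible_iff_null_sets)
    then show ?thesis by (rule AE_not_in[THEN eventually_mono]) (simp add: dist_norm norm_minus_commute)
  qed
  then have "(\<integral>\<^sup>+x\<in>E. frac_weight CARD('n) \<alpha> (norm (x - x\<^sub>0)) r \<partial>lebesgue)
     = (\<integral>\<^sup>+x. ennreal (1 / 2) * (w b x * indicator E x + w (- b) x * indicator E x) \<partial>lebesgue)"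
  proof (intro nn_integral_cong_AE, elim eventually_mono)
    fix x assume x: "norm (x - x\<^sub>0) \<noteq> r"
    let ?t = "norm (x - x\<^sub>0)"
    let ?A = "\<bar>?t - r\<bar> powr (- \<alpha>)" and ?B = "\<bar>?t + r\<bar> powr (- \<alpha>)"
    have "frac_weight CARD('n) \<alpha> ?t r = ennreal (half_space_factor / 2) * (ennreal ?A + ennreal ?B)"
      using ennreal_divide_powr[of 1 "?t - r" \<alpha>] ennreal_divide_powr[of 1 "?t + r" \<alpha>] x r
      by (simp add: frac_weight_def n half_space_factor_def mult.commute add_nonneg_eq_0_iff)
    also have "\<dots> = ennreal (1 / 2) * (ennreal (half_space_factor * ?A) + ennreal (half_space_factor * ?B))"
    proof -
      have "ennreal (half_space_factor / 2) = ennreal (1 / 2) * ennreal half_space_factor"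
        using half_space_factor_pos by (subst ennreal_mult[symmetric]) auto
      moreover have "ennreal (half_space_factor * a) = ennreal half_space_factor * ennreal a" if "0 \<le> a" for a
        using half_space_factor_pos that by (intro ennreal_mult) auto
      ultimately show ?thesis by (simp only: mult.assoc distrib_left powr_ge_zero)
    qed
    also have "ennreal (half_space_factor * ?A) + ennreal (half_space_factor * ?B) = w b x + w (- b) x"
    proof (cases "0 \<le> (x - x\<^sub>0) \<bullet> b")
      case True
      then have "(x - x\<^sub>0) \<bullet> b = ?t" using abs[of "x - x\<^sub>0"] by simp
      moreover have "\<bar>- ?t - r\<bar> = \<bar>?t + r\<bar>" by linarith
      ultimately show ?thesis by (simp add: w_def)
    next
      case False
      then have "(x - x\<^sub>0) \<bullet> b = - ?t" using abs[of "x - x\<^sub>0"] by simp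
      moreover have "\<bar>- ?t - r\<bar> = \<bar>?t + r\<bar>" by linarith
      ultimately show ?thesis by (simp add: w_def add.commute)
    qed
    finally show "frac_weight CARD('n) \<alpha> ?t r * indicator E x
       = ennreal (1 / 2) * (w b x * indicator E x + w (- b) x * indicator E x)"
      by (simp only: distrib_right mult.assoc)
  qed
  also have "\<dots> = ennreal (1 / 2) * ((\<integral>\<^sup>+x. w b x * indicator E x \<partial>lebesgue) + (\<integral>\<^sup>+x. w (- b) x * indicator E x \<partial>lebesgue))"
  proof -
    have "(\<integral>\<^sup>+x. w b x * indicator E x + w (- b) x * indicator E x \<partial>lebesgue)
        = (\<integral>\<^sup>+x. w b x * indicator E x \<partial>lebesgue) + (\<integral>\<^sup>+x. w (- b) x * indicator E x \<partial>lebesgue)"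
      by (rule nn_integral_add) measurable
    moreover have "(\<integral>\<^sup>+x. ennreal (1 / 2) * (w b x * indicator E x + w (- b) x * indicator E x) \<partial>lebesgue)
        = ennreal (1 / 2) * (\<integral>\<^sup>+x. w b x * indicator E x + w (- b) x * indicator E x \<partial>lebesgue)"
      by (rule nn_integral_cmult) measurable
    ultimately show ?thesis by simp
  qed
  also have "\<dots> \<le> ennreal (1 / 2) * (?M + ?M)"
    using nb by (intro mult_left_mono add_mono w) auto
  also have "\<dots> = ?M"
  proof -
    have "?M + ?M = ennreal 2 * ?M" by (simp add: mult_2)
    then have "ennreal (1 / 2) * (?M + ?M) = ennreal (1 / 2) * ennreal 2 * ?M" by (simp only: mult.assoc)
    also have "ennreal (1 / 2) * ennreal 2 = 1" by (subst ennreal_mult[symmetric]) auto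
    finally show ?thesis by simp
  qed
  finally show ?thesis .
qed

lemma weight_inequality:
  assumes "0 < r"
  shows "(\<integral>\<^sup>+x\<in>E. frac_weight CARD('n) \<alpha> (norm (x - x\<^sub>0)) r \<partial>lebesgue)
     \<le> emeasure (total_variation D) (UNIV - ball x\<^sub>0 r)"
proof (cases "CARD('n) = 1")
  case False
  then have "2 \<le> CARD('n)" using zero_less_card_finite[where 'a = 'n] by linarith
  then show ?thesis by (rule weight_inequality_ge2)
qed (rule weight_inequality_1[OF _ assms])

section \<open>Half-space relations, null sets and the reduced boundary\<close>

lemma half_space_identity:
  assumes \<nu>: "norm \<nu> = 1"
  shows "set_integrable lebesgue E (\<lambda>x. (1 / \<bar>(x - x\<^sub>0) \<bullet> \<nu>\<bar> powr \<alpha>) *\<^sub>R \<nu>)"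
    and "(frac_const 1 \<alpha> / \<alpha>) *\<^sub>R (LINT x:E|lebesgue. (1 / \<bar>(x - x\<^sub>0) \<bullet> \<nu>\<bar> powr \<alpha>) *\<^sub>R \<nu>) = - D (half_space \<nu> x\<^sub>0)"
proof -
  let ?I = "\<lambda>x. indicator E x * \<bar>(x - x\<^sub>0) \<bullet> \<nu>\<bar> powr (- \<alpha>)"
  have eq: "(\<lambda>x. indicator E x *\<^sub>R ((1 / \<bar>(x - x\<^sub>0) \<bullet> \<nu>\<bar> powr \<alpha>) *\<^sub>R \<nu>)) = (\<lambda>x. ?I x *\<^sub>R \<nu>)"
    by (simp add: powr_minus_divide)
  note int = half_space_integral[OF \<nu>, of x\<^sub>0]
  show "set_integrable lebesgue E (\<lambda>x. (1 / \<bar>(x - x\<^sub>0) \<bullet> \<nu>\<bar> powr \<alpha>) *\<^sub>R \<nu>)"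
    unfolding set_integrable_def eq using int(1) by (intro integrable_scaleR_left)
  have "(LINT x:E|lebesgue. (1 / \<bar>(x - x\<^sub>0) \<bullet> \<nu>\<bar> powr \<alpha>) *\<^sub>R \<nu>) = integral\<^sup>L lebesgue ?I *\<^sub>R \<nu>"
    unfolding set_lebesgue_integral_def eq using int(1) by (intro integral_scaleR_left)
  then show "(frac_const 1 \<alpha> / \<alpha>) *\<^sub>R (LINT x:E|lebesgue. (1 / \<bar>(x - x\<^sub>0) \<bullet> \<nu>\<bar> powr \<alpha>) *\<^sub>R \<nu>) = - D (half_space \<nu> x\<^sub>0)"
    unfolding int(2) half_space_factor_def by (simp only: scaleR_scaleR minus_minus)
qed

lemma half_space_inequality:
  assumes \<nu>: "norm \<nu> = 1"
  shows "(\<integral>\<^sup>+x\<in>E. ennreal (norm (frac_grad \<alpha> (indicator (half_space \<nu> x\<^sub>0)) x)) \<partial>lebesgue)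
     \<le> emeasure (total_variation D) (half_space \<nu> x\<^sub>0)"
proof -
  have "\<nu> \<noteq> 0" using \<nu> by auto
  then have "(\<integral>\<^sup>+x\<in>E. ennreal (norm (frac_grad \<alpha> (indicator (half_space \<nu> x\<^sub>0)) x)) \<partial>lebesgue)
     = (\<integral>\<^sup>+x. ennreal (half_space_factor * \<bar>(x - x\<^sub>0) \<bullet> \<nu>\<bar> powr (- \<alpha>)) * indicator E x \<partial>lebesgue)"
    using \<nu> half_space_factor_pos
    by (intro nn_integral_cong_AE eventually_mono[OF AE_not_on_hyperplane[of \<nu> x\<^sub>0 0]])
       (simp_all add: frac_grad_half_space abs_mult)
  also have "\<dots> \<le> emeasure (total_variation D) (half_space \<nu> x\<^sub>0)"
    unfolding nn_integral_half_space_weight[OF \<nu>]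
    using open_half_space by (intro norm_le_total_variation[OF vector_measure_D] borel_open)
  finally show ?thesis .
qed

text \<open>A half-space beyond a ball that contains the support has variation 0, hence vector
  measure 0.\<close>

lemma null_set_if_bounded_support:
  assumes "bounded (measure_support (total_variation D))"
  shows "emeasure lebesgue E = 0"
proof -
  obtain R where R: "\<And>x. x \<in> measure_support (total_variation D) \<Longrightarrow> norm x \<le> R"
    using assms unfolding bounded_iff by blast
  obtain \<nu> :: "real^'n" where \<nu>: "norm \<nu> = 1" using vector_choose_size[of 1] by auto
  then have n: "\<nu> \<bullet> \<nu> = 1" by (simp add: norm_eq_sqrt_inner)
  let ?H = "half_space \<nu> (R *\<^sub>R \<nu>)"
  have "R < norm x" if "x \<in> ?H" for x
    using that norm_cauchy_schwarz[of x \<nu>] \<nu> n by (simp add: half_space_def inner_diff_left)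
  then have "measure_support (total_variation D) \<inter> ?H = {}" using R by fastforce
  then have "emeasure (total_variation D) ?H = 0"
    using open_half_space by (intro emeasure_zero_outside_support borel_open) auto
  then have "D ?H = 0"
    using norm_le_total_variation[OF vector_measure_D borel_open[OF open_half_space], of \<nu> "R *\<^sub>R \<nu>"] by simp
  then show ?thesis by (rule null_set_if_half_space_zero[OF \<nu>])
qed

lemma half_space_meets_boundary:
  assumes E: "emeasure lebesgue E > 0" and \<nu>: "norm \<nu> = 1"
  shows "\<exists>x\<in>half_space \<nu> x\<^sub>0. x \<in> measure_support (total_variation D) \<and>
     (\<exists>\<nu>\<in>sphere 0 1. ((\<lambda>r. D (ball x r) /\<^sub>R measure (total_variation D) (ball x r)) \<longlongrightarrow> \<nu>) (at_right 0))"
proof (rule ccontr)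
  let ?H = "half_space \<nu> x\<^sub>0"
  have H: "?H \<in> sets borel" using open_half_space by (rule borel_open)
  assume "\<not> ?thesis"
  then have "AE x in total_variation D. x \<notin> ?H"
    using AE_reduced_boundary[OF vector_measure_D] by (auto elim: eventually_mono)
  then have "emeasure (total_variation D) ?H = 0"
    using H by (simp add: AE_iff_measurable[OF _ refl])
  then have "D ?H = 0" using norm_le_total_variation[OF vector_measure_D H] by simp
  then show False using null_set_if_half_space_zero[OF \<nu>] E by simp
qed

end

theorem corollary1p11:
  fixes \<alpha> :: real and E :: "(real^'n) set"
  defines "D \<equiv> frac_variation_measure \<alpha> (indicator E)"
  assumes "0 < \<alpha>" and "\<alpha> < 1"
    and "E \<in> sets lebesgue"
    and "indicator E \<in> frac_BV \<alpha>"
  shows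
    "(\<forall>x\<^sub>0 \<nu>. norm \<nu> = 1 \<longrightarrow>
        set_integrable lebesgue E (\<lambda>x. (1 / \<bar>(x - x\<^sub>0) \<bullet> \<nu>\<bar> powr \<alpha>) *\<^sub>R \<nu>) \<and>
        (frac_const 1 \<alpha> / \<alpha>) *\<^sub>R (LINT x:E|lebesgue. (1 / \<bar>(x - x\<^sub>0) \<bullet> \<nu>\<bar> powr \<alpha>) *\<^sub>R \<nu>)
          = - D (half_space \<nu> x\<^sub>0) \<and>
        (\<integral>\<^sup>+ x \<in> E. ennreal (norm (frac_grad \<alpha> (indicator (half_space \<nu> x\<^sub>0)) x)) \<partial>lebesgue)
          \<le> emeasure (total_variation D) (half_space \<nu> x\<^sub>0)) \<and>
     (\<forall>x\<^sub>0 r. r > 0 \<longrightarrow>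
        (\<integral>\<^sup>+ x \<in> E. frac_weight CARD('n) \<alpha> (norm (x - x\<^sub>0)) r \<partial>lebesgue)
          \<le> emeasure (total_variation D) (UNIV - ball x\<^sub>0 r)) \<and>
     (bounded (measure_support (total_variation D)) \<or>
        (\<exists>x\<^sub>0 \<nu>. norm \<nu> = 1 \<and> D (half_space \<nu> x\<^sub>0) = 0)
      \<longrightarrow> emeasure lebesgue E = 0) \<and>
     (emeasure lebesgue E > 0 \<longrightarrow>
        \<not> bounded (frac_reduced_boundary \<alpha> E) \<and>
        (\<forall>x\<^sub>0 \<nu>. norm \<nu> = 1 \<longrightarrow> frac_reduced_boundary \<alpha> E \<inter> half_space \<nu> x\<^sub>0 \<noteq> {}))"
proof -
  have int: "integrable lebesgue (indicator E :: real^'n \<Rightarrow> real)"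
    and tv: "frac_total_variation \<alpha> (indicator E) < \<infinity>"
    using assms(5) unfolding frac_BV_def by auto
  interpret fractional_order_set \<alpha> E using assms int by unfold_locales auto
  \<comment> \<open>A real constant extracted from the finite extended-real supremum; it becomes the
    bound of the functionals in the Riesz theorem.\<close>
  obtain N :: nat where N: "frac_total_variation \<alpha> (indicator E) < ereal (real N)"
    using tv less_PInf_Ex_of_nat by auto
  have "pairing \<psi> \<le> real N" if "\<psi> \<in> Cinf_c" "\<And>x. norm (\<psi> x) \<le> 1" for \<psi>
  proof -
    have "ereal (pairing \<psi>) \<le> frac_total_variation \<alpha> (indicator E)"
      unfolding pairing_def frac_total_variation_def using that by (intro SUP_upper) auto
    then have "ereal (pairing \<psi>) \<le> ereal (real N)" using N by (rule order_trans[OF _ order_less_imp_le])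
    then show ?thesis by simp
  qed
  then have "\<exists>D. is_frac_variation_measure \<alpha> (indicator E) D" by (rule frac_variation_measure_exists)
  \<comment> \<open>Existence turns the choice in \<open>frac_variation_measure\<close> into a
    measure satisfying the integration by parts identity, from which everything else is
    derived.\<close>
  then have "is_frac_variation_measure \<alpha> (indicator E) D"
    unfolding D_def frac_variation_measure_def by (rule someI_ex)
  then interpret fractional_variation_set \<alpha> E D by unfold_locales
  have meets: "frac_reduced_boundary \<alpha> E \<inter> half_space \<nu> x\<^sub>0 \<noteq> {}"
    if "emeasure lebesgue E > 0" "norm \<nu> = 1" for \<nu> x\<^sub>0
    using half_space_meets_boundary[OF that, of x\<^sub>0] unfolding frac_reduced_boundary_def D_def Let_def by blast
  have "\<not> bounded (frac_reduced_boundary \<alpha> E)" if E: "emeasure lebesgue E > 0"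
  proof
    assume "bounded (frac_reduced_boundary \<alpha> E)"
    then obtain R where R: "\<And>x. x \<in> frac_reduced_boundary \<alpha> E \<Longrightarrow> norm x \<le> R" unfolding bounded_iff by blast
    obtain \<nu> :: "real^'n" where \<nu>: "norm \<nu> = 1" using vector_choose_size[of 1] by auto
    obtain x where x: "x \<in> frac_reduced_boundary \<alpha> E" "x \<in> half_space \<nu> (R *\<^sub>R \<nu>)" using meets[OF E \<nu>] by blast
    from x(2) have "R < norm x"
      using norm_cauchy_schwarz[of x \<nu>] \<nu> by (simp add: half_space_def inner_diff_left norm_eq_1)
    then show False using R[OF x(1)] by simp
  qed
  then show ?thesis
    using half_space_identity half_space_inequality weight_inequality null_set_if_bounded_support
      null_set_if_half_space_zero meets by blast
qed

end
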